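(* Let $n\ge1$. For every partition $\lambda$ with $\lambda_1\le n$, $$\chi_n(\mathbf{S}_\lambda(n))=\mathbf{s}^*_\lambda(x_1,\dots,x_n),\qquad\text{where}\qquad \mathbf{s}^*_\lambda(x_1,\dots,x_n)=\frac{\det\big[(x_i+n-i)_{\widetilde\lambda_j+n-j}\big]_{1\le i,j\le n}}{\det\big[(x_i+n-i)_{n-j}\big]_{1\le i,j\le n}}.$$
   Context: $\widetilde\lambda$ is the conjugate partition of $\lambda$, padded by zeros to length $n$; $(z)_p=z(z-1)\cdots(z-p+1)$ for $p\ge1$ and $(z)_0=1$ (falling factorials). $\boldsymbol\zeta(n)$ is the center of $\mathbf{U}(gl(n))$, $gl(n)=gl(n,\mathbb C)$. $\Lambda^*(n)$ is the algebra of shifted symmetric polynomials: complex polynomials $f(x_1,\dots,x_n)$ with $f(\dots,x_i,x_{i+1},\dots)=f(\dots,x_{i+1}-1,x_i+1,\dots)$ for $i=1,\dots,n-1$. The Harish-Chandra isomorphism $\chi_n:\boldsymbol\zeta(n)\to\Lambda^*(n)$ sends $A$ to the shifted symmetric polynomial such that $\chi_n(A)(\mu_1,\dots,\mu_n)$ is the eigenvalue of $A$ on the highest weight module of highest weight $(\mu_1,\dots,\mu_n)$. Virtual method. $gl(m_0|m_1+n)$ ($m_0,m_1$ sufficiently large) is the complex general linear Lie superalgebra with basis $e_{a,b}$, $a,b\in A_0\cup A_1\cup L$, $A_0=\{\alpha_1,\dots,\alpha_{m_0}\}$ (parity $0$), $A_1=\{\beta_1,\dots,\beta_{m_1}\}$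 (parity $1$), $L=\{1,\dots,n\}$ (parity $1$), $|e_{a,b}|=|a|+|b|$, and $[e_{a,b},e_{c,d}]=\delta_{bc}e_{a,d}-(-1)^{(|a|+|b|)(|c|+|d|)}\delta_{ad}e_{c,b}$. Symbols in $A_0\cup A_1$ are virtual. $gl(n)$ is the subalgebra spanned by $e_{i,j}$, $i,j\in L$. A product $e_{a_M,b_M}\cdots e_{a_1,b_1}$ is irregular if there are $i\le M$ and a virtual symbol $\gamma$ with $\#\{j\le i: b_j=\gamma\}>\#\{j<i: a_j=\gamma\}$. Let $\mathbf{Irr}$ be the left ideal of $\mathbf{U}(gl(m_0|m_1+n))$ generated by irregular products. The sum $Virt(m_0+m_1,n)=\mathbf{U}(gl(n))\oplus\mathbf{Irr}$ is direct and is a subalgebra in which $\mathbf{Irr}$ is a two-sided ideal; $\mathfrak p:Virt(m_0+m_1,n)\to\mathbf{U}(gl(n))$ is the projection with kernel $\mathbf{Irr}$. For two Young tableaux $S,T$ of the same shape $\lambda$, $e_{S,T}$ is the product of the $e_{s,t}$, $s,t$ being the entries of $S,T$ in the same cell, cells being read row by row from top to bottom and left to right. $C^*_\lambda$ has all entries in row $i$ equal to $\alpha_i$; $D^*_\lambda$ has all entries in column $j$ equal to $\beta_j$. $H(\lambda)$ is the product of the hook lengths of $\lambda$. For $\lambda_1\le n$, $$\mathbf{S}_\lambda(n)=\frac1{H(\lambda)}\sum_S\mathfrak p\big(e_{S,C^*_\lambda}\cdot e_{C^*_\lambda,D^*_\lambda}\cdot e_{D^*_\lambda,C^*_\lambda}\cdot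 e_{C^*_\lambda,S}\big)\in\boldsymbol\zeta(n),$$ over all tableaux $S$ of shape $\lambda$ on $\{1,\dots,n\}$ with strictly increasing rows ($\mathbf{S}_\emptyset(n)=1$); the monomials lie in $Virt(m_0+m_1,n)$. *)

theory Defs
  imports
    "HOL-Library.Poly_Mapping"
    "HOL-Library.FuncSet"
    "HOL-Algebra.QuotRing"
    "HOL-Algebra.Module"
    "HOL-Computational_Algebra.Fraction_Field"
    "Jordan_Normal_Form.Determinant"
begin

section \<open>Free associative algebras over the complex numbers\<close>

datatype 'a free_word = Word (letters: "'a list")

instantiation free_word :: (type) monoid_add
begin

definition "0 = Word []"

definition "u + v = Word (letters u @ letters v)"

instance
  by standard (simp_all add: zero_free_word_def plus_free_word_def)

end

text \<open>Since words form a monoid under concatenation, the convolution product of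
  \<^typ>\<open>'a free_word \<Rightarrow>\<^sub>0 complex\<close> is the product of the free associative algebra.\<close>

type_synonym 'a free_alg = "'a free_word \<Rightarrow>\<^sub>0 complex"

definition free_algebra :: "'a set \<Rightarrow> 'a free_alg ring"
  where "free_algebra X =
    \<lparr>carrier = {p. \<forall>w \<in> Poly_Mapping.keys p. set (letters w) \<subseteq> X},
     monoid.mult = (*), one = 1, zero = 0, add = (+)\<rparr>"


section \<open>Enveloping algebras of general linear Lie superalgebras\<close>

datatype symb = Alpha nat | Beta nat | Proper nat

fun parity :: "symb \<Rightarrow> nat"
  where
    "parity (Alpha _) = 0"
  | "parity (Beta _) = 1"
  | "parity (Proper _) = 1"

definition is_virtual :: "symb \<Rightarrow> bool"
  where "is_virtual a \<longleftrightarrow> a \<notin> range Proper"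

definition proper_symbols :: "nat \<Rightarrow> symb set"
  where "proper_symbols n = Proper ` {1..n}"

definition all_symbols :: "nat \<Rightarrow> nat \<Rightarrow> nat \<Rightarrow> symb set"
  where "all_symbols m0 m1 n = Alpha ` {1..m0} \<union> Beta ` {1..m1} \<union> proper_symbols n"

definition free_e :: "symb \<Rightarrow> symb \<Rightarrow> (symb \<times> symb) free_alg"
  where "free_e a b = Poly_Mapping.single (Word [(a, b)]) 1"

definition super_sign :: "symb \<Rightarrow> symb \<Rightarrow> symb \<Rightarrow> symb \<Rightarrow> (symb \<times> symb) free_alg"
  where "super_sign a b c d = (- 1) ^ ((parity a + parity b) * (parity c + parity d))"

definition gl_bracket :: "symb \<Rightarrow> symb \<Rightarrow> symb \<Rightarrow> symb \<Rightarrow> (symb \<times> symb) free_alg"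
  where "gl_bracket a b c d =
    (if b = c then free_e a d else 0) - super_sign a b c d * (if a = d then free_e c b else 0)"

definition gl_relations :: "symb set \<Rightarrow> (symb \<times> symb) free_alg set"
  where "gl_relations A =
    {free_e a b * free_e c d - super_sign a b c d * (free_e c d * free_e a b) - gl_bracket a b c d
      | a b c d. a \<in> A \<and> b \<in> A \<and> c \<in> A \<and> d \<in> A}"

definition gl_ideal :: "symb set \<Rightarrow> (symb \<times> symb) free_alg set"
  where "gl_ideal A = Idl\<^bsub>free_algebra (A \<times> A)\<^esub> (gl_relations A)"

type_synonym ugl = "(symb \<times> symb) free_alg set"

text \<open>For a set \<open>A\<close> of symbols, \<open>U_gl A\<close> is the enveloping algebra of the Lie
  superalgebra with basis \<open>e\<^sub>a\<^sub>b\<close>, \<open>a, b \<in> A\<close>.\<close>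

definition U_gl :: "symb set \<Rightarrow> ugl ring"
  where "U_gl A = free_algebra (A \<times> A) Quot gl_ideal A"

text \<open>The class in \<open>U_gl A\<close> of the product of the generators listed in \<open>ps\<close>, in that order.\<close>

definition e_product :: "symb set \<Rightarrow> (symb \<times> symb) list \<Rightarrow> ugl"
  where "e_product A ps =
    gl_ideal A +>\<^bsub>free_algebra (A \<times> A)\<^esub> Poly_Mapping.single (Word ps) 1"

definition e_gen :: "symb set \<Rightarrow> symb \<Rightarrow> symb \<Rightarrow> ugl"
  where "e_gen A a b = e_product A [(a, b)]"

definition scalar :: "symb set \<Rightarrow> complex \<Rightarrow> ugl"
  where "scalar A c = gl_ideal A +>\<^bsub>free_algebra (A \<times> A)\<^esub> Poly_Mapping.single 0 c"

text \<open>The symbols in \<open>proper_symbols n\<close> all have the same parity, so this is the ordinary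
  enveloping algebra \<open>U(gl(n))\<close>.\<close>

definition U_gln :: "nat \<Rightarrow> ugl ring"
  where "U_gln n = U_gl (proper_symbols n)"

definition center_gln :: "nat \<Rightarrow> ugl set"
  where "center_gln n =
    {z \<in> carrier (U_gln n). \<forall>u \<in> carrier (U_gln n). z \<otimes>\<^bsub>U_gln n\<^esub> u = u \<otimes>\<^bsub>U_gln n\<^esub> z}"

section \<open>The virtual algebra and its projection\<close>

definition left_ideal :: "'a set \<Rightarrow> ('a, 'b) ring_scheme \<Rightarrow> bool"
  where "left_ideal J R \<longleftrightarrow>
    additive_subgroup J R \<and> (\<forall>r \<in> carrier R. \<forall>x \<in> J. r \<otimes>\<^bsub>R\<^esub> x \<in> J)"

definition gen_left_ideal :: "('a, 'b) ring_scheme \<Rightarrow> 'a set \<Rightarrow> 'a set"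
  where "gen_left_ideal R S = \<Inter> {J. left_ideal J R \<and> S \<subseteq> J}"

text \<open>A product \<open>e(a\<^sub>M,b\<^sub>M) \<cdots> e(a\<^sub>1,b\<^sub>1)\<close> is represented by the list
  \<open>[(a\<^sub>M,b\<^sub>M), \<dots>, (a\<^sub>1,b\<^sub>1)]\<close>, so that \<open>(a\<^sub>j,b\<^sub>j)\<close> is \<open>rev ps ! (j - 1)\<close>.\<close>

definition irregular :: "(symb \<times> symb) list \<Rightarrow> bool"
  where "irregular ps \<longleftrightarrow>
    (\<exists>i \<in> {1..length ps}. \<exists>g. is_virtual g \<and>
       card {j \<in> {1..i}. snd (rev ps ! (j - 1)) = g} > card {j \<in> {1..<i}. fst (rev ps ! (j - 1)) = g})"

definition Irr :: "nat \<Rightarrow> nat \<Rightarrow> nat \<Rightarrow> ugl set"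
  where "Irr m0 m1 n =
    (let A = all_symbols m0 m1 n
     in gen_left_ideal (U_gl A) {e_product A ps | ps. set ps \<subseteq> A \<times> A \<and> irregular ps})"

text \<open>The inclusion of \<open>U(gl(n))\<close> into the big enveloping algebra: the class of \<open>x\<close> is sent to
  the class of \<open>x\<close>, i.e. a coset is enlarged by the bigger ideal.\<close>

definition incl :: "nat \<Rightarrow> nat \<Rightarrow> nat \<Rightarrow> ugl \<Rightarrow> ugl"
  where "incl m0 m1 n u =
    (let A = all_symbols m0 m1 n in gl_ideal A <+>\<^bsub>free_algebra (A \<times> A)\<^esub> u)"

definition Virt :: "nat \<Rightarrow> nat \<Rightarrow> nat \<Rightarrow> ugl set"
  where "Virt m0 m1 n =
    incl m0 m1 n ` carrier (U_gln n) <+>\<^bsub>U_gl (all_symbols m0 m1 n)\<^esub> Irr m0 m1 n"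

definition virt_proj :: "nat \<Rightarrow> nat \<Rightarrow> nat \<Rightarrow> ugl \<Rightarrow> ugl"
  where "virt_proj m0 m1 n =
    (\<lambda>v \<in> Virt m0 m1 n. THE u. u \<in> carrier (U_gln n) \<and>
       (\<exists>r \<in> Irr m0 m1 n. v = incl m0 m1 n u \<oplus>\<^bsub>U_gl (all_symbols m0 m1 n)\<^esub> r))"


section \<open>Partitions and tableaux\<close>

definition is_partition :: "nat list \<Rightarrow> bool"
  where "is_partition l \<longleftrightarrow> sorted_wrt (\<ge>) l \<and> 0 \<notin> set l"

text \<open>Parts are indexed from 1 and are 0 beyond the length.\<close>

definition part :: "nat list \<Rightarrow> nat \<Rightarrow> nat"
  where "part l i = (if 1 \<le> i \<and> i \<le> length l then l ! (i - 1) else 0)"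

definition conj_part :: "nat list \<Rightarrow> nat \<Rightarrow> nat"
  where "conj_part l j = card {i \<in> {1..length l}. j \<le> part l i}"

definition cells :: "nat list \<Rightarrow> (nat \<times> nat) set"
  where "cells l = {(i, j). i \<in> {1..length l} \<and> j \<in> {1..part l i}}"

definition hook :: "nat list \<Rightarrow> nat \<Rightarrow> nat \<Rightarrow> nat"
  where "hook l i j =
    card {(i', j') \<in> cells l. (i' = i \<and> j \<le> j') \<or> (j' = j \<and> i \<le> i')}"

definition hook_product :: "nat list \<Rightarrow> nat"
  where "hook_product l = (\<Prod>(i, j) \<in> cells l. hook l i j)"

text \<open>A tableau is the list of its rows, so \<^const>\<open>concat\<close> reads it row by row.\<close>

type_synonym 'a tableau = "'a list list"

definition e_bitableau :: "symb set \<Rightarrow> symb tableau \<Rightarrow> symb tableau \<Rightarrow> ugl"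
  where "e_bitableau A S T = e_product A (zip (concat S) (concat T))"

definition C_star :: "nat list \<Rightarrow> symb tableau"
  where "C_star l = map (\<lambda>i. replicate (part l i) (Alpha i)) [1..<Suc (length l)]"

definition D_star :: "nat list \<Rightarrow> symb tableau"
  where "D_star l = map (\<lambda>r. map Beta [1..<Suc r]) l"

definition row_strict_tableaux :: "nat \<Rightarrow> nat list \<Rightarrow> symb tableau set"
  where "row_strict_tableaux n l =
    map (map Proper) ` {S. map length S = l \<and> (\<forall>r \<in> set S. sorted_wrt (<) r \<and> set r \<subseteq> {1..n})}"


section \<open>The central elements \<open>S\<^sub>\<lambda>(n)\<close>\<close>

definition S_elem :: "nat \<Rightarrow> nat \<Rightarrow> nat \<Rightarrow> nat list \<Rightarrow> ugl"
  where "S_elem m0 m1 n l =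
    (let A = all_symbols m0 m1 n; U = U_gl A; C = C_star l; D = D_star l
     in scalar (proper_symbols n) (1 / of_nat (hook_product l)) \<otimes>\<^bsub>U_gln n\<^esub>
        (\<Oplus>\<^bsub>U_gln n\<^esub> S \<in> row_strict_tableaux n l.
           virt_proj m0 m1 n
             (e_bitableau A S C \<otimes>\<^bsub>U\<^esub> e_bitableau A C D \<otimes>\<^bsub>U\<^esub> e_bitableau A D C \<otimes>\<^bsub>U\<^esub> e_bitableau A C S)))"


section \<open>Polynomials and shifted symmetric polynomials\<close>

type_synonym cpoly = "(nat \<Rightarrow>\<^sub>0 nat) \<Rightarrow>\<^sub>0 complex"

definition var :: "nat \<Rightarrow> cpoly"
  where "var i = Poly_Mapping.single (Poly_Mapping.single i 1) 1"

definition eval_poly :: "cpoly \<Rightarrow> (nat \<Rightarrow> complex) \<Rightarrow> complex"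
  where "eval_poly f x =
    (\<Sum>m \<in> Poly_Mapping.keys f. Poly_Mapping.lookup f m *
       (\<Prod>i \<in> Poly_Mapping.keys m. x i ^ Poly_Mapping.lookup m i))"

definition shifted_symmetric :: "nat \<Rightarrow> cpoly set"
  where "shifted_symmetric n =
    {f. (\<forall>m \<in> Poly_Mapping.keys f. Poly_Mapping.keys m \<subseteq> {1..n}) \<and>
        (\<forall>i \<in> {1..<n}. \<forall>x.
           eval_poly f (x(i := x (Suc i) - 1, Suc i := x i + 1)) = eval_poly f x)}"

definition falling :: "'a::comm_ring_1 \<Rightarrow> nat \<Rightarrow> 'a"
  where "falling z p = (\<Prod>k<p. z - of_nat k)"

definition shifted_schur :: "nat \<Rightarrow> nat list \<Rightarrow> cpoly fract"
  where "shifted_schur n l =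
    Fract
      (det (mat n n (\<lambda>(i0, j0). let i = Suc i0; j = Suc j0
         in falling (var i + of_nat (n - i)) (conj_part l j + n - j))))
      (det (mat n n (\<lambda>(i0, j0). let i = Suc i0; j = Suc j0
         in falling (var i + of_nat (n - i)) (n - j))))"


section \<open>Highest weight modules and the Harish-Chandra isomorphism\<close>

text \<open>The axioms of the library's \<^locale>\<open>module\<close> over a ring that need not be commutative.\<close>

locale left_module = R?: ring R + M?: abelian_group M
  for R (structure) and M (structure) +
  assumes smult_closed:
      "\<lbrakk>a \<in> carrier R; x \<in> carrier M\<rbrakk> \<Longrightarrow> a \<odot>\<^bsub>M\<^esub> x \<in> carrier M"
    and smult_l_distr:
      "\<lbrakk>a \<in> carrier R; b \<in> carrier R; x \<in> carrier M\<rbrakk> \<Longrightarrow>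
        (a \<oplus> b) \<odot>\<^bsub>M\<^esub> x = a \<odot>\<^bsub>M\<^esub> x \<oplus>\<^bsub>M\<^esub> b \<odot>\<^bsub>M\<^esub> x"
    and smult_r_distr:
      "\<lbrakk>a \<in> carrier R; x \<in> carrier M; y \<in> carrier M\<rbrakk> \<Longrightarrow>
        a \<odot>\<^bsub>M\<^esub> (x \<oplus>\<^bsub>M\<^esub> y) = a \<odot>\<^bsub>M\<^esub> x \<oplus>\<^bsub>M\<^esub> a \<odot>\<^bsub>M\<^esub> y"
    and smult_assoc1:
      "\<lbrakk>a \<in> carrier R; b \<in> carrier R; x \<in> carrier M\<rbrakk> \<Longrightarrow>
        (a \<otimes> b) \<odot>\<^bsub>M\<^esub> x = a \<odot>\<^bsub>M\<^esub> (b \<odot>\<^bsub>M\<^esub> x)"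
    and smult_one: "x \<in> carrier M \<Longrightarrow> \<one> \<odot>\<^bsub>M\<^esub> x = x"

text \<open>A module over \<open>U(gl(n))\<close> is a complex vector space through the scalars in \<open>U(gl(n))\<close>.\<close>

definition highest_weight_module :: "nat \<Rightarrow> (nat \<Rightarrow> complex) \<Rightarrow> (ugl, 'v) module \<Rightarrow> bool"
  where "highest_weight_module n \<mu> M \<longleftrightarrow>
    (let A = proper_symbols n
     in left_module (U_gln n) M \<and>
        (\<exists>v \<in> carrier M. v \<noteq> \<zero>\<^bsub>M\<^esub> \<and>
           (\<forall>i \<in> {1..n}. \<forall>j \<in> {1..n}. i < j \<longrightarrow> e_gen A (Proper i) (Proper j) \<odot>\<^bsub>M\<^esub> v = \<zero>\<^bsub>M\<^esub>) \<and>
           (\<forall>i \<in> {1..n}. e_gen A (Proper i) (Proper i) \<odot>\<^bsub>M\<^esub> v = scalar A (\<mu> i) \<odot>\<^bsub>M\<^esub> v) \<and>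
           carrier M = {u \<odot>\<^bsub>M\<^esub> v | u. u \<in> carrier (U_gln n)}))"

text \<open>The modules below range over a fixed type of elements, that of the cosets of left ideals of
  \<open>U(gl(n))\<close>. A highest weight module is cyclic, hence isomorphic to a quotient of \<open>U(gl(n))\<close> by
  a left ideal, so every isomorphism class is represented there.\<close>

definition harish_chandra :: "nat \<Rightarrow> ugl \<Rightarrow> cpoly"
  where "harish_chandra n =
    (\<lambda>z \<in> center_gln n. THE f. f \<in> shifted_symmetric n \<and>
       (\<forall>\<mu>. \<forall>M :: (ugl, ugl set) module. highest_weight_module n \<mu> M \<longrightarrow>
          (\<forall>w \<in> carrier M. z \<odot>\<^bsub>M\<^esub> w = scalar (proper_symbols n) (eval_poly f \<mu>) \<odot>\<^bsub>M\<^esub> w)))"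

end

theory Submission
  imports Defs "HOL-Library.Function_Algebras" "HOL-Library.Countable" "HOL-Combinatorics.Multiset_Permutations"
begin

text \<open>The Lie superalgebra acts by polarizations on a free supercommutative algebra, for either choice
  of parity of the variables. With the proper variables even the representation separates the elements of
  \<open>U(gl(n))\<close>, so the element is determined by its action on series in the proper variables alone,
  where irregular products vanish and the virtual projection can be ignored. Centrality is then visible
  on the operators, and sorting the letters of a representing word exhibits the eigenvalue as a
  polynomial \<open>f\<close> in the highest weight, of degree at most \<open>\<bar>l\<bar>\<close>; comparing highest weight
  vectors along the strings of the simple roots shows that \<open>f\<close> is shifted symmetric.

  With the proper variables odd there are highest weight vectors for all dominant weights \<open>\<mu>\<close>.
  Comparing contents shows that the element kills those with \<open>\<bar>\<mu>\<bar> \<le> \<bar>l\<bar>\<close> unless \<open>\<mu>\<close> is the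
  conjugate of \<open>l\<close>, when only the tableau with rows \<open>1, 2, \<dots>\<close> contributes and two odd
  reflections contribute \<open>H(l)\<^sup>2\<close>, so that \<open>f(\<mu>) = H(l)\<close>. The product of \<open>f\<close> and the
  denominator and the numerator are antisymmetric in the shifted variables and of the same degree;
  they agree at all lattice points up to that degree, the conjugate of \<open>l\<close> requiring the hook
  length formula, hence they are equal.\<close>

section \<open>Linear operators on formal power series\<close>

text \<open>Both \<open>virt_proj\<close> and \<open>harish_chandra\<close> are definite
  descriptions, so their values are accessible only after uniqueness is proved. For the projection
  this is the directness of the sum; it comes from a concrete action instead of an abstract basis
  theorem: \<open>Irr\<close> kills all series in the proper variables, while no nonzero element of
  \<open>U(gl(n))\<close> does. The two parities serve opposite ends. With even proper variables the
  coefficients that must be nonzero are counts, so nothing can cancel. With odd ones a single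
  monomial is a highest weight vector, where even variables would call for products of minors. The
  projected element is never computed. All that is kept of a representing word is that its weight is
  zero and its length at most \<bar>l\<bar>, although the monomials have 4\<bar>l\<bar> factors;
  this finer bound is what makes the interpolation possible. The number \<open>H(l)\<close> enters
  twice for different reasons: as a product of anticommutators, squared and then divided by the
  normalization, and as the quotient of factorials by a Vandermonde product on the side of the
  determinants.\<close>

instance symb :: countable
  by countable_datatype

type_synonym config = "symb \<times> nat \<Rightarrow> nat"
type_synonym vec = "config \<Rightarrow> complex"

definition scl :: "complex \<Rightarrow> vec \<Rightarrow> vec"
  where "scl c v = (\<lambda>m. c * v m)"

lemma scl_apply [simp]: "scl c v m = c * v m"
  by (simp add: scl_def)

text \<open>Linearity is part of the type, so that the operators form a \<open>ring_1\<close> and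
  identities between them can be computed there without side conditions.\<close>

typedef endo =
  "{T :: vec \<Rightarrow> vec. (\<forall>u v. T (u + v) = T u + T v) \<and> (\<forall>c v. T (scl c v) = scl c (T v))}"
  morphisms app Endo
  by (rule exI[of _ id]) simp

setup_lifting type_definition_endo

instantiation endo :: ring_1
begin

lift_definition zero_endo :: endo is "\<lambda>_. 0"
  by (auto simp: fun_eq_iff)

lift_definition one_endo :: endo is "\<lambda>v. v"
  by auto

lift_definition plus_endo :: "endo \<Rightarrow> endo \<Rightarrow> endo" is "\<lambda>S T v. S v + T v"
  by (auto simp: fun_eq_iff algebra_simps)

lift_definition minus_endo :: "endo \<Rightarrow> endo \<Rightarrow> endo" is "\<lambda>S T v. S v - T v"
  by (auto simp: fun_eq_iff algebra_simps)

lift_definition uminus_endo :: "endo \<Rightarrow> endo" is "\<lambda>S v. - S v"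
  by (auto simp: fun_eq_iff algebra_simps)

lift_definition times_endo :: "endo \<Rightarrow> endo \<Rightarrow> endo" is "\<lambda>S T v. S (T v)"
  by auto

instance
proof
  show "(0::endo) \<noteq> 1"
    by transfer (simp add: fun_eq_iff, rule exI[of _ "\<lambda>_. 1"], simp)
qed (transfer; auto simp: fun_eq_iff algebra_simps)+

end

lemma app_add [simp]: "app T (u + v) = app T u + app T v"
  by transfer auto

lemma app_scl [simp]: "app T (scl c v) = scl c (app T v)"
  by transfer auto

lemma app_zero [simp]: "app T 0 = 0"
  using app_scl[of T 0 0] by (simp add: scl_def zero_fun_def)

lemma app_uminus [simp]: "app T (- v) = - app T v"
  using app_add[of T v "- v"] by (simp add: eq_neg_iff_add_eq_0 add.commute)

lemma app_diff [simp]: "app T (u - v) = app T u - app T v"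
  using app_add[of T u "- v"] by simp

lemma app_ops [simp]:
  "app 0 v = 0" "app 1 v = v" "app (S + T) v = app S v + app T v" "app (S - T) v = app S v - app T v"
  "app (- T) v = - app T v" "app (S * T) v = app S (app T v)"
  by (transfer; simp)+

lemma app_sum: "app (sum f X) v = (\<Sum>x\<in>X. app (f x) v)"
  by (induct X rule: infinite_finite_induct) auto

lemma sum_vec_apply: "(sum f X :: vec) m = (\<Sum>x\<in>X. f x m)"
  by (induct X rule: infinite_finite_induct) auto

lift_definition cst :: "complex \<Rightarrow> endo" is scl
  by (auto simp: fun_eq_iff algebra_simps)

lemma app_cst [simp]: "app (cst c) v = scl c v"
  by transfer simp

lemma cst_hom: "cst 0 = 0" "cst 1 = 1" "cst (a + b) = cst a + cst b" "cst (a * b) = cst a * cst b"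
  "cst (- a) = - cst a" "cst (a - b) = cst a - cst b"
  by (transfer; simp add: fun_eq_iff algebra_simps)+

lemma cst_commute: "T * cst c = cst c * T"
  by transfer (auto simp: fun_eq_iff)

lemma cst_left_commute: "T * (cst c * S) = cst c * (T * S)"
  by (metis cst_commute mult.assoc)

lemma scl_simps [simp]: "scl 0 v = 0" "scl 1 v = v" "scl c 0 = 0" "scl a (scl b v) = scl (a * b) v"
  by (auto simp: fun_eq_iff)

lemma scl_add: "scl c (u + v) = scl c u + scl c v" "scl (a + b) v = scl a v + scl b v"
  "scl c (u - v) = scl c u - scl c v" "scl (a - b) v = scl a v - scl b v" "scl (- a) v = - scl a v"
  "scl a (- v) = - scl a v"
  by (auto simp: fun_eq_iff algebra_simps)

lemma scl_sum: "scl c (sum f X) = (\<Sum>x\<in>X. scl c (f x))" "scl (sum g X) v = (\<Sum>x\<in>X. scl (g x) v)"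
  by (induct X rule: infinite_finite_induct) (auto simp: scl_add)

lemma scl_eq_0_iff: "scl c v = 0 \<longleftrightarrow> c = 0 \<or> v = 0"
  by (auto simp: fun_eq_iff)


section \<open>Superpolynomials and polarizations\<close>

text \<open>The variables \<open>(a|p)\<close> with \<open>a\<close> a symbol and \<open>p\<close> a natural number generate a free
  supercommutative algebra, the parity of \<open>(a|p)\<close> being that of \<open>a\<close>, reversed if \<open>s\<close> holds. A vector is
  the coefficient function of a formal power series in them, and \<open>cr\<close>, \<open>an\<close> are multiplication
  by and differentiation with respect to a variable; \<open>jw\<close> is the sign from moving an odd variable
  to its place. On an odd variable only the parity of the exponent matters, which makes the
  relations hold without restricting the exponents to \<open>{0, 1}\<close>.\<close>

definition odd_sym :: "bool \<Rightarrow> symb \<Rightarrow> bool"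
  where "odd_sym s a \<longleftrightarrow> (odd (parity a) \<noteq> s)"

definition jw :: "bool \<Rightarrow> symb \<times> nat \<Rightarrow> config \<Rightarrow> complex"
  where "jw s x m = (- 1) ^ (\<Sum>y | to_nat y < to_nat x \<and> odd_sym s (fst y). m y)"

lemma finite_below: "finite {y :: symb \<times> nat. to_nat y < to_nat x \<and> P y}"
proof -
  have "finite (to_nat -` {..<to_nat x} :: (symb \<times> nat) set)"
    by (rule finite_vimageI) (auto intro: inj_to_nat)
  then show ?thesis
    by (rule rev_finite_subset) auto
qed

text \<open>All signs in the three commutation relations below come from this rule: an odd variable
  \<open>y\<close> is noticed by the sign of \<open>x\<close> only if it precedes \<open>x\<close>
  in the enumeration.\<close>

lemma jw_upd:
  "jw s x (m(y := k)) =
    (if odd_sym s (fst y) \<and> to_nat y < to_nat x then jw s x m * (- 1) ^ (m y + k) else jw s x m)"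
proof (cases "odd_sym s (fst y) \<and> to_nat y < to_nat x")
  case True
  let ?B = "{z :: symb \<times> nat. to_nat z < to_nat x \<and> odd_sym s (fst z)}"
  have y: "y \<in> ?B" "finite ?B"
    using True finite_below by auto
  have "(\<Sum>z\<in>?B. (m(y := k)) z) = k + (\<Sum>z\<in>?B - {y}. m z)"
    using y by (subst sum.remove[of _ y]) (auto intro!: sum.cong)
  moreover have "(\<Sum>z\<in>?B. m z) = m y + (\<Sum>z\<in>?B - {y}. m z)"
    using y by (subst sum.remove[of _ y]) auto
  ultimately show ?thesis
    using True by (simp add: jw_def power_add)
next
  case False
  then have "(\<Sum>z | to_nat z < to_nat x \<and> odd_sym s (fst z). (m(y := k)) z) =
    (\<Sum>z | to_nat z < to_nat x \<and> odd_sym s (fst z). m z)"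
    by (intro sum.cong) auto
  then have "jw s x (m(y := k)) = jw s x m"
    by (simp add: jw_def)
  then show ?thesis
    using False by (simp only: if_False)
qed

lemma jw_square: "jw s x m * jw s x m = 1"
  by (simp add: jw_def flip: power_mult_distrib)

lemma jw_square': "jw s x m * (jw s x m * c) = c"
  by (simp add: jw_square flip: mult.assoc)

lift_definition cr :: "bool \<Rightarrow> symb \<times> nat \<Rightarrow> endo" is
  "\<lambda>s x f m. if odd_sym s (fst x)
    then (if odd (m x) then jw s x m * f (m(x := m x - 1)) else 0)
    else (if m x = 0 then 0 else f (m(x := m x - 1)))"
  by (auto simp: fun_eq_iff algebra_simps)

lift_definition an :: "bool \<Rightarrow> symb \<times> nat \<Rightarrow> endo" is
  "\<lambda>s x f m. if odd_sym s (fst x)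
    then (if even (m x) then jw s x m * f (m(x := m x + 1)) else 0)
    else of_nat (m x + 1) * f (m(x := m x + 1))"
  by (auto simp: fun_eq_iff algebra_simps)

lemma app_cr: "app (cr s x) f m = (if odd_sym s (fst x)
    then (if odd (m x) then jw s x m * f (m(x := m x - 1)) else 0)
    else (if m x = 0 then 0 else f (m(x := m x - 1))))"
  by transfer simp

lemma app_an: "app (an s x) f m = (if odd_sym s (fst x)
    then (if even (m x) then jw s x m * f (m(x := m x + 1)) else 0)
    else of_nat (m x + 1) * f (m(x := m x + 1)))"
  by transfer simp

lemma endo_eqI: "(\<And>f m. app S f m = app T f m) \<Longrightarrow> S = T"
  by (metis app_inject ext)

definition swap_sign :: "bool \<Rightarrow> symb \<Rightarrow> symb \<Rightarrow> endo"
  where "swap_sign s a b = (if odd_sym s a \<and> odd_sym s b then - 1 else 1)"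

lemma order_cases: "(x :: symb \<times> nat) = y \<or> x \<noteq> y \<and> to_nat x < to_nat y \<or> x \<noteq> y \<and> to_nat y < to_nat x"
  by (metis inj_to_nat injD linorder_neqE_nat)

text \<open>For two distinct odd variables exactly one of the two signs \<open>jw\<close> notices
  the other variable, which produces the minus sign. An odd \<open>cr s x\<close> squares to zero,
  because it needs an odd exponent and leaves an even one.\<close>

lemma cr_cr: "cr s x * cr s y = swap_sign s (fst x) (fst y) * (cr s y * cr s x)"
proof (rule endo_eqI)
  fix f m
  show "app (cr s x * cr s y) f m = app (swap_sign s (fst x) (fst y) * (cr s y * cr s x)) f m"
    using order_cases[of x y]
    by (elim disjE; cases "odd_sym s (fst x)"; cases "odd_sym s (fst y)")
      (auto simp: swap_sign_def app_cr jw_upd fun_upd_twist jw_square' minus_one_power_iff)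
qed

lemma an_an: "an s x * an s y = swap_sign s (fst x) (fst y) * (an s y * an s x)"
proof (rule endo_eqI)
  fix f m
  show "app (an s x * an s y) f m = app (swap_sign s (fst x) (fst y) * (an s y * an s x)) f m"
    using order_cases[of x y]
    by (elim disjE; cases "odd_sym s (fst x)"; cases "odd_sym s (fst y)")
      (auto simp: swap_sign_def app_an jw_upd fun_upd_twist jw_square' minus_one_power_iff)
qed

text \<open>For an odd variable \<open>x = y\<close> one of the two products sees the even exponents
  and the other the odd ones, and in each the two signs \<open>jw\<close> cancel. So the
  anticommutator is the identity at every exponent.\<close>

lemma an_cr: "an s x * cr s y = swap_sign s (fst x) (fst y) * (cr s y * an s x) + (if x = y then 1 else 0)"
proof (rule endo_eqI)
  fix f m
  show "app (an s x * cr s y) f m =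
    app (swap_sign s (fst x) (fst y) * (cr s y * an s x) + (if x = y then 1 else 0)) f m"
    using order_cases[of x y]
    by (elim disjE; cases "odd_sym s (fst x)"; cases "odd_sym s (fst y)")
      (auto simp: swap_sign_def app_an app_cr jw_upd fun_upd_twist jw_square' jw_square minus_one_power_iff
        algebra_simps)
qed

text \<open>The cut-off \<open>K\<close> keeps the sum finite. It stays a parameter because
  faithfulness needs at least as many columns as a word has letters.\<close>

definition pol :: "nat \<Rightarrow> bool \<Rightarrow> symb \<Rightarrow> symb \<Rightarrow> endo"
  where "pol K s a b = (\<Sum>p<K. cr s (a, p) * an s (b, p))"

text \<open>Moving \<open>C * D\<close> past \<open>X * B\<close> crosses four pairs, and only the
  pairs \<open>B\<close>, \<open>C\<close> and \<open>D\<close>, \<open>X\<close> leave a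
  contraction. Treating the signs as unknown elements of \<open>{1, -1}\<close> lets one computation
  serve all parities.\<close>

lemma four_operators:
  fixes X B C D :: "'a :: ring_1"
  assumes "B * C = e1 * (C * B) + d1" "D * X = e2 * (X * D) + d2" "X * C = e3 * (C * X)"
    "B * D = e4 * (D * B)"
    and "e1 \<in> {1, -1}" "e2 \<in> {1, -1}" "e3 \<in> {1, -1}" "e4 \<in> {1, -1}" "g = e1 * e2 * e3 * e4"
    and "d1 \<in> {0, 1}" "d2 \<in> {0, 1}"
  shows "X * B * (C * D) - g * (C * D * (X * B)) = d1 * (X * D) - g * (d2 * (C * B))"
proof -
  have "X * B * (C * D) = X * (e1 * (C * B) + d1) * D"
    by (simp add: assms(1)[symmetric] mult.assoc)
  also have "\<dots> = e1 * (X * C) * (B * D) + d1 * (X * D)"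
    using assms(5,10) by (auto simp: algebra_simps)
  also have "\<dots> = e1 * e3 * e4 * (C * X * (D * B)) + d1 * (X * D)"
    unfolding assms(3,4) using assms(7,8) by (auto simp: algebra_simps)
  finally have 1: "X * B * (C * D) = e1 * e3 * e4 * (C * X * (D * B)) + d1 * (X * D)" .
  have "C * D * (X * B) = C * (e2 * (X * D) + d2) * B"
    by (simp add: assms(2)[symmetric] mult.assoc)
  also have "\<dots> = e2 * (C * X * (D * B)) + d2 * (C * B)"
    using assms(6,11) by (auto simp: algebra_simps)
  finally show ?thesis
    using 1 assms(5-9) by (auto simp: algebra_simps)
qed

text \<open>The product of the four exchange signs depends only on
  \<open>parity a + parity b\<close> and \<open>parity c + parity d\<close> modulo 2. Reversing the
  parity of all variables does not change these sums, which is why both values of \<open>s\<close>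
  represent the same Lie superalgebra.\<close>

lemma pol_relation:
  "pol K s a b * pol K s c d -
    (- 1) ^ ((parity a + parity b) * (parity c + parity d)) * (pol K s c d * pol K s a b) =
   (if b = c then pol K s a d else 0) -
    (- 1) ^ ((parity a + parity b) * (parity c + parity d)) * (if a = d then pol K s c b else 0)"
    (is "_ - ?g * _ = _")
proof -
  define X where "X p = cr s (a, p)" for p
  define B where "B p = an s (b, p)" for p
  define C where "C p = cr s (c, p)" for p
  define D where "D p = an s (d, p)" for p
  have g: "?g = swap_sign s b c * swap_sign s d a * swap_sign s a c * swap_sign s b d"
    by (auto simp: swap_sign_def odd_sym_def minus_one_power_iff)
  have single: "X p * B p * (C q * D q) - ?g * (C q * D q * (X p * B p)) =
    (if (b, p) = (c, q) then 1 else 0) * (X p * D q) - ?g * ((if (d, q) = (a, p) then 1 else 0) * (C q * B p))"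
    for p q
    by (rule four_operators[OF _ _ _ _ _ _ _ _ g])
      (use cr_cr[of s "(a, p)" "(c, q)"] an_an[of s "(b, p)" "(d, q)"] an_cr[of s "(b, p)" "(c, q)"]
        an_cr[of s "(d, q)" "(a, p)"] in \<open>simp_all add: X_def B_def C_def D_def swap_sign_def\<close>)
  have "pol K s a b * pol K s c d - ?g * (pol K s c d * pol K s a b) =
    (\<Sum>p<K. \<Sum>q<K. X p * B p * (C q * D q) - ?g * (C q * D q * (X p * B p)))"
    unfolding pol_def X_def B_def C_def D_def sum_product sum_subtractf
    by (subst (3) sum.swap) (simp add: sum_distrib_left)
  also have "\<dots> = (\<Sum>p<K. \<Sum>q<K. if p = q then (if b = c then X p * D p else 0) -
      ?g * (if a = d then C p * B p else 0) else 0)"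
    unfolding single by (intro sum.cong refl) auto
  also have "\<dots> = (if b = c then pol K s a d else 0) - ?g * (if a = d then pol K s c b else 0)"
    by (simp add: sum_subtractf pol_def X_def B_def C_def D_def sum_distrib_left)
  finally show ?thesis .
qed

definition pol_word :: "nat \<Rightarrow> bool \<Rightarrow> (symb \<times> symb) list \<Rightarrow> endo"
  where "pol_word K s ps = prod_list (map (\<lambda>(a, b). pol K s a b) ps)"

lemma pol_word_simps [simp]: "pol_word K s [] = 1" "pol_word K s (p # ps) = pol K s (fst p) (snd p) * pol_word K s ps"
  "pol_word K s (ps @ qs) = pol_word K s ps * pol_word K s qs"
  by (auto simp: pol_word_def split: prod.split)

text \<open>General in \<open>F\<close>, since it is used with \<open>pol_word\<close> for the
  representation and with \<open>nop\<close> for normally ordered products.\<close>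

definition lin :: "('a list \<Rightarrow> endo) \<Rightarrow> 'a free_alg \<Rightarrow> endo"
  where "lin F x = (\<Sum>w\<in>Poly_Mapping.keys x. cst (Poly_Mapping.lookup x w) * F (letters w))"

lemma lin_superset:
  assumes "finite S" "Poly_Mapping.keys x \<subseteq> S"
  shows "lin F x = (\<Sum>w\<in>S. cst (Poly_Mapping.lookup x w) * F (letters w))"
  unfolding lin_def using assms
  by (intro sum.mono_neutral_left) (auto simp: in_keys_iff cst_hom)

lemma lin_single: "lin F (Poly_Mapping.single w c) = cst c * F (letters w)"
  by (subst lin_superset[of "{w}"]) auto

lemma lin_zero [simp]: "lin F 0 = 0"
  by (simp add: lin_def)

lemma lin_add: "lin F (x + y) = lin F x + lin F y"
  by (subst (1 2 3) lin_superset[of "Poly_Mapping.keys x \<union> Poly_Mapping.keys y"])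
    (use keys_add[of x y] in \<open>auto simp: lookup_add cst_hom algebra_simps sum.distrib\<close>)

lemma lin_uminus: "lin F (- x) = - lin F x"
  using lin_add[of F x "- x"] by (simp add: eq_neg_iff_add_eq_0 add.commute)

lemma lin_diff: "lin F (x - y) = lin F x - lin F y"
  using lin_add[of F x "- y"] by (simp add: lin_uminus)

lemma lin_sum: "lin F (sum f X) = (\<Sum>x\<in>X. lin F (f x))"
  by (induct X rule: infinite_finite_induct) (auto simp: lin_add)

abbreviation rho :: "nat \<Rightarrow> bool \<Rightarrow> (symb \<times> symb) free_alg \<Rightarrow> endo"
  where "rho K s \<equiv> lin (pol_word K s)"

lemmas rho_single = lin_single[of "pol_word K s" for K s]
lemmas rho_add = lin_add[of "pol_word K s" for K s]
lemmas rho_uminus = lin_uminus[of "pol_word K s" for K s]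
lemmas rho_diff = lin_diff[of "pol_word K s" for K s]
lemmas rho_sum = lin_sum[of "pol_word K s" for K s]

lemma sum_of_monomials: "x = (\<Sum>w\<in>Poly_Mapping.keys x. Poly_Mapping.single w (Poly_Mapping.lookup x w))"
  by (rule poly_mapping_eqI)
    (auto simp: lookup_sum lookup_single when_def in_keys_iff cong: if_cong)

lemma rho_mult: "rho K s (x * y) = rho K s x * rho K s y"
proof -
  have "rho K s (x * y) = rho K s ((\<Sum>w\<in>Poly_Mapping.keys x. Poly_Mapping.single w (Poly_Mapping.lookup x w)) *
      (\<Sum>w\<in>Poly_Mapping.keys y. Poly_Mapping.single w (Poly_Mapping.lookup y w)))"
    by (simp flip: sum_of_monomials)
  also have "\<dots> = rho K s x * rho K s y"
    unfolding lin_def[of _ x] lin_def[of _ y]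
    by (simp add: sum_product rho_sum mult_single rho_single plus_free_word_def cst_hom mult.assoc
        cst_left_commute[of "pol_word K s ws" for ws])
  finally show ?thesis .
qed

section \<open>Words modulo the defining relations\<close>

abbreviation FA :: "symb set \<Rightarrow> (symb \<times> symb) free_alg ring"
  where "FA A \<equiv> free_algebra (A \<times> A)"

definition mon :: "(symb \<times> symb) list \<Rightarrow> (symb \<times> symb) free_alg"
  where "mon ps = Poly_Mapping.single (Word ps) 1"

definition con :: "complex \<Rightarrow> (symb \<times> symb) free_alg"
  where "con c = Poly_Mapping.single 0 c"

definition words :: "(symb \<times> symb) list set \<Rightarrow> (symb \<times> symb) free_alg set"
  where "words P = {x. \<forall>w\<in>Poly_Mapping.keys x. letters w \<in> P}"

lemma mon_append: "mon (ps @ qs) = mon ps * mon qs"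
  by (simp add: mon_def mult_single plus_free_word_def)

lemma mon_Cons: "mon (p # ps) = mon [p] * mon ps"
  using mon_append[of "[p]" ps] by simp

lemma mon_Nil [simp]: "mon [] = 1"
  by (metis mon_def single_one zero_free_word_def)

lemma con_hom: "con 0 = 0" "con 1 = 1" "con (a + b) = con a + con b" "con (- a) = - con a"
  "con (a * b) = con a * con b"
  by (simp_all add: con_def single_add single_uminus mult_single)

lemma con_mon: "con c * mon ps = Poly_Mapping.single (Word ps) c"
  by (simp add: con_def mon_def mult_single)

lemma con_commute: "x * con c = con c * x"
proof -
  have "(\<Sum>w\<in>Poly_Mapping.keys x. Poly_Mapping.single w (Poly_Mapping.lookup x w)) * con c =
    con c * (\<Sum>w\<in>Poly_Mapping.keys x. Poly_Mapping.single w (Poly_Mapping.lookup x w))"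
    by (simp add: sum_distrib_left sum_distrib_right con_def mult_single mult.commute)
  then show ?thesis
    by (simp flip: sum_of_monomials)
qed

lemma expand_words: "x = (\<Sum>w\<in>Poly_Mapping.keys x. con (Poly_Mapping.lookup x w) * mon (letters w))"
  by (subst con_mon) (simp flip: sum_of_monomials)

lemma lin_mon [simp]: "lin F (mon ps) = F ps"
  by (simp add: mon_def lin_single cst_hom)

lemma lin_con_mult: "lin F (con c * x) = cst c * lin F x"
proof -
  have "con c * x = (\<Sum>w\<in>Poly_Mapping.keys x. Poly_Mapping.single w (c * Poly_Mapping.lookup x w))"
    by (subst (1) sum_of_monomials) (simp add: sum_distrib_left con_def mult_single)
  then show ?thesis
    by (simp add: lin_sum lin_single cst_hom mult.assoc sum_distrib_left flip: lin_def) 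
      (simp add: lin_def sum_distrib_left)
qed

lemma rho_con [simp]: "rho K s (con c) = cst c"
  by (simp add: con_def rho_single zero_free_word_def)

lemma words_zero [simp]: "0 \<in> words P"
  by (simp add: words_def)

lemma words_add: "x \<in> words P \<Longrightarrow> y \<in> words P \<Longrightarrow> x + y \<in> words P"
  using keys_add[of x y] by (auto simp: words_def)

lemma words_uminus: "x \<in> words P \<Longrightarrow> - x \<in> words P"
  by (auto simp: words_def in_keys_iff)

lemma words_diff: "x \<in> words P \<Longrightarrow> y \<in> words P \<Longrightarrow> x - y \<in> words P"
  using words_add[OF _ words_uminus, of x P y] by simp

lemma words_sum: "(\<And>i. i \<in> I \<Longrightarrow> f i \<in> words P) \<Longrightarrow> sum f I \<in> words P"
  by (induct I rule: infinite_finite_induct) (auto intro: words_add)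

lemma words_mult:
  assumes "x \<in> words P" "y \<in> words Q" "\<And>ps qs. ps \<in> P \<Longrightarrow> qs \<in> Q \<Longrightarrow> ps @ qs \<in> R"
  shows "x * y \<in> words R"
  using keys_mult[of x y] assms by (fastforce simp: words_def plus_free_word_def)

lemma words_con: "x \<in> words P \<Longrightarrow> con c * x \<in> words P"
  by (rule words_mult[of _ "{[]}"]) (auto simp: words_def con_def zero_free_word_def)

lemma words_mon [simp]: "mon ps \<in> words P \<longleftrightarrow> ps \<in> P"
  by (auto simp: words_def mon_def)

lemma words_mono: "P \<subseteq> Q \<Longrightarrow> x \<in> words P \<Longrightarrow> x \<in> words Q"
  by (auto simp: words_def)

lemma carrier_FA: "carrier (FA A) = words (lists (A \<times> A))"
  by (auto simp: free_algebra_def words_def lists_eq_set)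

lemma FA_simps [simp]: "monoid.mult (FA A) = (*)" "add (FA A) = (+)" "one (FA A) = 1" "zero (FA A) = 0"
  by (simp_all add: free_algebra_def)

lemma one_in_words [simp]: "1 \<in> words P \<longleftrightarrow> [] \<in> P"
  using words_mon[of "[]" P] by simp

lemma carrier_mult: "x \<in> words (lists X) \<Longrightarrow> y \<in> words (lists X) \<Longrightarrow> x * y \<in> words (lists X)"
  by (erule words_mult) auto

lemma ring_FA: "ring (FA A)"
proof (rule ringI)
  show "abelian_group (FA A)"
  proof (rule abelian_groupI)
    fix x assume "x \<in> carrier (FA A)"
    then show "\<exists>y\<in>carrier (FA A). y \<oplus>\<^bsub>FA A\<^esub> x = \<zero>\<^bsub>FA A\<^esub>"
      by (intro bexI[of _ "- x"]) (auto simp: carrier_FA words_uminus)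
  qed (auto simp: carrier_FA words_add add.assoc add.commute)
  show "Group.monoid (FA A)"
    by (rule Group.monoidI) (auto simp: carrier_FA carrier_mult mult.assoc)
qed (auto simp: algebra_simps)

lemma gl_relations_subset: "gl_relations A \<subseteq> carrier (FA A)"
proof -
  have 1: "free_e a b \<in> words (lists (A \<times> A))" if "a \<in> A" "b \<in> A" for a b
    using that words_mon[of "[(a, b)]" "lists (A \<times> A)"] by (simp add: free_e_def mon_def)
  have "super_sign a b c d \<in> {1, - 1}" for a b c d
    by (auto simp: super_sign_def minus_one_power_iff)
  then have 2: "super_sign a b c d * x \<in> words (lists (A \<times> A))" if "x \<in> words (lists (A \<times> A))" for a b c d x
    using that words_uminus[OF that] by (metis insertE singletonD mult_1 mult_minus1)
  show ?thesis
    by (auto simp del: minus_diff_eq diff_minus_eq_add simp: gl_relations_def gl_bracket_def carrier_FA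
        intro!: words_diff words_uminus 2 carrier_mult 1)
qed

lemma gl_ideal: "ideal (gl_ideal A) (FA A)"
  unfolding gl_ideal_def by (rule ring.genideal_ideal[OF ring_FA gl_relations_subset])

lemma gl_ideal_subset: "gl_ideal A \<subseteq> words (lists (A \<times> A))"
  using ideal.Icarr[OF gl_ideal] by (auto simp: carrier_FA)

lemma gl_ideal_zero [simp]: "0 \<in> gl_ideal A"
  using additive_subgroup.zero_closed[OF ideal.axioms(1)[OF gl_ideal]] by simp

lemma gl_ideal_add: "x \<in> gl_ideal A \<Longrightarrow> y \<in> gl_ideal A \<Longrightarrow> x + y \<in> gl_ideal A"
  using additive_subgroup.a_closed[OF ideal.axioms(1)[OF gl_ideal]] by simp

lemma gl_ideal_mult:
  "x \<in> gl_ideal A \<Longrightarrow> y \<in> words (lists (A \<times> A)) \<Longrightarrow> x * y \<in> gl_ideal A"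
  "x \<in> gl_ideal A \<Longrightarrow> y \<in> words (lists (A \<times> A)) \<Longrightarrow> y * x \<in> gl_ideal A"
  using ideal.I_r_closed[OF gl_ideal] ideal.I_l_closed[OF gl_ideal] by (auto simp: carrier_FA)

lemma con_in_words [simp]: "con c \<in> words (lists X)"
  using words_con[of 1 "lists X" c] by simp

lemma gl_ideal_con: "x \<in> gl_ideal A \<Longrightarrow> con c * x \<in> gl_ideal A"
  by (rule gl_ideal_mult(2)) auto

lemma gl_ideal_uminus: "x \<in> gl_ideal A \<Longrightarrow> - x \<in> gl_ideal A"
  using gl_ideal_con[of x A "- 1"] by (simp add: con_hom)

lemma gl_ideal_diff: "x \<in> gl_ideal A \<Longrightarrow> y \<in> gl_ideal A \<Longrightarrow> x - y \<in> gl_ideal A"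
  using gl_ideal_add[OF _ gl_ideal_uminus, of x A y] by simp

lemma gl_ideal_least:
  assumes "J \<subseteq> words (lists (A \<times> A))" "0 \<in> J" "\<And>x y. x \<in> J \<Longrightarrow> y \<in> J \<Longrightarrow> x + y \<in> J"
    and "\<And>x y. x \<in> J \<Longrightarrow> y \<in> words (lists (A \<times> A)) \<Longrightarrow> x * y \<in> J \<and> y * x \<in> J"
    and "gl_relations A \<subseteq> J"
  shows "gl_ideal A \<subseteq> J"
proof -
  interpret ring "FA A"
    by (rule ring_FA)
  have neg: "\<ominus>\<^bsub>FA A\<^esub> x = con (- 1) * x" if "x \<in> carrier (FA A)" for x
    using that by (intro minus_equality) (auto simp: con_hom carrier_FA words_uminus)
  have "ideal J (FA A)"
  proof (rule idealI)
    show "subgroup J (add_monoid (FA A))"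
    proof (rule subgroup.intro)
      fix x assume "x \<in> J"
      then have "\<ominus>\<^bsub>FA A\<^esub> x \<in> J"
        using assms(1,4) neg[of x] by (auto simp: carrier_FA)
      then show "inv\<^bsub>add_monoid (FA A)\<^esub> x \<in> J"
        by (simp only: a_inv_def)
    qed (use assms in \<open>auto simp: carrier_FA\<close>)
  qed (use assms ring_FA in \<open>auto simp: carrier_FA\<close>)
  then show ?thesis
    unfolding gl_ideal_def by (rule genideal_minimal) fact
qed

lemma rho_relation: "x \<in> gl_relations A \<Longrightarrow> rho K s x = 0"
proof -
  have e: "rho K s (free_e a b) = pol K s a b" for a b
    using lin_mon[of "pol_word K s" "[(a, b)]"] by (simp add: free_e_def mon_def)
  have "super_sign a b c d = con ((- 1) ^ ((parity a + parity b) * (parity c + parity d)))" for a b c d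
    by (auto simp: super_sign_def minus_one_power_iff con_hom)
  then have s: "rho K s (super_sign a b c d) = (- 1) ^ ((parity a + parity b) * (parity c + parity d))" for a b c d
    by (auto simp: minus_one_power_iff cst_hom)
  show "x \<in> gl_relations A \<Longrightarrow> rho K s x = 0"
    using pol_relation[of K s]
    by (auto simp: gl_relations_def gl_bracket_def rho_diff rho_mult e s)
qed

lemma rho_gl_ideal: "x \<in> gl_ideal A \<Longrightarrow> rho K s x = 0"
  using gl_ideal_least[of "{x \<in> words (lists (A \<times> A)). rho K s x = 0}" A] gl_relations_subset[of A]
  by (auto simp: rho_add rho_mult words_add carrier_mult rho_relation carrier_FA subset_iff)

lemma gl_ideal_mono:
  assumes "A \<subseteq> B"
  shows "gl_ideal A \<subseteq> gl_ideal B"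
proof -
  have sub: "words (lists (A \<times> A)) \<subseteq> words (lists (B \<times> B))"
    using assms by (intro subsetI, elim words_mono[rotated]) auto
  have "gl_relations B \<subseteq> gl_ideal B"
    unfolding gl_ideal_def by (rule ring.genideal_self[OF ring_FA gl_relations_subset])
  moreover have "gl_relations A \<subseteq> gl_relations B"
    using assms unfolding gl_relations_def by blast
  ultimately have "gl_ideal A \<subseteq> gl_ideal B \<inter> words (lists (A \<times> A))"
    using sub gl_relations_subset[of A]
    by (intro gl_ideal_least) (auto simp: gl_ideal_add words_add carrier_mult gl_ideal_mult subset_iff carrier_FA)
  then show ?thesis
    by blast
qed


subsection \<open>Cosets\<close>

definition cls :: "symb set \<Rightarrow> (symb \<times> symb) free_alg \<Rightarrow> ugl"
  where "cls A x = gl_ideal A +>\<^bsub>FA A\<^esub> x"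

lemma cls_eq_image: "cls A x = (\<lambda>h. h + x) ` gl_ideal A"
  by (auto simp: cls_def a_r_coset_def')

lemma cls_eq_iff: "cls A x = cls A y \<longleftrightarrow> x - y \<in> gl_ideal A"
proof
  assume "cls A x = cls A y"
  then have "x \<in> cls A y"
    unfolding cls_eq_image by (metis gl_ideal_zero image_eqI add_0)
  then show "x - y \<in> gl_ideal A"
    by (auto simp: cls_eq_image)
next
  assume *: "x - y \<in> gl_ideal A"
  have "h + x \<in> cls A y" if "h \<in> gl_ideal A" for h
    using gl_ideal_add[OF that *] by (auto simp: cls_eq_image image_iff intro: bexI[of _ "h + (x - y)"])
  moreover have "h + y \<in> cls A x" if "h \<in> gl_ideal A" for h
    using gl_ideal_diff[OF that *] by (auto simp: cls_eq_image image_iff intro: bexI[of _ "h - (x - y)"])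
  ultimately show "cls A x = cls A y"
    by (auto simp: cls_eq_image)
qed

lemma U_gl_carrier: "carrier (U_gl A) = cls A ` words (lists (A \<times> A))"
  by (auto simp: U_gl_def FactRing_def A_RCOSETS_def' cls_def carrier_FA)

lemma U_gl_ring: "ring (U_gl A)"
  unfolding U_gl_def by (rule ideal.quotient_is_ring[OF gl_ideal])

lemma cls_hom: "cls A \<in> Ring.ring_hom (FA A) (U_gl A)"
  using ideal.rcos_ring_hom[OF gl_ideal] by (simp add: U_gl_def cls_def[abs_def])

lemma cls_mult: "x \<in> words (lists (A \<times> A)) \<Longrightarrow> y \<in> words (lists (A \<times> A)) \<Longrightarrow>
    cls A x \<otimes>\<^bsub>U_gl A\<^esub> cls A y = cls A (x * y)"
  using ring_hom_mult[OF cls_hom, of x A y] by (simp add: carrier_FA)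

lemma cls_add: "x \<in> words (lists (A \<times> A)) \<Longrightarrow> y \<in> words (lists (A \<times> A)) \<Longrightarrow>
    cls A x \<oplus>\<^bsub>U_gl A\<^esub> cls A y = cls A (x + y)"
  using ring_hom_add[OF cls_hom, of x A y] by (simp add: carrier_FA)

lemma cls_one: "\<one>\<^bsub>U_gl A\<^esub> = cls A 1"
  using ring_hom_one[OF cls_hom, of A] by simp

lemma cls_zero: "\<zero>\<^bsub>U_gl A\<^esub> = cls A 0"
proof -
  interpret ring "U_gl A"
    by (rule U_gl_ring)
  have "cls A 0 \<in> carrier (U_gl A)" "cls A 0 \<oplus>\<^bsub>U_gl A\<^esub> cls A 0 = cls A 0"
    by (auto simp: U_gl_carrier cls_add)
  then show ?thesis
    by (metis add.r_cancel_one)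
qed

lemma cls_uminus: "x \<in> words (lists (A \<times> A)) \<Longrightarrow> \<ominus>\<^bsub>U_gl A\<^esub> cls A x = cls A (- x)"
proof -
  assume x: "x \<in> words (lists (A \<times> A))"
  interpret ring "U_gl A"
    by (rule U_gl_ring)
  show ?thesis
    using x by (intro minus_equality) (auto simp: U_gl_carrier cls_add cls_zero words_uminus)
qed

lemma e_product_cls: "e_product A ps = cls A (mon ps)"
  by (simp add: e_product_def cls_def mon_def)

lemma scalar_cls: "scalar A c = cls A (con c)"
  by (simp add: scalar_def cls_def con_def)

lemma cls_sum:
  assumes "finite S" "\<And>i. i \<in> S \<Longrightarrow> f i \<in> words (lists (A \<times> A))"
  shows "(\<Oplus>\<^bsub>U_gl A\<^esub>i\<in>S. cls A (f i)) = cls A (sum f S)"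
proof -
  interpret ring "U_gl A"
    by (rule U_gl_ring)
  show ?thesis
    using assms
  proof (induct S)
    case (insert i S)
    then show ?case
      by (subst finsum_insert) (auto simp: U_gl_carrier cls_add words_sum)
  qed (simp add: cls_zero)
qed


subsection \<open>Reduction of words\<close>

text \<open>The weight of a word under the adjoint action of the diagonal elements. The defining
  relations are homogeneous for it, so every rewriting below preserves it.\<close>

definition wt :: "(symb \<times> symb) list \<Rightarrow> symb \<Rightarrow> int"
  where "wt ps a = (\<Sum>p\<leftarrow>ps. of_bool (fst p = a) - of_bool (snd p = a))"

lemma wt_simps [simp]: "wt [] a = 0" "wt (p # ps) a = of_bool (fst p = a) - of_bool (snd p = a) + wt ps a"
  "wt (ps @ qs) a = wt ps a + wt qs a"
  by (simp_all add: wt_def)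

definition linear_set :: "(symb \<times> symb) free_alg set \<Rightarrow> bool"
  where "linear_set L \<longleftrightarrow> 0 \<in> L \<and> (\<forall>x\<in>L. \<forall>y\<in>L. x + y \<in> L) \<and> (\<forall>x\<in>L. \<forall>c. con c * x \<in> L)"

text \<open>Rewriting is needed modulo two different sets, the ideal of relations and the preimage
  of \<open>Irr\<close>. The second is only shown to be stable under multiplication from the left,
  so the rules extend words on the left only.\<close>

definition reduces :: "(symb \<times> symb) free_alg set \<Rightarrow> (symb \<times> symb) list set \<Rightarrow> (symb \<times> symb) free_alg \<Rightarrow> bool"
  where "reduces L Q x \<longleftrightarrow> (\<exists>y\<in>words Q. x - y \<in> L)"

lemma linear_set_gl_ideal: "linear_set (gl_ideal A)"
  by (auto simp: linear_set_def gl_ideal_add gl_ideal_con)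

lemma reduces_add: "linear_set L \<Longrightarrow> reduces L Q x \<Longrightarrow> reduces L Q y \<Longrightarrow> reduces L Q (x + y)"
  unfolding reduces_def linear_set_def by (metis words_add add_diff_add)

lemma reduces_con: "linear_set L \<Longrightarrow> reduces L Q x \<Longrightarrow> reduces L Q (con c * x)"
  unfolding reduces_def linear_set_def by (metis words_con right_diff_distrib)

lemma reduces_words: "linear_set L \<Longrightarrow> x \<in> words Q \<Longrightarrow> reduces L Q x"
  by (auto simp: reduces_def linear_set_def intro: bexI[of _ x])

lemma reduces_zero [simp]: "linear_set L \<Longrightarrow> reduces L Q 0"
  by (simp add: reduces_words)

lemma reduces_mem: "x \<in> L \<Longrightarrow> reduces L Q x"
  by (auto simp: reduces_def intro: bexI[of _ 0])

lemma reduces_cong: "linear_set L \<Longrightarrow> x - x' \<in> L \<Longrightarrow> reduces L Q x' \<Longrightarrow> reduces L Q x"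
  using reduces_add[of L Q "x - x'" x'] reduces_mem[of "x - x'" L Q] by simp

lemma reduces_mono: "Q \<subseteq> Q' \<Longrightarrow> reduces L Q x \<Longrightarrow> reduces L Q' x"
  unfolding reduces_def by (metis words_mono)

lemma reduces_sum: "linear_set L \<Longrightarrow> (\<And>i. i \<in> I \<Longrightarrow> reduces L Q (f i)) \<Longrightarrow> reduces L Q (sum f I)"
  by (induct I rule: infinite_finite_induct) (auto intro: reduces_add)

lemma reduces_trans:
  assumes L: "linear_set L" and "reduces L P x" and *: "\<And>ps. ps \<in> P \<Longrightarrow> reduces L Q (mon ps)"
  shows "reduces L Q x"
proof -
  obtain y where y: "y \<in> words P" "x - y \<in> L"
    using assms(2) by (auto simp: reduces_def)
  have "reduces L Q (\<Sum>w\<in>Poly_Mapping.keys y. con (Poly_Mapping.lookup y w) * mon (letters w))"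
    using y(1) by (intro reduces_sum L reduces_con *) (auto simp: words_def)
  then have "reduces L Q y"
    by (simp flip: expand_words)
  then show ?thesis
    by (rule reduces_cong[OF L y(2)])
qed

lemma reduces_Cons:
  assumes L: "linear_set L" and "reduces L P (mon ps)"
    and "\<And>x. x \<in> L \<Longrightarrow> mon [p] * x \<in> L"
    and *: "\<And>qs. qs \<in> P \<Longrightarrow> reduces L Q (mon (p # qs))"
  shows "reduces L Q (mon (p # ps))"
proof -
  obtain y where y: "y \<in> words P" "mon ps - y \<in> L"
    using assms(2) by (auto simp: reduces_def)
  have 1: "mon (p # ps) - mon [p] * y \<in> L"
    using assms(3)[OF y(2)] by (simp add: mon_Cons[of p ps] right_diff_distrib)
  have "mon [p] * y \<in> words ((#) p ` P)"
    using y(1) by (intro words_mult[of _ "{[p]}"]) auto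
  then have "reduces L ((#) p ` P) (mon [p] * y)"
    by (rule reduces_words[OF L])
  then have "reduces L Q (mon [p] * y)"
    by (rule reduces_trans[OF L]) (use * in auto)
  then show ?thesis
    by (rule reduces_cong[OF L 1])
qed

text \<open>Reductions care about which words occur and not about their coefficients, so the sign is
  hidden in \<open>k\<close>.\<close>

lemma swap_letters:
  assumes "a \<in> A" "b \<in> A" "c \<in> A" "d \<in> A" "ps \<in> lists (A \<times> A)"
  obtains k where "mon ((a, b) # (c, d) # ps) - (con k * mon ((c, d) # (a, b) # ps) +
      con (of_bool (b = c)) * mon ((a, d) # ps) + con (- k * of_bool (a = d)) * mon ((c, b) # ps)) \<in> gl_ideal A"
proof -
  let ?k = "(- 1) ^ ((parity a + parity b) * (parity c + parity d))"
  have s: "super_sign a b c d = con ?k"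
    by (auto simp: super_sign_def minus_one_power_iff con_hom)
  have "gl_relations A \<subseteq> gl_ideal A"
    unfolding gl_ideal_def by (rule ring.genideal_self[OF ring_FA gl_relations_subset])
  then have "free_e a b * free_e c d - super_sign a b c d * (free_e c d * free_e a b) - gl_bracket a b c d \<in> gl_ideal A"
    using assms unfolding gl_relations_def by blast
  then have "(free_e a b * free_e c d - super_sign a b c d * (free_e c d * free_e a b) - gl_bracket a b c d) * mon ps \<in> gl_ideal A"
    using assms by (intro gl_ideal_mult) auto
  moreover have "(free_e a b * free_e c d - super_sign a b c d * (free_e c d * free_e a b) - gl_bracket a b c d) * mon ps =
    mon ((a, b) # (c, d) # ps) - (con ?k * mon ((c, d) # (a, b) # ps) +
      con (of_bool (b = c)) * mon ((a, d) # ps) + con (- ?k * of_bool (a = d)) * mon ((c, b) # ps))"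
    by (auto simp: s mon_Cons[of _ "_ # _"] mon_Cons[of _ ps] gl_bracket_def con_hom free_e_def
        simp flip: mon_def) (auto simp: algebra_simps)
  ultimately show ?thesis
    using that by metis
qed

lemma wt_insort_key: "wt (insort_key key p qs) a = wt (p # qs) a"
  by (induct qs) auto

text \<open>The letter \<open>p\<close> travels to the right by exchanges of neighbours. Each
  bracket term has one letter fewer and the same weight, so it falls into the second set and needs
  no further treatment here.\<close>

lemma insert_letter:
  fixes key :: "symb \<times> symb \<Rightarrow> nat"
  assumes "p \<in> A \<times> A" "qs \<in> lists (A \<times> A)"
  shows "reduces (gl_ideal A)
    ({insort_key key p qs} \<union> {us \<in> lists (A \<times> A). length us < length (p # qs) \<and> wt us = wt (p # qs)})
    (mon (p # qs))"
  using assms(2)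
proof (induct qs)
  case Nil
  then show ?case
    by (intro reduces_words linear_set_gl_ideal) auto
next
  case (Cons q r)
  note L = linear_set_gl_ideal[of A]
  let ?S = "\<lambda>us. {qs \<in> lists (A \<times> A). length qs < length us \<and> wt qs = wt us}"
  show ?case
  proof (cases "key p \<le> key q")
    case True
    then show ?thesis
      by (intro reduces_words L) auto
  next
    case False
    obtain a b c d where pq: "p = (a, b)" "q = (c, d)"
      by (metis surj_pair)
    have abcd: "a \<in> A" "b \<in> A" "c \<in> A" "d \<in> A" "r \<in> lists (A \<times> A)"
      using assms(1) Cons by (auto simp: pq)
    let ?T = "{insort_key key p (q # r)} \<union> ?S (p # q # r)"
    obtain k where k: "mon (p # q # r) - (con k * mon (q # p # r) +
      con (of_bool (b = c)) * mon ((a, d) # r) + con (- k * of_bool (a = d)) * mon ((c, b) # r)) \<in> gl_ideal A"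
      using swap_letters[OF abcd] pq by metis
    have 1: "reduces (gl_ideal A) ?T (mon (q # p # r))"
    proof (rule reduces_Cons[OF L Cons.hyps(3)])
      show "mon [q] * x \<in> gl_ideal A" if "x \<in> gl_ideal A" for x
        using that abcd by (intro gl_ideal_mult) (auto simp: pq)
      show "reduces (gl_ideal A) ?T (mon (q # qs))"
        if "qs \<in> {insort_key key p r} \<union> ?S (p # r)" for qs
        using that abcd False by (intro reduces_words L) (auto simp: pq fun_eq_iff)
    qed
    have 2: "reduces (gl_ideal A) ?T (con (of_bool (b = c)) * mon ((a, d) # r))"
      using abcd by (cases "b = c") (auto simp: con_hom L pq fun_eq_iff intro!: reduces_words)
    have "a = d \<Longrightarrow> reduces (gl_ideal A) ?T (mon ((c, b) # r))"
      using abcd by (intro reduces_words L) (auto simp: pq fun_eq_iff)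
    then have 3: "reduces (gl_ideal A) ?T (con (- k * of_bool (a = d)) * mon ((c, b) # r))"
      using reduces_con[OF L] by (cases "a = d") (auto simp: con_hom(1) L)
    show ?thesis
      by (rule reduces_cong[OF L k]) (intro reduces_add L reduces_con 1 2 3)
  qed
qed

text \<open>The spanning half of the Poincare-Birkhoff-Witt theorem, for an arbitrary sorting key:
  inserting a letter into a sorted word leaves only shorter words to be sorted, hence the induction
  on the length. The record of length and weight later bounds the degree of the eigenvalue and
  removes the words with unbalanced letters.\<close>

lemma straighten:
  fixes key :: "symb \<times> symb \<Rightarrow> nat"
  assumes "ps \<in> lists (A \<times> A)"
  shows "reduces (gl_ideal A)
    {qs \<in> lists (A \<times> A). sorted (map key qs) \<and> length qs \<le> length ps \<and> wt qs = wt ps} (mon ps)"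
  using assms
proof (induct "length ps" arbitrary: ps rule: less_induct)
  case less
  note L = linear_set_gl_ideal[of A]
  show ?case
  proof (cases ps)
    case Nil
    then show ?thesis
      by (intro reduces_words L) auto
  next
    case ps: (Cons p ps')
    let ?G = "\<lambda>us. {qs \<in> lists (A \<times> A). sorted (map key qs) \<and> length qs \<le> length us \<and> wt qs = wt us}"
    have p: "p \<in> A \<times> A" "ps' \<in> lists (A \<times> A)"
      using less.prems ps by auto
    have "reduces (gl_ideal A) (?G ps') (mon ps')"
      using less.hyps[of ps'] p ps by auto
    then show ?thesis
      unfolding ps
    proof (rule reduces_Cons[OF L])
      show "mon [p] * x \<in> gl_ideal A" if "x \<in> gl_ideal A" for x
        using that p by (intro gl_ideal_mult) auto
      fix qs assume qs: "qs \<in> ?G ps'"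
      show "reduces (gl_ideal A) (?G (p # ps')) (mon (p # qs))"
      proof (rule reduces_trans[OF L insert_letter])
        fix us
        assume "us \<in> {insort_key key p qs} \<union>
          {us \<in> lists (A \<times> A). length us < length (p # qs) \<and> wt us = wt (p # qs)}"
        then consider "us = insort_key key p qs"
          | "us \<in> lists (A \<times> A)" "length us < length (p # qs)" "wt us = wt (p # qs)"
          by auto
        then show "reduces (gl_ideal A) (?G (p # ps')) (mon us)"
        proof cases
          case 1
          then show ?thesis
            using qs p
            by (intro reduces_words L) (auto simp: sorted_insort_key set_insort_key fun_eq_iff wt_insort_key)
        next
          case 2
          then have "reduces (gl_ideal A) (?G us) (mon us)"
            using qs ps by (intro less.hyps) auto
          then show ?thesis
            by (rule reduces_mono[rotated]) (use 2 qs in \<open>auto simp: fun_eq_iff\<close>)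
        qed
      qed (use p qs in auto)
    qed
  qed
qed

subsection \<open>Irregular products\<close>

lemma card_indices_filter:
  assumes "i \<le> length xs"
  shows "card {j \<in> {1..i}. P (xs ! (j - 1))} = length (filter P (take i xs))"
proof -
  have "{j \<in> {1..i}. P (xs ! (j - 1))} = Suc ` {j. j < length (take i xs) \<and> P (take i xs ! j)}"
    using assms by (auto simp: image_iff Suc_le_eq gr0_conv_Suc)
  then show ?thesis
    by (simp add: card_image length_filter_conv_card)
qed

text \<open>In terms of operators: the factors \<open>ys\<close> act before \<open>(a, b)\<close>,
  and up to this point some virtual symbol is removed more often than it has been created.\<close>

lemma irregular_iff:
  "irregular ps \<longleftrightarrow> (\<exists>xs a b ys g. ps = xs @ (a, b) # ys \<and> is_virtual g \<and>
    length (filter (\<lambda>p. fst p = g) ys) < length (filter (\<lambda>p. snd p = g) ((a, b) # ys)))"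
  (is "_ = ?R")
proof -
  have count: "card {j \<in> {1..i}. snd (rev ps ! (j - 1)) = g} > card {j \<in> {1..<i}. fst (rev ps ! (j - 1)) = g}
      \<longleftrightarrow> length (filter (\<lambda>p. fst p = g) ys) < length (filter (\<lambda>p. snd p = g) ((a, b) # ys))"
    if "ps = xs @ (a, b) # ys" "i = Suc (length ys)" for i g xs a b ys
  proof -
    have "{1..<i} = {1..length ys}"
      using that by auto
    then show ?thesis
      using card_indices_filter[of i "rev ps" "\<lambda>p. snd p = g"]
        card_indices_filter[of "length ys" "rev ps" "\<lambda>p. fst p = g"] that
      by (simp flip: rev_filter)
  qed
  have split: "\<exists>xs a b ys. ps = xs @ (a, b) # ys \<and> i = Suc (length ys)" if "i \<in> {1..length ps}" for i
  proof -
    have "ps = take (length ps - i) ps @ ps ! (length ps - i) # drop (Suc (length ps - i)) ps"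
      using that by (intro id_take_nth_drop) auto
    then show ?thesis
      using that by (intro exI[of _ "take (length ps - i) ps"] exI[of _ "fst (ps ! (length ps - i))"]
          exI[of _ "snd (ps ! (length ps - i))"] exI[of _ "drop (Suc (length ps - i)) ps"]) auto
  qed
  show ?thesis
  proof
    assume "irregular ps"
    then obtain i g where i: "i \<in> {1..length ps}" "is_virtual g"
      "card {j \<in> {1..i}. snd (rev ps ! (j - 1)) = g} > card {j \<in> {1..<i}. fst (rev ps ! (j - 1)) = g}"
      by (auto simp: irregular_def)
    obtain xs a b ys where "ps = xs @ (a, b) # ys" "i = Suc (length ys)"
      using split[OF i(1)] by blast
    then show ?R
      using count i by blast
  next
    assume ?R
    then obtain xs a b ys g where *: "ps = xs @ (a, b) # ys" "is_virtual g"
      "length (filter (\<lambda>p. fst p = g) ys) < length (filter (\<lambda>p. snd p = g) ((a, b) # ys))"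
      by blast
    then show "irregular ps"
      unfolding irregular_def using count[OF *(1) refl]
      by (intro bexI[of _ "Suc (length ys)"] exI[of _ g]) auto
  qed
qed

definition content :: "nat \<Rightarrow> config \<Rightarrow> symb \<Rightarrow> nat"
  where "content K m a = (\<Sum>p<K. m (a, p))"

lemma content_upd: "p < K \<Longrightarrow> content K (m((a, p) := Suc (m (a, p)))) b = content K m b + of_bool (a = b)"
proof -
  assume p: "p < K"
  have "(\<Sum>q<K. (m((a, p) := Suc (m (a, p)))) (b, q)) = (\<Sum>q<K. m (b, q) + (if q = p then of_bool (a = b) else 0))"
    by (intro sum.cong) auto
  then show ?thesis
    using p by (simp add: content_def sum.distrib)
qed

text \<open>A polarization exchanges one variable for another in the same column \<open>p\<close>;
  \<open>m0\<close> is what both configurations have in common. The last clause says that an odd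
  variable is created only on an even exponent, which is how occupied places are detected
  later.\<close>

lemma pol_support:
  assumes "app (pol K s a b) f m \<noteq> 0"
  obtains p m0 where "p < K" "m = m0((a, p) := Suc (m0 (a, p)))" "f (m0((b, p) := Suc (m0 (b, p)))) \<noteq> 0"
    "odd_sym s a \<Longrightarrow> even (m0 (a, p))"
proof -
  have "(\<Sum>p<K. app (cr s (a, p)) (app (an s (b, p)) f) m) \<noteq> 0"
    using assms by (simp add: pol_def app_sum sum_vec_apply)
  then obtain p where p: "p < K" "app (cr s (a, p)) (app (an s (b, p)) f) m \<noteq> 0"
    by (meson lessThan_iff sum.neutral)
  define m0 where "m0 = m((a, p) := m (a, p) - 1)"
  have "m (a, p) > 0 \<and> (odd_sym s a \<longrightarrow> odd (m (a, p)))" "app (an s (b, p)) f m0 \<noteq> 0"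
    using p(2) odd_pos[of "m (a, p)"] by (auto simp: app_cr m0_def split: if_splits)
  moreover from this(2) have "f (m0((b, p) := Suc (m0 (b, p)))) \<noteq> 0"
    by (auto simp: app_an split: if_splits)
  ultimately show ?thesis
    using p(1) by (intro that[of p m0]) (auto simp: m0_def)
qed

lemma pol_word_content:
  assumes "\<And>m. f m \<noteq> 0 \<Longrightarrow> int (content K m a) = c" and "app (pol_word K s ps) f m \<noteq> 0"
  shows "int (content K m a) = c + wt ps a"
  using assms(2)
proof (induct ps arbitrary: m)
  case (Cons p ps)
  obtain q m0 where q: "q < K" "m = m0((fst p, q) := Suc (m0 (fst p, q)))"
    "app (pol_word K s ps) f (m0((snd p, q) := Suc (m0 (snd p, q)))) \<noteq> 0"
    using Cons.prems by (auto elim: pol_support)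
  show ?case
    using Cons.hyps[OF q(3)] content_upd[OF q(1), of m0 "snd p" a] content_upd[OF q(1), of m0 "fst p" a, folded q(2)]
    by (simp del: fun_upd_apply)
qed (use assms(1) in auto)

definition proper_vec :: "vec \<Rightarrow> bool"
  where "proper_vec f \<longleftrightarrow> (\<forall>m a p. f m \<noteq> 0 \<longrightarrow> is_virtual a \<longrightarrow> m (a, p) = 0)"

lemma wt_filter: "wt ps a = int (length (filter (\<lambda>p. fst p = a) ps)) - int (length (filter (\<lambda>p. snd p = a) ps))"
  by (induct ps) auto

text \<open>On a series in the proper variables the content of \<open>g\<close> after
  \<open>ys\<close> is \<open>wt ys g\<close>. Irregularity makes this number negative, or at most
  zero while another \<open>g\<close> still has to be removed; both are impossible for a
  content.\<close>

lemma irregular_kills: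
  assumes "irregular ps" "proper_vec f"
  shows "app (pol_word K s ps) f = 0"
proof -
  obtain xs a b ys g where ps: "ps = xs @ (a, b) # ys" "is_virtual g"
    "length (filter (\<lambda>p. fst p = g) ys) < length (filter (\<lambda>p. snd p = g) ((a, b) # ys))"
    using assms(1) irregular_iff by blast
  let ?g = "app (pol_word K s ys) f"
  have "app (pol K s a b) ?g m = 0" for m
  proof (rule ccontr)
    assume "app (pol K s a b) ?g m \<noteq> 0"
    then obtain p m0 where p: "p < K" "?g (m0((b, p) := Suc (m0 (b, p)))) \<noteq> 0"
      using pol_support by metis
    have "int (content K (m0((b, p) := Suc (m0 (b, p)))) g) = 0 + wt ys g"
      using assms(2) ps(2) by (intro pol_word_content[OF _ p(2)]) (auto simp: proper_vec_def content_def)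
    then show False
      using ps(3) p(1) by (auto simp: wt_filter content_upd split: if_splits)
  qed
  then have "app (pol K s a b) ?g = 0"
    by auto
  then show ?thesis
    by (simp add: ps(1))
qed

lemma left_ideal_Int:
  assumes R: "ring R" and "S \<subseteq> carrier R"
  shows "left_ideal (gen_left_ideal R S) R" "S \<subseteq> gen_left_ideal R S"
proof -
  interpret ring R by fact
  let ?F = "{J. left_ideal J R \<and> S \<subseteq> J}"
  have "left_ideal (carrier R) R"
    by (auto simp: left_ideal_def additive_subgroup_def add.subgroup_self)
  then have ne: "?F \<noteq> {}"
    using assms(2) by auto
  have "additive_subgroup (\<Inter> ?F) R"
    using add.subgroups_Inter[of ?F] ne by (auto simp: left_ideal_def additive_subgroup_def)
  then show "left_ideal (gen_left_ideal R S) R"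
    by (auto simp: left_ideal_def gen_left_ideal_def)
  show "S \<subseteq> gen_left_ideal R S"
    by (auto simp: gen_left_ideal_def)
qed

text \<open>The preimage of \<open>Irr\<close> in the free algebra, so that reductions can be
  carried out on words instead of cosets.\<close>

definition irr_lift :: "nat \<Rightarrow> nat \<Rightarrow> nat \<Rightarrow> (symb \<times> symb) free_alg set"
  where "irr_lift m0 m1 n = {x \<in> words (lists (all_symbols m0 m1 n \<times> all_symbols m0 m1 n)).
    cls (all_symbols m0 m1 n) x \<in> Irr m0 m1 n}"

lemma Irr_left_ideal: "left_ideal (Irr m0 m1 n) (U_gl (all_symbols m0 m1 n))"
  and irregular_in_Irr: "set ps \<subseteq> all_symbols m0 m1 n \<times> all_symbols m0 m1 n \<Longrightarrow> irregular ps \<Longrightarrow>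
    cls (all_symbols m0 m1 n) (mon ps) \<in> Irr m0 m1 n"
proof -
  let ?A = "all_symbols m0 m1 n"
  let ?S = "{e_product ?A ps | ps. set ps \<subseteq> ?A \<times> ?A \<and> irregular ps}"
  have "?S \<subseteq> carrier (U_gl ?A)"
    by (auto simp: U_gl_carrier e_product_cls intro!: imageI)
  note * = left_ideal_Int[OF U_gl_ring this]
  show "left_ideal (Irr m0 m1 n) (U_gl ?A)"
    using *(1) by (simp add: Irr_def Let_def)
  show "set ps \<subseteq> ?A \<times> ?A \<Longrightarrow> irregular ps \<Longrightarrow> cls ?A (mon ps) \<in> Irr m0 m1 n"
    using *(2) by (auto simp: Irr_def Let_def e_product_cls)
qed

lemma irr_lift_closed:
  shows "linear_set (irr_lift m0 m1 n)"
    and "x \<in> irr_lift m0 m1 n \<Longrightarrow> y \<in> words (lists (all_symbols m0 m1 n \<times> all_symbols m0 m1 n)) \<Longrightarrow>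
      y * x \<in> irr_lift m0 m1 n"
    and "gl_ideal (all_symbols m0 m1 n) \<subseteq> irr_lift m0 m1 n"
    and "ps \<in> lists (all_symbols m0 m1 n \<times> all_symbols m0 m1 n) \<Longrightarrow> irregular ps \<Longrightarrow>
      mon ps \<in> irr_lift m0 m1 n"
proof -
  let ?A = "all_symbols m0 m1 n"
  note I = Irr_left_ideal[of m0 m1 n, unfolded left_ideal_def]
  have Z: "\<zero>\<^bsub>U_gl ?A\<^esub> \<in> Irr m0 m1 n"
    using I additive_subgroup.zero_closed by blast
  have m: "y * x \<in> irr_lift m0 m1 n" if "x \<in> irr_lift m0 m1 n" "y \<in> words (lists (?A \<times> ?A))" for x y
  proof -
    have "cls ?A y \<otimes>\<^bsub>U_gl ?A\<^esub> cls ?A x \<in> Irr m0 m1 n"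
      using I that by (auto simp: irr_lift_def U_gl_carrier)
    then show ?thesis
      using that by (auto simp: irr_lift_def cls_mult carrier_mult)
  qed
  show "x \<in> irr_lift m0 m1 n \<Longrightarrow> y \<in> words (lists (?A \<times> ?A)) \<Longrightarrow> y * x \<in> irr_lift m0 m1 n"
    by (rule m)
  show "linear_set (irr_lift m0 m1 n)"
    unfolding linear_set_def
  proof (intro conjI ballI allI)
    show "0 \<in> irr_lift m0 m1 n"
      using Z by (simp add: irr_lift_def cls_zero)
    fix x assume x: "x \<in> irr_lift m0 m1 n"
    show "con c * x \<in> irr_lift m0 m1 n" for c
      by (rule m) (use x in auto)
    fix y assume y: "y \<in> irr_lift m0 m1 n"
    have "cls ?A x \<oplus>\<^bsub>U_gl ?A\<^esub> cls ?A y \<in> Irr m0 m1 n"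
      using additive_subgroup.a_closed I x y by (fastforce simp: irr_lift_def)
    then show "x + y \<in> irr_lift m0 m1 n"
      using x y by (auto simp: irr_lift_def cls_add words_add)
  qed
  show "gl_ideal ?A \<subseteq> irr_lift m0 m1 n"
  proof
    fix x assume "x \<in> gl_ideal ?A"
    then show "x \<in> irr_lift m0 m1 n"
      using Z gl_ideal_subset[of ?A] cls_eq_iff[of ?A x 0] by (auto simp: irr_lift_def cls_zero)
  qed
  show "ps \<in> lists (?A \<times> ?A) \<Longrightarrow> irregular ps \<Longrightarrow> mon ps \<in> irr_lift m0 m1 n"
    using irregular_in_Irr[of ps] by (auto simp: irr_lift_def lists_eq_set)
qed

text \<open>The classes of the elements that kill a fixed \<open>f\<close> form a left ideal,
  because the right factor acts first, and this ideal contains the irregular products.\<close>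

lemma irr_lift_kills:
  assumes "x \<in> irr_lift m0 m1 n" "proper_vec f"
  shows "app (rho K s x) f = 0"
proof -
  let ?A = "all_symbols m0 m1 n"
  let ?J = "{cls ?A x | x. x \<in> words (lists (?A \<times> ?A)) \<and> app (rho K s x) f = 0}"
  have "left_ideal ?J (U_gl ?A)"
    unfolding left_ideal_def additive_subgroup_def
  proof (intro conjI ballI)
    show "subgroup ?J (add_monoid (U_gl ?A))"
    proof (rule subgroup.intro)
      fix u v assume uv: "u \<in> ?J" "v \<in> ?J"
      then obtain x y where "u = cls ?A x" "x \<in> words (lists (?A \<times> ?A))" "app (rho K s x) f = 0"
        "v = cls ?A y" "y \<in> words (lists (?A \<times> ?A))" "app (rho K s y) f = 0"
        by auto
      then show "u \<otimes>\<^bsub>add_monoid (U_gl ?A)\<^esub> v \<in> ?J"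
        by (auto simp: cls_add rho_add words_add intro!: exI[of _ "x + y"])
      have "\<ominus>\<^bsub>U_gl ?A\<^esub> u \<in> ?J"
        using \<open>u = _\<close> \<open>x \<in> _\<close> \<open>app (rho K s x) f = 0\<close>
        by (auto simp: cls_uminus rho_uminus words_uminus intro!: exI[of _ "- x"])
      then show "inv\<^bsub>add_monoid (U_gl ?A)\<^esub> u \<in> ?J"
        by (simp only: a_inv_def)
    qed (auto simp: U_gl_carrier cls_zero intro: exI[of _ 0])
    fix u v assume "u \<in> carrier (U_gl ?A)" "v \<in> ?J"
    then obtain x y where "u = cls ?A x" "x \<in> words (lists (?A \<times> ?A))"
      "v = cls ?A y" "y \<in> words (lists (?A \<times> ?A))" "app (rho K s y) f = 0"
      by (auto simp: U_gl_carrier)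
    then show "u \<otimes>\<^bsub>U_gl ?A\<^esub> v \<in> ?J"
      by (auto simp: cls_mult rho_mult carrier_mult intro!: exI[of _ "x * y"])
  qed
  moreover have "{e_product ?A ps | ps. set ps \<subseteq> ?A \<times> ?A \<and> irregular ps} \<subseteq> ?J"
    using irregular_kills[OF _ assms(2)] by (auto simp: e_product_cls lists_eq_set)
  ultimately have "Irr m0 m1 n \<subseteq> ?J"
    unfolding Irr_def Let_def gen_left_ideal_def by blast
  then obtain y where y: "cls ?A x = cls ?A y" "app (rho K s y) f = 0"
    using assms(1) by (auto simp: irr_lift_def)
  have "rho K s (x - y) = 0"
    using y(1) by (intro rho_gl_ideal[of _ ?A]) (simp add: cls_eq_iff)
  then show ?thesis
    using y(2) by (simp add: rho_diff)
qed



subsection \<open>Eliminating the virtual symbols\<close>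

text \<open>Replaces the length as the measure of a word: eliminating the virtual symbols leaves at
  most this many letters, and most letters of the monomials in question have a virtual first
  symbol.\<close>

definition proper_degree :: "(symb \<times> symb) list \<Rightarrow> nat"
  where "proper_degree ps = length (filter (\<lambda>p. \<not> is_virtual (fst p)) ps)"

text \<open>The normal form modulo \<open>Irr\<close>: letters that turn a proper symbol into a
  virtual one stand on the left, and letters with a virtual second symbol are gone.\<close>

definition split_words :: "symb set \<Rightarrow> symb set \<Rightarrow> nat \<Rightarrow> (symb \<Rightarrow> int) \<Rightarrow> (symb \<times> symb) list set"
  where "split_words A P d w = {zs @ us | zs us. zs \<in> lists ((A - P) \<times> P) \<and> us \<in> lists (P \<times> P) \<and>
    length us \<le> d \<and> (\<forall>a. wt (zs @ us) a = w a)}"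

lemma split_words_Cons:
  assumes "p \<in> (A - P) \<times> P" "ps \<in> split_words A P d w"
    and "\<And>a. wt [p] a + w a = w' a" "d \<le> d'"
  shows "p # ps \<in> split_words A P d' w'"
proof -
  obtain zs us where ps: "ps = zs @ us" "zs \<in> lists ((A - P) \<times> P)" "us \<in> lists (P \<times> P)"
    "length us \<le> d" "\<And>a. wt (zs @ us) a = w a"
    using assms(2) by (auto simp: split_words_def)
  show ?thesis
    unfolding split_words_def
    by (rule CollectI, intro exI[of _ "p # zs"] exI[of _ us]) (use assms ps in \<open>auto simp: algebra_simps\<close>)
qed

lemma split_words_mono:
  assumes "d \<le> d'" "\<And>a. w a = w' a"
  shows "split_words A P d w \<subseteq> split_words A P d' w'"
proof
  fix ps assume "ps \<in> split_words A P d w"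
  then obtain zs us where "ps = zs @ us" "zs \<in> lists ((A - P) \<times> P)" "us \<in> lists (P \<times> P)"
    "length us \<le> d" "\<forall>a. wt (zs @ us) a = w a"
    by (auto simp: split_words_def)
  with assms show "ps \<in> split_words A P d' w'"
    unfolding split_words_def by (intro CollectI exI[of _ zs] exI[of _ us]) simp
qed

lemma proper_symbols_virtual: "a \<in> all_symbols m0 m1 n \<Longrightarrow> is_virtual a \<longleftrightarrow> a \<notin> proper_symbols n"
  by (auto simp: all_symbols_def proper_symbols_def is_virtual_def)

lemma proper_subset: "proper_symbols n \<subseteq> all_symbols m0 m1 n"
  by (auto simp: all_symbols_def)

lemma irregular_virtual_letter:
  assumes "is_virtual g" "us \<in> lists (proper_symbols n \<times> proper_symbols n)"
  shows "irregular ((a, g) # us)"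
proof -
  have "filter (\<lambda>p. fst p = g) us = []"
    using assms by (auto simp: filter_empty_conv is_virtual_def proper_symbols_def)
  then show ?thesis
    unfolding irregular_iff using assms(1)
    by (intro exI[of _ "[]"] exI[of _ a] exI[of _ g] exI[of _ us]) auto
qed

text \<open>The letter moves to the right through \<open>zs\<close>. If \<open>b\<close> is virtual,
  it ends directly before proper letters and makes the word irregular; if both symbols are proper,
  it joins \<open>us\<close>. A contraction keeps the first symbol \<open>a\<close> or replaces it
  by a virtual one, so the bound on the length of the proper part never grows.\<close>

lemma reduce_letter:
  fixes m0 m1 n
  defines "A \<equiv> all_symbols m0 m1 n" and "P \<equiv> proper_symbols n"
  assumes "a \<in> A" "b \<in> A" "zs \<in> lists ((A - P) \<times> P)" "us \<in> lists (P \<times> P)"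
  shows "reduces (irr_lift m0 m1 n)
    (split_words A P (of_bool (a \<in> P) + length us) (wt ((a, b) # zs @ us))) (mon ((a, b) # zs @ us))"
  using assms(3-5)
proof (induct zs arbitrary: a b)
  case Nil
  note L = irr_lift_closed(1)[of m0 m1 n]
  consider "b \<notin> P" | "b \<in> P" "a \<in> P" | "b \<in> P" "a \<notin> P"
    by auto
  then show ?case
  proof cases
    case 1
    then have "is_virtual b" "set us \<subseteq> A \<times> A"
      using Nil proper_symbols_virtual[of b m0 m1 n] assms(6) proper_subset[of n m0 m1] by (auto simp: A_def P_def)
    then show ?thesis
      using Nil assms(6)
      by (intro reduces_mem irr_lift_closed(4))
        (auto simp: A_def P_def lists_eq_set intro!: irregular_virtual_letter[of b us n])
  next
    case 2
    then show ?thesis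
      using assms(6) unfolding split_words_def
      by (intro reduces_words L, unfold words_mon, intro CollectI exI[of _ "[]"] exI[of _ "(a, b) # us"]) auto
  next
    case 3
    then show ?thesis
      using assms(6) Nil unfolding split_words_def
      by (intro reduces_words L, unfold words_mon, intro CollectI exI[of _ "[(a, b)]"] exI[of _ us]) auto
  qed
next
  case (Cons z zs)
  note L = irr_lift_closed(1)[of m0 m1 n]
  obtain g i where z: "z = (g, i)" "g \<in> A - P" "i \<in> P" "zs \<in> lists ((A - P) \<times> P)"
    using Cons.prems by (cases z) auto
  have gA: "g \<in> A"
    using z by simp
  have iA: "i \<in> A" and rA: "zs @ us \<in> lists (A \<times> A)"
    using z(3,4) assms(6) proper_subset[of n m0 m1] by (auto simp: A_def P_def lists_eq_set)
  let ?Q = "split_words A P (of_bool (a \<in> P) + length us) (wt ((a, b) # (z # zs) @ us))"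
  show ?case
  proof (cases "(a, b) \<in> (A - P) \<times> P")
    case True
    have "z # zs @ us \<in> split_words A P (length us) (wt (z # zs @ us))"
      unfolding split_words_def using Cons.prems(3) assms(6) by (intro CollectI exI[of _ "z # zs"] exI[of _ us]) auto
    from split_words_Cons[OF True this] show ?thesis
      by (intro reduces_words L) auto
  next
    case False
    obtain k where k: "mon ((a, b) # (g, i) # zs @ us) - (con k * mon ((g, i) # (a, b) # zs @ us) +
      con (of_bool (b = g)) * mon ((a, i) # zs @ us) + con (- k * of_bool (a = i)) * mon ((g, b) # zs @ us))
      \<in> gl_ideal A"
      using swap_letters[of a A b g i "zs @ us"] Cons.prems z iA rA by auto
    have 1: "reduces (irr_lift m0 m1 n) ?Q (mon ((g, i) # (a, b) # zs @ us))"
    proof (rule reduces_Cons[OF L Cons.hyps[OF Cons.prems(1,2) z(4)]])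
      show "mon [(g, i)] * x \<in> irr_lift m0 m1 n" if "x \<in> irr_lift m0 m1 n" for x
        using that z iA by (intro irr_lift_closed) (auto simp: A_def)
      show "reduces (irr_lift m0 m1 n) ?Q (mon ((g, i) # qs))"
        if "qs \<in> split_words A P (of_bool (a \<in> P) + length us) (wt ((a, b) # zs @ us))" for qs
        using z by (intro reduces_words L, unfold words_mon, intro split_words_Cons[OF _ that]) auto
    qed
    have "reduces (irr_lift m0 m1 n) ?Q (mon ((a, i) # zs @ us))" if "b = g"
      by (rule reduces_mono[OF _ Cons.hyps[OF Cons.prems(1) iA z(4)]])
        (intro split_words_mono; use that z in simp)
    then have 2: "reduces (irr_lift m0 m1 n) ?Q (con (of_bool (b = g)) * mon ((a, i) # zs @ us))"
      by (cases "b = g") (auto simp: con_hom L)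
    have "reduces (irr_lift m0 m1 n) ?Q (mon ((g, b) # zs @ us))" if "a = i"
      by (rule reduces_mono[OF _ Cons.hyps[OF gA Cons.prems(2) z(4)]])
        (intro split_words_mono; use that z in simp)
    then have 3: "reduces (irr_lift m0 m1 n) ?Q (con (- k * of_bool (a = i)) * mon ((g, b) # zs @ us))"
      using reduces_con[OF L] by (cases "a = i") (auto simp: con_hom(1) L)
    show ?thesis
      unfolding z append_Cons
      by (rule reduces_cong[OF L subsetD[OF irr_lift_closed(3) k[unfolded A_def]]])
        (intro reduces_add L reduces_con 1[unfolded z append_Cons] 2[unfolded z append_Cons] 3[unfolded z append_Cons])
  qed
qed

lemma reduce_word:
  fixes m0 m1 n
  defines "A \<equiv> all_symbols m0 m1 n" and "P \<equiv> proper_symbols n"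
  assumes "ps \<in> lists (A \<times> A)"
  shows "reduces (irr_lift m0 m1 n) (split_words A P (proper_degree ps) (wt ps)) (mon ps)"
  using assms(3)
proof (induct ps)
  case Nil
  show ?case
    by (intro reduces_words irr_lift_closed, unfold words_mon split_words_def) auto
next
  case (Cons p ps)
  note L = irr_lift_closed(1)[of m0 m1 n]
  obtain a b where p: "p = (a, b)" "a \<in> A" "b \<in> A"
    using Cons by (cases p) auto
  show ?case
  proof (rule reduces_Cons[OF L Cons(3)])
    show "mon [p] * x \<in> irr_lift m0 m1 n" if "x \<in> irr_lift m0 m1 n" for x
      using that p by (intro irr_lift_closed) (auto simp: A_def)
    fix qs assume "qs \<in> split_words A P (proper_degree ps) (wt ps)"
    then obtain zs us where qs: "qs = zs @ us" "zs \<in> lists ((A - P) \<times> P)" "us \<in> lists (P \<times> P)"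
      "length us \<le> proper_degree ps" "\<And>a. wt qs a = wt ps a"
      by (auto simp: split_words_def)
    have deg: "of_bool (a \<in> P) + length us \<le> proper_degree (p # ps)"
      using proper_symbols_virtual[of a m0 m1 n] p qs(4) by (simp add: A_def P_def proper_degree_def)
    have "split_words A P (of_bool (a \<in> P) + length us) (wt ((a, b) # zs @ us))
        \<subseteq> split_words A P (proper_degree (p # ps)) (wt (p # ps))"
      by (rule split_words_mono[OF deg]) (use qs(1,5) p(1) in simp)
    then show "reduces (irr_lift m0 m1 n) (split_words A P (proper_degree (p # ps)) (wt (p # ps))) (mon (p # qs))"
      unfolding p(1) qs(1)
      by (rule reduces_mono[OF _ reduce_letter[of a m0 m1 n b zs us, folded A_def P_def, OF p(2,3) qs(2,3)]])
  qed
qed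

lemma wt_outside:
  assumes "us \<in> lists (P \<times> P)" "g \<notin> P"
  shows "wt us g = 0"
proof -
  have "filter (\<lambda>p. fst p = g) us = []" "filter (\<lambda>p. snd p = g) us = []"
    unfolding filter_empty_conv using assms by auto
  then show ?thesis
    by (simp add: wt_filter)
qed

text \<open>A virtual first symbol in \<open>zs\<close> could be balanced only by the same symbol in
  a second position, and none is left there. So zero weight on the virtual symbols forces
  \<open>zs\<close> to be empty, and the word lies in the subalgebra.\<close>

lemma reduce_balanced_word:
  fixes m0 m1 n
  defines "A \<equiv> all_symbols m0 m1 n" and "P \<equiv> proper_symbols n"
  assumes "ps \<in> lists (A \<times> A)" "\<And>a. is_virtual a \<Longrightarrow> wt ps a = 0"
  shows "reduces (irr_lift m0 m1 n)
    {us \<in> lists (P \<times> P). length us \<le> proper_degree ps \<and> (\<forall>a. wt us a = wt ps a)} (mon ps)"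
proof (rule reduces_mono[OF _ reduce_word[of ps m0 m1 n, folded A_def P_def, OF assms(3)]])
  have zs_Nil: "zs = []" if zs: "zs \<in> lists ((A - P) \<times> P)" "us \<in> lists (P \<times> P)"
    "\<And>a. wt (zs @ us) a = wt ps a" for zs us
  proof (rule ccontr)
    assume "zs \<noteq> []"
    then obtain z where z: "z \<in> set zs"
      by (cases zs) auto
    define g where "g = fst z"
    have g: "g \<in> A - P"
      using zs(1) z by (auto simp: lists_eq_set g_def)
    have "is_virtual g"
      using g proper_symbols_virtual[of g m0 m1 n] by (auto simp: A_def P_def)
    then have "wt zs g + wt us g = 0"
      using zs(3)[of g] assms(4)[of g] by simp
    moreover have "wt us g = 0"
      using g by (intro wt_outside[OF zs(2)]) auto
    moreover have "filter (\<lambda>p. snd p = g) zs = []"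
      unfolding filter_empty_conv using zs(1) g by (auto simp: lists_eq_set)
    moreover have "length (filter (\<lambda>p. fst p = g) zs) > 0"
      using z by (simp add: filter_empty_conv g_def) blast
    ultimately show False
      by (simp add: wt_filter)
  qed
  show "split_words A P (proper_degree ps) (wt ps)
    \<subseteq> {us \<in> lists (P \<times> P). length us \<le> proper_degree ps \<and> (\<forall>a. wt us a = wt ps a)}"
  proof
    fix qs assume "qs \<in> split_words A P (proper_degree ps) (wt ps)"
    then obtain zs us where qs: "qs = zs @ us" "zs \<in> lists ((A - P) \<times> P)" "us \<in> lists (P \<times> P)"
      "length us \<le> proper_degree ps" "\<forall>a. wt (zs @ us) a = wt ps a"
      by (auto simp: split_words_def)
    have "zs = []"
      using qs(5) by (intro zs_Nil[OF qs(2,3)]) simp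
    then show "qs \<in> {us \<in> lists (P \<times> P). length us \<le> proper_degree ps \<and> (\<forall>a. wt us a = wt ps a)}"
      using qs by simp
  qed
qed

section \<open>Faithfulness\<close>

text \<open>For \<open>s = True\<close> the variables \<open>(a|p)\<close> with \<open>a\<close> proper are even. The normally ordered products
  \<open>nop\<close> of polarizations are then symmetric in their letters, a word equals its normally ordered
  product up to shorter ones, and normally ordered products are independent because their lowest
  term can be read off on monomials with one letter in each column.\<close>

fun nop :: "nat \<Rightarrow> bool \<Rightarrow> (symb \<times> symb) list \<Rightarrow> endo" where
  "nop K s [] = 1"
| "nop K s (x # ps) = (\<Sum>p<K. cr s (fst x, p) * nop K s ps * an s (snd x, p))"

text \<open>All single contractions of \<open>x\<close> with a letter of a word; a list, so that
  equal results are counted with multiplicity.\<close>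

fun contract :: "symb \<times> symb \<Rightarrow> (symb \<times> symb) list \<Rightarrow> (symb \<times> symb) list list" where
  "contract x [] = []"
| "contract x (y # ps) = (if snd x = fst y then [(fst x, snd y) # ps] else []) @ map ((#) y) (contract x ps)"

lemma contract_length: "qs \<in> set (contract x ps) \<Longrightarrow> length qs = length ps"
  by (induct x ps arbitrary: qs rule: contract.induct) (auto split: if_splits)

lemma contract_letters:
  "qs \<in> set (contract x ps) \<Longrightarrow> x \<in> P \<times> P \<Longrightarrow> ps \<in> lists (P \<times> P) \<Longrightarrow> qs \<in> lists (P \<times> P)"
  unfolding lists_eq_set mem_Collect_eq
proof (induct x ps arbitrary: qs rule: contract.induct)
  case (2 x y ps)
  show ?case
  proof (cases "qs = (fst x, snd y) # ps")
    case True
    then show ?thesis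
      using 2 by (cases x; cases y) auto
  next
    case False
    then obtain us where us: "qs = y # us" "us \<in> set (contract x ps)"
      using 2(2) by (auto split: if_splits)
    then have "set us \<subseteq> P \<times> P"
      using 2 by simp
    then show ?thesis
      using us 2(4) by simp
  qed
qed simp

lemma even_sym_proper: "a \<in> proper_symbols n \<Longrightarrow> \<not> odd_sym True a"
  by (auto simp: proper_symbols_def odd_sym_def)

lemma pol_cr:
  assumes "\<not> odd_sym s a" "\<not> odd_sym s b" "\<not> odd_sym s c" "q < K"
  shows "pol K s a b * cr s (c, q) = cr s (c, q) * pol K s a b + (if b = c then cr s (a, q) else 0)"
proof -
  have "cr s (a, p) * an s (b, p) * cr s (c, q) = cr s (c, q) * (cr s (a, p) * an s (b, p)) +
    (if p = q then (if b = c then cr s (a, p) else 0) else 0)" for p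
  proof -
    have ac: "cr s (a, p) * cr s (c, q) = cr s (c, q) * cr s (a, p)"
      using assms cr_cr[of s "(a, p)" "(c, q)"] by (simp add: swap_sign_def)
    have bc: "an s (b, p) * cr s (c, q) = cr s (c, q) * an s (b, p) + (if b = c \<and> p = q then 1 else 0)"
      using assms an_cr[of s "(b, p)" "(c, q)"] by (simp add: swap_sign_def)
    have "cr s (a, p) * an s (b, p) * cr s (c, q) =
      cr s (a, p) * cr s (c, q) * an s (b, p) + cr s (a, p) * (if b = c \<and> p = q then 1 else 0)"
      unfolding mult.assoc bc by (simp only: distrib_left)
    then show ?thesis
      unfolding ac by (auto simp: mult.assoc)
  qed
  then show ?thesis
    using assms(4) by (simp add: pol_def sum_distrib_right sum_distrib_left sum.distrib)
qed

lemma nop_swap: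
  assumes "\<not> odd_sym s (fst x)" "\<not> odd_sym s (snd x)" "\<not> odd_sym s (fst y)" "\<not> odd_sym s (snd y)"
  shows "nop K s (x # y # ps) = nop K s (y # x # ps)"
proof -
  have "cr s (fst x, p) * (cr s (fst y, q) * nop K s ps * an s (snd y, q)) * an s (snd x, p) =
    cr s (fst y, q) * (cr s (fst x, p) * nop K s ps * an s (snd x, p)) * an s (snd y, q)" for p q
  proof -
    have "cr s (fst x, p) * cr s (fst y, q) = cr s (fst y, q) * cr s (fst x, p)"
      "an s (snd y, q) * an s (snd x, p) = an s (snd x, p) * an s (snd y, q)"
      using assms cr_cr[of s "(fst x, p)" "(fst y, q)"] an_an[of s "(snd y, q)" "(snd x, p)"]
      by (auto simp: swap_sign_def)
    then show ?thesis
      by (metis mult.assoc)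
  qed
  then show ?thesis
    by (simp add: sum_distrib_left sum_distrib_right) (rule sum.swap)
qed

text \<open>The derivative belonging to \<open>x\<close> meets the creation operators of
  \<open>ps\<close> one at a time and is used up by the first contraction. Hence the correction
  consists of words with as many letters as \<open>ps\<close>, one fewer than
  \<open>x # ps\<close>.\<close>

lemma pol_nop:
  assumes "\<not> odd_sym s (fst x)" "\<not> odd_sym s (snd x)" "\<And>y. y \<in> set ps \<Longrightarrow> \<not> odd_sym s (fst y) \<and> \<not> odd_sym s (snd y)"
  shows "pol K s (fst x) (snd x) * nop K s ps = nop K s (x # ps) + (\<Sum>qs\<leftarrow>contract x ps. nop K s qs)"
  using assms(3)
proof (induct ps)
  case Nil
  then show ?case
    by (simp add: pol_def)
next
  case (Cons y ps)
  let ?E = "pol K s (fst x) (snd x)" and ?N = "nop K s"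
  have y: "\<not> odd_sym s (fst y)" "\<not> odd_sym s (snd y)"
    using Cons.prems by auto
  have "?E * ?N (y # ps) = (\<Sum>q<K. ?E * cr s (fst y, q) * ?N ps * an s (snd y, q))"
    by (simp add: sum_distrib_left mult.assoc)
  also have "\<dots> = (\<Sum>q<K. cr s (fst y, q) * (?E * ?N ps) * an s (snd y, q)) +
      (if snd x = fst y then ?N ((fst x, snd y) # ps) else 0)"
    using assms(1,2) y by (simp add: pol_cr sum.distrib algebra_simps)
  also have "(\<Sum>q<K. cr s (fst y, q) * (?E * ?N ps) * an s (snd y, q)) =
     ?N (y # x # ps) + (\<Sum>q<K. cr s (fst y, q) * (\<Sum>qs\<leftarrow>contract x ps. ?N qs) * an s (snd y, q))"
    using Cons by (simp add: distrib_left distrib_right sum.distrib)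
  also have "(\<Sum>q<K. cr s (fst y, q) * (\<Sum>qs\<leftarrow>contract x ps. ?N qs) * an s (snd y, q)) =
      (\<Sum>qs\<leftarrow>map ((#) y) (contract x ps). ?N qs)"
  proof -
    have "(\<Sum>q<K. cr s (fst y, q) * (\<Sum>qs\<leftarrow>L. ?N qs) * an s (snd y, q)) = (\<Sum>qs\<leftarrow>map ((#) y) L. ?N qs)" for L
      by (induct L) (simp_all add: distrib_left distrib_right sum.distrib)
    then show ?thesis .
  qed
  also have "?N (y # x # ps) = ?N (x # y # ps)"
    by (rule nop_swap) (use assms(1,2) y in auto)
  finally show ?case
    by (simp add: algebra_simps)
qed

lemma nop_insort_key:
  assumes "\<And>y. y \<in> set (x # ps) \<Longrightarrow> \<not> odd_sym s (fst y) \<and> \<not> odd_sym s (snd y)"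
  shows "nop K s (insort_key key x ps) = nop K s (x # ps)"
  using assms
proof (induct ps)
  case (Cons y ps)
  show ?case
  proof (cases "key x \<le> key y")
    case False
    have "nop K s (insort_key key x ps) = nop K s (x # ps)"
      by (rule Cons.hyps) (use Cons.prems in auto)
    then have "nop K s (insort_key key x (y # ps)) = nop K s (y # x # ps)"
      using False by simp
    also have "\<dots> = nop K s (x # y # ps)"
      by (rule nop_swap) (use Cons.prems in auto)
    finally show ?thesis .
  qed simp
qed simp

lemma nop_sort_key:
  assumes "\<And>y. y \<in> set ps \<Longrightarrow> \<not> odd_sym s (fst y) \<and> \<not> odd_sym s (snd y)"
  shows "nop K s (sort_key key ps) = nop K s ps"
  using assms
proof (induct ps)
  case (Cons x ps)
  have "nop K s (insort_key key x (sort_key key ps)) = nop K s (x # sort_key key ps)"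
    using Cons.prems by (intro nop_insort_key) auto
  then show ?case
    using Cons by simp
qed simp

section \<open>Triangularity between words and normally ordered products\<close>

abbreviation key :: "symb \<times> symb \<Rightarrow> nat"
  where "key \<equiv> to_nat"

definition sorted_words :: "nat \<Rightarrow> nat \<Rightarrow> (symb \<times> symb) list set"
  where "sorted_words n d = {qs \<in> lists (proper_symbols n \<times> proper_symbols n). sorted (map key qs) \<and> length qs < d}"

definition normal :: "nat \<Rightarrow> nat \<Rightarrow> nat \<Rightarrow> endo \<Rightarrow> bool"
  where "normal K n d T \<longleftrightarrow> (\<exists>z\<in>words (sorted_words n d). T = lin (nop K True) z)"

lemma normal_add: "normal K n d S \<Longrightarrow> normal K n d T \<Longrightarrow> normal K n d (S + T)"
  unfolding normal_def by (metis lin_add words_add)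

lemma normal_cst: "normal K n d T \<Longrightarrow> normal K n d (cst c * T)"
  unfolding normal_def by (metis lin_con_mult words_con)

lemma normal_zero: "normal K n d 0"
  unfolding normal_def by (intro bexI[of _ 0]) auto

lemma normal_sum: "(\<And>i. i \<in> I \<Longrightarrow> normal K n d (f i)) \<Longrightarrow> normal K n d (sum f I)"
  by (induct I rule: infinite_finite_induct) (auto intro: normal_add normal_zero)

lemma normal_sum_list: "(\<And>i. i \<in> set xs \<Longrightarrow> normal K n d (f i)) \<Longrightarrow> normal K n d (\<Sum>i\<leftarrow>xs. f i)"
  by (induct xs) (auto intro: normal_add normal_zero)

lemma even_word: "ps \<in> lists (proper_symbols n \<times> proper_symbols n) \<Longrightarrow> y \<in> set ps \<Longrightarrow>
    \<not> odd_sym True (fst y) \<and> \<not> odd_sym True (snd y)"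
  by (auto simp: lists_eq_set dest!: subsetD even_sym_proper)

lemma normal_nop:
  assumes "qs \<in> lists (proper_symbols n \<times> proper_symbols n)" "length qs < d"
  shows "normal K n d (nop K True qs)"
proof -
  have "nop K True (sort_key key qs) = nop K True qs"
    by (rule nop_sort_key) (rule even_word[OF assms(1)])
  moreover have "sort_key key qs \<in> sorted_words n d"
    using assms by (auto simp: sorted_words_def lists_eq_set)
  ultimately show ?thesis
    unfolding normal_def by (intro bexI[of _ "mon (sort_key key qs)"]) auto
qed

lemma normal_mono: "d \<le> d' \<Longrightarrow> normal K n d T \<Longrightarrow> normal K n d' T"
  unfolding normal_def by (elim bexE, intro bexI) (auto simp: sorted_words_def words_def)

lemma normal_lin:
  assumes "\<And>qs. qs \<in> Q \<Longrightarrow> normal K n d (G (nop K True qs))" "z \<in> words Q"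
    and "G 0 = 0" "\<And>S T. G (S + T) = G S + G T" "\<And>c T. G (cst c * T) = cst c * G T"
  shows "normal K n d (G (lin (nop K True) z))"
proof -
  have "G (sum f X) = (\<Sum>x\<in>X. G (f x))" for f :: "(symb \<times> symb) free_word \<Rightarrow> endo" and X
    by (induct X rule: infinite_finite_induct) (auto simp: assms(3,4))
  then show ?thesis
    unfolding lin_def using assms(1,2,5) by (auto intro!: normal_sum normal_cst simp: words_def)
qed

lemma pol_word_nop:
  assumes "ps \<in> lists (proper_symbols n \<times> proper_symbols n)"
  shows "normal K n (length ps) (pol_word K True ps - nop K True ps)"
  using assms
proof (induct ps)
  case Nil
  then show ?case
    by (simp add: normal_zero)
next
  case (Cons x ps)
  let ?E = "pol K True (fst x) (snd x)"
  have x: "\<not> odd_sym True (fst x)" "\<not> odd_sym True (snd x)"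
    using Cons even_sym_proper by auto
  have E: "normal K n (Suc d) (?E * nop K True qs)" if "qs \<in> sorted_words n d" for qs d
  proof -
    have qs: "qs \<in> lists (proper_symbols n \<times> proper_symbols n)" "length qs < d"
      using that by (auto simp: sorted_words_def)
    have "?E * nop K True qs = nop K True (x # qs) + (\<Sum>us\<leftarrow>contract x qs. nop K True us)"
      using x even_word[OF qs(1)] by (intro pol_nop) auto
    moreover have "normal K n (Suc d) (nop K True (x # qs))"
      using qs Cons.hyps(1) by (intro normal_nop) auto
    moreover have "normal K n (Suc d) (nop K True us)" if "us \<in> set (contract x qs)" for us
      using qs contract_length[OF that] contract_letters[OF that Cons.hyps(1)] by (intro normal_nop) auto
    ultimately show ?thesis
      by (simp only:) (intro normal_add normal_sum_list)
  qed
  have "normal K n (Suc (length ps)) (?E * (pol_word K True ps - nop K True ps))"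
  proof -
    obtain z where z: "z \<in> words (sorted_words n (length ps))" "pol_word K True ps - nop K True ps = lin (nop K True) z"
      using Cons.hyps(3) by (auto simp: normal_def)
    show ?thesis
      unfolding z(2) by (rule normal_lin[where G = "(*) ?E", OF E z(1)]) (auto simp: distrib_left cst_left_commute[of ?E])
  qed
  moreover have "?E * nop K True ps = nop K True (x # ps) + (\<Sum>us\<leftarrow>contract x ps. nop K True us)"
    using x even_word[OF Cons.hyps(2)] by (intro pol_nop) auto
  moreover have "normal K n (Suc (length ps)) (\<Sum>us\<leftarrow>contract x ps. nop K True us)"
  proof (rule normal_sum_list)
    fix us assume us: "us \<in> set (contract x ps)"
    show "normal K n (Suc (length ps)) (nop K True us)"
      using contract_length[OF us] contract_letters[OF us Cons.hyps(1,2)] by (intro normal_nop) auto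
  qed
  ultimately have "normal K n (Suc (length ps)) (?E * (pol_word K True ps - nop K True ps) +
      (?E * nop K True ps - nop K True (x # ps)))"
    by (intro normal_add) simp_all
  then show ?case
    by (simp add: right_diff_distrib)
qed

section \<open>Coefficients on monomials with one variable per column\<close>

definition col_config :: "nat set \<Rightarrow> (nat \<Rightarrow> symb) \<Rightarrow> config"
  where "col_config C b = (\<lambda>(x, p). of_bool (p \<in> C \<and> x = b p))"

definition ind :: "config \<Rightarrow> vec"
  where "ind m0 = (\<lambda>m. of_bool (m = m0))"

lemma an_ind:
  assumes "\<not> odd_sym s d"
  shows "app (an s (d, p)) (ind (col_config C b)) = (if p \<in> C \<and> b p = d then ind (col_config (C - {p}) b) else 0)"
proof
  fix m
  have "m((d, p) := Suc (m (d, p))) = col_config C b \<longleftrightarrow> p \<in> C \<and> b p = d \<and> m = col_config (C - {p}) b"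
    by (auto simp: fun_eq_iff col_config_def split: if_splits)
  moreover have "col_config (C - {p}) b (d, p) = 0"
    by (simp add: col_config_def)
  ultimately show "app (an s (d, p)) (ind (col_config C b)) m =
    (if p \<in> C \<and> b p = d then ind (col_config (C - {p}) b) else 0) m"
    using assms by (auto simp: app_an ind_def)
qed

lemma cr_col:
  assumes "\<not> odd_sym s c"
  shows "app (cr s (c, p)) g (col_config C a) = (if p \<in> C \<and> a p = c then g (col_config (C - {p}) a) else 0)"
proof -
  have "p \<in> C \<and> a p = c \<Longrightarrow> (col_config C a)((c, p) := col_config C a (c, p) - 1) = col_config (C - {p}) a"
    by (auto simp: fun_eq_iff col_config_def)
  then show ?thesis
    using assms by (auto simp: app_cr col_config_def)
qed

lemma nop_step:
  assumes "\<not> odd_sym s (fst x)" "\<not> odd_sym s (snd x)" "C \<subseteq> {..<K}"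
  shows "app (nop K s (x # ps)) (ind (col_config C b)) (col_config C a) =
    (\<Sum>p | p \<in> C \<and> (a p, b p) = x. app (nop K s ps) (ind (col_config (C - {p}) b)) (col_config (C - {p}) a))"
proof -
  have "app (nop K s (x # ps)) (ind (col_config C b)) (col_config C a) =
    (\<Sum>p<K. if p \<in> C \<and> (a p, b p) = x
      then app (nop K s ps) (ind (col_config (C - {p}) b)) (col_config (C - {p}) a) else 0)"
    using assms by (cases x) (auto simp: app_sum sum_vec_apply cr_col an_ind intro!: sum.cong)
  then show ?thesis
    using assms(3) by (simp add: sum.If_cases) (intro sum.cong, auto)
qed

lemma nop_value_long:
  assumes "\<And>y. y \<in> set ps \<Longrightarrow> \<not> odd_sym s (fst y) \<and> \<not> odd_sym s (snd y)"
    and "C \<subseteq> {..<K}" "card C < length ps"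
  shows "app (nop K s ps) (ind (col_config C b)) (col_config C a) = 0"
  using assms
proof (induct ps arbitrary: C)
  case (Cons x ps)
  have "app (nop K s ps) (ind (col_config (C - {p}) b)) (col_config (C - {p}) a) = 0" if "p \<in> C" for p
  proof -
    have "card C = Suc (card (C - {p}))"
      using that Cons.prems(2) finite_subset by (intro card.remove) auto
    then show ?thesis
      using Cons by (intro Cons.hyps) auto
  qed
  then show ?case
    using Cons.prems by (subst nop_step) auto
qed simp

text \<open>The number \<open>N\<close> counts the ways to assign the letters of \<open>ps\<close>
  to the columns in \<open>C\<close> such that column \<open>p\<close> receives the letter
  \<open>(a p, b p)\<close>. As a count it cannot vanish by cancellation.\<close>

lemma nop_value:
  assumes "\<And>y. y \<in> set ps \<Longrightarrow> \<not> odd_sym s (fst y) \<and> \<not> odd_sym s (snd y)"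
    and "C \<subseteq> {..<K}" "card C = length ps"
  shows "\<exists>N. app (nop K s ps) (ind (col_config C b)) (col_config C a) = of_nat N \<and>
    (N \<noteq> 0 \<longleftrightarrow> mset ps = image_mset (\<lambda>p. (a p, b p)) (mset_set C))"
  using assms
proof (induct ps arbitrary: C)
  case Nil
  then have "C = {}"
    by (metis card_0_eq finite_lessThan finite_subset list.size(3))
  then show ?case
    by (auto simp: ind_def col_config_def intro!: exI[of _ 1])
next
  case (Cons x ps)
  have fin: "finite C"
    using Cons.prems(2) finite_subset by auto
  let ?v = "\<lambda>p. app (nop K s ps) (ind (col_config (C - {p}) b)) (col_config (C - {p}) a)"
  have "\<exists>N. ?v p = of_nat N \<and> (N \<noteq> 0 \<longleftrightarrow> mset ps = image_mset (\<lambda>p. (a p, b p)) (mset_set (C - {p})))"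
    if "p \<in> C" for p
  proof -
    have "card C = Suc (card (C - {p}))"
      using that fin by (intro card.remove)
    then show ?thesis
      using Cons.prems by (intro Cons.hyps) auto
  qed
  then obtain N where N: "\<And>p. p \<in> C \<Longrightarrow> ?v p = of_nat (N p)"
    "\<And>p. p \<in> C \<Longrightarrow> N p \<noteq> 0 \<longleftrightarrow> mset ps = image_mset (\<lambda>p. (a p, b p)) (mset_set (C - {p}))"
    by metis
  let ?X = "{p. p \<in> C \<and> (a p, b p) = x}"
  have "app (nop K s (x # ps)) (ind (col_config C b)) (col_config C a) = (\<Sum>p\<in>?X. ?v p)"
    using Cons.prems by (intro nop_step) auto
  also have "\<dots> = of_nat (\<Sum>p\<in>?X. N p)"
    using N(1) by simp
  finally have 1: "app (nop K s (x # ps)) (ind (col_config C b)) (col_config C a) = of_nat (\<Sum>p\<in>?X. N p)" .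
  have rem: "mset (x # ps) = image_mset (\<lambda>p. (a p, b p)) (mset_set C) \<longleftrightarrow>
      mset ps = image_mset (\<lambda>p. (a p, b p)) (mset_set (C - {p}))" if "p \<in> ?X" for p
    using that fin by (auto simp: mset_set.remove[of C p])
  have "(\<Sum>p\<in>?X. N p) \<noteq> 0 \<longleftrightarrow> (\<exists>p\<in>?X. N p \<noteq> 0)"
    using fin by (simp add: sum_eq_0_iff)
  also have "\<dots> \<longleftrightarrow> (\<exists>p\<in>?X. mset (x # ps) = image_mset (\<lambda>p. (a p, b p)) (mset_set C))"
    using rem N(2) by (intro bex_cong refl) (metis (no_types, lifting) mem_Collect_eq)
  also have "\<dots> \<longleftrightarrow> mset (x # ps) = image_mset (\<lambda>p. (a p, b p)) (mset_set C)"
  proof -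
    have "?X \<noteq> {}" if "mset (x # ps) = image_mset (\<lambda>p. (a p, b p)) (mset_set C)"
    proof -
      have "x \<in># image_mset (\<lambda>p. (a p, b p)) (mset_set C)"
        using that by (metis list.set_intros(1) set_mset_mset)
      then show ?thesis
        using fin by auto
    qed
    then show ?thesis
      by blast
  qed
  finally show ?case
    using 1 by blast
qed

lemma sorted_words_unique:
  assumes "mset ps = mset qs" "sorted (map key ps)" "sorted (map key qs)"
  shows "ps = qs"
proof -
  have "map key ps = map key qs"
    using assms by (metis mset_map properties_for_sort sorted_sort_id)
  then show ?thesis
    by (simp add: inj_map_eq_map)
qed

text \<open>The test monomial has one column for each letter of a shortest word \<open>w0\<close> of
  \<open>z\<close>. Longer words run out of columns, and another sorted word of the same length has
  a different multiset of letters, so only the coefficient at \<open>w0\<close> is seen.\<close>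

lemma normal_independent:
  assumes "z \<in> words (sorted_words n d)" "\<And>f. proper_vec f \<Longrightarrow> app (lin (nop d True) z) f = 0"
  shows "z = 0"
proof (rule ccontr)
  assume "z \<noteq> 0"
  then have "Poly_Mapping.keys z \<noteq> {}"
    by simp
  then obtain w0 where w0: "w0 \<in> Poly_Mapping.keys z"
    "\<And>w. w \<in> Poly_Mapping.keys z \<Longrightarrow> length (letters w0) \<le> length (letters w)"
    using ex_has_least_nat[of "\<lambda>w. w \<in> Poly_Mapping.keys z" _ "\<lambda>w. length (letters w)"] by (metis equals0I)
  define ps where "ps = letters w0"
  define a b where "a = (\<lambda>k. fst (ps ! k))" and "b = (\<lambda>k. snd (ps ! k))"
  let ?C = "{..<length ps}"
  have words: "letters w \<in> sorted_words n d" if "w \<in> Poly_Mapping.keys z" for w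
    using that assms(1) by (auto simp: words_def)
  have ps: "ps \<in> lists (proper_symbols n \<times> proper_symbols n)" "length ps < d" "sorted (map key ps)"
    using words[OF w0(1)] by (auto simp: ps_def sorted_words_def)
  have "b k \<in> proper_symbols n" if "k < length ps" for k
    using ps(1) nth_mem[OF that] by (auto simp: b_def mem_Times_iff)
  then have "\<not> is_virtual (b k)" if "k < length ps" for k
    using that by (fastforce simp: proper_symbols_def is_virtual_def)
  then have "proper_vec (ind (col_config ?C b))"
    by (auto simp: proper_vec_def ind_def col_config_def)
  from assms(2)[OF this]
  have 0: "(\<Sum>w\<in>Poly_Mapping.keys z. Poly_Mapping.lookup z w *
      app (nop d True (letters w)) (ind (col_config ?C b)) (col_config ?C a)) = 0"
    by (simp add: lin_def app_sum fun_eq_iff sum_vec_apply)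
  have eq: "image_mset (\<lambda>p. (a p, b p)) (mset_set ?C) = mset ps"
    by (simp add: a_def b_def) (metis map_nth mset_map mset_upt atLeast0LessThan)
  have val: "app (nop d True (letters w)) (ind (col_config ?C b)) (col_config ?C a) = 0"
    if w: "w \<in> Poly_Mapping.keys z" "w \<noteq> w0" for w
  proof (cases "length (letters w) = length ps")
    case True
    have "letters w \<noteq> ps"
      using w(2) by (cases w; cases w0) (simp add: ps_def)
    then have "mset (letters w) \<noteq> mset ps"
      using sorted_words_unique words[OF w(1)] ps(3) by (auto simp: sorted_words_def)
    then show ?thesis
      using nop_value[of "letters w" True ?C d b a] even_word[of "letters w" n] words[OF w(1)] True ps(2) eq
      by (auto simp: sorted_words_def)
  next
    case False
    then show ?thesis
      using w0(2)[OF w(1)] even_word[of "letters w" n] words[OF w(1)] ps(2)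
      by (intro nop_value_long) (auto simp: sorted_words_def ps_def)
  qed
  have "app (nop d True ps) (ind (col_config ?C b)) (col_config ?C a) \<noteq> 0"
    using nop_value[of ps True ?C d b a] even_word[OF ps(1)] ps(2) eq by auto
  moreover have "Poly_Mapping.lookup z w0 * app (nop d True ps) (ind (col_config ?C b)) (col_config ?C a) = 0"
    using 0 w0(1) val by (simp add: sum.remove[of _ w0] ps_def)
  ultimately show False
    using w0(1) by (simp add: in_keys_iff)
qed

text \<open>The injectivity half of the Poincare-Birkhoff-Witt theorem, tested on proper vectors
  only. Passing from a straightened \<open>y\<close> to normal order adds a combination
  \<open>z\<close> of words shorter than a longest word \<open>w0\<close> of \<open>y\<close>;
  independence gives \<open>y + z = 0\<close>, and \<open>z\<close> cannot cancel the coefficient at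
  \<open>w0\<close>.\<close>

theorem faithful:
  assumes x: "x \<in> words (lists (proper_symbols n \<times> proper_symbols n))"
    and kills: "\<And>K f. proper_vec f \<Longrightarrow> app (rho K True x) f = 0"
  shows "x \<in> gl_ideal (proper_symbols n)"
proof -
  let ?P = "proper_symbols n"
  let ?S = "{qs \<in> lists (?P \<times> ?P). sorted (map key qs)}"
  have "reduces (gl_ideal ?P) ?S x"
  proof (rule reduces_trans[OF linear_set_gl_ideal reduces_words[OF linear_set_gl_ideal x]])
    show "reduces (gl_ideal ?P) ?S (mon ps)" if "ps \<in> lists (?P \<times> ?P)" for ps
      by (rule reduces_mono[OF _ straighten[OF that, of key]]) auto
  qed
  then obtain y where y: "y \<in> words ?S" "x - y \<in> gl_ideal ?P"
    by (auto simp: reduces_def)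
  have "y = 0"
  proof (rule ccontr)
    assume "y \<noteq> 0"
    then have "Poly_Mapping.keys y \<noteq> {}"
      by simp
    then obtain w0 where w0: "w0 \<in> Poly_Mapping.keys y"
      "\<And>w. w \<in> Poly_Mapping.keys y \<Longrightarrow> length (letters w) \<le> length (letters w0)"
      using ex_has_greatest_nat[of "\<lambda>w. w \<in> Poly_Mapping.keys y" _ "\<lambda>w. length (letters w)"
          "Suc (Max ((\<lambda>w. length (letters w)) ` Poly_Mapping.keys y))"]
      by (metis (no_types, lifting) Max_ge equals0I finite_imageI finite_keys image_eqI le_imp_less_Suc)
    define d where "d = length (letters w0)"
    let ?K = "Suc d"
    have "rho ?K True y - lin (nop ?K True) y = (\<Sum>w\<in>Poly_Mapping.keys y. cst (Poly_Mapping.lookup y w) *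
        (pol_word ?K True (letters w) - nop ?K True (letters w)))"
      by (simp add: lin_def sum_subtractf right_diff_distrib)
    moreover have "normal ?K n d \<dots>"
    proof (intro normal_sum normal_cst)
      fix w assume w: "w \<in> Poly_Mapping.keys y"
      then have "letters w \<in> lists (?P \<times> ?P)" "length (letters w) \<le> d"
        using y(1) w0(2)[OF w] by (auto simp: words_def d_def)
      then show "normal ?K n d (pol_word ?K True (letters w) - nop ?K True (letters w))"
        using normal_mono pol_word_nop by blast
    qed
    ultimately obtain z where z: "z \<in> words (sorted_words n d)" "rho ?K True y - lin (nop ?K True) y = lin (nop ?K True) z"
      by (auto simp: normal_def)
    have "y \<in> words (sorted_words n ?K)"
      using y(1) w0(2) by (auto simp: words_def sorted_words_def d_def le_imp_less_Suc)
    moreover have "z \<in> words (sorted_words n ?K)"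
      by (rule words_mono[OF _ z(1)]) (auto simp: sorted_words_def)
    moreover have "lin (nop ?K True) (y + z) = rho ?K True x"
      using z(2) rho_gl_ideal[OF y(2), of ?K True] by (simp add: lin_add lin_diff algebra_simps)
    ultimately have "y + z = 0"
      using kills by (intro normal_independent[of "y + z" n ?K]) (auto intro: words_add)
    moreover have "Poly_Mapping.lookup z w0 = 0"
      using z(1) by (auto simp: words_def sorted_words_def d_def in_keys_iff)
    ultimately have "Poly_Mapping.lookup y w0 = 0"
      by (metis add.right_neutral lookup_add lookup_zero)
    then show False
      using w0(1) by (simp add: in_keys_iff)
  qed
  then show ?thesis
    using y(2) by simp
qed

section \<open>The virtual projection\<close>

lemma incl_cls:
  assumes "x \<in> words (lists (proper_symbols n \<times> proper_symbols n))"
  shows "incl m0 m1 n (cls (proper_symbols n) x) = cls (all_symbols m0 m1 n) x"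
proof -
  let ?I = "gl_ideal (all_symbols m0 m1 n)" and ?J = "gl_ideal (proper_symbols n)"
  have sub: "?J \<subseteq> ?I"
    by (rule gl_ideal_mono[OF proper_subset])
  have "incl m0 m1 n (cls (proper_symbols n) x) = (\<Union>h\<in>?I. \<Union>k\<in>?J. {h + (k + x)})"
    by (simp add: incl_def Let_def set_add_def' cls_eq_image)
  also have "\<dots> = (\<lambda>h. h + x) ` ?I"
  proof (intro equalityI subsetI)
    fix y assume "y \<in> (\<Union>h\<in>?I. \<Union>k\<in>?J. {h + (k + x)})"
    then obtain h k where "h \<in> ?I" "k \<in> ?J" "y = h + (k + x)"
      by blast
    then have "h + k \<in> ?I" "y = (h + k) + x"
      using sub by (auto simp only: add.assoc intro!: gl_ideal_add)
    then show "y \<in> (\<lambda>h. h + x) ` ?I"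
      by (rule rev_image_eqI)
  next
    fix y assume "y \<in> (\<lambda>h. h + x) ` ?I"
    then obtain h where "h \<in> ?I" "y = h + (0 + x)"
      by auto
    then show "y \<in> (\<Union>h\<in>?I. \<Union>k\<in>?J. {h + (k + x)})"
      using gl_ideal_zero[of "proper_symbols n"] by blast
  qed
  finally show ?thesis
    by (simp only: cls_eq_image)
qed

text \<open>Uniqueness in the definite description is the directness of the sum. The difference of
  two candidates is a combination of elements of \<open>irr_lift\<close> and of the ideal, so it
  kills every proper vector and is zero by \<open>faithful\<close>.\<close>

lemma virt_proj_cls:
  fixes m0 m1 n
  defines "A \<equiv> all_symbols m0 m1 n" and "P \<equiv> proper_symbols n"
  assumes x: "x \<in> words (lists (P \<times> P))" and y: "y \<in> words (lists (A \<times> A))"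
    and xy: "y - x \<in> irr_lift m0 m1 n"
  shows "virt_proj m0 m1 n (cls A y) = cls P x"
proof -
  have x': "x \<in> words (lists (A \<times> A))" if "x \<in> words (lists (P \<times> P))" for x
    by (rule words_mono[OF _ that]) (use proper_subset[of n m0 m1] in \<open>auto simp: A_def P_def lists_eq_set\<close>)
  have sum: "cls A y = incl m0 m1 n (cls P x) \<oplus>\<^bsub>U_gl A\<^esub> cls A (y - x)"
    using x x'[OF x] y incl_cls[of x n m0 m1] by (simp add: A_def P_def cls_add words_diff)
  have irr: "cls A (y - x) \<in> Irr m0 m1 n"
    using xy by (simp add: irr_lift_def A_def)
  have carr: "cls P x \<in> carrier (U_gln n)"
    using x by (simp add: U_gln_def U_gl_carrier P_def)
  have "cls A y \<in> Virt m0 m1 n"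
    unfolding Virt_def set_add_def' using sum irr carr by (auto simp: A_def)
  moreover have "(THE u. u \<in> carrier (U_gln n) \<and> (\<exists>r \<in> Irr m0 m1 n. cls A y = incl m0 m1 n u \<oplus>\<^bsub>U_gl A\<^esub> r)) = cls P x"
  proof (rule the_equality)
    fix u assume u: "u \<in> carrier (U_gln n) \<and> (\<exists>r \<in> Irr m0 m1 n. cls A y = incl m0 m1 n u \<oplus>\<^bsub>U_gl A\<^esub> r)"
    then obtain x2 r where x2: "x2 \<in> words (lists (P \<times> P))" "u = cls P x2"
      and r: "r \<in> Irr m0 m1 n" "cls A y = incl m0 m1 n u \<oplus>\<^bsub>U_gl A\<^esub> r"
      by (auto simp: U_gln_def U_gl_carrier P_def)
    have "Irr m0 m1 n \<subseteq> carrier (U_gl A)"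
      using Irr_left_ideal[of m0 m1 n] additive_subgroup.a_subset by (auto simp: left_ideal_def A_def)
    then obtain z where z: "z \<in> words (lists (A \<times> A))" "r = cls A z"
      using r(1) by (auto simp: U_gl_carrier)
    have zi: "z \<in> irr_lift m0 m1 n"
      using z r(1) by (simp add: irr_lift_def A_def)
    have "cls A y = cls A (x2 + z)"
      using r(2) x2 x'[OF x2(1)] z incl_cls[of x2 n m0 m1] by (simp add: A_def P_def cls_add)
    then have ideal: "y - (x2 + z) \<in> gl_ideal A"
      by (simp add: cls_eq_iff)
    have "app (rho K True (x2 - x)) f = 0" if "proper_vec f" for K f
    proof -
      have "x2 - x = (y - x) - (y - (x2 + z)) - z"
        by simp
      then show ?thesis
        using irr_lift_kills[OF xy that, of K True] irr_lift_kills[OF zi that, of K True] rho_gl_ideal[OF ideal, of K True]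
        by (simp add: rho_diff rho_add)
    qed
    then have "x2 - x \<in> gl_ideal P"
      unfolding P_def using x x2(1) by (intro faithful) (auto simp: P_def words_diff)
    then show "u = cls P x"
      using x2(2) by (simp add: cls_eq_iff)
  qed (use carr irr sum in auto)
  ultimately show ?thesis
    by (simp add: virt_proj_def A_def)
qed

section \<open>The elements as operators\<close>

lemma pol_anticommute:
  assumes "even (parity a) \<noteq> even (parity b)" "even (parity c) \<noteq> even (parity d)" "b \<noteq> c" "a \<noteq> d"
  shows "pol K s a b * pol K s c d = - (pol K s c d * pol K s a b)"
proof -
  have "odd ((parity a + parity b) * (parity c + parity d))"
    using assms by auto
  then show ?thesis
    using pol_relation[of K s a b c d] assms by (simp add: eq_neg_iff_add_eq_0)
qed

lemma pol_square:
  assumes "even (parity a) \<noteq> even (parity b)"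
  shows "pol K s a b * pol K s a b = 0"
proof -
  let ?T = "pol K s a b * pol K s a b"
  have "?T + ?T = 0"
    using pol_anticommute[of a b a b K s] assms by (auto simp: eq_neg_iff_add_eq_0)
  then have "cst (1/2) * (cst 2 * ?T) = 0"
    using cst_hom(3)[of 1 1] by (simp add: cst_hom(2) mult_2)
  then show ?thesis
    by (simp add: mult.assoc[symmetric] cst_hom(4)[symmetric] cst_hom(2))
qed

lemma pol_even:
  assumes "even (parity k) = even (parity j)"
  shows "pol K s k j * pol K s c d =
    pol K s c d * pol K s k j + (if j = c then pol K s k d else 0) - (if k = d then pol K s c j else 0)"
proof -
  have "even ((parity k + parity j) * (parity c + parity d))"
    using assms by auto
  then show ?thesis
    using pol_relation[of K s k j c d] by (simp add: algebra_simps)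
qed

text \<open>The sign (-1)^(k(k-1)/2) of reversing \<open>k\<close> anticommuting factors.\<close>

definition rev_sign :: "nat \<Rightarrow> 'a :: ring_1"
  where "rev_sign k = (- 1) ^ (\<Sum>i<k. i)"

lemma rev_sign_Suc: "rev_sign (Suc k) = rev_sign k * (- 1) ^ k"
  by (simp add: rev_sign_def power_add)

lemma rev_sign_square: "rev_sign k * rev_sign k = 1"
  by (simp add: rev_sign_def minus_one_power_iff)

lemma rev_sign_commute: "x * rev_sign k = rev_sign k * x"
  by (cases "even (\<Sum>i<k. i)") (simp_all add: rev_sign_def minus_one_power_iff)

lemma anticommute_prod_list:
  fixes x :: "'a :: ring_1"
  assumes "\<And>y. y \<in> set ys \<Longrightarrow> y * x = - (x * y)"
  shows "prod_list ys * x = (- 1) ^ length ys * (x * prod_list ys)"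
  using assms
proof (induct ys)
  case (Cons y ys)
  have "prod_list (y # ys) * x = y * ((- 1) ^ length ys * (x * prod_list ys))"
    using Cons by (simp add: mult.assoc)
  also have "\<dots> = (- 1) ^ length ys * (y * x * prod_list ys)"
    by (simp add: minus_one_power_iff mult.assoc)
  finally show ?case
    using Cons.prems by (simp add: mult.assoc)
qed simp

lemma prod_list_rev:
  fixes xs :: "'a :: ring_1 list"
  assumes "\<And>x y. x \<in> set xs \<Longrightarrow> y \<in> set xs \<Longrightarrow> y * x = - (x * y)"
  shows "prod_list (rev xs) = rev_sign (length xs) * prod_list xs"
  using assms
proof (induct xs)
  case (Cons x xs)
  have "prod_list (rev xs) = rev_sign (length xs) * prod_list xs"
    by (rule Cons.hyps) (rule Cons.prems; simp)
  then have "prod_list (rev (x # xs)) = rev_sign (length xs) * (prod_list xs * x)"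
    by (simp add: mult.assoc)
  also have "prod_list xs * x = (- 1) ^ length xs * (x * prod_list xs)"
    by (intro anticommute_prod_list Cons.prems) simp_all
  finally show ?case
    by (simp add: rev_sign_Suc mult.assoc)
qed (simp add: rev_sign_def)

lemma pol_word_prod_list: "pol_word K s ps = prod_list (map (\<lambda>p. pol K s (fst p) (snd p)) ps)"
  by (induct ps) auto

lemma pol_word_rev:
  assumes "\<And>p q. p \<in> set ps \<Longrightarrow> q \<in> set ps \<Longrightarrow> even (parity (fst p)) \<noteq> even (parity (snd p)) \<and> snd p \<noteq> fst q"
  shows "pol_word K s (rev ps) = rev_sign (length ps) * pol_word K s ps"
proof -
  have "prod_list (rev (map (\<lambda>p. pol K s (fst p) (snd p)) ps)) =
    rev_sign (length (map (\<lambda>p. pol K s (fst p) (snd p)) ps)) * prod_list (map (\<lambda>p. pol K s (fst p) (snd p)) ps)"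
  proof (rule prod_list_rev)
    fix x y
    assume "x \<in> set (map (\<lambda>p. pol K s (fst p) (snd p)) ps)" "y \<in> set (map (\<lambda>p. pol K s (fst p) (snd p)) ps)"
    then obtain p q where "p \<in> set ps" "q \<in> set ps" "x = pol K s (fst p) (snd p)" "y = pol K s (fst q) (snd q)"
      by auto
    then show "y * x = - (x * y)"
      using assms[of p q] assms[of q p] by (simp only:) (rule pol_anticommute; metis)
  qed
  then show ?thesis
    by (simp add: pol_word_prod_list rev_map)
qed

subsection \<open>Rows\<close>

definition row_words :: "nat \<Rightarrow> nat \<Rightarrow> nat list set"
  where "row_words n r = {w. length w = r \<and> set w \<subseteq> {1..n}}"

lemma finite_row_words: "finite (row_words n r)"
  using finite_lists_length_eq[of "{1..n}" r] by (simp add: row_words_def conj_commute)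

lemma sum_row_words_Suc: "(\<Sum>w\<in>row_words n (Suc r). F w) = (\<Sum>i\<in>{1..n}. \<Sum>w\<in>row_words n r. F (i # w))"
proof -
  have "row_words n (Suc r) = (\<lambda>(i, w). i # w) ` ({1..n} \<times> row_words n r)"
    by (auto simp: row_words_def length_Suc_conv image_iff)
  then have "(\<Sum>w\<in>row_words n (Suc r). F w) = (\<Sum>(i, w)\<in>{1..n} \<times> row_words n r. F (i # w))"
    by (simp add: sum.reindex inj_on_def case_prod_beta)
  then show ?thesis
    by (simp add: sum.cartesian_product)
qed

lemma row_words_0: "row_words n 0 = {[]}"
  by (auto simp: row_words_def)

lemma sum_row_words_add:
  "(\<Sum>w\<in>row_words n (a + b). F w) = (\<Sum>u\<in>row_words n a. \<Sum>v\<in>row_words n b. F (u @ v))"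
  by (induct a arbitrary: F) (simp_all add: row_words_0 sum_row_words_Suc)

definition strict_rows :: "nat \<Rightarrow> nat \<Rightarrow> nat list set"
  where "strict_rows n r = {w \<in> row_words n r. sorted_wrt (<) w}"

lemma sum_row_words_symmetric:
  fixes G :: "nat list \<Rightarrow> 'a :: ring_1"
  assumes "\<And>w. w \<in> row_words n r \<Longrightarrow> distinct w \<Longrightarrow> G (sort w) = G w"
    and "\<And>w. w \<in> row_words n r \<Longrightarrow> \<not> distinct w \<Longrightarrow> G w = 0"
  shows "(\<Sum>w\<in>row_words n r. G w) = of_nat (fact r) * (\<Sum>w\<in>strict_rows n r. G w)"
proof -
  let ?D = "{w \<in> row_words n r. distinct w}"
  have fin: "finite ?D" "finite (strict_rows n r)"
    using finite_row_words by (auto simp: strict_rows_def)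
  have "(\<Sum>w\<in>row_words n r. G w) = (\<Sum>w\<in>?D. G w)"
    using assms(2) finite_row_words by (intro sum.mono_neutral_right) auto
  also have "\<dots> = (\<Sum>y\<in>strict_rows n r. \<Sum>w | w \<in> ?D \<and> sort w = y. G w)"
    using fin by (intro sum.group[symmetric]) (auto simp: strict_rows_def row_words_def strict_sorted_iff)
  also have "\<dots> = (\<Sum>y\<in>strict_rows n r. of_nat (fact r) * G y)"
  proof (rule sum.cong[OF refl])
    fix y assume y: "y \<in> strict_rows n r"
    then have y': "distinct y" "sorted y" "length y = r" "set y \<subseteq> {1..n}"
      by (auto simp: strict_rows_def strict_sorted_iff row_words_def)
    have *: "{w \<in> ?D. sort w = y} = permutations_of_set (set y)"
    proof (intro equalityI subsetI)
      fix w assume "w \<in> {w \<in> ?D. sort w = y}"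
      then show "w \<in> permutations_of_set (set y)"
        by (auto simp: permutations_of_set_def)
    next
      fix w assume "w \<in> permutations_of_set (set y)"
      then have w: "set w = set y" "distinct w"
        by (auto simp: permutations_of_set_def)
      then have "sort w = y"
        using y' by (metis sorted_distinct_set_unique distinct_sort set_sort sorted_sort)
      then show "w \<in> {w \<in> ?D. sort w = y}"
        using w y' distinct_card[of w] distinct_card[of y] by (simp add: row_words_def)
    qed
    have "(\<Sum>w | w \<in> ?D \<and> sort w = y. G w) = (\<Sum>w\<in>permutations_of_set (set y). G y)"
      unfolding *[symmetric] using assms(1) by (intro sum.cong) auto
    then show "(\<Sum>w | w \<in> ?D \<and> sort w = y. G w) = of_nat (fact r) * G y"
      using y' by (simp add: distinct_card)
  qed
  finally show ?thesis
    by (simp add: sum_distrib_left)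
qed

text \<open>The admissible rows are a parameter, so that strictly increasing rows and unrestricted
  rows share their lemmas.\<close>

definition tableaux :: "(nat \<Rightarrow> nat list set) \<Rightarrow> nat list \<Rightarrow> nat list list set"
  where "tableaux R l = {S. list_all2 (\<lambda>w r. w \<in> R r) S l}"

lemma tableaux_Nil: "tableaux R [] = {[]}"
  by (auto simp: tableaux_def)

lemma sum_tableaux_Cons:
  "(\<Sum>S\<in>tableaux R (r # l). F S) = (\<Sum>w\<in>R r. \<Sum>S\<in>tableaux R l. F (w # S))"
proof -
  have "tableaux R (r # l) = (\<lambda>(w, S). w # S) ` (R r \<times> tableaux R l)"
    by (auto simp: tableaux_def list_all2_Cons2 image_iff)
  then have "(\<Sum>S\<in>tableaux R (r # l). F S) = (\<Sum>(w, S)\<in>R r \<times> tableaux R l. F (w # S))"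
    by (simp add: sum.reindex inj_on_def case_prod_beta)
  then show ?thesis
    by (simp add: sum.cartesian_product)
qed

text \<open>Trades strictly increasing rows for arbitrary fillings, in which the cells are
  independent of each other. Each strict row of length \<open>r\<close> is the sorted form of
  \<open>r!\<close> words, and the hypotheses make the other words contribute nothing.\<close>

lemma sum_tableaux_symmetric:
  fixes G :: "nat list list \<Rightarrow> 'a :: ring_1"
  assumes "\<And>pre w post. pre @ w # post \<in> tableaux (row_words n) l \<Longrightarrow> distinct w \<Longrightarrow>
      G (pre @ sort w # post) = G (pre @ w # post)"
    and "\<And>pre w post. pre @ w # post \<in> tableaux (row_words n) l \<Longrightarrow> \<not> distinct w \<Longrightarrow>
      G (pre @ w # post) = 0"
  shows "(\<Sum>S\<in>tableaux (row_words n) l. G S) =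
    of_nat (\<Prod>r\<leftarrow>l. fact r) * (\<Sum>S\<in>tableaux (strict_rows n) l. G S)"
  using assms
proof (induct l arbitrary: G)
  case Nil
  then show ?case
    by (simp add: tableaux_Nil)
next
  case (Cons r l)
  have "(\<Sum>S\<in>tableaux (row_words n) l. G (w # S)) =
      of_nat (\<Prod>r\<leftarrow>l. fact r) * (\<Sum>S\<in>tableaux (strict_rows n) l. G (w # S))" if "w \<in> row_words n r" for w
  proof (rule Cons.hyps)
    fix pre u post assume "pre @ u # post \<in> tableaux (row_words n) l"
    then have *: "(w # pre) @ u # post \<in> tableaux (row_words n) (r # l)"
      using that by (auto simp: tableaux_def)
    show "distinct u \<Longrightarrow> G (w # pre @ sort u # post) = G (w # pre @ u # post)"
      using Cons.prems(1)[OF *] by simp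
    show "\<not> distinct u \<Longrightarrow> G (w # pre @ u # post) = 0"
      using Cons.prems(2)[OF *] by simp
  qed
  then have "(\<Sum>S\<in>tableaux (row_words n) (r # l). G S) =
      of_nat (\<Prod>r\<leftarrow>l. fact r) * (\<Sum>w\<in>row_words n r. \<Sum>S\<in>tableaux (strict_rows n) l. G (w # S))"
    by (simp add: sum_tableaux_Cons sum_distrib_left)
  also have "(\<Sum>w\<in>row_words n r. \<Sum>S\<in>tableaux (strict_rows n) l. G (w # S)) =
      of_nat (fact r) * (\<Sum>w\<in>strict_rows n r. \<Sum>S\<in>tableaux (strict_rows n) l. G (w # S))"
  proof (rule sum_row_words_symmetric)
    fix w assume w: "w \<in> row_words n r"
    have *: "[] @ w # S \<in> tableaux (row_words n) (r # l)" if "S \<in> tableaux (strict_rows n) l" for S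
    proof -
      have "list_all2 (\<lambda>w r. w \<in> row_words n r) S l"
        using that unfolding tableaux_def mem_Collect_eq
        by (rule list_all2_mono) (simp add: strict_rows_def)
      then show ?thesis
        using w by (simp add: tableaux_def)
    qed
    show "distinct w \<Longrightarrow> (\<Sum>S\<in>tableaux (strict_rows n) l. G (sort w # S)) =
        (\<Sum>S\<in>tableaux (strict_rows n) l. G (w # S))"
      using Cons.prems(1)[OF *] by (intro sum.cong) auto
    show "\<not> distinct w \<Longrightarrow> (\<Sum>S\<in>tableaux (strict_rows n) l. G (w # S)) = 0"
      using Cons.prems(2)[OF *] by (intro sum.neutral) auto
  qed
  also have "of_nat (\<Prod>r\<leftarrow>l. fact r) * (of_nat (fact r) * Y) = of_nat (\<Prod>r\<leftarrow>r # l. fact r) * Y" for Y :: 'a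
    by (simp only: mult.assoc[symmetric] of_nat_mult[symmetric]) (simp add: mult.commute)
  finally show ?case
    by (simp only: sum_tableaux_Cons)
qed

lemma sum_tableaux_concat:
  "(\<Sum>S\<in>tableaux (row_words n) l. F (concat S)) = (\<Sum>w\<in>row_words n (sum_list l). F w)"
proof (induct l arbitrary: F)
  case (Cons r l)
  then show ?case
    using Cons[of "\<lambda>v. F (u @ v)" for u] by (simp add: sum_tableaux_Cons sum_row_words_add)
qed (simp add: tableaux_Nil row_words_0)

lemma row_strict_tableaux_eq: "row_strict_tableaux n l = map (map Proper) ` tableaux (strict_rows n) l"
proof -
  have "(map length S = l \<and> (\<forall>w \<in> set S. P w)) = list_all2 (\<lambda>w r. length w = r \<and> P w) S l"
    for P and S :: "nat list list"
  proof (induct S arbitrary: l)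
    case (Cons w S)
    then show ?case
      by (cases l) auto
  qed auto
  then show ?thesis
    unfolding row_strict_tableaux_def tableaux_def strict_rows_def row_words_def mem_Collect_eq
    by (simp only: conj_assoc conj_commute[of "set _ \<subseteq> _"])
qed

lemma finite_tableaux: "(\<And>r. finite (R r)) \<Longrightarrow> finite (tableaux R l)"
proof (induct l)
  case (Cons r l)
  have "tableaux R (r # l) = (\<lambda>(w, S). w # S) ` (R r \<times> tableaux R l)"
    by (auto simp: tableaux_def list_all2_Cons2 image_iff)
  then show ?case
    using Cons by auto
qed (simp add: tableaux_Nil)

subsection \<open>Commutation with the general linear algebra\<close>

definition out_word :: "nat list \<Rightarrow> symb list \<Rightarrow> (symb \<times> symb) list"
  where "out_word w cs = zip (map Proper w) cs"

definition in_word :: "nat list \<Rightarrow> symb list \<Rightarrow> (symb \<times> symb) list"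
  where "in_word w cs = zip cs (map Proper w)"

text \<open>Reversing the inner word puts the two factors with the same letter at the same depth
  around \<open>X\<close>, so the sum over words becomes a sum over one index at each depth.\<close>

lemma nested_sum:
  assumes "length cs = h"
  shows "(\<Sum>w\<in>row_words n h. pol_word K s (out_word w cs) * X * pol_word K s (rev (in_word w cs))) =
    foldr (\<lambda>c Z. \<Sum>i\<in>{1..n}. pol K s (Proper i) c * Z * pol K s c (Proper i)) cs X"
  using assms
proof (induct cs arbitrary: h)
  case Nil
  then show ?case
    by (simp add: row_words_0 out_word_def in_word_def)
next
  case (Cons c cs)
  have "(\<Sum>w\<in>row_words n h. pol_word K s (out_word w (c # cs)) * X * pol_word K s (rev (in_word w (c # cs)))) =
    (\<Sum>i\<in>{1..n}. pol K s (Proper i) c * (\<Sum>w\<in>row_words n (length cs).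
      pol_word K s (out_word w cs) * X * pol_word K s (rev (in_word w cs))) * pol K s c (Proper i))"
    using Cons.prems[symmetric]
    by (simp add: sum_row_words_Suc out_word_def in_word_def sum_distrib_left sum_distrib_right mult.assoc)
  then show ?case
    using Cons by simp
qed

text \<open>Each layer preserves commutation with \<open>gl(n)\<close>: moving the element through
  the left factor contributes a term for \<open>i = j\<close>, moving it through the right factor
  the same term with the opposite sign for \<open>i = k\<close>, and the sum over \<open>i\<close>
  contains both.\<close>

lemma nested_commute:
  assumes "\<And>c. c \<in> set cs \<Longrightarrow> is_virtual c" and X: "pol K s (Proper k) (Proper j) * X = X * pol K s (Proper k) (Proper j)"
    and "k \<in> {1..n}" "j \<in> {1..n}"
  defines "Z \<equiv> foldr (\<lambda>c Z. \<Sum>i\<in>{1..n}. pol K s (Proper i) c * Z * pol K s c (Proper i)) cs X"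
  shows "pol K s (Proper k) (Proper j) * Z = Z * pol K s (Proper k) (Proper j)"
  unfolding Z_def using assms(1)
proof (induct cs)
  case Nil
  then show ?case
    using X by simp
next
  case (Cons c cs)
  define Z where "Z = foldr (\<lambda>c Z. \<Sum>i\<in>{1..n}. pol K s (Proper i) c * Z * pol K s c (Proper i)) cs X"
  let ?E = "pol K s (Proper k) (Proper j)" and ?a = "\<lambda>i. pol K s (Proper i) c" and ?b = "\<lambda>i. pol K s c (Proper i)"
  have c: "Proper i \<noteq> c" for i
    using Cons.prems by (auto simp: is_virtual_def)
  have IH: "?E * Z = Z * ?E"
    using Cons by (simp add: Z_def)
  have 1: "?E * ?a i = ?a i * ?E + (if i = j then ?a k else 0)" for i
    using c by (subst pol_even) auto
  have 2: "?E * ?b i = ?b i * ?E - (if i = k then ?b j else 0)" for i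
    using c[of j] by (subst pol_even) auto
  have step: "?E * (?a i * Z * ?b i) = ?a i * Z * ?b i * ?E + (if i = j then ?a k * Z * ?b j else 0) -
      (if i = k then ?a k * Z * ?b j else 0)" for i
  proof -
    have "?E * (?a i * Z * ?b i) = (?E * ?a i) * (Z * ?b i)"
      by (simp only: mult.assoc)
    also have "\<dots> = ?a i * (?E * Z) * ?b i + (if i = j then ?a k * Z * ?b j else 0)"
      unfolding 1 by (auto simp: algebra_simps)
    also have "?a i * (?E * Z) * ?b i = ?a i * Z * (?E * ?b i)"
      unfolding IH by (simp only: mult.assoc)
    also have "\<dots> = ?a i * Z * ?b i * ?E - (if i = k then ?a k * Z * ?b j else 0)"
      unfolding 2 by (auto simp: algebra_simps)
    finally show ?thesis
      by (simp add: algebra_simps)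
  qed
  have "?E * (\<Sum>i\<in>{1..n}. ?a i * Z * ?b i) = (\<Sum>i\<in>{1..n}. ?a i * Z * ?b i) * ?E +
      ((\<Sum>i\<in>{1..n}. if i = j then ?a k * Z * ?b j else 0) - (\<Sum>i\<in>{1..n}. if i = k then ?a k * Z * ?b j else 0))"
    unfolding sum_distrib_left step by (simp only: sum.distrib sum_subtractf sum_distrib_right add_diff_eq)
  then show ?case
    using assms(3,4) by (simp add: Z_def)
qed

lemma pol_word_virtual_commute:
  assumes "\<And>p. p \<in> set ps \<Longrightarrow> is_virtual (fst p) \<and> is_virtual (snd p)"
  shows "pol K s (Proper k) (Proper j) * pol_word K s ps = pol_word K s ps * pol K s (Proper k) (Proper j)"
  using assms
proof (induct ps)
  case (Cons p ps)
  have "fst p \<noteq> Proper j" "snd p \<noteq> Proper k"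
    using Cons.prems[of p] by (auto simp: is_virtual_def)
  then have 1: "pol K s (Proper k) (Proper j) * pol K s (fst p) (snd p) =
      pol K s (fst p) (snd p) * pol K s (Proper k) (Proper j)"
    by (subst pol_even) auto
  have 2: "pol K s (Proper k) (Proper j) * pol_word K s ps = pol_word K s ps * pol K s (Proper k) (Proper j)"
    by (rule Cons.hyps) (use Cons.prems in simp)
  show ?case
    by (simp only: pol_word_simps mult.assoc[symmetric] 1) (simp only: mult.assoc 2)
qed simp

fun alpha_word :: "nat \<Rightarrow> nat list \<Rightarrow> symb list" where
  "alpha_word k [] = []"
| "alpha_word k (r # l) = replicate r (Alpha k) @ alpha_word (Suc k) l"

lemma alpha_word_append:
  "alpha_word k (l1 @ l2) = alpha_word k l1 @ alpha_word (k + length l1) l2"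
  by (induct l1 arbitrary: k) auto

lemma length_alpha_word: "length (alpha_word k l) = sum_list l"
  by (induct l arbitrary: k) auto

lemma concat_C_star: "concat (C_star l) = alpha_word 1 l"
proof -
  have "concat (map (\<lambda>i. replicate (l ! (i - k)) (Alpha i)) [k..<k + length l]) = alpha_word k l" for k
  proof (induct l arbitrary: k)
    case (Cons r l)
    have "concat (map (\<lambda>i. replicate ((r # l) ! (i - k)) (Alpha i)) [k..<k + length (r # l)]) =
      replicate r (Alpha k) @ concat (map (\<lambda>i. replicate ((r # l) ! (i - k)) (Alpha i)) [Suc k..<Suc k + length l])"
      by (simp add: upt_conv_Cons del: upt_Suc)
    also have "map (\<lambda>i. replicate ((r # l) ! (i - k)) (Alpha i)) [Suc k..<Suc k + length l] =
      map (\<lambda>i. replicate (l ! (i - Suc k)) (Alpha i)) [Suc k..<Suc k + length l]"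
      by (intro map_cong refl) (auto simp: nth_Cons' Suc_diff_le)
    finally show ?case
      by (simp only: Cons alpha_word.simps)
  qed simp
  moreover have "C_star l = map (\<lambda>i. replicate (l ! (i - 1)) (Alpha i)) [1..<1 + length l]"
    unfolding C_star_def by (intro map_cong) (auto simp: part_def)
  ultimately show ?thesis
    by (simp only:)
qed

lemma set_alpha_word: "set (alpha_word k l) \<subseteq> Alpha ` {k..<k + length l}"
proof (induct l arbitrary: k)
  case (Cons r l)
  have "set (alpha_word (Suc k) l) \<subseteq> Alpha ` {k..<k + length (r # l)}"
    using Cons[of "Suc k"] by fastforce
  then show ?case
    by auto
qed simp

definition row_out :: "nat \<Rightarrow> bool \<Rightarrow> nat \<Rightarrow> nat list \<Rightarrow> endo"
  where "row_out K s i w = pol_word K s (out_word w (replicate (length w) (Alpha i)))"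

definition row_in :: "nat \<Rightarrow> bool \<Rightarrow> nat \<Rightarrow> nat list \<Rightarrow> endo"
  where "row_in K s i w = pol_word K s (in_word w (replicate (length w) (Alpha i)))"

lemma row_out_Cons: "row_out K s i (x # w) = pol K s (Proper x) (Alpha i) * row_out K s i w"
  by (simp add: row_out_def out_word_def)

lemma row_in_Cons: "row_in K s i (x # w) = pol K s (Alpha i) (Proper x) * row_in K s i w"
  by (simp add: row_in_def in_word_def)

lemma row_swap:
  "row_out K s i (x # y # w) = - row_out K s i (y # x # w)"
  "row_in K s i (x # y # w) = - row_in K s i (y # x # w)"
proof -
  have "pol K s (Proper x) (Alpha i) * pol K s (Proper y) (Alpha i) =
      - (pol K s (Proper y) (Alpha i) * pol K s (Proper x) (Alpha i))"
    "pol K s (Alpha i) (Proper x) * pol K s (Alpha i) (Proper y) =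
      - (pol K s (Alpha i) (Proper y) * pol K s (Alpha i) (Proper x))"
    by (rule pol_anticommute; simp)+
  then show "row_out K s i (x # y # w) = - row_out K s i (y # x # w)"
    "row_in K s i (x # y # w) = - row_in K s i (y # x # w)"
    by (simp_all add: row_out_Cons row_in_Cons mult.assoc[symmetric])
qed

text \<open>The letters anticommute in the outgoing row exactly as in the incoming one, so one sign
  \<open>e\<close> serves both and disappears from the product.\<close>

lemma row_insort:
  "\<exists>e\<in>{1, - 1}. row_out K s i (insort x w) = e * row_out K s i (x # w) \<and>
    row_in K s i (insort x w) = e * row_in K s i (x # w)"
proof (induct w)
  case (Cons y w)
  show ?case
  proof (cases "x \<le> y")
    case False
    obtain e where e: "e \<in> {1, - 1}" "row_out K s i (insort x w) = e * row_out K s i (x # w)"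
      "row_in K s i (insort x w) = e * row_in K s i (x # w)"
      using Cons by blast
    have "row_out K s i (insort x (y # w)) = e * row_out K s i (y # x # w)"
      "row_in K s i (insort x (y # w)) = e * row_in K s i (y # x # w)"
      using False e by (auto simp: row_out_Cons row_in_Cons)
    then show ?thesis
      using e(1) by (intro bexI[of _ "- e"]) (auto simp: row_swap[of K s i y x])
  qed auto
qed auto

lemma row_sort:
  "\<exists>e\<in>{1, - 1}. row_out K s i (sort w) = e * row_out K s i w \<and> row_in K s i (sort w) = e * row_in K s i w"
proof (induct w)
  case (Cons x w)
  then obtain e where e: "e \<in> {1, - 1}" "row_out K s i (sort w) = e * row_out K s i w"
    "row_in K s i (sort w) = e * row_in K s i w"
    by blast
  obtain f where f: "f \<in> {1, - 1}" "row_out K s i (insort x (sort w)) = f * row_out K s i (x # sort w)"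
    "row_in K s i (insort x (sort w)) = f * row_in K s i (x # sort w)"
    using row_insort by blast
  show ?case
    using e f by (intro bexI[of _ "f * e"]) (auto simp: row_out_Cons row_in_Cons)
qed auto

lemma row_repeat: "\<not> distinct w \<Longrightarrow> row_out K s i w = 0"
proof (induct w)
  case (Cons x w)
  have "row_out K s i (x # w) = 0" if "x \<in> set w" for w
    using that
  proof (induct w)
    case (Cons y w)
    show ?case
    proof (cases "x = y")
      case True
      then show ?thesis
        using pol_square[of "Proper x" "Alpha i" K s]
        by (simp add: row_out_Cons mult.assoc[symmetric])
    next
      case False
      then show ?thesis
        using Cons by (simp add: row_swap[of K s i x y] row_out_Cons[of K s i y])
    qed
  qed simp
  then show ?case
    using Cons by (auto simp: row_out_Cons)
qed simp

definition mid_word :: "nat list \<Rightarrow> (symb \<times> symb) list"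
  where "mid_word l = zip (concat (C_star l)) (concat (D_star l)) @ zip (concat (D_star l)) (concat (C_star l))"

definition imm_word :: "nat list \<Rightarrow> nat list \<Rightarrow> (symb \<times> symb) list"
  where "imm_word l w = out_word w (concat (C_star l)) @ mid_word l @ in_word w (concat (C_star l))"

text \<open>The sum that defines the central element, as an operator, before projection and without
  the factor \<open>1 / hook_product l\<close>.\<close>

definition imm_op :: "nat \<Rightarrow> bool \<Rightarrow> nat \<Rightarrow> nat list \<Rightarrow> endo"
  where "imm_op K s n l = (\<Sum>S\<in>tableaux (strict_rows n) l. pol_word K s (imm_word l (concat S)))"

lemma tableaux_shape: "S \<in> tableaux (row_words n) l \<Longrightarrow> map length S = l"
  unfolding tableaux_def mem_Collect_eq by (induct rule: list_all2_induct) (auto simp: row_words_def)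

text \<open>Isolates one row of the tableau in both outer words; the remaining factors do not depend
  on the entries \<open>u\<close> of that row.\<close>

lemma split_imm_word:
  assumes "map length (pre @ w # post) = l"
  obtains Rp Rq Lp Lq where "\<And>u. length u = length w \<Longrightarrow> pol_word K s (imm_word l (concat (pre @ u # post))) =
    Rp * row_out K s (Suc (length pre)) u * Rq * pol_word K s (mid_word l) * Lp * row_in K s (Suc (length pre)) u * Lq"
proof -
  let ?c1 = "alpha_word 1 (map length pre)" and ?c2 = "alpha_word (Suc (Suc (length pre))) (map length post)"
  let ?r = "\<lambda>u. replicate (length w) (Alpha (Suc (length pre)))"
  have c: "concat (C_star l) = ?c1 @ ?r w @ ?c2"
    unfolding concat_C_star assms[symmetric] by (simp add: alpha_word_append)
  have len: "length ?c1 = length (concat pre)"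
    by (simp add: length_alpha_word length_concat)
  have "pol_word K s (imm_word l (concat (pre @ u # post))) =
      pol_word K s (out_word (concat pre) ?c1) * row_out K s (Suc (length pre)) u *
      pol_word K s (out_word (concat post) ?c2) * pol_word K s (mid_word l) *
      pol_word K s (in_word (concat pre) ?c1) * row_in K s (Suc (length pre)) u *
      pol_word K s (in_word (concat post) ?c2)" if "length u = length w" for u
    using that len by (simp add: imm_word_def c out_word_def in_word_def row_out_def row_in_def mult.assoc)
  then show ?thesis
    using that by blast
qed

text \<open>Reordering a row changes both outer words by the same sign, and a repeated letter gives
  zero. So each strict row stands for all its orderings, and after multiplication by the row
  factorials the sum runs over unrestricted words.\<close>

lemma imm_op_flat:
  "of_nat (\<Prod>r\<leftarrow>l. fact r) * imm_op K s n l = (\<Sum>w\<in>row_words n (sum_list l). pol_word K s (imm_word l w))"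
proof -
  have "(\<Sum>S\<in>tableaux (row_words n) l. pol_word K s (imm_word l (concat S))) =
      of_nat (\<Prod>r\<leftarrow>l. fact r) * (\<Sum>S\<in>tableaux (strict_rows n) l. pol_word K s (imm_word l (concat S)))"
  proof (rule sum_tableaux_symmetric)
    fix pre w post
    assume "pre @ w # post \<in> tableaux (row_words n) l"
    then have "map length (pre @ w # post) = l"
      by (rule tableaux_shape)
    then obtain Rp Rq Lp Lq where *: "\<And>u. length u = length w \<Longrightarrow> pol_word K s (imm_word l (concat (pre @ u # post))) =
      Rp * row_out K s (Suc (length pre)) u * Rq * pol_word K s (mid_word l) * Lp * row_in K s (Suc (length pre)) u * Lq"
      using split_imm_word by blast
    show "pol_word K s (imm_word l (concat (pre @ w # post))) = 0" if "\<not> distinct w"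
      by (simp only: *[OF refl] row_repeat[OF that]) simp
    obtain e where "e \<in> {1, - 1}" "row_out K s (Suc (length pre)) (sort w) = e * row_out K s (Suc (length pre)) w"
      "row_in K s (Suc (length pre)) (sort w) = e * row_in K s (Suc (length pre)) w"
      using row_sort by blast
    then show "pol_word K s (imm_word l (concat (pre @ sort w # post))) = pol_word K s (imm_word l (concat (pre @ w # post)))"
      by (auto simp only: *[OF refl] *[OF length_sort] insert_iff empty_iff mult_minus1 mult_1 mult_minus_left
          mult_minus_right minus_minus)
  qed
  then show ?thesis
    using sum_tableaux_concat[of "\<lambda>w. pol_word K s (imm_word l w)" n l] by (simp only: imm_op_def)
qed

lemma of_nat_endo: "(of_nat m :: endo) = cst (of_nat m)"
  by (induct m) (auto simp: cst_hom)

lemma virtual_C_star: "c \<in> set (concat (C_star l)) \<Longrightarrow> is_virtual c"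
  using set_alpha_word[of 1 l] unfolding concat_C_star by (auto simp: is_virtual_def)

lemma length_concat_C_star: "length (concat (C_star l)) = sum_list l"
  by (simp only: concat_C_star length_alpha_word)

lemma mid_word_virtual: "p \<in> set (mid_word l) \<Longrightarrow> is_virtual (fst p) \<and> is_virtual (snd p)"
proof -
  have "is_virtual c" if "c \<in> set (concat (D_star l))" for c
    using that by (auto simp: D_star_def is_virtual_def)
  then show "p \<in> set (mid_word l) \<Longrightarrow> is_virtual (fst p) \<and> is_virtual (snd p)"
    using virtual_C_star[of _ l] set_zip_leftD[of "fst p" "snd p"] set_zip_rightD[of "fst p" "snd p"]
    unfolding mid_word_def set_append prod.collapse by blast
qed

text \<open>In the flat sum all inner words can be reversed at the cost of one common sign, after
  which the operator is a multiple of a nested sum around a product in virtual symbols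
  alone.\<close>

lemma imm_op_commute:
  assumes "k \<in> {1..n}" "j \<in> {1..n}"
  shows "pol K s (Proper k) (Proper j) * imm_op K s n l = imm_op K s n l * pol K s (Proper k) (Proper j)"
proof -
  let ?E = "pol K s (Proper k) (Proper j)" and ?c = "concat (C_star l)" and ?X = "pol_word K s (mid_word l)"
  let ?N = "foldr (\<lambda>c Z. \<Sum>i\<in>{1..n}. pol K s (Proper i) c * Z * pol K s c (Proper i)) ?c ?X"
  have "pol_word K s (imm_word l w) =
      rev_sign (sum_list l) * (pol_word K s (out_word w ?c) * ?X * pol_word K s (rev (in_word w ?c)))"
    if w: "w \<in> row_words n (sum_list l)" for w
  proof -
    have len: "length (in_word w ?c) = sum_list l"
      using w length_concat_C_star[of l] by (simp only: in_word_def row_words_def length_zip length_map mem_Collect_eq min.idem)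
    have "pol_word K s (rev (in_word w ?c)) = rev_sign (length (in_word w ?c)) * pol_word K s (in_word w ?c)"
    proof (rule pol_word_rev)
      fix p q assume "p \<in> set (in_word w ?c)" "q \<in> set (in_word w ?c)"
      then have "fst p \<in> set ?c" "fst q \<in> set ?c" "snd p \<in> Proper ` set w"
        using set_zip_leftD[of "fst p" "snd p" ?c "map Proper w"] set_zip_leftD[of "fst q" "snd q" ?c "map Proper w"]
          set_zip_rightD[of "fst p" "snd p" ?c "map Proper w"] by (simp_all only: in_word_def prod.collapse set_map)
      moreover have "set ?c \<subseteq> range Alpha"
        using set_alpha_word[of 1 l] unfolding concat_C_star by auto
      ultimately show "even (parity (fst p)) \<noteq> even (parity (snd p)) \<and> snd p \<noteq> fst q"
        by auto
    qed
    then have "pol_word K s (in_word w ?c) = rev_sign (sum_list l) * pol_word K s (rev (in_word w ?c))"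
      unfolding len by (simp only: mult.assoc[symmetric] rev_sign_square mult_1)
    then have "pol_word K s (imm_word l w) =
      pol_word K s (out_word w ?c) * ?X * (rev_sign (sum_list l) * pol_word K s (rev (in_word w ?c)))"
      by (simp only: imm_word_def pol_word_simps mult.assoc)
    also have "\<dots> = pol_word K s (out_word w ?c) * ?X * rev_sign (sum_list l) * pol_word K s (rev (in_word w ?c))"
      by (simp only: mult.assoc)
    finally show ?thesis
      unfolding rev_sign_commute by (simp only: mult.assoc)
  qed
  then have "of_nat (\<Prod>r\<leftarrow>l. fact r) * imm_op K s n l = rev_sign (sum_list l) * ?N"
    unfolding imm_op_flat nested_sum[OF length_concat_C_star, symmetric] sum_distrib_left by (rule sum.cong[OF refl])
  then have eq: "cst (of_nat (\<Prod>r\<leftarrow>l. fact r)) * imm_op K s n l = rev_sign (sum_list l) * ?N"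
    unfolding of_nat_endo .
  have N: "?E * ?N = ?N * ?E"
    using virtual_C_star mid_word_virtual assms by (intro nested_commute pol_word_virtual_commute)
  \<comment> \<open>The flat sum gives the operator only up to the row factorials, so these have to
    be cancelled as invertible scalars.\<close>
  have nz: "(\<Prod>r\<leftarrow>l. fact r :: nat) \<noteq> 0"
    by (induct l) auto
  have inv: "cst (1 / of_nat (\<Prod>r\<leftarrow>l. fact r)) * (cst (of_nat (\<Prod>r\<leftarrow>l. fact r)) * T) = T" for T
    using nz by (simp add: mult.assoc[symmetric] cst_hom(4)[symmetric] cst_hom(2))
  have Z: "imm_op K s n l = cst (1 / of_nat (\<Prod>r\<leftarrow>l. fact r)) * (rev_sign (sum_list l) * ?N)"
    using inv[of "imm_op K s n l"] unfolding eq by simp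
  have "?E * (cst c * (rev_sign d * M)) = cst c * (rev_sign d * M) * ?E" if "?E * M = M * ?E" for c d M
    using that by (metis cst_left_commute mult.assoc rev_sign_commute)
  from this[OF N] show ?thesis
    unfolding Z .
qed

subsection \<open>Representatives of the elements\<close>

lemma wt_zip: "length xs = length ys \<Longrightarrow> wt (zip xs ys) a = int (count_list xs a) - int (count_list ys a)"
  by (induct xs ys rule: list_induct2) auto

lemma length_concat_D_star: "length (concat (D_star l)) = sum_list l"
  by (induct l) (simp_all add: D_star_def)

lemma part_le_first: "is_partition l \<Longrightarrow> r \<in> set l \<Longrightarrow> r \<le> part l 1"
  by (cases l) (auto simp: is_partition_def part_def)

lemma set_concat_D_star: "is_partition l \<Longrightarrow> set (concat (D_star l)) \<subseteq> Beta ` {1..part l 1}"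
  using part_le_first[of l] by (force simp: D_star_def)

lemma tableaux_concat: "S \<in> tableaux (strict_rows n) l \<Longrightarrow> length (concat S) = sum_list l \<and> set (concat S) \<subseteq> {1..n}"
  unfolding tableaux_def mem_Collect_eq
  by (induct rule: list_all2_induct) (auto simp: strict_rows_def row_words_def)

text \<open>Every symbol enters and leaves equally often, which gives weight zero. Only the letters
  of \<open>out_word\<close> have a proper first symbol; this brings the degree down to
  \<open>sum_list l\<close>. The bounds on \<open>m0\<close> and \<open>m1\<close> place the virtual
  letters in the alphabet.\<close>

lemma imm_word_props:
  assumes "is_partition l" "part l 1 \<le> n" "length l \<le> m0" "part l 1 \<le> m1"
    and w: "length w = sum_list l" "set w \<subseteq> {1..n}"
  shows "imm_word l w \<in> lists (all_symbols m0 m1 n \<times> all_symbols m0 m1 n)"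
    and "wt (imm_word l w) a = 0" and "proper_degree (imm_word l w) \<le> sum_list l"
proof -
  let ?A = "all_symbols m0 m1 n" and ?c = "concat (C_star l)" and ?d = "concat (D_star l)"
  have "Alpha ` {1..<1 + length l} \<subseteq> ?A"
    unfolding all_symbols_def using assms(3) by (intro le_supI1 image_mono) auto
  then have c: "set ?c \<subseteq> ?A"
    using set_alpha_word[of 1 l] unfolding concat_C_star by (rule subset_trans[rotated])
  have "Beta ` {1..part l 1} \<subseteq> ?A"
    unfolding all_symbols_def using assms(4) by (intro le_supI1 le_supI2 image_mono) auto
  then have d: "set ?d \<subseteq> ?A"
    using set_concat_D_star[OF assms(1)] by (rule subset_trans[rotated])
  have p: "set (map Proper w) \<subseteq> ?A"
    using w(2) by (auto simp: all_symbols_def proper_symbols_def)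
  have zip: "zip xs ys \<in> lists (?A \<times> ?A)" if "set xs \<subseteq> ?A" "set ys \<subseteq> ?A" for xs ys
  proof -
    have "set (zip xs ys) \<subseteq> set xs \<times> set ys"
      by (rule subrelI) (blast dest: set_zip_leftD set_zip_rightD)
    then show ?thesis
      using that unfolding lists_eq_set by blast
  qed
  show "imm_word l w \<in> lists (?A \<times> ?A)"
    unfolding imm_word_def mid_word_def out_word_def in_word_def append_in_lists_conv
    by (intro conjI zip c d p)
  show "wt (imm_word l w) a = 0"
    unfolding imm_word_def mid_word_def out_word_def in_word_def wt_simps
    by (simp only: wt_zip length_map w(1) length_concat_C_star length_concat_D_star)
  have virt: "proper_degree (zip xs ys) = 0" if "\<And>x. x \<in> set xs \<Longrightarrow> is_virtual x" for xs ys
  proof -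
    have "filter (\<lambda>p. \<not> is_virtual (fst p)) (zip xs ys) = []"
      unfolding filter_empty_conv using that set_zip_leftD[of "fst p" "snd p" xs ys for p] by simp
    then show ?thesis
      by (simp add: proper_degree_def)
  qed
  have "proper_degree (mid_word l) = 0"
    unfolding proper_degree_def filter_empty_conv length_0_conv using mid_word_virtual[of _ l] by simp
  moreover have "proper_degree (in_word w ?c) = 0"
    unfolding in_word_def using virtual_C_star by (rule virt)
  moreover have "proper_degree (out_word w ?c) \<le> sum_list l"
    unfolding proper_degree_def out_word_def
    by (rule order_trans[OF length_filter_le]) (simp add: w(1))
  ultimately show "proper_degree (imm_word l w) \<le> sum_list l"
    by (simp add: imm_word_def proper_degree_def)
qed

text \<open>The words of \<open>x\<close> carry the bounds on length and weight that control the
  eigenvalue polynomial. Reduction changes the monomials by elements that kill proper vectors, so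
  the action of \<open>x\<close> on these is known for all \<open>K\<close> and both parities at
  once.\<close>

lemma S_elem_rep:
  fixes m0 m1 n l
  defines "P \<equiv> proper_symbols n"
  assumes l: "is_partition l" "part l 1 \<le> n" "length l \<le> m0" "part l 1 \<le> m1"
  obtains x where "x \<in> words {us \<in> lists (P \<times> P). length us \<le> sum_list l \<and> (\<forall>a. wt us a = 0)}"
    "S_elem m0 m1 n l = cls P x"
    "\<And>K s f. proper_vec f \<Longrightarrow> app (rho K s x) f = scl (1 / of_nat (hook_product l)) (app (imm_op K s n l) f)"
proof -
  let ?A = "all_symbols m0 m1 n" and ?C = "C_star l" and ?D = "D_star l"
  let ?U = "U_gl ?A" and ?T = "tableaux (strict_rows n) l" and ?R = "row_strict_tableaux n l"
  let ?Q = "{us \<in> lists (P \<times> P). length us \<le> sum_list l \<and> (\<forall>a. wt us a = 0)}"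
  define W where "W S = zip (concat S) (concat ?C) @ mid_word l @ zip (concat ?C) (concat S)" for S
  have W: "W (map (map Proper) S) = imm_word l (concat S)" for S
    by (simp add: W_def imm_word_def out_word_def in_word_def map_concat)
  have R: "\<exists>S'\<in>?T. S = map (map Proper) S'" if "S \<in> ?R" for S
    using that unfolding row_strict_tableaux_eq by blast
  have Wp: "W S \<in> lists (?A \<times> ?A)" "wt (W S) a = 0" "proper_degree (W S) \<le> sum_list l" if S: "S \<in> ?R" for S a
  proof -
    obtain S' where S': "S' \<in> ?T" "S = map (map Proper) S'"
      using R[OF S] by blast
    note * = conjunct1[OF tableaux_concat[OF S'(1)]] conjunct2[OF tableaux_concat[OF S'(1)]]
    show "W S \<in> lists (?A \<times> ?A)" "wt (W S) a = 0" "proper_degree (W S) \<le> sum_list l"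
      unfolding S'(2) W by (rule imm_word_props[OF l *])+
  qed
  have "\<exists>x\<in>words ?Q. mon (W S) - x \<in> irr_lift m0 m1 n" if "S \<in> ?R" for S
  proof -
    have "reduces (irr_lift m0 m1 n) {us \<in> lists (P \<times> P). length us \<le> proper_degree (W S) \<and> (\<forall>a. wt us a = wt (W S) a)} (mon (W S))"
      unfolding P_def using Wp[OF that] by (intro reduce_balanced_word) auto
    then have "reduces (irr_lift m0 m1 n) ?Q (mon (W S))"
    proof (rule reduces_mono[rotated], intro subsetI)
      fix us
      assume us: "us \<in> {us \<in> lists (P \<times> P). length us \<le> proper_degree (W S) \<and> (\<forall>a. wt us a = wt (W S) a)}"
      then have "us \<in> lists (P \<times> P)" "length us \<le> sum_list l" "\<forall>a. wt us a = 0"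
        using Wp(2,3)[OF that] by (simp_all del: in_lists_conv_set)
      then show "us \<in> ?Q"
        by (simp only: mem_Collect_eq simp_thms)
    qed
    then show ?thesis
      by (simp add: reduces_def)
  qed
  then have "\<forall>S\<in>?R. \<exists>x. x \<in> words ?Q \<and> mon (W S) - x \<in> irr_lift m0 m1 n"
    by (intro ballI) (simp only: Bex_def)
  from bchoice[OF this] obtain X where
    "\<forall>S\<in>?R. X S \<in> words ?Q \<and> mon (W S) - X S \<in> irr_lift m0 m1 n" ..
  then have X: "X S \<in> words ?Q" "mon (W S) - X S \<in> irr_lift m0 m1 n" if "S \<in> ?R" for S
    using that by (simp_all only:)
  have QP: "?Q \<subseteq> lists (P \<times> P)"
    by (rule Collect_restrict)
  have XP: "X S \<in> words (lists (P \<times> P))" if "S \<in> ?R" for S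
    by (rule words_mono[OF QP X(1)[OF that]])
  have fin: "finite ?R"
    unfolding row_strict_tableaux_eq using finite_row_words
    by (intro finite_imageI finite_tableaux) (simp add: strict_rows_def)
  have proj: "virt_proj m0 m1 n (e_bitableau ?A S ?C \<otimes>\<^bsub>?U\<^esub> e_bitableau ?A ?C ?D \<otimes>\<^bsub>?U\<^esub> e_bitableau ?A ?D ?C
      \<otimes>\<^bsub>?U\<^esub> e_bitableau ?A ?C S) = cls P (X S)" if S: "S \<in> ?R" for S
  proof -
    have in_lists: "zip (concat S) (concat ?C) \<in> lists (?A \<times> ?A)" "zip (concat ?C) (concat ?D) \<in> lists (?A \<times> ?A)"
      "zip (concat ?D) (concat ?C) \<in> lists (?A \<times> ?A)" "zip (concat ?C) (concat S) \<in> lists (?A \<times> ?A)"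
      using Wp(1)[OF S] by (simp_all add: W_def mid_word_def del: in_lists_conv_set)
    have "e_bitableau ?A S ?C \<otimes>\<^bsub>?U\<^esub> e_bitableau ?A ?C ?D \<otimes>\<^bsub>?U\<^esub> e_bitableau ?A ?D ?C \<otimes>\<^bsub>?U\<^esub> e_bitableau ?A ?C S =
        cls ?A (mon (W S))"
      using in_lists by (simp add: e_bitableau_def e_product_cls cls_mult mon_append[symmetric] W_def mid_word_def
          del: in_lists_conv_set)
    then show ?thesis
      unfolding P_def using XP[OF S, unfolded P_def] Wp(1)[OF S] X(2)[OF S]
      by (simp only:) (rule virt_proj_cls, simp_all)
  qed
  define x where "x = con (1 / of_nat (hook_product l)) * (\<Sum>S\<in>?R. X S)"
  have monoid: "abelian_monoid (U_gl P)"
    using U_gl_ring[of P] by (simp add: ring_def abelian_group_def)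
  have "(\<Oplus>\<^bsub>U_gl P\<^esub> S \<in> ?R. virt_proj m0 m1 n (e_bitableau ?A S ?C \<otimes>\<^bsub>?U\<^esub> e_bitableau ?A ?C ?D \<otimes>\<^bsub>?U\<^esub>
      e_bitableau ?A ?D ?C \<otimes>\<^bsub>?U\<^esub> e_bitableau ?A ?C S)) = (\<Oplus>\<^bsub>U_gl P\<^esub> S \<in> ?R. cls P (X S))"
  proof (rule abelian_monoid.finsum_cong'[OF monoid refl])
    show "(\<lambda>S. cls P (X S)) \<in> ?R \<rightarrow> carrier (U_gl P)"
      unfolding U_gl_carrier by (intro Pi_I imageI XP)
  qed (rule proj)
  also have "\<dots> = cls P (\<Sum>S\<in>?R. X S)"
    using fin XP by (rule cls_sum)
  finally have sum: "(\<Oplus>\<^bsub>U_gl P\<^esub> S \<in> ?R. virt_proj m0 m1 n (e_bitableau ?A S ?C \<otimes>\<^bsub>?U\<^esub> e_bitableau ?A ?C ?D \<otimes>\<^bsub>?U\<^esub>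
      e_bitableau ?A ?D ?C \<otimes>\<^bsub>?U\<^esub> e_bitableau ?A ?C S)) = cls P (\<Sum>S\<in>?R. X S)" .
  have S: "S_elem m0 m1 n l = cls P x"
    unfolding S_elem_def Let_def U_gln_def P_def[symmetric] sum scalar_cls x_def
    by (rule cls_mult[OF con_in_words words_sum[OF XP]])
  have xQ: "x \<in> words ?Q"
    unfolding x_def by (intro words_con words_sum X(1))
  have "app (rho K s x) f = scl (1 / of_nat (hook_product l)) (app (imm_op K s n l) f)" if f: "proper_vec f" for K s f
  proof -
    have "app (rho K s (X S)) f = app (pol_word K s (W S)) f" if "S \<in> ?R" for S
      using irr_lift_kills[OF X(2)[OF that] f, of K s] by (simp add: lin_diff)
    then have "app (\<Sum>S\<in>?R. rho K s (X S)) f = (\<Sum>S\<in>?R. app (pol_word K s (W S)) f)"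
      unfolding app_sum by (rule sum.cong[OF refl])
    also have "\<dots> = (\<Sum>S\<in>?T. app (pol_word K s (imm_word l (concat S))) f)"
    proof -
      have "inj_on (map (map Proper)) ?T"
        by (rule inj_on_subset[OF inj_mapI[OF inj_mapI] subset_UNIV]) (simp add: inj_def)
      then show ?thesis
        unfolding row_strict_tableaux_eq by (subst sum.reindex) (simp_all only: W comp_def)
    qed
    finally show ?thesis
      unfolding x_def lin_con_mult lin_sum imm_op_def app_ops app_cst app_sum by (simp only:)
  qed
  then show ?thesis
    by (rule that[OF xQ S])
qed

lemma proper_vec_pol:
  assumes "proper_vec f" "\<not> is_virtual a" "\<not> is_virtual b"
  shows "proper_vec (app (pol K s a b) f)"
  unfolding proper_vec_def
proof (intro allI impI)
  fix m c p assume m: "app (pol K s a b) f m \<noteq> 0" "is_virtual c"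
  then obtain q m0 where q: "m = m0((a, q) := Suc (m0 (a, q)))" "f (m0((b, q) := Suc (m0 (b, q)))) \<noteq> 0"
    by (auto elim: pol_support)
  have "(m0((b, q) := Suc (m0 (b, q)))) (c, p) = 0"
    using assms(1) q(2) m(2) unfolding proper_vec_def by blast
  then show "m (c, p) = 0"
    using assms(2,3) m(2) q(1) by (auto split: if_splits)
qed

lemma proper_vec_pol_word:
  assumes "proper_vec f" "ps \<in> lists (proper_symbols n \<times> proper_symbols n)"
  shows "proper_vec (app (pol_word K s ps) f)"
  using assms(2)
proof (induct ps)
  case (Cons p ps)
  then have "\<not> is_virtual (fst p)" "\<not> is_virtual (snd p)"
    by (auto simp: proper_symbols_def is_virtual_def)
  then show ?case
    using Cons by (simp add: proper_vec_pol)
qed (simp add: assms)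

lemma proper_vec_zero: "proper_vec 0"
  by (simp add: proper_vec_def)

lemma proper_vec_add: "proper_vec f \<Longrightarrow> proper_vec g \<Longrightarrow> proper_vec (f + g)"
  unfolding proper_vec_def by (metis add.right_neutral plus_fun_apply)

lemma proper_vec_scl: "proper_vec f \<Longrightarrow> proper_vec (scl c f)"
  by (simp add: proper_vec_def)

lemma proper_vec_rho:
  assumes "proper_vec f" "x \<in> words (lists (proper_symbols n \<times> proper_symbols n))"
  shows "proper_vec (app (rho K s x) f)"
proof -
  have sum: "proper_vec (\<Sum>w\<in>X. g w)" if "\<And>w. w \<in> X \<Longrightarrow> proper_vec (g w)"
    for X :: "(symb \<times> symb) free_word set" and g
    using that by (induct X rule: infinite_finite_induct) (simp_all add: proper_vec_zero proper_vec_add)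
  have "app (rho K s x) f =
      (\<Sum>w\<in>Poly_Mapping.keys x. scl (Poly_Mapping.lookup x w) (app (pol_word K s (letters w)) f))"
    by (simp add: lin_def app_sum)
  then show ?thesis
    using assms(2) by (simp only:) (intro sum proper_vec_scl proper_vec_pol_word[OF assms(1), where n = n],
      simp only: words_def mem_Collect_eq)
qed

text \<open>The representative agrees with \<open>imm_op\<close> on proper vectors only. Since
  \<open>U(gl(n))\<close> maps proper vectors to proper vectors, both products in the commutator can
  still be evaluated, and \<open>faithful\<close> turns the vanishing action into membership in the
  ideal.\<close>

lemma S_elem_central:
  assumes l: "is_partition l" "part l 1 \<le> n" "length l \<le> m0" "part l 1 \<le> m1"
  shows "S_elem m0 m1 n l \<in> center_gln n"
proof -
  let ?P = "proper_symbols n" and ?c = "1 / of_nat (hook_product l)"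
  obtain x where x: "x \<in> words {us \<in> lists (?P \<times> ?P). length us \<le> sum_list l \<and> (\<forall>a. wt us a = 0)}"
    "S_elem m0 m1 n l = cls ?P x"
    "\<And>K s f. proper_vec f \<Longrightarrow> app (rho K s x) f = scl ?c (app (imm_op K s n l) f)"
    by (rule S_elem_rep[OF l]) (rule that)
  have xP: "x \<in> words (lists (?P \<times> ?P))"
    by (rule words_mono[OF _ x(1)]) auto
  have word: "pol_word K s ps * imm_op K s n l = imm_op K s n l * pol_word K s ps" if "ps \<in> lists (?P \<times> ?P)" for K s ps
    using that
  proof (induct ps)
    case (Cons p ps)
    obtain k j where p: "p = (Proper k, Proper j)" "k \<in> {1..n}" "j \<in> {1..n}"
      using Cons.hyps(1) by (auto simp: proper_symbols_def)
    show ?case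
      unfolding pol_word_simps p(1) fst_conv snd_conv
      using imm_op_commute[OF p(2,3), of K s l] Cons.hyps(3) by (metis mult.assoc)
  qed simp
  have comm: "rho K s y * imm_op K s n l = imm_op K s n l * rho K s y" if "y \<in> words (lists (?P \<times> ?P))" for K s y
    unfolding lin_def sum_distrib_left sum_distrib_right
    unfolding cst_left_commute[of "imm_op K s n l"] mult.assoc
    by (intro sum.cong refl arg_cong[where f = "(*) _"] word) (use that in \<open>simp only: words_def mem_Collect_eq\<close>)
  have "x * y - y * x \<in> gl_ideal ?P" if y: "y \<in> words (lists (?P \<times> ?P))" for y
  proof (rule faithful)
    show "x * y - y * x \<in> words (lists (?P \<times> ?P))"
      using xP y by (intro words_diff carrier_mult)
    fix K f assume f: "proper_vec f"
    have "app (rho K True (x * y)) f = scl ?c (app (imm_op K True n l * rho K True y) f)"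
      using x(3)[OF proper_vec_rho[OF f y], of K True] by (simp add: rho_mult)
    moreover have "app (rho K True (y * x)) f = scl ?c (app (rho K True y * imm_op K True n l) f)"
      using x(3)[OF f, of K True] by (simp add: rho_mult)
    ultimately show "app (rho K True (x * y - y * x)) f = 0"
      using comm[OF y] by (simp only: lin_diff app_ops) simp
  qed
  then have "cls ?P (x * y) = cls ?P (y * x)" if "y \<in> words (lists (?P \<times> ?P))" for y
    using that by (simp add: cls_eq_iff)
  then show ?thesis
    using xP by (auto simp: center_gln_def x(2) U_gln_def U_gl_carrier cls_mult)
qed

section \<open>Polynomial functions\<close>

text \<open>Polynomial functions by their closure properties: substitution and restriction to one
  variable then follow by induction, without touching coefficients.\<close>

inductive_set pfun :: "nat \<Rightarrow> ((nat \<Rightarrow> complex) \<Rightarrow> complex) set" for n where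
  const: "(\<lambda>x. c) \<in> pfun n"
| coord: "i \<in> {1..n} \<Longrightarrow> (\<lambda>x. x i) \<in> pfun n"
| add: "f \<in> pfun n \<Longrightarrow> g \<in> pfun n \<Longrightarrow> (\<lambda>x. f x + g x) \<in> pfun n"
| mult: "f \<in> pfun n \<Longrightarrow> g \<in> pfun n \<Longrightarrow> (\<lambda>x. f x * g x) \<in> pfun n"

lemma pfun_diff: "f \<in> pfun n \<Longrightarrow> g \<in> pfun n \<Longrightarrow> (\<lambda>x. f x - g x) \<in> pfun n"
  using pfun.add[of f n, OF _ pfun.mult[OF pfun.const[of "- 1"]]] by simp

lemma pfun_sum: "(\<And>i. i \<in> I \<Longrightarrow> f i \<in> pfun n) \<Longrightarrow> (\<lambda>x. \<Sum>i\<in>I. f i x) \<in> pfun n"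
  by (induct I rule: infinite_finite_induct) (simp_all add: pfun.const pfun.add)

lemma pfun_prod: "(\<And>i. i \<in> I \<Longrightarrow> f i \<in> pfun n) \<Longrightarrow> (\<lambda>x. \<Prod>i\<in>I. f i x) \<in> pfun n"
  by (induct I rule: infinite_finite_induct) (simp_all add: pfun.const pfun.mult)

lemma pfun_power: "f \<in> pfun n \<Longrightarrow> (\<lambda>x. f x ^ k) \<in> pfun n"
  by (induct k) (simp_all add: pfun.const pfun.mult)

lemma pfun_subst:
  assumes "f \<in> pfun n" "\<And>i. i \<in> {1..n} \<Longrightarrow> (\<lambda>x. h x i) \<in> pfun n"
  shows "(\<lambda>x. f (h x)) \<in> pfun n"
  using assms(1) by induct (auto intro: pfun.intros assms(2))

lemma pfun_univariate:
  assumes "f \<in> pfun n"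
  shows "\<exists>p. \<forall>t. f (x(i := t)) = poly p t"
  using assms
proof induct
  case (const c)
  show ?case
    by (rule exI[of _ "[:c:]"]) simp
next
  case (coord j)
  show ?case
    by (rule exI[of _ "if j = i then [:0, 1:] else [:x j:]"]) simp
next
  case (add f g)
  then obtain p q where "\<forall>t. f (x(i := t)) = poly p t" "\<forall>t. g (x(i := t)) = poly q t"
    by blast
  then show ?case
    by (intro exI[of _ "p + q"]) (simp del: fun_upd_apply)
next
  case (mult f g)
  then obtain p q where "\<forall>t. f (x(i := t)) = poly p t" "\<forall>t. g (x(i := t)) = poly q t"
    by blast
  then show ?case
    by (intro exI[of _ "p * q"]) (simp del: fun_upd_apply)
qed

lemma pfun_cong: "f \<in> pfun n \<Longrightarrow> (\<And>i. i \<in> {1..n} \<Longrightarrow> x i = y i) \<Longrightarrow> f x = f y"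
  by (induct rule: pfun.induct) auto

text \<open>The gap will be a bound on the length of words, which makes every simple root string
  long enough to interpolate along it; the gap 0 gives ordinary partitions.\<close>

definition gap_partitions :: "nat \<Rightarrow> nat \<Rightarrow> (nat \<Rightarrow> nat) set"
  where "gap_partitions n g = {m. \<forall>i\<in>{1..<n}. m (Suc i) + g \<le> m i}"

text \<open>Zariski density of these lattice points. The coordinates up to \<open>r\<close> are
  arbitrary and the later ones form a gap sequence; the induction frees one more coordinate at a
  time, in which the function is a polynomial with infinitely many roots.\<close>

lemma pfun_dense:
  assumes f: "f \<in> pfun n" and zero: "\<And>m. m \<in> gap_partitions n g \<Longrightarrow> f (\<lambda>i. of_nat (m i)) = 0"
  shows "f x = 0"
proof -
  have "f x = 0" if "r \<le> n" "\<And>i. r < i \<Longrightarrow> i \<le> n \<Longrightarrow> x i = of_nat (m i)"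
    "\<And>i. r < i \<Longrightarrow> i < n \<Longrightarrow> m (Suc i) + g \<le> m i" for r x m
    using that
  proof (induct r arbitrary: x m)
    case 0
    have "f x = f (\<lambda>i. of_nat (m i))"
      using f by (rule pfun_cong) (use 0 in simp)
    also have "\<dots> = 0"
      by (rule zero) (use 0 in \<open>simp add: gap_partitions_def\<close>)
    finally show ?case .
  next
    case (Suc r)
    obtain p where p: "\<And>t. f (x(Suc r := t)) = poly p t"
      using pfun_univariate[OF f] by blast
    \<comment> \<open>Only a lower bound on \<open>t\<close> is needed, because the coordinates
      before it are already unrestricted.\<close>
    have root: "poly p (of_nat t) = 0" if t: "m (Suc (Suc r)) + g \<le> t" for t
    proof -
      have "f (x(Suc r := of_nat t)) = 0"
      proof (rule Suc.hyps[of _ "m(Suc r := t)"])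
        fix i assume i: "r < i"
        show "(x(Suc r := of_nat t)) i = of_nat ((m(Suc r := t)) i)" if "i \<le> n"
          using Suc.prems(2)[of i] i that by simp
        show "(m(Suc r := t)) (Suc i) + g \<le> (m(Suc r := t)) i" if "i < n"
          using Suc.prems(3)[of i] i that t by (cases "i = Suc r") simp_all
      qed (use Suc.prems in simp)
      then show ?thesis
        by (simp add: p)
    qed
    have "p = 0"
    proof (rule ccontr)
      assume "p \<noteq> 0"
      then have "finite {z. poly p z = 0}"
        by (rule poly_roots_finite)
      moreover have "of_nat ` {m (Suc (Suc r)) + g..} \<subseteq> {z. poly p z = 0}"
        using root by blast
      ultimately have "finite (of_nat ` {m (Suc (Suc r)) + g..} :: complex set)"
        by (rule rev_finite_subset)
      then have "finite {m (Suc (Suc r)) + g..}"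
        by (rule finite_imageD) (simp add: inj_on_def)
      then show False
        by (simp add: infinite_Ici)
    qed
    then show ?case
      using p[of "x (Suc r)"] by simp
  qed
  from this[of n x "\<lambda>_. 0"] show ?thesis
    by simp
qed


subsection \<open>Evaluation of polynomials\<close>

definition mval :: "(nat \<Rightarrow>\<^sub>0 nat) \<Rightarrow> (nat \<Rightarrow> complex) \<Rightarrow> complex"
  where "mval m x = (\<Prod>i\<in>Poly_Mapping.keys m. x i ^ Poly_Mapping.lookup m i)"

lemma mval_superset:
  assumes "finite S" "Poly_Mapping.keys m \<subseteq> S"
  shows "mval m x = (\<Prod>i\<in>S. x i ^ Poly_Mapping.lookup m i)"
  unfolding mval_def using assms by (intro prod.mono_neutral_left) (auto simp: in_keys_iff)

lemma mval_add: "mval (m + m') x = mval m x * mval m' x"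
proof -
  let ?S = "Poly_Mapping.keys m \<union> Poly_Mapping.keys m'"
  have "mval (m + m') x = (\<Prod>i\<in>?S. x i ^ Poly_Mapping.lookup (m + m') i)"
    by (intro mval_superset keys_add) simp
  also have "\<dots> = (\<Prod>i\<in>?S. x i ^ Poly_Mapping.lookup m i) * (\<Prod>i\<in>?S. x i ^ Poly_Mapping.lookup m' i)"
    by (simp add: lookup_add power_add prod.distrib)
  also have "\<dots> = mval m x * mval m' x"
    by (simp add: mval_superset[of ?S])
  finally show ?thesis .
qed

lemma eval_poly_mval: "eval_poly f x = (\<Sum>m\<in>Poly_Mapping.keys f. Poly_Mapping.lookup f m * mval m x)"
  by (simp add: eval_poly_def mval_def)

lemma eval_poly_superset:
  assumes "finite S" "Poly_Mapping.keys f \<subseteq> S"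
  shows "eval_poly f x = (\<Sum>m\<in>S. Poly_Mapping.lookup f m * mval m x)"
  unfolding eval_poly_mval using assms by (intro sum.mono_neutral_left) (auto simp: in_keys_iff)

lemma eval_poly_add: "eval_poly (f + g) x = eval_poly f x + eval_poly g x"
proof -
  let ?S = "Poly_Mapping.keys f \<union> Poly_Mapping.keys g"
  have "eval_poly (f + g) x = (\<Sum>m\<in>?S. Poly_Mapping.lookup (f + g) m * mval m x)"
    by (intro eval_poly_superset keys_add) simp
  also have "\<dots> = eval_poly f x + eval_poly g x"
    by (simp add: lookup_add distrib_right sum.distrib eval_poly_superset[of ?S])
  finally show ?thesis .
qed

lemma eval_poly_zero [simp]: "eval_poly 0 x = 0"
  by (simp add: eval_poly_mval)

lemma eval_poly_uminus: "eval_poly (- f) x = - eval_poly f x"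
  using eval_poly_add[of f "- f" x] by (simp add: eq_neg_iff_add_eq_0 add.commute)

lemma eval_poly_diff: "eval_poly (f - g) x = eval_poly f x - eval_poly g x"
  using eval_poly_add[of f "- g" x] by (simp add: eval_poly_uminus)

lemma eval_poly_sum: "eval_poly (sum f X) x = (\<Sum>i\<in>X. eval_poly (f i) x)"
  by (induct X rule: infinite_finite_induct) (auto simp: eval_poly_add)

lemma eval_poly_single: "eval_poly (Poly_Mapping.single m c) x = c * mval m x"
  by (subst eval_poly_superset[of "{m}"]) auto

lemma cpoly_expand: "f = (\<Sum>m\<in>Poly_Mapping.keys f. Poly_Mapping.single m (Poly_Mapping.lookup f m))"
  by (rule poly_mapping_eqI)
    (auto simp: lookup_sum lookup_single when_def in_keys_iff cong: if_cong)

lemma eval_poly_mult: "eval_poly (f * g) x = eval_poly f x * eval_poly g x" for f g :: cpoly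
proof -
  have "eval_poly (f * g) x = eval_poly ((\<Sum>m\<in>Poly_Mapping.keys f. Poly_Mapping.single m (Poly_Mapping.lookup f m)) *
      (\<Sum>m\<in>Poly_Mapping.keys g. Poly_Mapping.single m (Poly_Mapping.lookup g m))) x"
    by (simp flip: cpoly_expand)
  also have "\<dots> = eval_poly f x * eval_poly g x"
    unfolding eval_poly_mval[of f] eval_poly_mval[of g]
    by (simp add: sum_product eval_poly_sum mult_single eval_poly_single mval_add mult_ac)
  finally show ?thesis .
qed

lemma eval_poly_one [simp]: "eval_poly 1 x = 1"
  using eval_poly_single[of 0 1 x] by (simp add: mval_def)

lemma eval_poly_const: "eval_poly (Poly_Mapping.single 0 c) x = c"
  by (simp add: eval_poly_single mval_def)

lemma eval_poly_var: "eval_poly (var i) x = x i"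
  by (simp add: var_def eval_poly_single mval_def)

lemma eval_poly_of_nat [simp]: "eval_poly (of_nat k) x = of_nat k"
  by (induct k) (auto simp: eval_poly_add)

lemma eval_poly_prod: "eval_poly (prod f X) x = (\<Prod>i\<in>X. eval_poly (f i) x)" for f :: "'a \<Rightarrow> cpoly"
  by (induct X rule: infinite_finite_induct) (auto simp: eval_poly_mult)

lemma eval_poly_prod_list: "eval_poly (\<Prod>i\<leftarrow>X. f i) x = (\<Prod>i\<leftarrow>X. eval_poly (f i) x)" for f :: "'a \<Rightarrow> cpoly"
  by (induct X) (auto simp: eval_poly_mult)

interpretation eval_poly: comm_ring_hom "\<lambda>f :: cpoly. eval_poly f x"
  by unfold_locales (auto simp: eval_poly_add eval_poly_mult)

section \<open>Polynomials in the variables 1 to n and their functions\<close>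

definition vars_in :: "nat \<Rightarrow> cpoly set"
  where "vars_in n = {f. \<forall>m\<in>Poly_Mapping.keys f. Poly_Mapping.keys m \<subseteq> {1..n}}"

lemma vars_in_add: "f \<in> vars_in n \<Longrightarrow> g \<in> vars_in n \<Longrightarrow> f + g \<in> vars_in n"
  using keys_add[of f g] unfolding vars_in_def by blast

lemma vars_in_uminus: "f \<in> vars_in n \<Longrightarrow> - f \<in> vars_in n"
  by (simp add: vars_in_def in_keys_iff)

lemma vars_in_diff: "f \<in> vars_in n \<Longrightarrow> g \<in> vars_in n \<Longrightarrow> f - g \<in> vars_in n"
  using vars_in_add[of f n "- g"] vars_in_uminus[of g n] by simp

lemma vars_in_mult: "f \<in> vars_in n \<Longrightarrow> g \<in> vars_in n \<Longrightarrow> f * g \<in> vars_in n"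
  unfolding vars_in_def
proof (intro CollectI ballI)
  fix m assume *: "f \<in> {f. \<forall>m\<in>Poly_Mapping.keys f. Poly_Mapping.keys m \<subseteq> {1..n}}"
    "g \<in> {f. \<forall>m\<in>Poly_Mapping.keys f. Poly_Mapping.keys m \<subseteq> {1..n}}" "m \<in> Poly_Mapping.keys (f * g)"
  then obtain a b where "a \<in> Poly_Mapping.keys f" "b \<in> Poly_Mapping.keys g" "m = a + b"
    using keys_mult[of f g] by blast
  then show "Poly_Mapping.keys m \<subseteq> {1..n}"
    using *(1,2) keys_add[of a b] by blast
qed

lemma vars_in_const: "Poly_Mapping.single 0 c \<in> vars_in n"
  by (simp add: vars_in_def)

lemma vars_in_one: "1 \<in> vars_in n"
  using vars_in_const[of 1 n] by simp

lemma vars_in_of_nat: "of_nat k \<in> vars_in n"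
  using vars_in_const[of "of_nat k" n] by simp

lemma vars_in_var: "i \<in> {1..n} \<Longrightarrow> var i \<in> vars_in n"
  by (simp add: vars_in_def var_def)

lemma vars_in_sum: "(\<And>i. i \<in> X \<Longrightarrow> f i \<in> vars_in n) \<Longrightarrow> sum f X \<in> vars_in n"
  using vars_in_const[of 0 n] by (induct X rule: infinite_finite_induct) (simp_all add: vars_in_add)

lemma vars_in_prod: "(\<And>i. i \<in> X \<Longrightarrow> f i \<in> vars_in n) \<Longrightarrow> prod f X \<in> vars_in n"
  by (induct X rule: infinite_finite_induct) (simp_all add: vars_in_mult vars_in_one)

lemma vars_in_prod_list: "(\<And>i. i \<in> set X \<Longrightarrow> f i \<in> vars_in n) \<Longrightarrow> (\<Prod>i\<leftarrow>X. f i) \<in> vars_in n"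
  by (induct X) (simp_all add: vars_in_mult vars_in_one)

lemma eval_poly_pfun: "f \<in> vars_in n \<Longrightarrow> eval_poly f \<in> pfun n"
proof -
  assume f: "f \<in> vars_in n"
  have "(\<lambda>x. \<Sum>m\<in>Poly_Mapping.keys f. Poly_Mapping.lookup f m * (\<Prod>i\<in>Poly_Mapping.keys m. x i ^ Poly_Mapping.lookup m i)) \<in> pfun n"
    by (intro pfun_sum pfun.mult pfun.const pfun_prod pfun_power pfun.coord)
      (use f in \<open>simp only: vars_in_def mem_Collect_eq subset_eq\<close>)
  then show ?thesis
    by (simp add: eval_poly_def[abs_def])
qed

lemma univariate_coeffs:
  assumes "finite M" "\<And>t. (\<Sum>m\<in>M. a m * t ^ e m) = (0::complex)"
  shows "(\<Sum>m | m \<in> M \<and> e m = d. a m) = 0"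
proof -
  let ?p = "\<Sum>m\<in>M. monom (a m) (e m)"
  have "poly ?p = poly 0"
    using assms(2) by (simp add: fun_eq_iff poly_sum poly_monom)
  then have "coeff ?p d = 0"
    by (simp only: poly_eq_poly_eq_iff coeff_0)
  moreover have "coeff ?p d = (\<Sum>m\<in>M. if e m = d then a m else 0)"
    by (simp add: coeff_sum)
  ultimately show ?thesis
    using assms(1) by (simp add: sum.inter_filter)
qed

lemma mval_independent:
  assumes "finite M" "\<And>m. m \<in> M \<Longrightarrow> Poly_Mapping.keys m \<subseteq> {1..n}" "\<And>x. (\<Sum>m\<in>M. c m * mval m x) = 0"
    and "m0 \<in> M"
  shows "c m0 = 0"
  using assms
proof (induct n arbitrary: M c m0)
  case 0
  then have "M = {0}"
    by auto
  then show ?case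
    using 0(3)[of "\<lambda>_. 0"] 0(4) by (simp add: mval_def)
next
  case (Suc n)
  \<comment> \<open>Removes the last variable from a monomial. On monomials with a fixed exponent
    \<open>d\<close> of that variable nothing is lost, and the induction hypothesis applies to the
    coefficient of its \<open>d\<close>-th power.\<close>
  define cut where "cut m = m - Poly_Mapping.single (Suc n) (Poly_Mapping.lookup m (Suc n))" for m :: "nat \<Rightarrow>\<^sub>0 nat"
  have lookup_cut: "Poly_Mapping.lookup (cut m) i = (if i = Suc n then 0 else Poly_Mapping.lookup m i)" for m i
    by (simp add: cut_def lookup_minus lookup_single when_def)
  have cut: "m = cut m + Poly_Mapping.single (Suc n) (Poly_Mapping.lookup m (Suc n))" for m
    by (rule poly_mapping_eqI) (simp add: lookup_add lookup_cut lookup_single when_def)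
  have keys_cut: "Poly_Mapping.keys (cut m) \<subseteq> {1..n}" if "m \<in> M" for m
  proof
    fix i assume i: "i \<in> Poly_Mapping.keys (cut m)"
    then have "i \<noteq> Suc n" "i \<in> Poly_Mapping.keys m"
      by (simp_all add: in_keys_iff lookup_cut split: if_splits)
    then show "i \<in> {1..n}"
      using Suc.prems(2)[OF that] by auto
  qed
  have mval_cut: "mval m (x(Suc n := t)) = mval (cut m) x * t ^ Poly_Mapping.lookup m (Suc n)" if "m \<in> M" for m x t
  proof -
    have "mval (cut m) (x(Suc n := t)) = mval (cut m) x"
      unfolding mval_def using keys_cut[OF that] by (intro prod.cong refl) auto
    moreover have "mval (Poly_Mapping.single (Suc n) k) (x(Suc n := t)) = t ^ k" for k
      by (simp add: mval_superset[of "{Suc n}"])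
    ultimately show ?thesis
      by (subst cut) (simp only: mval_add)
  qed
  define d where "d = Poly_Mapping.lookup m0 (Suc n)"
  let ?M = "{m \<in> M. Poly_Mapping.lookup m (Suc n) = d}"
  let ?s = "Poly_Mapping.single (Suc n) d"
  have inj: "inj_on cut ?M"
    using cut by (intro inj_onI) (metis (mono_tags, lifting) mem_Collect_eq)
  have "(\<Sum>m\<in>cut ` ?M. c (m + ?s) * mval m x) = 0" for x
  proof -
    have "(\<Sum>m\<in>M. c m * mval (cut m) x * t ^ Poly_Mapping.lookup m (Suc n)) = 0" for t
      using Suc.prems(3)[of "x(Suc n := t)"] by (simp add: mval_cut mult.assoc del: fun_upd_apply)
    from univariate_coeffs[OF Suc.prems(1) this, of d]
    have "(\<Sum>m\<in>?M. c m * mval (cut m) x) = 0" .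
    moreover have "(\<Sum>m\<in>?M. c m * mval (cut m) x) = (\<Sum>m\<in>?M. c (cut m + ?s) * mval (cut m) x)"
    proof (rule sum.cong[OF refl])
      fix m assume "m \<in> ?M"
      then have "cut m + ?s = m"
        using cut[of m] by simp
      then show "c m * mval (cut m) x = c (cut m + ?s) * mval (cut m) x"
        by (simp only:)
    qed
    ultimately show ?thesis
      using inj by (simp add: sum.reindex)
  qed
  from Suc.hyps[of "cut ` ?M" "\<lambda>m. c (m + ?s)" "cut m0", OF _ _ this]
  have "c (cut m0 + ?s) = 0"
    using Suc.prems(1,4) keys_cut by (auto simp: d_def)
  then show ?case
    using cut[of m0] by (simp add: d_def)
qed

lemma eval_poly_inject:
  assumes "f \<in> vars_in n" "g \<in> vars_in n" "\<And>x. eval_poly f x = eval_poly g x"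
  shows "f = g"
proof -
  let ?h = "f - g"
  have h: "?h \<in> vars_in n" "\<And>x. eval_poly ?h x = 0"
    using assms by (simp_all add: vars_in_diff eval_poly_diff)
  have "Poly_Mapping.lookup ?h m = 0" if "m \<in> Poly_Mapping.keys ?h" for m
    using h mval_independent[of "Poly_Mapping.keys ?h" n "Poly_Mapping.lookup ?h" m] that
    by (simp add: vars_in_def eval_poly_mval)
  then have "?h = 0"
    by (metis keys_eq_empty all_not_in_conv in_keys_iff)
  then show ?thesis
    by simp
qed

section \<open>Highest weight vectors\<close>

text \<open>From here on vectors are handled through the operators, and pointwise unfolding would
  destroy normal forms such as \<open>scl c v\<close>.\<close>

declare scl_apply [simp del] zero_fun_apply [simp del] plus_fun_apply [simp del] minus_apply [simp del]

lemmas vec_apply = scl_apply zero_fun_apply plus_fun_apply minus_apply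

definition hw_vec :: "nat \<Rightarrow> bool \<Rightarrow> nat \<Rightarrow> (nat \<Rightarrow> complex) \<Rightarrow> vec \<Rightarrow> bool"
  where "hw_vec K s n mu v \<longleftrightarrow> v \<noteq> 0 \<and>
    (\<forall>p q. 1 \<le> p \<longrightarrow> p < q \<longrightarrow> q \<le> n \<longrightarrow> app (pol K s (Proper p) (Proper q)) v = 0) \<and>
    (\<forall>p\<in>{1..n}. app (pol K s (Proper p) (Proper p)) v = scl (mu p) v)"

lemma pol_proper_commute:
  "app (pol K s (Proper p) (Proper q)) (app (pol K s (Proper c) (Proper d)) v) =
    app (pol K s (Proper c) (Proper d)) (app (pol K s (Proper p) (Proper q)) v) +
    (if q = c then app (pol K s (Proper p) (Proper d)) v else 0) -
    (if p = d then app (pol K s (Proper c) (Proper q)) v else 0)"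
proof -
  have "pol K s (Proper p) (Proper q) * pol K s (Proper c) (Proper d) =
      pol K s (Proper c) (Proper d) * pol K s (Proper p) (Proper q) +
      (if q = c then pol K s (Proper p) (Proper d) else 0) - (if p = d then pol K s (Proper c) (Proper q) else 0)"
    by (subst pol_even) auto
  then have "app (pol K s (Proper p) (Proper q) * pol K s (Proper c) (Proper d)) v =
     app (pol K s (Proper c) (Proper d) * pol K s (Proper p) (Proper q) +
      (if q = c then pol K s (Proper p) (Proper d) else 0) - (if p = d then pol K s (Proper c) (Proper q) else 0)) v"
    by (rule arg_cong[where f = "\<lambda>T. app T v"])
  then show ?thesis
    by (simp split: if_split)
qed

locale hw_string =
  fixes K :: nat and s :: bool and n :: nat and mu :: "nat \<Rightarrow> complex" and v :: vec and i :: nat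
  assumes hw: "hw_vec K s n mu v" and i: "1 \<le> i" "i < n"
begin

abbreviation E :: "nat \<Rightarrow> nat \<Rightarrow> vec \<Rightarrow> vec"
  where "E p q \<equiv> app (pol K s (Proper p) (Proper q))"

definition vs :: "nat \<Rightarrow> vec"
  where "vs j = (E (Suc i) i ^^ j) v"

text \<open>The weight of the \<open>t\<close>-th vector of the string. The parameter is complex
  because eigenvalues along the string are continued from natural numbers to a polynomial in
  \<open>t\<close>.\<close>

definition wts :: "complex \<Rightarrow> nat \<Rightarrow> complex"
  where "wts t p = mu p - t * of_bool (p = i) + t * of_bool (p = Suc i)"

lemma vs_simps: "vs 0 = v" "vs (Suc j) = E (Suc i) i (vs j)"
  by (simp_all add: vs_def)

text \<open>The commutator of such a raising operator with the lowering operator of the simple root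
  \<open>i\<close> is again a raising operator other than that of \<open>i\<close>, or zero.\<close>

lemma kill: "1 \<le> p \<Longrightarrow> p < q \<Longrightarrow> q \<le> n \<Longrightarrow> \<not> (p = i \<and> q = Suc i) \<Longrightarrow> E p q (vs j) = 0"
proof (induct j arbitrary: p q)
  case 0
  then show ?case
    using hw by (simp add: vs_simps hw_vec_def)
next
  case (Suc j)
  have 1: "E p q (vs j) = 0"
    using Suc by simp
  have 2: "E p i (vs j) = 0" if "q = Suc i"
    using Suc.prems that i by (intro Suc.hyps) auto
  have 3: "E (Suc i) q (vs j) = 0" if "p = i"
    using Suc.prems that i by (intro Suc.hyps) auto
  show ?case
    by (simp add: vs_simps(2) pol_proper_commute[of K s p q] 1 2 3)
qed

lemma weight: "p \<in> {1..n} \<Longrightarrow> E p p (vs j) = scl (wts (of_nat j) p) (vs j)"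
proof (induct j)
  case 0
  then show ?case
    using hw by (simp add: vs_simps hw_vec_def wts_def)
next
  case (Suc j)
  have "E p p (vs (Suc j)) = E (Suc i) i (E p p (vs j)) + (if p = Suc i then E p i (vs j) else 0) -
      (if p = i then E (Suc i) p (vs j) else 0)"
    by (simp add: vs_simps(2) pol_proper_commute[of K s p p])
  also have "\<dots> = scl (wts (of_nat j) p) (vs (Suc j)) + (if p = Suc i then vs (Suc j) else 0) - (if p = i then vs (Suc j) else 0)"
    using Suc by (simp add: vs_simps(2))
  also have "\<dots> = scl (wts (of_nat (Suc j)) p) (vs (Suc j))"
    by (auto simp: wts_def fun_eq_iff algebra_simps vec_apply)
  finally show ?case .
qed

lemma raise: "E i (Suc i) (vs (Suc j)) = scl ((of_nat j + 1) * (mu i - mu (Suc i) - of_nat j)) (vs j)"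
proof (induct j)
  case 0
  have "E i (Suc i) (vs 0) = 0"
    using hw i by (simp add: vs_simps hw_vec_def)
  then show ?case
    using weight[of i 0] weight[of "Suc i" 0] i
    by (simp add: vs_simps(2) pol_proper_commute[of K s i "Suc i"] wts_def scl_add(4))
next
  case (Suc j)
  have "E i (Suc i) (vs (Suc (Suc j))) = E (Suc i) i (E i (Suc i) (vs (Suc j))) + E i i (vs (Suc j)) - E (Suc i) (Suc i) (vs (Suc j))"
    by (subst vs_simps(2)) (simp add: pol_proper_commute[of K s i "Suc i"])
  also have "\<dots> = scl ((of_nat j + 1) * (mu i - mu (Suc i) - of_nat j)) (vs (Suc j)) +
      scl (wts (of_nat (Suc j)) i) (vs (Suc j)) - scl (wts (of_nat (Suc j)) (Suc i)) (vs (Suc j))"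
    using Suc weight[of i "Suc j"] weight[of "Suc i" "Suc j"] i by (simp add: vs_simps(2))
  also have "\<dots> = scl ((of_nat (Suc j) + 1) * (mu i - mu (Suc i) - of_nat (Suc j))) (vs (Suc j))"
    by (simp add: scl_add(2,4)[symmetric] wts_def) (simp add: algebra_simps)
  finally show ?case .
qed

text \<open>The factor picked up by raising \<open>a\<close> times, as a polynomial in the position
  \<open>t\<close> on the string. The factors \<open>t - r\<close> make it vanish at natural
  \<open>t < a\<close>, which agrees with the truncated subtraction in
  \<open>vs (j - a)\<close>.\<close>

definition coef :: "nat \<Rightarrow> complex \<Rightarrow> complex"
  where "coef a t = (\<Prod>r<a. (t - of_nat r) * (mu i - mu (Suc i) - t + of_nat r + 1))"

lemma raise_power: "(E i (Suc i) ^^ a) (vs j) = scl (coef a (of_nat j)) (vs (j - a))"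
proof (induct a)
  case (Suc a)
  show ?case
  proof (cases "j - a")
    case 0
    then have "E i (Suc i) (vs (j - a)) = 0"
      using hw i by (simp add: vs_simps hw_vec_def)
    moreover have "coef (Suc a) (of_nat j) = 0"
    proof -
      have "j \<in> {..<Suc a}"
        using 0 by simp
      then show ?thesis
        unfolding coef_def by (intro prod_zero) auto
    qed
    ultimately show ?thesis
      using Suc by simp
  next
    case (Suc m)
    then have "j = m + a + 1"
      by linarith
    then have m: "of_nat j = of_nat m + of_nat a + (1 :: complex)" "j - Suc a = m"
      by simp_all
    have "(E i (Suc i) ^^ Suc a) (vs j) = scl (coef a (of_nat j)) (E i (Suc i) (vs (Suc m)))"
      using Suc.hyps Suc by simp
    also have "\<dots> = scl (coef a (of_nat j) * ((of_nat m + 1) * (mu i - mu (Suc i) - of_nat m))) (vs m)"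
      by (simp add: raise)
    also have "coef a (of_nat j) * ((of_nat m + 1) * (mu i - mu (Suc i) - of_nat m)) = coef (Suc a) (of_nat j)"
      by (simp add: coef_def m(1))
    finally show ?thesis
      by (simp only: m(2))
  qed
qed (simp add: coef_def)

text \<open>Raising \<open>vs j\<close> back \<open>j\<close> times returns a multiple of
  \<open>v\<close>, and for \<open>j \<le> k\<close> none of the factors of that multiple
  vanishes.\<close>

lemma vs_nonzero:
  assumes "mu i - mu (Suc i) = of_nat k" "j \<le> k"
  shows "vs j \<noteq> 0"
proof
  assume 0: "vs j = 0"
  have "(E i (Suc i) ^^ a) 0 = 0" for a
    by (induct a) auto
  then have "scl (coef j (of_nat j)) (vs 0) = 0"
    using raise_power[of j j] by (simp add: 0)
  moreover have "coef j (of_nat j) \<noteq> 0"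
  proof -
    have "(of_nat j - of_nat r) * (of_nat k - of_nat j + of_nat r + 1) \<noteq> (0 :: complex)" if "r < j" for r
    proof -
      have "of_nat j - of_nat r = (of_nat (j - r) :: complex)" "of_nat k - of_nat j + of_nat r + 1 = (of_nat (Suc (k - j + r)) :: complex)"
        using that assms(2) by (simp_all add: of_nat_diff)
      then show ?thesis
        using that by (simp only: mult_eq_0_iff of_nat_eq_0_iff) simp
    qed
    then show ?thesis
      unfolding coef_def assms(1) by (simp add: prod_zero_iff)
  qed
  moreover have "vs 0 \<noteq> 0"
    using hw by (simp add: vs_simps hw_vec_def)
  ultimately show False
    by (simp add: scl_eq_0_iff)
qed

lemma diag_word:
  assumes "\<And>x. x \<in> set D \<Longrightarrow> x \<in> proper_symbols n \<times> proper_symbols n \<and> fst x = snd x"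
    and idx: "\<And>p. idx (Proper p) = p"
  shows "app (pol_word K s D) (vs j) = scl (\<Prod>x\<leftarrow>D. wts (of_nat j) (idx (fst x))) (vs j)"
  using assms(1)
proof (induct D)
  case (Cons x D)
  obtain p where p: "x = (Proper p, Proper p)" "p \<in> {1..n}"
    using Cons.prems[of x] by (cases x) (auto simp: proper_symbols_def)
  have "app (pol_word K s D) (vs j) = scl (\<Prod>x\<leftarrow>D. wts (of_nat j) (idx (fst x))) (vs j)"
    by (rule Cons.hyps) (rule Cons.prems, simp)
  then show ?case
    using weight[OF p(2)] by (simp add: p(1) idx mult.commute)
qed simp

lemma pol_word_replicate: "app (pol_word K s (replicate a (x, y))) u = (app (pol K s x y) ^^ a) u"
  by (induct a) auto

lemma string_word:
  assumes "\<And>x. x \<in> set D \<Longrightarrow> x \<in> proper_symbols n \<times> proper_symbols n \<and> fst x = snd x"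
    and idx: "\<And>p. idx (Proper p) = p"
  shows "app (pol_word K s (replicate a (Proper (Suc i), Proper i) @ D @ replicate a (Proper i, Proper (Suc i)))) (vs j) =
    scl (coef a (of_nat j) * (\<Prod>x\<leftarrow>D. wts (of_nat j - of_nat a) (idx (fst x)))) (vs j)"
proof -
  have scl_pow: "(E p q ^^ b) (scl c u) = scl c ((E p q ^^ b) u)" for p q b c u
    by (induct b) auto
  have pow: "(E (Suc i) i ^^ b) (vs m) = vs (m + b)" for b m
    by (induct b) (auto simp: vs_simps)
  have "app (pol_word K s (replicate a (Proper (Suc i), Proper i) @ D @ replicate a (Proper i, Proper (Suc i)))) (vs j) =
    scl (coef a (of_nat j) * (\<Prod>x\<leftarrow>D. wts (of_nat (j - a)) (idx (fst x)))) (vs (j - a + a))"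
    by (simp add: pol_word_replicate raise_power diag_word[OF assms] scl_pow pow)
  moreover have "coef a (of_nat j) = 0" if "j < a"
    unfolding coef_def using that by (intro prod_zero) auto
  ultimately show ?thesis
    by (cases "j < a") (simp_all add: of_nat_diff)
qed

end

subsection \<open>A monomial of prescribed weight\<close>

definition hw_config :: "nat \<Rightarrow> (nat \<Rightarrow> nat) \<Rightarrow> config"
  where "hw_config n m = (\<lambda>(x, p). case x of Proper i \<Rightarrow> of_bool (1 \<le> i \<and> i \<le> n \<and> p < m i) | _ \<Rightarrow> 0)"

lemma hw_config_simps [simp]:
  "hw_config n m (Proper i, p) = of_bool (1 \<le> i \<and> i \<le> n \<and> p < m i)"
  "hw_config n m (Alpha i, p) = 0" "hw_config n m (Beta i, p) = 0"
  by (simp_all add: hw_config_def)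

lemma pol_diag:
  assumes "\<And>p. p < K \<Longrightarrow> m (a, p) \<le> 1"
  shows "app (pol K s a a) f m = of_nat (content K m a) * f m"
proof -
  have "app (cr s (a, p)) (app (an s (a, p)) f) m = of_nat (m (a, p)) * f m" if "p < K" for p
  proof -
    have "m (a, p) = 0 \<or> m (a, p) = 1"
      using assms[OF that] by linarith
    then show ?thesis
      by (elim disjE) (simp_all add: app_cr app_an jw_upd jw_square' fun_upd_idem)
  qed
  then show ?thesis
    by (simp add: pol_def app_sum sum_vec_apply content_def sum_distrib_right)
qed

lemma content_hw_config:
  assumes "p \<in> {1..n}" "m p \<le> K"
  shows "content K (hw_config n m) (Proper p) = m p"
proof -
  have "content K (hw_config n m) (Proper p) = card {q. q < K \<and> q < m p}"
    using assms(1) by (simp add: content_def sum.If_cases Int_def of_bool_def)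
  also have "{q. q < K \<and> q < m p} = {..<m p}"
    using assms(2) by auto
  finally show ?thesis
    by simp
qed

lemma ind_weight:
  assumes "\<And>p. m0 (a, p) \<le> 1"
  shows "app (pol K s a a) (ind m0) = scl (of_nat (content K m0 a)) (ind m0)"
proof
  fix m
  have "app (pol K s a a) (ind m0) m = 0" if "m \<noteq> m0"
  proof (rule ccontr)
    assume "app (pol K s a a) (ind m0) m \<noteq> 0"
    then obtain p m1 where "m = m1((a, p) := Suc (m1 (a, p)))" "ind m0 (m1((a, p) := Suc (m1 (a, p)))) \<noteq> 0"
      by (auto elim: pol_support)
    then show False
      using that by (simp add: ind_def split: if_splits)
  qed
  then show "app (pol K s a a) (ind m0) m = scl (of_nat (content K m0 a)) (ind m0) m"
    using pol_diag[of K m0 a s "ind m0"] assms by (cases "m = m0") (auto simp: ind_def vec_apply)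
qed

lemma ind_nonzero: "ind m0 \<noteq> 0"
  by (metis (full_types) ind_def of_bool_eq(2) zero_fun_apply zero_neq_one)

lemma proper_vec_hw: "proper_vec (ind (hw_config n m))"
  unfolding proper_vec_def
proof (intro allI impI)
  fix m' a p assume "ind (hw_config n m) m' \<noteq> 0" "is_virtual a"
  then show "m' (a, p) = 0"
    by (cases a) (auto simp: ind_def is_virtual_def split: if_splits)
qed

lemma gap_partitions_mono:
  assumes "m \<in> gap_partitions n g" "1 \<le> p" "p \<le> q" "q \<le> n"
  shows "m q \<le> m p"
  using assms(3,4)
proof (induct q rule: dec_induct)
  case (step q)
  then have "m (Suc q) + g \<le> m q"
    using assms(1,2) by (simp add: gap_partitions_def)
  then show ?case
    using step by simp
qed simp

text \<open>Raising replaces some \<open>q\<close> in a column \<open>r\<close> by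
  \<open>p < q\<close>. As \<open>m q \<le> m p\<close>, the column already contains
  \<open>p\<close>, and for \<open>s = False\<close> the proper variables are odd, so the place is
  occupied.\<close>

lemma hw_vec_hw_config:
  assumes m: "m \<in> gap_partitions n g" and K: "m 1 \<le> K"
  shows "hw_vec K False n (\<lambda>i. of_nat (m i)) (ind (hw_config n m))"
  unfolding hw_vec_def
proof (intro conjI allI impI ballI ind_nonzero)
  fix p assume p: "p \<in> {1..n}"
  then have "m p \<le> K"
    using gap_partitions_mono[OF m, of 1 p] K by simp
  then show "app (pol K False (Proper p) (Proper p)) (ind (hw_config n m)) = scl (of_nat (m p)) (ind (hw_config n m))"
    using content_hw_config[of p n m K] p by (simp add: ind_weight)
next
  fix p q assume pq: "1 \<le> p" "p < q" "q \<le> n"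
  show "app (pol K False (Proper p) (Proper q)) (ind (hw_config n m)) = 0"
  proof (rule ccontr)
    assume "app (pol K False (Proper p) (Proper q)) (ind (hw_config n m)) \<noteq> 0"
    then obtain m' where "app (pol K False (Proper p) (Proper q)) (ind (hw_config n m)) m' \<noteq> 0"
      by (auto simp: fun_eq_iff vec_apply)
    then obtain r m0 where r: "ind (hw_config n m) (m0((Proper q, r) := Suc (m0 (Proper q, r)))) \<noteq> 0"
      "odd_sym False (Proper p) \<Longrightarrow> even (m0 (Proper p, r))"
      by (auto elim: pol_support)
    then have eq: "m0((Proper q, r) := Suc (m0 (Proper q, r))) = hw_config n m"
      by (simp add: ind_def split: if_splits)
    have "(m0((Proper q, r) := Suc (m0 (Proper q, r)))) (Proper q, r) \<noteq> 0"
      by simp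
    then have "r < m q"
      unfolding eq by (simp split: if_splits)
    then have "hw_config n m (Proper p, r) = 1"
      using gap_partitions_mono[OF m pq(1), of q] pq by simp
    then have "m0 (Proper p, r) = 1"
      using pq(2) unfolding eq[symmetric] by simp
    then show False
      using r(2) by (simp add: odd_sym_def)
  qed
qed

section \<open>The Harish-Chandra polynomial of a central element\<close>

fun idx :: "symb \<Rightarrow> nat" where
  "idx (Proper p) = p"
| "idx _ = 0"

text \<open>Sorting by \<open>ikey i\<close> puts lowering operators first, raising operators last and the root vectors
  of the simple root \<open>i\<close> next to the diagonal; for \<open>i = 0\<close> no simple root is singled out.\<close>

definition ikey :: "nat \<Rightarrow> symb \<times> symb \<Rightarrow> nat"
  where "ikey i x = (let p = idx (fst x); q = idx (snd x) in
    if p = q then 2 else if p = Suc i \<and> q = i then 1 else if p = i \<and> q = Suc i then 3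
    else if q < p then 0 else 4)"

definition hc_words :: "nat \<Rightarrow> nat \<Rightarrow> nat \<Rightarrow> (symb \<times> symb) list set"
  where "hc_words n i h = {w \<in> lists (proper_symbols n \<times> proper_symbols n).
    sorted (map (ikey i) w) \<and> length w \<le> h \<and> (\<forall>a. wt w a = 0)}"

definition low :: "nat \<Rightarrow> (symb \<times> symb) list \<Rightarrow> nat"
  where "low i w = length (filter (\<lambda>x. ikey i x = 1) w)"

definition diag :: "nat \<Rightarrow> (symb \<times> symb) list \<Rightarrow> (symb \<times> symb) list"
  where "diag i w = filter (\<lambda>x. ikey i x = 2) w"

text \<open>The letters of key 4 are the raising operators that kill the whole string of the simple
  root \<open>i\<close>.\<close>

definition good :: "nat \<Rightarrow> (symb \<times> symb) list \<Rightarrow> bool"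
  where "good i w \<longleftrightarrow> (\<forall>x\<in>set w. ikey i x \<noteq> 4)"

lemma proper_pair:
  assumes "x \<in> proper_symbols n \<times> proper_symbols n"
  obtains p q where "x = (Proper p, Proper q)" "1 \<le> p" "p \<le> n" "1 \<le> q" "q \<le> n"
  using assms by (cases x) (auto simp: proper_symbols_def)

text \<open>Evaluates a linear functional \<open>th\<close> on the weight of a word letter by
  letter; for a word of weight zero the sum is zero.\<close>

lemma weighted_wt:
  assumes "w \<in> lists (proper_symbols n \<times> proper_symbols n)"
  shows "(\<Sum>x\<leftarrow>w. th (idx (fst x)) - th (idx (snd x))) = (\<Sum>p\<in>{1..n}. (th p :: int) * wt w (Proper p))"
  using assms
proof (induct w)
  case (Cons x w)
  obtain p q where x: "x = (Proper p, Proper q)" "p \<in> {1..n}" "q \<in> {1..n}"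
    using Cons.hyps(1) by (elim proper_pair) simp
  have delta: "(\<Sum>r\<in>{1..n}. th r * of_bool (t = r)) = th t" if "t \<in> {1..n}" for t
  proof -
    have "(\<Sum>r\<in>{1..n}. th r * of_bool (t = r)) = (\<Sum>r\<in>{1..n}. if t = r then th r else 0)"
      by (intro sum.cong) auto
    then show ?thesis
      using that by simp
  qed
  have "(\<Sum>r\<in>{1..n}. th r * wt (x # w) (Proper r)) =
    (\<Sum>r\<in>{1..n}. th r * of_bool (p = r)) - (\<Sum>r\<in>{1..n}. th r * of_bool (q = r)) + (\<Sum>r\<in>{1..n}. th r * wt w (Proper r))"
    by (simp only: x(1) wt_simps fst_conv snd_conv symb.inject distrib_left right_diff_distrib sum.distrib sum_subtractf)
  then show ?case
    using Cons.hyps(3) x by (simp only: delta) simp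
qed simp

lemma sorted_three_parts:
  assumes "sorted (map k w)" "\<And>x. x \<in> set w \<Longrightarrow> k x \<in> {1, 2, 3 :: nat}"
  shows "w = filter (\<lambda>x. k x = 1) w @ filter (\<lambda>x. k x = 2) w @ filter (\<lambda>x. k x = 3) w"
  using assms
proof (induct w)
  case (Cons x w)
  have ge: "k x \<le> k y" if "y \<in> set w" for y
    using Cons.prems(1) that by simp
  have IH: "w = filter (\<lambda>x. k x = 1) w @ filter (\<lambda>x. k x = 2) w @ filter (\<lambda>x. k x = 3) w"
    using Cons by simp
  have no: "filter (\<lambda>y. k y = c) w = []" if "c < k x" for c
    using ge that by (fastforce simp: filter_empty_conv)
  consider "k x = 1" | "k x = 2" | "k x = 3"
    using Cons.prems(2)[of x] by auto
  then show ?case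
  proof cases
    case 1
    then show ?thesis
      using IH by simp
  next
    case 2
    then show ?thesis
      using IH no[of 1] by simp
  next
    case 3
    then show ?thesis
      using IH no[of 1] no[of 2] by simp
  qed
qed simp

text \<open>With no letters of key 4, weight zero leaves nothing to balance the lowering letters
  outside the simple root \<open>i\<close>, so these are absent; the two kinds of letters for the
  root \<open>i\<close> occur equally often.\<close>

lemma good_word_structure:
  assumes w: "w \<in> hc_words n i h" and "good i w"
  shows "w = replicate (low i w) (Proper (Suc i), Proper i) @ diag i w @ replicate (low i w) (Proper i, Proper (Suc i))"
    and "\<And>x. x \<in> set (diag i w) \<Longrightarrow> x \<in> proper_symbols n \<times> proper_symbols n \<and> fst x = snd x"
    and "i = 0 \<Longrightarrow> low i w = 0" and "length (diag i w) + 2 * low i w \<le> h"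
proof -
  let ?P = "proper_symbols n"
  have wP: "w \<in> lists (?P \<times> ?P)" and wt0: "\<And>a. wt w a = 0" and sorted: "sorted (map (ikey i) w)" and len: "length w \<le> h"
    using w unfolding hc_words_def by blast+
  have xP: "x \<in> ?P \<times> ?P" if "x \<in> set w" for x
    using wP that unfolding lists_eq_set by blast
  \<comment> \<open>This functional agrees at \<open>i\<close> and \<open>Suc i\<close> and is
    strictly increasing otherwise: it ignores the simple root \<open>i\<close> and is positive on
    all other lowering letters.\<close>
  define th :: "nat \<Rightarrow> int" where "th p = (if p \<le> i then int p else int p - 1)" for p
  have nonneg: "0 \<le> th (idx (fst x)) - th (idx (snd x))"
    and pos: "ikey i x = 0 \<Longrightarrow> 0 < th (idx (fst x)) - th (idx (snd x))" if x: "x \<in> set w" for x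
  proof -
    obtain p q where pq: "x = (Proper p, Proper q)" "1 \<le> p" "p \<le> n" "1 \<le> q" "q \<le> n"
      using xP[OF x] by (rule proper_pair)
    have "ikey i x \<noteq> 4"
      using assms(2) x by (simp add: good_def)
    then show "0 \<le> th (idx (fst x)) - th (idx (snd x))"
      using pq by (auto simp: ikey_def th_def Let_def split: if_splits)
    show "0 < th (idx (fst x)) - th (idx (snd x))" if "ikey i x = 0"
      using pq that by (auto simp: ikey_def th_def Let_def split: if_splits)
  qed
  have total: "(\<Sum>x\<leftarrow>w. th (idx (fst x)) - th (idx (snd x))) = 0"
    unfolding weighted_wt[OF wP] wt0 by simp
  have no0: "ikey i x \<noteq> 0" if "x \<in> set w" for x
  proof
    assume "ikey i x = 0"
    then have "0 < th (idx (fst x)) - th (idx (snd x))"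
      using pos that by blast
    moreover have "th (idx (fst x)) - th (idx (snd x)) \<le> (\<Sum>x\<leftarrow>w. th (idx (fst x)) - th (idx (snd x)))"
      by (rule member_le_sum_list) (use that nonneg in auto)
    ultimately show False
      using total by linarith
  qed
  have "ikey i x \<in> {1, 2, 3}" if "x \<in> set w" for x
    using no0[OF that] assms(2) that by (auto simp: good_def ikey_def Let_def split: if_splits)
  note parts = sorted_three_parts[OF sorted this]
  have rep1: "filter (\<lambda>x. ikey i x = 1) w = replicate (low i w) (Proper (Suc i), Proper i)"
    unfolding low_def
  proof (intro replicate_eqI refl)
    fix y assume "y \<in> set (filter (\<lambda>x. ikey i x = 1) w)"
    then have y: "y \<in> set w" "ikey i y = 1"
      by simp_all
    obtain p q where "y = (Proper p, Proper q)"
      using xP[OF y(1)] by (rule proper_pair)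
    then show "y = (Proper (Suc i), Proper i)"
      using y(2) by (simp add: ikey_def Let_def split: if_splits)
  qed
  define b where "b = length (filter (\<lambda>x. ikey i x = 3) w)"
  have rep3: "filter (\<lambda>x. ikey i x = 3) w = replicate b (Proper i, Proper (Suc i))"
    unfolding b_def
  proof (intro replicate_eqI refl)
    fix y assume "y \<in> set (filter (\<lambda>x. ikey i x = 3) w)"
    then have y: "y \<in> set w" "ikey i y = 3"
      by simp_all
    obtain p q where "y = (Proper p, Proper q)"
      using xP[OF y(1)] by (rule proper_pair)
    then show "y = (Proper i, Proper (Suc i))"
      using y(2) by (simp add: ikey_def Let_def split: if_splits)
  qed
  show diag: "x \<in> ?P \<times> ?P \<and> fst x = snd x" if "x \<in> set (diag i w)" for x
  proof -
    have x: "x \<in> set w" "ikey i x = 2"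
      using that by (simp_all add: diag_def)
    obtain p q where "x = (Proper p, Proper q)"
      using xP[OF x(1)] by (rule proper_pair)
    then show ?thesis
      using xP[OF x(1)] x(2) by (simp add: ikey_def Let_def split: if_splits)
  qed
  have "wt D a = 0" if "\<And>x. x \<in> set D \<Longrightarrow> fst x = snd x" for D a
    using that by (induct D) simp_all
  then have wt_diag: "wt (diag i w) a = 0" for a
    using diag by blast
  have "wt (replicate c x) a = int c * (of_bool (fst x = a) - of_bool (snd x = a))" for c x a
    by (induct c) (auto simp: algebra_simps)
  \<comment> \<open>The weight at \<open>Proper i\<close> alone compares the two exponents: lowering
    letters count -1 and raising letters +1.\<close>
  moreover have "wt (replicate (low i w) (Proper (Suc i), Proper i) @ diag i w @ replicate b (Proper i, Proper (Suc i))) (Proper i) = 0"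
    using wt0[of "Proper i"] parts unfolding rep1 rep3 diag_def by metis
  ultimately have b: "b = low i w"
    by (simp add: wt_diag)
  show decomp: "w = replicate (low i w) (Proper (Suc i), Proper i) @ diag i w @ replicate (low i w) (Proper i, Proper (Suc i))"
    using parts unfolding rep1 rep3 b diag_def .
  have "length w = length (diag i w) + 2 * low i w"
    by (subst decomp) simp
  then show "length (diag i w) + 2 * low i w \<le> h"
    using len by simp
  \<comment> \<open>For \<open>i = 0\<close> the letters of key 1 would contain
    \<open>Proper 0\<close>, which is not among the symbols.\<close>
  show "low i w = 0" if "i = 0"
  proof (rule ccontr)
    assume "low i w \<noteq> 0"
    then have "(Proper (Suc i), Proper i) \<in> set (filter (\<lambda>x. ikey i x = 1) w)"
      unfolding rep1 by simp
    then have "(Proper (Suc i), Proper i) \<in> ?P \<times> ?P"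
      by (intro xP) simp
    then show False
      using that by (auto simp: proper_symbols_def)
  qed
qed

text \<open>Key 4 is the largest, so a sorted word containing it ends with such a letter, and this
  letter acts first.\<close>

lemma bad_word_last:
  assumes w: "w \<in> hc_words n i h" and "\<not> good i w"
  obtains us p q where "w = us @ [(Proper p, Proper q)]" "us \<in> lists (proper_symbols n \<times> proper_symbols n)"
    "1 \<le> p" "p < q" "q \<le> n" "\<not> (p = i \<and> q = Suc i)"
proof -
  obtain x where x: "x \<in> set w" "ikey i x = 4"
    using assms(2) by (auto simp: good_def)
  then obtain us y where us: "w = us @ [y]"
    by (metis append_butlast_last_id empty_iff empty_set)
  have wP: "w \<in> lists (proper_symbols n \<times> proper_symbols n)" and sorted: "sorted (map (ikey i) w)"
    using w unfolding hc_words_def by blast+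
  have "4 \<le> ikey i y"
    using sorted x unfolding us by (auto simp: sorted_append)
  then have "ikey i y = 4"
    by (auto simp: ikey_def Let_def split: if_splits)
  moreover have "y \<in> proper_symbols n \<times> proper_symbols n"
    using wP by (simp add: us)
  then obtain p q where "y = (Proper p, Proper q)" "1 \<le> p" "p \<le> n" "1 \<le> q" "q \<le> n"
    by (rule proper_pair)
  ultimately show ?thesis
    using that[of us p q] wP by (auto simp: us ikey_def Let_def split: if_splits)
qed

lemma reduces_hc_words:
  assumes "x \<in> words {us \<in> lists (proper_symbols n \<times> proper_symbols n). length us \<le> h \<and> (\<forall>a. wt us a = 0)}"
  obtains y where "y \<in> words (hc_words n i h)" "x - y \<in> gl_ideal (proper_symbols n)"
proof -
  let ?P = "proper_symbols n"
  have "reduces (gl_ideal ?P) (hc_words n i h) x"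
  proof (rule reduces_trans[OF linear_set_gl_ideal reduces_words[OF linear_set_gl_ideal assms]])
    fix ps assume "ps \<in> {us \<in> lists (?P \<times> ?P). length us \<le> h \<and> (\<forall>a. wt us a = 0)}"
    then have ps: "ps \<in> lists (?P \<times> ?P)" "length ps \<le> h" "\<And>a. wt ps a = 0"
      by blast+
    show "reduces (gl_ideal ?P) (hc_words n i h) (mon ps)"
    proof (rule reduces_mono[OF _ straighten[OF ps(1), of "ikey i"]], intro subsetI)
      fix qs assume "qs \<in> {qs \<in> lists (?P \<times> ?P). sorted (map (ikey i) qs) \<and> length qs \<le> length ps \<and> wt qs = wt ps}"
      then show "qs \<in> hc_words n i h"
        using ps(2,3) unfolding hc_words_def by simp
    qed
  qed
  then show ?thesis
    using that unfolding reduces_def by blast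
qed

text \<open>The Harish-Chandra projection: under these conditions the words of \<open>y\<close> that
  remain consist of diagonal letters only.\<close>

definition hc_poly :: "nat \<Rightarrow> (symb \<times> symb) free_alg \<Rightarrow> cpoly"
  where "hc_poly i y = (\<Sum>w | w \<in> Poly_Mapping.keys y \<and> good i (letters w) \<and> low i (letters w) = 0.
    Poly_Mapping.single 0 (Poly_Mapping.lookup y w) * (\<Prod>p\<leftarrow>map (\<lambda>x. idx (fst x)) (diag i (letters w)). var p))"

lemma eval_hc_poly: "eval_poly (hc_poly i y) mu =
  (\<Sum>w | w \<in> Poly_Mapping.keys y \<and> good i (letters w) \<and> low i (letters w) = 0.
    Poly_Mapping.lookup y w * (\<Prod>x\<leftarrow>diag i (letters w). mu (idx (fst x))))"
  by (simp add: hc_poly_def eval_poly_sum eval_poly_mult eval_poly_const eval_poly_prod_list eval_poly_var comp_def)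

context hw_string
begin

text \<open>The eigenvalue on the vectors of the string, continued to complex positions
  \<open>t\<close>.\<close>

definition action :: "(symb \<times> symb) free_alg \<Rightarrow> complex \<Rightarrow> complex"
  where "action y t = (\<Sum>w | w \<in> Poly_Mapping.keys y \<and> good i (letters w).
    Poly_Mapping.lookup y w * (coef (low i (letters w)) t *
      (\<Prod>x\<leftarrow>diag i (letters w). wts (t - of_nat (low i (letters w))) (idx (fst x)))))"

lemma action_vs:
  assumes "y \<in> words (hc_words n i h)"
  shows "app (rho K s y) (vs j) = scl (action y (of_nat j)) (vs j)"
proof -
  let ?c = "\<lambda>w. coef (low i (letters w)) (of_nat j) *
      (\<Prod>x\<leftarrow>diag i (letters w). wts (of_nat j - of_nat (low i (letters w))) (idx (fst x)))"
  have word: "app (pol_word K s (letters w)) (vs j) = scl (if good i (letters w) then ?c w else 0) (vs j)"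
    if "w \<in> Poly_Mapping.keys y" for w
  proof -
    have w: "letters w \<in> hc_words n i h"
      using assms that by (simp add: words_def)
    show ?thesis
    proof (cases "good i (letters w)")
      case True
      note * = good_word_structure[OF w True]
      have "app (pol_word K s (replicate (low i (letters w)) (Proper (Suc i), Proper i) @ diag i (letters w) @
          replicate (low i (letters w)) (Proper i, Proper (Suc i)))) (vs j) = scl (?c w) (vs j)"
        by (rule string_word[OF *(2)]) simp_all
      then show ?thesis
        unfolding *(1)[symmetric] using True by simp
    next
      case False
      obtain us p q where "letters w = us @ [(Proper p, Proper q)]" "1 \<le> p" "p < q" "q \<le> n" "\<not> (p = i \<and> q = Suc i)"
        by (rule bad_word_last[OF w False])
      then show ?thesis
        using kill[of p q j] False by simp
    qed
  qed
  have "app (rho K s y) (vs j) = (\<Sum>w\<in>Poly_Mapping.keys y. scl (Poly_Mapping.lookup y w * (if good i (letters w) then ?c w else 0)) (vs j))"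
    by (simp add: lin_def app_sum word mult.commute)
  also have "\<dots> = scl (\<Sum>w\<in>Poly_Mapping.keys y. Poly_Mapping.lookup y w * (if good i (letters w) then ?c w else 0)) (vs j)"
    by (simp only: scl_sum)
  also have "(\<Sum>w\<in>Poly_Mapping.keys y. Poly_Mapping.lookup y w * (if good i (letters w) then ?c w else 0)) = action y (of_nat j)"
    unfolding action_def by (intro sum.mono_neutral_cong_right) auto
  finally show ?thesis .
qed

text \<open>At these two positions the factor \<open>r = 0\<close> of \<open>coef\<close> vanishes,
  so only the diagonal words contribute. They are the start of the string and the first position
  after its end, whose weights are exchanged by the shifted reflection.\<close>

lemma action_boundary:
  assumes t: "t = 0 \<or> t = mu i - mu (Suc i) + 1"
  shows "action y t = eval_poly (hc_poly i y) (wts t)"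
proof -
  have "coef a t = 0" if "a \<noteq> 0" for a
    unfolding coef_def using that t by (intro prod_zero) (auto intro: bexI[of _ 0])
  then show ?thesis
    unfolding action_def eval_hc_poly by (intro sum.mono_neutral_cong_right) (auto simp: coef_def)
qed

text \<open>Each pair of a lowering and a raising letter contributes degree at most 2 through
  \<open>coef\<close> and each diagonal letter at most 1, so the degree is bounded by the length of
  the words.\<close>

lemma action_poly:
  assumes "y \<in> words (hc_words n i h)"
  shows "\<exists>p. degree p \<le> h \<and> (\<forall>t. action y t = poly p t)"
proof -
  have lin: "\<exists>p. degree p \<le> 1 \<and> (\<forall>t. wts (t - c) q = poly p t)" for c q
    by (rule exI[of _ "[:mu q + c * of_bool (q = i) - c * of_bool (q = Suc i), of_bool (q = Suc i) - of_bool (q = i):]"])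
      (simp add: wts_def algebra_simps)
  have diag: "\<exists>p. degree p \<le> length D \<and> (\<forall>t. (\<Prod>x\<leftarrow>D. wts (t - c) (idx (fst x))) = poly p t)"
    for D :: "(symb \<times> symb) list" and c
  proof (induct D)
    case (Cons x D)
    then obtain p q where "degree p \<le> length D" "\<forall>t. (\<Prod>x\<leftarrow>D. wts (t - c) (idx (fst x))) = poly p t"
      "degree q \<le> 1" "\<forall>t. wts (t - c) (idx (fst x)) = poly q t"
      using lin by blast
    then show ?case
      using degree_mult_le[of q p] by (intro exI[of _ "q * p"]) auto
  next
    case Nil
    show ?case
      by (rule exI[of _ 1]) simp
  qed
  have coef: "\<exists>p. degree p \<le> 2 * a \<and> (\<forall>t. coef a t = poly p t)" for a
  proof (induct a)
    case (Suc a)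
    then obtain p where p: "degree p \<le> 2 * a" "\<forall>t. coef a t = poly p t"
      by blast
    let ?q = "[:- of_nat a, 1:] * [:mu i - mu (Suc i) + of_nat a + 1, - 1:]"
    have "degree ?q \<le> 2"
      by (rule order_trans[OF degree_mult_le]) simp
    moreover have "coef (Suc a) t = poly (p * ?q) t" for t
      using p(2) by (simp add: coef_def algebra_simps)
    ultimately show ?case
      using p(1) degree_mult_le[of p ?q] by (intro exI[of _ "p * ?q"]) simp
  next
    case 0
    show ?case
      by (rule exI[of _ 1]) (simp add: coef_def)
  qed
  have summand: "\<exists>p. degree p \<le> h \<and> (\<forall>t. Poly_Mapping.lookup y w * (coef (low i (letters w)) t *
      (\<Prod>x\<leftarrow>diag i (letters w). wts (t - of_nat (low i (letters w))) (idx (fst x)))) = poly p t)"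
    if w: "w \<in> Poly_Mapping.keys y" "good i (letters w)" for w
  proof -
    have "letters w \<in> hc_words n i h"
      using assms w by (simp add: words_def)
    then have len: "length (diag i (letters w)) + 2 * low i (letters w) \<le> h"
      using w(2) by (rule good_word_structure(4))
    obtain p q where "degree p \<le> 2 * low i (letters w)" "\<forall>t. coef (low i (letters w)) t = poly p t"
      "degree q \<le> length (diag i (letters w))"
      "\<forall>t. (\<Prod>x\<leftarrow>diag i (letters w). wts (t - of_nat (low i (letters w))) (idx (fst x))) = poly q t"
      using coef diag by metis
    then show ?thesis
      using len degree_mult_le[of p q] degree_smult_le[of "Poly_Mapping.lookup y w" "p * q"]
      by (intro exI[of _ "smult (Poly_Mapping.lookup y w) (p * q)"]) simp
  qed
  have total: "\<exists>p. degree p \<le> h \<and> (\<forall>t. (\<Sum>w\<in>X. F w t) = poly p t)"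
    if "finite X" "\<And>w. w \<in> X \<Longrightarrow> \<exists>p. degree p \<le> h \<and> (\<forall>t. F w t = poly p t)"
    for X :: "(symb \<times> symb) free_word set" and F :: "(symb \<times> symb) free_word \<Rightarrow> complex \<Rightarrow> complex"
    using that
  proof (induct X)
    case (insert w X)
    have "\<exists>p. degree p \<le> h \<and> (\<forall>t. (\<Sum>w\<in>X. F w t) = poly p t)"
      by (rule insert.hyps(3)) (rule insert.prems, simp)
    moreover have "\<exists>q. degree q \<le> h \<and> (\<forall>t. F w t = poly q t)"
      by (rule insert.prems) simp
    ultimately obtain p q where "degree p \<le> h" "\<forall>t. (\<Sum>w\<in>X. F w t) = poly p t" "degree q \<le> h" "\<forall>t. F w t = poly q t"
      by (elim exE conjE) (rule that)
    then show ?case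
      using insert.hyps degree_add_le[of q h p] by (intro exI[of _ "q + p"]) simp
  next
    case empty
    show ?case
      by (rule exI[of _ 0]) simp
  qed
  show ?thesis
    unfolding action_def
  proof (rule total)
    fix w assume "w \<in> {w. w \<in> Poly_Mapping.keys y \<and> good i (letters w)}"
    then show "\<exists>p. degree p \<le> h \<and> (\<forall>t. Poly_Mapping.lookup y w * (coef (low i (letters w)) t *
      (\<Prod>x\<leftarrow>diag i (letters w). wts (t - of_nat (low i (letters w))) (idx (fst x)))) = poly p t)"
      by (intro summand) simp_all
  qed simp
qed

text \<open>A central element acts on the whole string by one scalar, so the polynomial \<open>action y\<close> is
  constant at \<open>0, \<dots>, k\<close>, hence everywhere once \<open>k\<close> is large; its value at \<open>k + 1\<close> is that of the
  Harish-Chandra polynomial at the reflected weight.\<close>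

lemma hc_poly_reflect:
  assumes y: "y \<in> words (hc_words n i h)" and k: "mu i - mu (Suc i) = of_nat k" "h \<le> k"
    and scalar: "\<And>j. app (rho K s y) (vs j) = scl c (vs j)"
  shows "eval_poly (hc_poly i y) mu = c"
    and "eval_poly (hc_poly i y) (mu(i := mu (Suc i) - 1, Suc i := mu i + 1)) = c"
proof -
  have const: "action y (of_nat j) = c" if "j \<le> k" for j
  proof -
    have "scl (action y (of_nat j) - c) (vs j) = 0"
      using scalar[of j] action_vs[OF y, of j] by (simp add: scl_add(4))
    then show ?thesis
      using vs_nonzero[OF k(1) that] by (simp add: scl_eq_0_iff)
  qed
  obtain p where p: "degree p \<le> h" "\<And>t. action y t = poly p t"
    using action_poly[OF y] by blast
  have "p - [:c:] = 0"
  proof (rule ccontr)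
    assume nz: "p - [:c:] \<noteq> 0"
    have "of_nat ` {..k} \<subseteq> {z. poly (p - [:c:]) z = 0}"
      using const by (auto simp: p(2)[symmetric])
    then have "card (of_nat ` {..k} :: complex set) \<le> card {z. poly (p - [:c:]) z = 0}"
      by (rule card_mono[OF poly_roots_finite[OF nz]])
    also have "\<dots> \<le> degree (p - [:c:])"
      by (rule card_poly_roots_bound[OF nz])
    also have "\<dots> \<le> h"
      using p(1) by (intro degree_diff_le) auto
    finally show False
      using k(2) by (simp add: card_image inj_on_def)
  qed
  then have "p = [:c:]"
    by simp
  then have all: "action y t = c" for t
    by (simp add: p(2))
  have "wts 0 = mu"
    by (simp add: wts_def fun_eq_iff)
  then show "eval_poly (hc_poly i y) mu = c"
    using action_boundary[of 0 y] all by simp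
  have "wts (mu i - mu (Suc i) + 1) = mu(i := mu (Suc i) - 1, Suc i := mu i + 1)"
    by (auto simp: wts_def fun_eq_iff)
  then show "eval_poly (hc_poly i y) (mu(i := mu (Suc i) - 1, Suc i := mu i + 1)) = c"
    using action_boundary[of "mu i - mu (Suc i) + 1" y] all by simp
qed

end

lemma center_commute:
  assumes "x \<in> words (lists (proper_symbols n \<times> proper_symbols n))" "cls (proper_symbols n) x \<in> center_gln n"
    and "p \<in> proper_symbols n" "q \<in> proper_symbols n"
  shows "rho K s x * pol K s p q = pol K s p q * rho K s x"
proof -
  let ?P = "proper_symbols n" and ?e = "mon [(p, q)]"
  have e: "?e \<in> words (lists (?P \<times> ?P))"
    using assms(3,4) by simp
  have "cls ?P x \<otimes>\<^bsub>U_gl ?P\<^esub> cls ?P ?e = cls ?P ?e \<otimes>\<^bsub>U_gl ?P\<^esub> cls ?P x"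
    using assms(2) e unfolding center_gln_def U_gln_def U_gl_carrier by blast
  then have "x * ?e - ?e * x \<in> gl_ideal ?P"
    using assms(1) e by (simp only: cls_mult cls_eq_iff)
  then have "rho K s (x * ?e - ?e * x) = 0"
    by (rule rho_gl_ideal)
  then show ?thesis
    by (simp add: lin_diff rho_mult)
qed

lemma good0_word:
  assumes "w \<in> hc_words n 0 h" "good 0 w"
  shows "low 0 w = 0" "diag 0 w = w" "\<And>x. x \<in> set w \<Longrightarrow> x \<in> proper_symbols n \<times> proper_symbols n \<and> fst x = snd x"
proof -
  show 0: "low 0 w = 0"
    by (rule good_word_structure(3)[OF assms refl])
  show d: "diag 0 w = w"
    using good_word_structure(1)[OF assms] 0 by simp
  show "x \<in> proper_symbols n \<times> proper_symbols n \<and> fst x = snd x" if "x \<in> set w" for x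
    by (rule good_word_structure(2)[OF assms]) (simp add: d that)
qed

lemma eval_hc_poly_0:
  assumes "y \<in> words (hc_words n 0 h)"
  shows "eval_poly (hc_poly 0 y) mu = (\<Sum>w\<in>Poly_Mapping.keys y. Poly_Mapping.lookup y w *
    (if good 0 (letters w) then \<Prod>x\<leftarrow>letters w. mu (idx (fst x)) else 0))"
  unfolding eval_hc_poly
proof (rule sum.mono_neutral_cong_left)
  fix w assume "w \<in> {w. w \<in> Poly_Mapping.keys y \<and> good 0 (letters w) \<and> low 0 (letters w) = 0}"
  moreover from this have "letters w \<in> hc_words n 0 h"
    using assms by (simp add: words_def)
  ultimately show "Poly_Mapping.lookup y w * (\<Prod>x\<leftarrow>diag 0 (letters w). mu (idx (fst x))) = Poly_Mapping.lookup y w *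
    (if good 0 (letters w) then \<Prod>x\<leftarrow>letters w. mu (idx (fst x)) else 0)"
    using good0_word(2)[of "letters w" n h] by simp
qed (use assms good0_word(1) in \<open>auto simp: words_def\<close>)

lemma hc_poly_vector:
  assumes y: "y \<in> words (hc_words n 0 h)" and v: "hw_vec K s n mu v"
  shows "app (rho K s y) v = scl (eval_poly (hc_poly 0 y) mu) v"
proof -
  have word: "app (pol_word K s (letters w)) v = scl (if good 0 (letters w) then \<Prod>x\<leftarrow>letters w. mu (idx (fst x)) else 0) v"
    if "w \<in> Poly_Mapping.keys y" for w
  proof -
    have w: "letters w \<in> hc_words n 0 h"
      using y that by (simp add: words_def)
    show ?thesis
    proof (cases "good 0 (letters w)")
      case True
      have "app (pol_word K s D) v = scl (\<Prod>x\<leftarrow>D. mu (idx (fst x))) v"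
        if "\<And>x. x \<in> set D \<Longrightarrow> x \<in> proper_symbols n \<times> proper_symbols n \<and> fst x = snd x" for D
        using that
      proof (induct D)
        case (Cons x D)
        have "x \<in> proper_symbols n \<times> proper_symbols n"
          using Cons.prems[of x] by (simp only: list.set_intros simp_thms)
        then obtain p q where p: "x = (Proper p, Proper q)" "1 \<le> p" "p \<le> n"
          by (rule proper_pair)
        have "p = q"
          using Cons.prems[of x] p(1) by simp
        have "app (pol_word K s D) v = scl (\<Prod>x\<leftarrow>D. mu (idx (fst x))) v"
          by (rule Cons.hyps) (rule Cons.prems, simp)
        then show ?case
          using v p \<open>p = q\<close> by (simp add: hw_vec_def mult.commute)
      qed simp
      then show ?thesis
        using good0_word(3)[OF w True] True by simp
    next
      case False
      obtain us p q where "letters w = us @ [(Proper p, Proper q)]" "1 \<le> p" "p < q" "q \<le> n"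
        by (rule bad_word_last[OF w False])
      then show ?thesis
        using v False by (simp add: hw_vec_def)
    qed
  qed
  have "app (rho K s y) v = (\<Sum>w\<in>Poly_Mapping.keys y. scl (Poly_Mapping.lookup y w *
      (if good 0 (letters w) then \<Prod>x\<leftarrow>letters w. mu (idx (fst x)) else 0)) v)"
    by (simp add: lin_def app_sum word mult.commute)
  also have "\<dots> = scl (eval_poly (hc_poly 0 y) mu) v"
    unfolding eval_hc_poly_0[OF y] by (simp only: scl_sum)
  finally show ?thesis .
qed

lemma hc_poly_vars:
  assumes "y \<in> words (hc_words n i h)"
  shows "hc_poly i y \<in> vars_in n"
  unfolding hc_poly_def
proof (intro vars_in_sum vars_in_mult vars_in_const vars_in_prod_list)
  fix w p assume w: "w \<in> {w. w \<in> Poly_Mapping.keys y \<and> good i (letters w) \<and> low i (letters w) = 0}"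
    "p \<in> set (map (\<lambda>x. idx (fst x)) (diag i (letters w)))"
  then have "letters w \<in> hc_words n i h" "good i (letters w)"
    using assms by (simp_all add: words_def)
  note * = good_word_structure(2)[OF this]
  obtain x where x: "x \<in> set (diag i (letters w))" "p = idx (fst x)"
    using w(2) by auto
  then show "var p \<in> vars_in n"
    using *[OF x(1)] by (elim conjE proper_pair) (simp add: vars_in_var)
qed

text \<open>For each simple root \<open>i\<close> the same element is sorted anew with
  \<open>i\<close> singled out, giving a second polynomial. It takes the eigenvalue both at a weight
  with gaps \<open>h\<close> and at the reflected weight, so by density it equals the first
  polynomial and transfers the reflection invariance to it.\<close>

lemma hc_symmetric:
  assumes x: "x \<in> words {us \<in> lists (proper_symbols n \<times> proper_symbols n). length us \<le> h \<and> (\<forall>a. wt us a = 0)}"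
    and central: "cls (proper_symbols n) x \<in> center_gln n"
    and y: "y \<in> words (hc_words n 0 h)" "x - y \<in> gl_ideal (proper_symbols n)"
  shows "hc_poly 0 y \<in> shifted_symmetric n"
proof -
  let ?P = "proper_symbols n" and ?f = "eval_poly (hc_poly 0 y)"
  have f: "?f \<in> pfun n"
    by (intro eval_poly_pfun hc_poly_vars[OF y(1)])
  have xP: "x \<in> words (lists (?P \<times> ?P))"
    by (rule words_mono[OF Collect_restrict x])
  have "?f (t(i := t (Suc i) - 1, Suc i := t i + 1)) = ?f t" if i: "i \<in> {1..<n}" for i t
  proof -
    let ?r = "\<lambda>t :: nat \<Rightarrow> complex. t(i := t (Suc i) - 1, Suc i := t i + 1)"
    obtain yi where yi: "yi \<in> words (hc_words n i h)" "x - yi \<in> gl_ideal ?P"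
      by (rule reduces_hc_words[OF x])
    let ?g = "eval_poly (hc_poly i yi)"
    have g: "?g \<in> pfun n"
      by (intro eval_poly_pfun hc_poly_vars[OF yi(1)])
    have gap: "?g (\<lambda>i. of_nat (m i)) = ?f (\<lambda>i. of_nat (m i)) \<and> ?g (?r (\<lambda>i. of_nat (m i))) = ?f (\<lambda>i. of_nat (m i))"
      if m: "m \<in> gap_partitions n h" for m
    proof -
      let ?mu = "\<lambda>i. of_nat (m i) :: complex" and ?v = "ind (hw_config n m)"
      obtain K where hw: "hw_vec K False n ?mu ?v"
        using hw_vec_hw_config[OF m order_refl] by blast
      interpret hw_string K False n ?mu ?v i
        using hw i by unfold_locales auto
      have rho_yi: "rho K False yi = rho K False x" and rho_y: "rho K False y = rho K False x"
        using rho_gl_ideal[OF yi(2), of K False] rho_gl_ideal[OF y(2), of K False] by (simp_all add: lin_diff)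
      have "app (rho K False x) (vs j) = scl (?f ?mu) (vs j)" for j
      proof (induct j)
        case 0
        show ?case
          using hc_poly_vector[OF y(1) hw] by (simp only: vs_simps rho_y)
      next
        case (Suc j)
        have "app (rho K False x) (vs (Suc j)) = app (rho K False x * pol K False (Proper (Suc i)) (Proper i)) (vs j)"
          by (simp add: vs_simps(2))
        also have "\<dots> = app (pol K False (Proper (Suc i)) (Proper i)) (app (rho K False x) (vs j))"
          by (subst center_commute[OF xP central]) (use i in \<open>auto simp: proper_symbols_def\<close>)
        finally show ?case
          using Suc by (simp add: vs_simps(2))
      qed
      then have scalar: "app (rho K False yi) (vs j) = scl (?f ?mu) (vs j)" for j
        by (simp only: rho_yi)
      have "m (Suc i) + h \<le> m i"
        using m i by (simp add: gap_partitions_def)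
      then have k: "?mu i - ?mu (Suc i) = of_nat (m i - m (Suc i))" "h \<le> m i - m (Suc i)"
        by (simp_all add: of_nat_diff)
      show ?thesis
        using hc_poly_reflect[OF yi(1) k scalar] by simp
    qed
    have eq: "?g t = ?f t" for t
      using pfun_dense[OF pfun_diff[OF g f], of h t] gap by simp
    have "(\<lambda>t. ?f (?r t)) \<in> pfun n"
    proof (rule pfun_subst[OF f])
      fix j assume j: "j \<in> {1..n}"
      have "(\<lambda>t. t (Suc i) - 1) \<in> pfun n" "(\<lambda>t. t i + 1) \<in> pfun n" "(\<lambda>t. t j) \<in> pfun n"
        using i j by (auto intro!: pfun.add pfun.coord pfun.const pfun_diff)
      then show "(\<lambda>t. ?r t j) \<in> pfun n"
        by (cases "j = i"; cases "j = Suc i") simp_all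
    qed
    from pfun_dense[OF pfun_diff[OF this f], of h t] show ?thesis
      using gap eq by simp
  qed
  then show ?thesis
    using hc_poly_vars[OF y(1)] by (simp add: shifted_symmetric_def vars_in_def)
qed


subsection \<open>Highest weight modules\<close>

lemma module_smult_zero:
  assumes "left_module R M" "a \<in> carrier R"
  shows "a \<odot>\<^bsub>M\<^esub> \<zero>\<^bsub>M\<^esub> = \<zero>\<^bsub>M\<^esub>"
proof -
  interpret left_module R M by fact
  have z: "\<zero>\<^bsub>M\<^esub> \<in> carrier M" "a \<odot>\<^bsub>M\<^esub> \<zero>\<^bsub>M\<^esub> \<in> carrier M"
    using assms(2) smult_closed by simp_all
  have "a \<odot>\<^bsub>M\<^esub> \<zero>\<^bsub>M\<^esub> \<oplus>\<^bsub>M\<^esub> a \<odot>\<^bsub>M\<^esub> \<zero>\<^bsub>M\<^esub> = a \<odot>\<^bsub>M\<^esub> \<zero>\<^bsub>M\<^esub>"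
    using smult_r_distr[OF assms(2) z(1) z(1)] z(1) by simp
  then show ?thesis
    using z(2) M.add.r_cancel_one by blast
qed

lemma module_cls_mult:
  assumes "left_module (U_gl A) M" "x \<in> words (lists (A \<times> A))" "y \<in> words (lists (A \<times> A))" "v \<in> carrier M"
  shows "cls A (x * y) \<odot>\<^bsub>M\<^esub> v = cls A x \<odot>\<^bsub>M\<^esub> (cls A y \<odot>\<^bsub>M\<^esub> v)"
proof -
  have "cls A x \<in> carrier (U_gl A)" "cls A y \<in> carrier (U_gl A)"
    using assms(2,3) by (simp_all add: U_gl_carrier)
  from left_module.smult_assoc1[OF assms(1) this assms(4)] show ?thesis
    using assms(2,3) by (simp only: cls_mult)
qed

lemma module_cls_add:
  assumes "left_module (U_gl A) M" "x \<in> words (lists (A \<times> A))" "y \<in> words (lists (A \<times> A))" "v \<in> carrier M"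
  shows "cls A (x + y) \<odot>\<^bsub>M\<^esub> v = cls A x \<odot>\<^bsub>M\<^esub> v \<oplus>\<^bsub>M\<^esub> cls A y \<odot>\<^bsub>M\<^esub> v"
proof -
  have "cls A x \<in> carrier (U_gl A)" "cls A y \<in> carrier (U_gl A)"
    using assms(2,3) by (simp_all add: U_gl_carrier)
  from left_module.smult_l_distr[OF assms(1) this assms(4)] show ?thesis
    using assms(2,3) by (simp only: cls_add)
qed

lemma module_cls_zero:
  assumes "left_module (U_gl A) M" "v \<in> carrier M"
  shows "cls A 0 \<odot>\<^bsub>M\<^esub> v = \<zero>\<^bsub>M\<^esub>"
proof -
  interpret left_module "U_gl A" M by fact
  have c: "cls A 0 \<odot>\<^bsub>M\<^esub> v \<in> carrier M"
    using assms(2) smult_closed by (simp add: U_gl_carrier)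
  have "cls A 0 \<odot>\<^bsub>M\<^esub> v \<oplus>\<^bsub>M\<^esub> cls A 0 \<odot>\<^bsub>M\<^esub> v = cls A 0 \<odot>\<^bsub>M\<^esub> v"
    using module_cls_add[OF assms(1) _ _ assms(2), of 0 0] by simp
  then show ?thesis
    using c M.add.r_cancel_one by blast
qed

text \<open>The relation \<open>Q\<close> between an element and its eigenvalue on \<open>v\<close>
  is linear, so it suffices to establish it for sorted words: a bad word ends in a letter that kills
  \<open>v\<close>, and the letters of a good word are diagonal.\<close>

lemma hc_poly_module_vector:
  fixes M :: "(ugl, 'v) module" and n :: nat
  defines "P \<equiv> proper_symbols n"
  assumes y: "y \<in> words (hc_words n 0 h)" and M: "left_module (U_gl P) M" and v: "v \<in> carrier M"
    and upper: "\<And>p q. p \<in> {1..n} \<Longrightarrow> q \<in> {1..n} \<Longrightarrow> p < q \<Longrightarrow> cls P (mon [(Proper p, Proper q)]) \<odot>\<^bsub>M\<^esub> v = \<zero>\<^bsub>M\<^esub>"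
    and weight: "\<And>p. p \<in> {1..n} \<Longrightarrow> cls P (mon [(Proper p, Proper p)]) \<odot>\<^bsub>M\<^esub> v = cls P (con (mu p)) \<odot>\<^bsub>M\<^esub> v"
  shows "cls P y \<odot>\<^bsub>M\<^esub> v = cls P (con (eval_poly (hc_poly 0 y) mu)) \<odot>\<^bsub>M\<^esub> v"
proof -
  define Q where "Q y c \<longleftrightarrow> y \<in> words (lists (P \<times> P)) \<and> cls P y \<odot>\<^bsub>M\<^esub> v = cls P (con c) \<odot>\<^bsub>M\<^esub> v" for y c
  have Q_zero: "Q 0 0"
    by (simp add: Q_def con_hom)
  have Q_add: "Q (a + b) (c + d)" if "Q a c" "Q b d" for a b c d
    using that module_cls_add[OF M _ _ v] by (simp add: Q_def words_add con_hom)
  have Q_con: "Q (con k * a) (k * c)" if "Q a c" for a c k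
    using that module_cls_mult[OF M _ _ v] by (simp add: Q_def carrier_mult con_hom)
  have Q_word: "Q (mon w) (if good 0 w then \<Prod>x\<leftarrow>w. mu (idx (fst x)) else 0)" if w: "w \<in> hc_words n 0 h" for w
  proof (cases "good 0 w")
    case True
    have "Q (mon D) (\<Prod>x\<leftarrow>D. mu (idx (fst x)))" if "\<And>x. x \<in> set D \<Longrightarrow> x \<in> P \<times> P \<and> fst x = snd x" for D
      using that
    proof (induct D)
      case Nil
      then show ?case
        by (simp add: Q_def con_hom)
    next
      case (Cons x D)
      have "x \<in> proper_symbols n \<times> proper_symbols n"
        using Cons.prems[of x] by (simp only: list.set_intros simp_thms P_def)
      then obtain p q where p: "x = (Proper p, Proper q)" "1 \<le> p" "p \<le> n"
        by (rule proper_pair)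
      have pq: "p = q" and xP: "mon [x] \<in> words (lists (P \<times> P))"
        using Cons.prems[of x] p(1) by simp_all
      have D: "Q (mon D) (\<Prod>x\<leftarrow>D. mu (idx (fst x)))" (is "Q _ ?c")
        by (rule Cons.hyps) (rule Cons.prems, simp)
      then have DP: "mon D \<in> words (lists (P \<times> P))"
        by (simp only: Q_def)
      have "cls P (mon (x # D)) \<odot>\<^bsub>M\<^esub> v = cls P (mon [x]) \<odot>\<^bsub>M\<^esub> (cls P (con ?c) \<odot>\<^bsub>M\<^esub> v)"
        using D xP DP module_cls_mult[OF M xP DP v] by (simp only: mon_Cons[of x D] Q_def simp_thms)
      also have "\<dots> = cls P (con ?c) \<odot>\<^bsub>M\<^esub> (cls P (mon [x]) \<odot>\<^bsub>M\<^esub> v)"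
        by (simp only: module_cls_mult[OF M _ _ v, symmetric] xP con_in_words con_commute[of "mon [x]"])
      also have "cls P (mon [x]) \<odot>\<^bsub>M\<^esub> v = cls P (con (mu p)) \<odot>\<^bsub>M\<^esub> v"
        using weight[of p] p pq by simp
      also have "cls P (con ?c) \<odot>\<^bsub>M\<^esub> (cls P (con (mu p)) \<odot>\<^bsub>M\<^esub> v) = cls P (con (?c * mu p)) \<odot>\<^bsub>M\<^esub> v"
        by (simp only: module_cls_mult[OF M _ _ v, symmetric] con_in_words con_hom)
      finally show ?case
        using Cons.prems p(1) xP DP by (simp add: Q_def mult.commute lists_eq_set)
    qed
    then show ?thesis
      using good0_word(3)[OF w True] True by (simp add: P_def)
  next
    case False
    obtain us p q where w': "w = us @ [(Proper p, Proper q)]" "us \<in> lists (P \<times> P)" "1 \<le> p" "p < q" "q \<le> n"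
      unfolding P_def by (rule bad_word_last[OF w False])
    have in_P: "mon us \<in> words (lists (P \<times> P))" "mon [(Proper p, Proper q)] \<in> words (lists (P \<times> P))"
      using w' by (auto simp: P_def proper_symbols_def)
    have "cls P (mon w) \<odot>\<^bsub>M\<^esub> v = cls P (mon us) \<odot>\<^bsub>M\<^esub> \<zero>\<^bsub>M\<^esub>"
      using module_cls_mult[OF M in_P v] upper[of p q] w'(3-5) by (simp add: w'(1) mon_append)
    also have "\<dots> = cls P (con 0) \<odot>\<^bsub>M\<^esub> v"
      using in_P(1) module_cls_zero[OF M v] by (simp add: module_smult_zero[OF M] U_gl_carrier con_hom)
    finally show ?thesis
      using in_P False by (simp add: Q_def w'(1) mon_append carrier_mult del: words_mon)
  qed
  have Q_sum: "Q (\<Sum>w\<in>X. F w) (\<Sum>w\<in>X. c w)" if "finite X" "\<And>w. w \<in> X \<Longrightarrow> Q (F w) (c w)"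
    for X :: "(symb \<times> symb) free_word set" and F c
    using that
  proof (induct X rule: finite_induct)
    case (insert w X)
    then show ?case
      using Q_add[of "F w" "c w" "\<Sum>w\<in>X. F w" "\<Sum>w\<in>X. c w"] by simp
  qed (simp add: Q_zero)
  have "Q (\<Sum>w\<in>Poly_Mapping.keys y. con (Poly_Mapping.lookup y w) * mon (letters w)) (\<Sum>w\<in>Poly_Mapping.keys y.
      Poly_Mapping.lookup y w * (if good 0 (letters w) then \<Prod>x\<leftarrow>letters w. mu (idx (fst x)) else 0))"
  proof (rule Q_sum)
    fix w assume "w \<in> Poly_Mapping.keys y"
    then have "letters w \<in> hc_words n 0 h"
      using y by (simp add: words_def)
    then show "Q (con (Poly_Mapping.lookup y w) * mon (letters w)) (Poly_Mapping.lookup y w *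
        (if good 0 (letters w) then \<Prod>x\<leftarrow>letters w. mu (idx (fst x)) else 0))"
      by (intro Q_con Q_word)
  qed simp
  then show ?thesis
    unfolding eval_hc_poly_0[OF y] expand_words[symmetric] by (simp only: Q_def)
qed

text \<open>The eigenvalue on the generator \<open>v\<close> passes to \<open>w\<close>, a multiple
  of \<open>v\<close> by some \<open>u\<close>, because the classes of \<open>x\<close> and
  \<open>u\<close> commute.\<close>

lemma hw_module_eigenvalue:
  fixes M :: "(ugl, 'v) module"
  assumes M: "highest_weight_module n mu M"
    and x: "x \<in> words (lists (proper_symbols n \<times> proper_symbols n))" and central: "cls (proper_symbols n) x \<in> center_gln n"
    and y: "y \<in> words (hc_words n 0 h)" "x - y \<in> gl_ideal (proper_symbols n)" and w: "w \<in> carrier M"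
  shows "cls (proper_symbols n) x \<odot>\<^bsub>M\<^esub> w = scalar (proper_symbols n) (eval_poly (hc_poly 0 y) mu) \<odot>\<^bsub>M\<^esub> w"
proof -
  let ?P = "proper_symbols n" and ?c = "con (eval_poly (hc_poly 0 y) mu)"
  obtain v where LM: "left_module (U_gl ?P) M" and v: "v \<in> carrier M"
    "\<forall>p\<in>{1..n}. \<forall>q\<in>{1..n}. p < q \<longrightarrow> cls ?P (mon [(Proper p, Proper q)]) \<odot>\<^bsub>M\<^esub> v = \<zero>\<^bsub>M\<^esub>"
    "\<forall>p\<in>{1..n}. cls ?P (mon [(Proper p, Proper p)]) \<odot>\<^bsub>M\<^esub> v = cls ?P (con (mu p)) \<odot>\<^bsub>M\<^esub> v"
    "carrier M = {u \<odot>\<^bsub>M\<^esub> v | u. u \<in> carrier (U_gl ?P)}"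
    using M unfolding highest_weight_module_def Let_def U_gln_def e_gen_def e_product_cls scalar_cls by blast
  have eig: "cls ?P x \<odot>\<^bsub>M\<^esub> v = cls ?P ?c \<odot>\<^bsub>M\<^esub> v"
  proof -
    have "cls ?P x = cls ?P y"
      using y(2) by (simp add: cls_eq_iff)
    moreover have "cls ?P y \<odot>\<^bsub>M\<^esub> v = cls ?P ?c \<odot>\<^bsub>M\<^esub> v"
      by (rule hc_poly_module_vector[OF y(1) LM v(1)]) (use v(2,3) in blast)+
    ultimately show ?thesis
      by simp
  qed
  obtain u where u: "u \<in> words (lists (?P \<times> ?P))" "w = cls ?P u \<odot>\<^bsub>M\<^esub> v"
    using w unfolding v(4) U_gl_carrier by blast
  have "cls ?P x \<otimes>\<^bsub>U_gl ?P\<^esub> cls ?P u = cls ?P u \<otimes>\<^bsub>U_gl ?P\<^esub> cls ?P x"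
    using central u(1) unfolding center_gln_def U_gln_def U_gl_carrier by blast
  then have xu: "cls ?P (x * u) = cls ?P (u * x)"
    using x u(1) by (simp only: cls_mult)
  have "cls ?P x \<odot>\<^bsub>M\<^esub> w = cls ?P (u * x) \<odot>\<^bsub>M\<^esub> v"
    by (simp only: u(2) module_cls_mult[OF LM x u(1) v(1), symmetric] xu)
  also have "\<dots> = cls ?P (u * ?c) \<odot>\<^bsub>M\<^esub> v"
    by (simp only: module_cls_mult[OF LM u(1) x v(1)] eig module_cls_mult[OF LM u(1) con_in_words v(1)])
  also have "\<dots> = cls ?P ?c \<odot>\<^bsub>M\<^esub> w"
    by (simp only: con_commute u(2) module_cls_mult[OF LM con_in_words u(1) v(1)])
  finally show ?thesis
    by (simp only: scalar_cls)
qed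

lemma scalar_inject:
  fixes M :: "(ugl, 'v) module"
  assumes M: "left_module (U_gl A) M" and v: "v \<in> carrier M" "v \<noteq> \<zero>\<^bsub>M\<^esub>"
    and eq: "scalar A a \<odot>\<^bsub>M\<^esub> v = scalar A b \<odot>\<^bsub>M\<^esub> v"
  shows "a = b"
proof (rule ccontr)
  assume "a \<noteq> b"
  interpret left_module "U_gl A" M by fact
  have carr: "cls A (con c) \<odot>\<^bsub>M\<^esub> v \<in> carrier M" for c
    using v(1) by (intro smult_closed) (simp_all add: U_gl_carrier)
  have "cls A (con a) \<odot>\<^bsub>M\<^esub> v = cls A (con (a - b)) \<odot>\<^bsub>M\<^esub> v \<oplus>\<^bsub>M\<^esub> cls A (con b) \<odot>\<^bsub>M\<^esub> v"
    using module_cls_add[OF M con_in_words con_in_words v(1), of "a - b" b] con_hom(3)[of "a - b" b] by simp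
  then have "cls A (con (a - b)) \<odot>\<^bsub>M\<^esub> v \<oplus>\<^bsub>M\<^esub> cls A (con b) \<odot>\<^bsub>M\<^esub> v = cls A (con b) \<odot>\<^bsub>M\<^esub> v"
    using eq by (simp add: scalar_cls)
  then have 0: "cls A (con (a - b)) \<odot>\<^bsub>M\<^esub> v = \<zero>\<^bsub>M\<^esub>"
    using M.add.r_cancel_one[OF carr carr] by (simp only:)
  have one: "(1 :: (symb \<times> symb) free_alg) = con (1 / (a - b)) * con (a - b)"
    using \<open>a \<noteq> b\<close> by (simp add: con_hom(2) con_hom(5)[symmetric])
  have "v = cls A 1 \<odot>\<^bsub>M\<^esub> v"
    using smult_one[OF v(1)] by (simp only: cls_one)
  then have "v = cls A (con (1 / (a - b))) \<odot>\<^bsub>M\<^esub> \<zero>\<^bsub>M\<^esub>"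
    unfolding one module_cls_mult[OF M con_in_words con_in_words v(1)] 0 .
  then show False
    using v(2) module_smult_zero[OF M, of "cls A (con (1 / (a - b)))"] by (simp add: U_gl_carrier)
qed

lemma rho_cls_eq: "cls A x = cls A y \<Longrightarrow> rho K s x = rho K s y"
  using rho_gl_ideal[of "x - y" A K s] by (simp add: cls_eq_iff lin_diff)

text \<open>The elements of the module generated by \<open>v\<close> are encoded by the cosets of the annihilator
  of \<open>v\<close>.\<close>

lemma hw_module_exists:
  assumes "hw_vec K s n mu v"
  obtains M :: "(ugl, ugl set) module" where "highest_weight_module n mu M"
proof -
  define P where "P = proper_symbols n"
  define X where "X = words (lists (P \<times> P))"
  define act where "act x = app (rho K s x)" for x
  define W where "W = (\<lambda>x. act x v) ` X"
  define cl where "cl w = {cls P x | x. x \<in> X \<and> act x v = w}" for w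
  define rep where "rep = inv_into X (cls P)"
  define dec where "dec = inv_into W cl"
  have act_eq: "act x = act y" if "cls P x = cls P y" for x y
    using rho_cls_eq[of P x y K s] that by (simp only: act_def)
  have act_rep: "act (rep (cls P x)) = act x" if "x \<in> X" for x
    unfolding rep_def by (rule act_eq[OF f_inv_into_f[of "cls P x" "cls P" X, OF imageI[OF that]]])
  have act_hom: "act (x + y) w = act x w + act y w" "act (x * y) w = act x (act y w)" "act 1 w = w"
    "act 0 w = 0" "act (- x) w = - act x w" "act x (u + w) = act x u + act x w" for x y u w
    using rho_con[of K s 1]
    by (simp_all add: act_def lin_add rho_mult lin_uminus app_add con_hom cst_hom)
  have inj: "inj_on cl W"
  proof (rule inj_onI)
    fix w w' assume w: "w \<in> W" "w' \<in> W" "cl w = cl w'"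
    obtain x where x: "x \<in> X" "w = act x v"
      using w(1) unfolding W_def by blast
    then have "cls P x \<in> cl w'"
      using w(3) unfolding cl_def by blast
    then obtain x' where "cls P x = cls P x'" "act x' v = w'"
      unfolding cl_def by blast
    then show "w = w'"
      using act_eq x(2) by metis
  qed
  have dec: "dec (cl w) = w" if "w \<in> W" for w
    unfolding dec_def by (rule inv_into_f_f[OF inj that])
  have W_act: "act x w \<in> W" if x: "x \<in> X" and w: "w \<in> W" for x w
  proof -
    obtain y where y: "y \<in> X" "w = act y v"
      using w unfolding W_def by blast
    have "act (x * y) v \<in> W"
      unfolding W_def using carrier_mult x y(1) by (intro imageI) (simp add: X_def)
    then show ?thesis
      by (simp only: act_hom y(2))
  qed
  have v: "v \<in> W"
    unfolding W_def using act_hom(3)[of v] by (intro image_eqI[of _ _ 1]) (simp_all add: X_def)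
  have W_add: "u + w \<in> W" if uw: "u \<in> W" "w \<in> W" for u w
  proof -
    obtain x y where xy: "x \<in> X" "u = act x v" "y \<in> X" "w = act y v"
      using uw unfolding W_def by blast
    have "act (x + y) v \<in> W"
      unfolding W_def using xy by (intro imageI) (simp add: X_def words_add)
    then show ?thesis
      by (simp only: act_hom xy)
  qed
  have W_zero: "0 \<in> W"
    using W_act[OF _ v, of 0] by (simp add: act_hom X_def)
  have W_uminus: "- w \<in> W" if "w \<in> W" for w
    using W_act[OF _ that, of "- 1"] by (simp add: act_hom X_def words_uminus)
  \<comment> \<open>The fields \<open>mult\<close> and \<open>one\<close> are dummies: the record of
    modules extends that of rings, and the module laws refer only to the additive part and the
    scalar action.\<close>
  define M :: "(ugl, ugl set) module" where "M =
    \<lparr>carrier = cl ` W, monoid.mult = (\<lambda>a b. a), one = cl 0, zero = cl 0, add = (\<lambda>a b. cl (dec a + dec b)),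
     Module.module.smult = (\<lambda>u a. cl (act (rep u) (dec a)))\<rparr>"
  have M_simps: "carrier M = cl ` W" "\<zero>\<^bsub>M\<^esub> = cl 0"
    "a \<oplus>\<^bsub>M\<^esub> b = cl (dec a + dec b)" "u \<odot>\<^bsub>M\<^esub> a = cl (act (rep u) (dec a))" for a b u
    by (simp_all add: M_def)
  have M_cl: "cl u \<oplus>\<^bsub>M\<^esub> cl w = cl (u + w)" if "u \<in> W" "w \<in> W" for u w
    using that by (simp add: M_simps dec)
  have M_smult: "cls P x \<odot>\<^bsub>M\<^esub> cl w = cl (act x w)" if "x \<in> X" "w \<in> W" for x w
    using that by (simp add: M_simps dec act_rep)
  have carrier_U: "carrier (U_gl P) = cls P ` X"
    by (simp add: U_gl_carrier X_def)
  have abelian: "abelian_group M"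
  proof (rule abelian_groupI)
    fix a assume "a \<in> carrier M"
    then obtain w where w: "w \<in> W" "a = cl w"
      unfolding M_simps by blast
    show "\<exists>b\<in>carrier M. b \<oplus>\<^bsub>M\<^esub> a = \<zero>\<^bsub>M\<^esub>"
      by (rule bexI[of _ "cl (- w)"]) (simp_all add: w M_cl W_uminus, simp_all add: M_simps W_uminus w)
    show "\<zero>\<^bsub>M\<^esub> \<oplus>\<^bsub>M\<^esub> a = a"
      unfolding M_simps(2) w(2) using M_cl[OF W_zero w(1)] by simp
    fix b assume "b \<in> carrier M"
    then obtain u where u: "u \<in> W" "b = cl u"
      unfolding M_simps by blast
    show "a \<oplus>\<^bsub>M\<^esub> b \<in> carrier M" "a \<oplus>\<^bsub>M\<^esub> b = b \<oplus>\<^bsub>M\<^esub> a"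
      unfolding w(2) u(2) using M_cl[OF w(1) u(1)] M_cl[OF u(1) w(1)] W_add[OF w(1) u(1)]
      by (simp_all add: M_simps(1) add.commute)
    fix c assume "c \<in> carrier M"
    then obtain t where t: "t \<in> W" "c = cl t"
      unfolding M_simps by blast
    show "a \<oplus>\<^bsub>M\<^esub> b \<oplus>\<^bsub>M\<^esub> c = a \<oplus>\<^bsub>M\<^esub> (b \<oplus>\<^bsub>M\<^esub> c)"
      unfolding w(2) u(2) t(2) by (simp add: M_cl w u t W_add add.assoc)
  qed (simp add: M_simps W_zero)
  have left: "left_module (U_gl P) M"
  proof (rule left_module.intro[OF U_gl_ring abelian], rule left_module_axioms.intro)
    fix a x assume "a \<in> carrier (U_gl P)" "x \<in> carrier M"
    then obtain p w where p: "p \<in> X" "a = cls P p" "w \<in> W" "x = cl w"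
      unfolding M_simps carrier_U by blast
    show "a \<odot>\<^bsub>M\<^esub> x \<in> carrier M"
      unfolding p(2,4) M_smult[OF p(1,3)] M_simps(1) using W_act p by (intro imageI)
    fix y assume "y \<in> carrier M"
    then obtain u where u: "u \<in> W" "y = cl u"
      unfolding M_simps by blast
    show "a \<odot>\<^bsub>M\<^esub> (x \<oplus>\<^bsub>M\<^esub> y) = a \<odot>\<^bsub>M\<^esub> x \<oplus>\<^bsub>M\<^esub> a \<odot>\<^bsub>M\<^esub> y"
      unfolding p(2,4) u(2) by (simp add: M_cl M_smult p(1,3) u(1) W_act W_add act_hom)
  next
    fix a b x assume abx: "a \<in> carrier (U_gl P)" "b \<in> carrier (U_gl P)" "x \<in> carrier M"
    obtain p where p: "p \<in> X" "a = cls P p"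
      using abx(1) unfolding carrier_U by (elim imageE)
    obtain q where q: "q \<in> X" "b = cls P q"
      using abx(2) unfolding carrier_U by (elim imageE)
    obtain w where w: "w \<in> W" "x = cl w"
      using abx(3) unfolding M_simps by (elim imageE)
    have pq: "p + q \<in> X" "p * q \<in> X" "cls P p \<oplus>\<^bsub>U_gl P\<^esub> cls P q = cls P (p + q)"
      "cls P p \<otimes>\<^bsub>U_gl P\<^esub> cls P q = cls P (p * q)"
      using p(1) q(1) unfolding X_def by (simp_all only: words_add carrier_mult cls_add cls_mult)
    show "(a \<oplus>\<^bsub>U_gl P\<^esub> b) \<odot>\<^bsub>M\<^esub> x = a \<odot>\<^bsub>M\<^esub> x \<oplus>\<^bsub>M\<^esub> b \<odot>\<^bsub>M\<^esub> x"
      "a \<otimes>\<^bsub>U_gl P\<^esub> b \<odot>\<^bsub>M\<^esub> x = a \<odot>\<^bsub>M\<^esub> (b \<odot>\<^bsub>M\<^esub> x)"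
      unfolding p(2) q(2) w(2) pq(3,4) by (simp_all add: M_cl M_smult p(1) q(1) w(1) pq(1,2) W_act act_hom)
  next
    fix x assume "x \<in> carrier M"
    then obtain w where w: "w \<in> W" "x = cl w"
      unfolding M_simps by blast
    show "\<one>\<^bsub>U_gl P\<^esub> \<odot>\<^bsub>M\<^esub> x = x"
      unfolding w(2) cls_one using M_smult[OF _ w(1), of 1] by (simp add: act_hom X_def)
  qed
  have gen: "mon [(Proper i, Proper j)] \<in> X" if "i \<in> {1..n}" "j \<in> {1..n}" for i j
    using that by (simp add: X_def P_def proper_symbols_def)
  have act_gen: "act (mon [(Proper i, Proper j)]) v = app (pol K s (Proper i) (Proper j)) v" for i j
    by (simp add: act_def)
  have "highest_weight_module n mu M"
    unfolding highest_weight_module_def Let_def U_gln_def P_def[symmetric] e_gen_def e_product_cls scalar_cls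
  proof (rule conjI[OF left], rule bexI[of _ "cl v"], intro conjI ballI impI)
    show "cl v \<noteq> \<zero>\<^bsub>M\<^esub>"
      using inj_onD[OF inj _ v W_zero] assms by (auto simp: M_simps hw_vec_def)
    show "cls P (mon [(Proper i, Proper j)]) \<odot>\<^bsub>M\<^esub> cl v = \<zero>\<^bsub>M\<^esub>" if "i \<in> {1..n}" "j \<in> {1..n}" "i < j" for i j
      unfolding M_smult[OF gen[OF that(1,2)] v] M_simps(2) act_gen using assms that by (simp add: hw_vec_def)
    show "cls P (mon [(Proper i, Proper i)]) \<odot>\<^bsub>M\<^esub> cl v = cls P (con (mu i)) \<odot>\<^bsub>M\<^esub> cl v" if "i \<in> {1..n}" for i
    proof -
      have con: "con (mu i) \<in> X"
        by (simp add: X_def)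
      have "act (con (mu i)) v = scl (mu i) v"
        by (simp add: act_def)
      moreover have "app (pol K s (Proper i) (Proper i)) v = scl (mu i) v"
        using assms that by (simp add: hw_vec_def)
      ultimately show ?thesis
        by (simp only: M_smult[OF gen[OF that that] v] M_smult[OF con v] act_gen)
    qed
    have "cl ` W = (\<lambda>x. cls P x \<odot>\<^bsub>M\<^esub> cl v) ` X"
      unfolding W_def image_image by (rule image_cong) (simp_all add: M_smult v)
    then show "carrier M = {u \<odot>\<^bsub>M\<^esub> cl v | u. u \<in> carrier (U_gl P)}"
      by (simp only: carrier_U M_simps(1) setcompr_eq_image Collect_mem_eq image_image)
    show "cl v \<in> carrier M"
      unfolding M_simps using v by (rule imageI)
  qed
  then show ?thesis
    by (rule that)
qed

text \<open>Uniqueness: a highest weight module exists for every partition, so two candidates have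
  the same value at all partitions, and these are dense.\<close>

lemma harish_chandra_eq:
  assumes z: "z \<in> center_gln n" and n: "1 \<le> n" and f: "f \<in> shifted_symmetric n"
    and eig: "\<And>mu (M :: (ugl, ugl set) module) w. highest_weight_module n mu M \<Longrightarrow> w \<in> carrier M \<Longrightarrow>
      z \<odot>\<^bsub>M\<^esub> w = scalar (proper_symbols n) (eval_poly f mu) \<odot>\<^bsub>M\<^esub> w"
  shows "harish_chandra n z = f"
proof -
  let ?P = "\<lambda>f. f \<in> shifted_symmetric n \<and> (\<forall>mu. \<forall>M :: (ugl, ugl set) module. highest_weight_module n mu M \<longrightarrow>
    (\<forall>w \<in> carrier M. z \<odot>\<^bsub>M\<^esub> w = scalar (proper_symbols n) (eval_poly f mu) \<odot>\<^bsub>M\<^esub> w))"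
  have "(THE f. ?P f) = f"
  proof (rule the_equality)
    show "?P f"
      by (intro conjI allI impI ballI f eig)
    fix g assume g: "?P g"
    have gap: "eval_poly g (\<lambda>i. of_nat (m i)) = eval_poly f (\<lambda>i. of_nat (m i))" if m: "m \<in> gap_partitions n 0" for m
    proof -
      let ?mu = "\<lambda>i. of_nat (m i) :: complex"
      obtain M :: "(ugl, ugl set) module" where M: "highest_weight_module n ?mu M"
        by (rule hw_module_exists[OF hw_vec_hw_config[OF m order_refl]])
      have left: "left_module (U_gl (proper_symbols n)) M"
        using M unfolding highest_weight_module_def Let_def U_gln_def by (rule conjunct1)
      obtain v where v: "v \<in> carrier M" "v \<noteq> \<zero>\<^bsub>M\<^esub>"
        using M unfolding highest_weight_module_def Let_def by (elim conjE bexE) (rule that)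
      have "scalar (proper_symbols n) (eval_poly g ?mu) \<odot>\<^bsub>M\<^esub> v = scalar (proper_symbols n) (eval_poly f ?mu) \<odot>\<^bsub>M\<^esub> v"
        using g M v(1) eig[OF M v(1)] by simp
      then show ?thesis
        by (rule scalar_inject[OF left v])
    qed
    have vars: "f \<in> vars_in n" "g \<in> vars_in n"
      using f g by (simp_all add: shifted_symmetric_def vars_in_def)
    show "g = f"
    proof (rule eval_poly_inject[OF vars(2,1)])
      fix x
      have "eval_poly g x - eval_poly f x = 0"
        by (rule pfun_dense[OF pfun_diff[OF eval_poly_pfun[OF vars(2)] eval_poly_pfun[OF vars(1)]], of 0]) (simp add: gap)
      then show "eval_poly g x = eval_poly f x"
        by simp
    qed
  qed
  then show ?thesis
    unfolding harish_chandra_def using z by simp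
qed

section \<open>The eigenvalue polynomial of the element\<close>

lemma cells_Sigma: "cells l = Sigma {1..length l} (\<lambda>i. {1..part l i})"
  unfolding cells_def by blast

lemma finite_cells: "finite (cells l)"
  unfolding cells_Sigma by (intro finite_SigmaI finite_atLeastAtMost)

lemma hook_product_nonzero: "hook_product l \<noteq> 0"
  unfolding hook_product_def
proof
  assume "(\<Prod>(i, j)\<in>cells l. hook l i j) = 0"
  then obtain c where c: "c \<in> cells l" "(case c of (i, j) \<Rightarrow> hook l i j) = 0"
    unfolding prod_zero_iff[OF finite_cells] by (elim bexE) (rule that)
  obtain i j where ij: "c = (i, j)"
    by (cases c)
  let ?X = "{(i', j') \<in> cells l. (i' = i \<and> j \<le> j') \<or> (j' = j \<and> i \<le> i')}"
  have fin: "finite ?X"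
    by (rule finite_subset[OF _ finite_cells[of l]]) (rule subsetI, simp only: mem_Collect_eq split_beta prod.collapse)
  have mem: "(i, j) \<in> ?X"
    using c(1) unfolding ij by simp
  have nz: "card X \<noteq> 0" if "finite X" "x \<in> X" for X and x :: "nat \<times> nat"
    using that by auto
  have "card ?X = 0"
    using c(2) unfolding ij hook_def split_conv .
  then show False
    using nz[OF fin mem] by (rule notE[rotated])
qed

text \<open>The last clause bounds the degree of \<open>f\<close> by \<open>\<bar>l\<bar>\<close>.\<close>

lemma harish_chandra_S_elem:
  assumes n: "1 \<le> n" and l: "is_partition l" "part l 1 \<le> n" "length l \<le> m0" "part l 1 \<le> m1"
  obtains f where "harish_chandra n (S_elem m0 m1 n l) = f" "f \<in> shifted_symmetric n"
    "\<And>K s mu v. hw_vec K s n mu v \<Longrightarrow> proper_vec v \<Longrightarrow>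
      app (imm_op K s n l) v = scl (of_nat (hook_product l) * eval_poly f mu) v"
    "\<exists>(I :: (symb \<times> symb) free_word set) c ps. finite I \<and>
      (\<forall>w\<in>I. length (ps w) \<le> sum_list l \<and> set (ps w) \<subseteq> {1..n}) \<and>
      (\<forall>x. eval_poly f x = (\<Sum>w\<in>I. c w * (\<Prod>p\<leftarrow>ps w. x p)))"
proof -
  let ?P = "proper_symbols n"
  obtain x where x: "x \<in> words {us \<in> lists (?P \<times> ?P). length us \<le> sum_list l \<and> (\<forall>a. wt us a = 0)}"
    "S_elem m0 m1 n l = cls ?P x"
    "\<And>K s f. proper_vec f \<Longrightarrow> app (rho K s x) f = scl (1 / of_nat (hook_product l)) (app (imm_op K s n l) f)"
    by (rule S_elem_rep[OF l]) (rule that)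
  have xP: "x \<in> words (lists (?P \<times> ?P))"
    by (rule words_mono[OF Collect_restrict x(1)])
  have central: "cls ?P x \<in> center_gln n"
    using S_elem_central[OF l] by (simp only: x(2))
  obtain y where y: "y \<in> words (hc_words n 0 (sum_list l))" "x - y \<in> gl_ideal ?P"
    by (rule reduces_hc_words[OF x(1)])
  let ?f = "hc_poly 0 y"
  show ?thesis
  proof (rule that)
    show sym: "?f \<in> shifted_symmetric n"
      by (rule hc_symmetric[OF x(1) central y])
    show "harish_chandra n (S_elem m0 m1 n l) = ?f"
      unfolding x(2) by (rule harish_chandra_eq[OF central n sym hw_module_eigenvalue[OF _ xP central y]])
    show "app (imm_op K s n l) v = scl (of_nat (hook_product l) * eval_poly ?f mu) v"
      if v: "hw_vec K s n mu v" "proper_vec v" for K s mu v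
    proof -
      have "rho K s x = rho K s y"
        using rho_gl_ideal[OF y(2), of K s] by (simp add: lin_diff)
      then have eq: "scl (1 / of_nat (hook_product l)) (app (imm_op K s n l) v) = scl (eval_poly ?f mu) v"
        using x(3)[OF v(2), of K s] hc_poly_vector[OF y(1) v(1)] by simp
      have "hook_product l \<noteq> 0"
        by (rule hook_product_nonzero)
      then have "app (imm_op K s n l) v = scl (of_nat (hook_product l)) (scl (1 / of_nat (hook_product l)) (app (imm_op K s n l) v))"
        by (simp add: scl_simps)
      then show ?thesis
        by (simp only: eq scl_simps)
    qed
    let ?c = "\<lambda>w. if good 0 (letters w) then Poly_Mapping.lookup y w else 0"
    let ?ps = "\<lambda>w. if good 0 (letters w) then map (\<lambda>x. idx (fst x)) (letters w) else []"
    have 1: "length (?ps w) \<le> sum_list l \<and> set (?ps w) \<subseteq> {1..n}" if "w \<in> Poly_Mapping.keys y" for w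
    proof (cases "good 0 (letters w)")
      case True
      have "letters w \<in> hc_words n 0 (sum_list l)"
        using y(1) that by (simp add: words_def)
      then have w: "letters w \<in> lists (?P \<times> ?P)" "length (letters w) \<le> sum_list l"
        by (simp_all only: hc_words_def mem_Collect_eq)
      have "idx (fst x) \<in> {1..n}" if "x \<in> ?P \<times> ?P" for x
        using that by (rule proper_pair) simp
      then show ?thesis
        using w True by auto
    qed simp
    have 2: "eval_poly ?f x = (\<Sum>w\<in>Poly_Mapping.keys y. ?c w * (\<Prod>p\<leftarrow>?ps w. x p))" for x
      unfolding eval_hc_poly_0[OF y(1)] by (intro sum.cong refl) (simp add: comp_def)
    show "\<exists>(I :: (symb \<times> symb) free_word set) c ps. finite I \<and>
      (\<forall>w\<in>I. length (ps w) \<le> sum_list l \<and> set (ps w) \<subseteq> {1..n}) \<and>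
      (\<forall>x. eval_poly ?f x = (\<Sum>w\<in>I. c w * (\<Prod>p\<leftarrow>ps w. x p)))"
      by (intro exI[of _ "Poly_Mapping.keys y"] exI[of _ ?c] exI[of _ ?ps])
        (rule conjI[OF finite_keys conjI[OF ballI[OF 1] allI[OF 2]]])
  qed
qed

section \<open>Odd reflections\<close>

text \<open>Two families of symbols of opposite parity. It is used with proper and Alpha symbols,
  and again with Alpha and Beta symbols, which accounts for the two factors
  \<open>H(l)\<close>.\<close>

locale odd_pair =
  fixes K :: nat and s :: bool and p q :: "nat \<Rightarrow> symb"
  assumes inj_p: "inj p" and inj_q: "inj q"
    and parity_p: "parity (p i) = parity (p i')" and parity_q: "even (parity (q j)) \<longleftrightarrow> odd (parity (p i))"
begin

lemma eq_simps [simp]: "p i = p k \<longleftrightarrow> i = k" "q t = q j \<longleftrightarrow> t = j" "p i \<noteq> q j" "q j \<noteq> p i"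
  using inj_p inj_q parity_q[of j i] by (auto dest: injD)

abbreviation E :: "symb \<Rightarrow> symb \<Rightarrow> vec \<Rightarrow> vec"
  where "E a b \<equiv> app (pol K s a b)"

definition in_cells :: "(nat \<times> nat) list \<Rightarrow> (symb \<times> symb) list"
  where "in_cells L = map (\<lambda>(i, j). (q j, p i)) L"

definition out_cells :: "(nat \<times> nat) list \<Rightarrow> (symb \<times> symb) list"
  where "out_cells L = map (\<lambda>(i, j). (p i, q j)) L"

definition B :: "(nat \<times> nat) list \<Rightarrow> endo"
  where "B L = pol_word K s (in_cells L)"

definition A :: "(nat \<times> nat) list \<Rightarrow> endo"
  where "A L = pol_word K s (out_cells L)"

lemma AB_simps: "B [] = 1" "B ((i, j) # L) = pol K s (q j) (p i) * B L" "B (L @ M) = B L * B M"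
  "A [] = 1" "A ((i, j) # L) = pol K s (p i) (q j) * A L" "A (L @ M) = A L * A M"
  by (simp_all add: A_def B_def in_cells_def out_cells_def)

lemma in_anticommute: "pol K s (q j) (p i) * pol K s (q t) (p k) = - (pol K s (q t) (p k) * pol K s (q j) (p i))"
  using parity_q[of j i] parity_q[of t k] by (intro pol_anticommute) simp_all

lemma out_anticommute: "pol K s (p i) (q j) * pol K s (p k) (q t) = - (pol K s (p k) (q t) * pol K s (p i) (q j))"
  using parity_q[of j i] parity_q[of t k] by (intro pol_anticommute) simp_all

lemma p_in: "E (p i) (p k) (E (q t) (p m) x) = E (q t) (p m) (E (p i) (p k) x) - (if i = m then E (q t) (p k) x else 0)"
proof -
  have "pol K s (p i) (p k) * pol K s (q t) (p m) = pol K s (q t) (p m) * pol K s (p i) (p k) -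
      (if i = m then pol K s (q t) (p k) else 0)"
    using pol_even[of "p i" "p k" K s "q t" "p m"] parity_p[of i k] by simp
  from arg_cong[OF this, of "\<lambda>T. app T x"] show ?thesis
    by (simp split: if_split)
qed

lemma q_in: "E (q t) (q j) (E (q u) (p m) x) = E (q u) (p m) (E (q t) (q j) x) + (if j = u then E (q t) (p m) x else 0)"
proof -
  have "pol K s (q t) (q j) * pol K s (q u) (p m) = pol K s (q u) (p m) * pol K s (q t) (q j) +
      (if j = u then pol K s (q t) (p m) else 0)"
    using pol_even[of "q t" "q j" K s "q u" "p m"] parity_q[of t m] parity_q[of j m] by simp
  from arg_cong[OF this, of "\<lambda>T. app T x"] show ?thesis
    by (simp split: if_split)
qed

lemma odd_in: "E (p i) (q j) (E (q t) (p k) x) = - E (q t) (p k) (E (p i) (q j) x) +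
    (if j = t then E (p i) (p k) x else 0) + (if i = k then E (q t) (q j) x else 0)"
proof -
  have "odd ((parity (p i) + parity (q j)) * (parity (q t) + parity (p k)))"
    using parity_q[of j i] parity_q[of t k] by simp
  then have "pol K s (p i) (q j) * pol K s (q t) (p k) = - (pol K s (q t) (p k) * pol K s (p i) (q j)) +
      (if j = t then pol K s (p i) (p k) else 0) + (if i = k then pol K s (q t) (q j) else 0)"
    using pol_relation[of K s "p i" "q j" "q t" "p k"] by (simp add: algebra_simps split: if_splits)
  from arg_cong[OF this, of "\<lambda>T. app T x"] show ?thesis
    by (simp split: if_split)
qed

lemma B_prod_list: "B L = prod_list (map (\<lambda>c. pol K s (q (snd c)) (p (fst c))) L)"
  by (simp add: B_def in_cells_def pol_word_prod_list comp_def split_beta)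

lemma A_prod_list: "A L = prod_list (map (\<lambda>c. pol K s (p (fst c)) (q (snd c))) L)"
  by (simp add: A_def out_cells_def pol_word_prod_list comp_def split_beta)

lemma B_move: "B L * pol K s (q j) (p i) = (- 1) ^ length L * (pol K s (q j) (p i) * B L)"
proof -
  let ?ys = "map (\<lambda>c. pol K s (q (snd c)) (p (fst c))) L"
  have "prod_list ?ys * pol K s (q j) (p i) = (- 1) ^ length ?ys * (pol K s (q j) (p i) * prod_list ?ys)"
    by (rule anticommute_prod_list) (simp only: set_map, erule imageE, simp only:, rule in_anticommute)
  then show ?thesis
    by (simp only: B_prod_list length_map)
qed

lemma A_move: "A L * pol K s (p i) (q j) = (- 1) ^ length L * (pol K s (p i) (q j) * A L)"
proof -
  let ?ys = "map (\<lambda>c. pol K s (p (fst c)) (q (snd c))) L"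
  have "prod_list ?ys * pol K s (p i) (q j) = (- 1) ^ length ?ys * (pol K s (p i) (q j) * prod_list ?ys)"
    by (rule anticommute_prod_list) (simp only: set_map, erule imageE, simp only:, rule out_anticommute)
  then show ?thesis
    by (simp only: A_prod_list length_map)
qed

lemma B_dup:
  assumes "\<not> distinct L"
  shows "B L = 0"
proof -
  obtain xs ys zs c where L: "L = xs @ [c] @ ys @ [c] @ zs"
    using not_distinct_decomp[OF assms] by blast
  obtain i j where c: "c = (i, j)"
    by (cases c)
  have "pol K s (q j) (p i) * pol K s (q j) (p i) = 0"
    using parity_q[of j i] by (intro pol_square) simp
  then have "pol K s (q j) (p i) * (B ys * pol K s (q j) (p i)) = 0"
    by (cases "even (length ys)") (simp_all add: B_move mult.assoc[symmetric])
  then have "pol K s (q j) (p i) * (B ys * (pol K s (q j) (p i) * B zs)) = 0"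
    by (simp only: mult.assoc[symmetric] mult_zero_left)
  then show ?thesis
    by (simp add: L c AB_simps)
qed

text \<open>The two operators below replace one factor of \<open>B L\<close> at a time; under the hypothesis on \<open>L\<close>
  the new factor already occurs.\<close>

lemma p_kill:
  assumes "\<And>t. (i, t) \<in> set L \<Longrightarrow> (k, t) \<in> set M \<union> set L" "i \<noteq> k" "E (p i) (p k) v = 0"
  shows "app (B M) (E (p i) (p k) (app (B L) v)) = 0"
  using assms(1)
proof (induct L arbitrary: M)
  case (Cons c L)
  obtain m t where c: "c = (m, t)"
    by (cases c)
  have "app (B (M @ [(m, t)])) (E (p i) (p k) (app (B L) v)) = 0"
    by (rule Cons.hyps) (use Cons.prems in \<open>auto simp: c\<close>)
  moreover have "app (B (M @ (k, t) # L)) v = 0" if "i = m"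
    using Cons.prems[of t] that assms(2) by (subst B_dup) (auto simp: c)
  ultimately show ?case
    by (cases "i = m") (simp_all add: c AB_simps p_in)
qed (simp add: AB_simps assms)

lemma q_kill:
  assumes "\<And>m. (m, j) \<in> set L \<Longrightarrow> (m, t) \<in> set M \<union> set L" "t \<noteq> j" "E (q t) (q j) v = 0"
  shows "app (B M) (E (q t) (q j) (app (B L) v)) = 0"
  using assms(1)
proof (induct L arbitrary: M)
  case (Cons c L)
  obtain m u where c: "c = (m, u)"
    by (cases c)
  have "app (B (M @ [(m, u)])) (E (q t) (q j) (app (B L) v)) = 0"
    by (rule Cons.hyps) (use Cons.prems in \<open>auto simp: c\<close>)
  moreover have "app (B (M @ (m, t) # L)) v = 0" if "j = u"
    using Cons.prems[of m] that assms(2) by (subst B_dup) (auto simp: c)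
  ultimately show ?case
    by (simp add: c AB_simps q_in split: if_splits)
qed (simp add: AB_simps assms)

lemma p_weight:
  assumes "E (p i) (p i) v = scl a v"
  shows "E (p i) (p i) (app (B L) v) = scl (a - of_nat (length (filter (\<lambda>c. fst c = i) L))) (app (B L) v)"
proof (induct L)
  case (Cons c L)
  then show ?case
    by (cases c) (auto simp: AB_simps p_in scl_add)
qed (simp add: AB_simps assms)

lemma q_weight:
  assumes "E (q j) (q j) v = 0"
  shows "E (q j) (q j) (app (B L) v) = scl (of_nat (length (filter (\<lambda>c. snd c = j) L))) (app (B L) v)"
proof (induct L)
  case (Cons c L)
  then show ?case
    by (cases c) (auto simp: AB_simps q_in scl_add)
qed (simp add: AB_simps assms scl_simps)

text \<open>Both kinds of factors anticommute among themselves, so a reordering costs the same sign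
  in each, and the product \<open>A L * B L\<close> does not notice it.\<close>

lemma AB_mset:
  assumes "mset L = mset M"
  shows "\<exists>e\<in>{1, - 1}. B L = e * B M \<and> A L = e * A M"
  using assms
proof (induct L arbitrary: M)
  case (Cons c L)
  obtain i j where c: "c = (i, j)"
    by (cases c)
  have "c \<in> set M"
    using Cons.prems by (metis list.set_intros(1) set_mset_mset)
  then obtain U V where M: "M = U @ c # V"
    by (meson split_list)
  have "mset L = mset (U @ V)"
    using Cons.prems by (simp add: M)
  then obtain e where e: "e \<in> {1, - 1}" "B L = e * B (U @ V)" "A L = e * A (U @ V)"
    using Cons.hyps by blast
  have "B M = (- 1) ^ length U * (pol K s (q j) (p i) * B (U @ V))" "A M = (- 1) ^ length U * (pol K s (p i) (q j) * A (U @ V))"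
    using B_move[of U j i] A_move[of U i j] by (simp_all add: M c AB_simps mult.assoc[symmetric])
  moreover have "B (c # L) = e * (pol K s (q j) (p i) * B (U @ V))" "A (c # L) = e * (pol K s (p i) (q j) * A (U @ V))"
    using e by (auto simp: c AB_simps)
  ultimately show ?case
    using e(1) by (intro bexI[of _ "e * (- 1) ^ length U"]) (auto simp: minus_one_power_iff)
qed auto

lemma AB_reorder: "mset L = mset M \<Longrightarrow> A L * B L = A M * B M"
  using AB_mset[of L M] by auto

lemma A_rev: "A L = rev_sign (length L) * A (rev L)"
proof -
  let ?xs = "map (\<lambda>c. pol K s (p (fst c)) (q (snd c))) (rev L)"
  have "prod_list (rev ?xs) = rev_sign (length ?xs) * prod_list ?xs"
    by (rule prod_list_rev) (simp only: set_map, elim imageE, simp only:, rule out_anticommute)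
  then show ?thesis
    by (simp add: A_prod_list rev_map)
qed

end

text \<open>The cells \<open>(i, j)\<close> are reflected in turn, column by column and each column from the bottom.
  Then \<open>E (p i) (q j)\<close> kills the vector reached so far, and the anticommutator of \<open>E (p i) (q j)\<close>
  and \<open>E (q j) (p i)\<close> acts on it by the hook length of \<open>(i, j)\<close>.\<close>

locale odd_reflection = odd_pair +
  fixes a b :: "nat \<Rightarrow> nat" and r :: nat and v :: vec
  assumes shape: "1 \<le> i \<Longrightarrow> 1 \<le> j \<Longrightarrow> j \<le> a i \<longleftrightarrow> i \<le> b j" and b_le: "1 \<le> j \<Longrightarrow> b j \<le> r"
    and weight: "1 \<le> i \<Longrightarrow> i \<le> r \<Longrightarrow> E (p i) (p i) v = scl (of_nat (a i)) v"
    and raise: "1 \<le> i \<Longrightarrow> i < k \<Longrightarrow> k \<le> r \<Longrightarrow> E (p i) (p k) v = 0"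
    and no_q: "1 \<le> j \<Longrightarrow> E (p i) (q j) v = 0" "1 \<le> j \<Longrightarrow> E (q t) (q j) v = 0"
begin

definition col :: "nat \<Rightarrow> nat \<Rightarrow> (nat \<times> nat) list"
  where "col j i = map (\<lambda>m. (m, j)) [Suc i..<Suc (b j)]"

primrec full :: "nat \<Rightarrow> (nat \<times> nat) list" where
  "full 0 = []"
| "full (Suc j) = col (Suc j) 0 @ full j"

lemma set_col: "(m, t) \<in> set (col j i) \<longleftrightarrow> t = j \<and> i < m \<and> m \<le> b j"
  by (auto simp: col_def)

lemma set_full: "(m, t) \<in> set (full J) \<longleftrightarrow> 1 \<le> t \<and> t \<le> J \<and> 1 \<le> m \<and> m \<le> b t"
  by (induct J) (auto simp: set_col le_Suc_eq)

lemma distinct_full: "distinct (full J)"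
proof (induct J)
  case (Suc J)
  have "distinct (col (Suc J) 0)"
    by (simp add: col_def distinct_map inj_on_def)
  then show ?case
    using Suc by (auto simp: set_col set_full)
qed simp

lemma col_Cons: "i < b j \<Longrightarrow> col j i = (Suc i, j) # col j (Suc i)"
  by (simp add: col_def upt_conv_Cons del: upt_Suc)

lemma col_empty: "b j \<le> i \<Longrightarrow> col j i = []"
  by (simp add: col_def)

lemma b_antitone: "1 \<le> i \<Longrightarrow> 1 \<le> t \<Longrightarrow> t \<le> j \<Longrightarrow> i \<le> b j \<Longrightarrow> i \<le> b t"
  using shape[of i j] shape[of i t] by simp

text \<open>No cell in column \<open>j\<close> has been used, so passing a factor of
  \<open>B\<close> can only leave an operator from \<open>q j\<close> to another \<open>q t\<close>,
  and this kills the vector by \<open>q_kill\<close>.\<close>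

lemma odd_kill_full:
  assumes "J < j"
  shows "E (p i) (q j) (app (B (full J)) v) = 0"
proof -
  have kill: "E (p i) (q j) (app (B L) v) = 0" if "\<And>m t. (m, t) \<in> set L \<Longrightarrow> t \<noteq> j" for L
    using that
  proof (induct L)
    case Nil
    show ?case
      using no_q(1)[of j i] assms by (simp add: AB_simps)
  next
    case (Cons c L)
    obtain k t where c: "c = (k, t)"
      by (cases c)
    have t: "t \<noteq> j" and L: "\<And>m t. (m, t) \<in> set L \<Longrightarrow> t \<noteq> j"
      using Cons.prems by (auto simp: c)
    have "app (B []) (E (q t) (q j) (app (B L) v)) = 0"
      using t L no_q(2)[of j t] assms by (intro q_kill) auto
    then show ?case
      using Cons.hyps[OF L] t by (simp add: c AB_simps odd_in)
  qed
  show ?thesis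
    by (rule kill) (use assms in \<open>simp add: set_full\<close>)
qed

text \<open>Passing the topmost used cell of the current column leaves an operator from
  \<open>p (Suc i')\<close> to \<open>p i\<close>. All earlier columns are complete and at least as
  long as this one, so they contain row \<open>Suc i'\<close>, as \<open>p_kill\<close>
  requires.\<close>

lemma odd_kill:
  assumes "1 \<le> i" "i \<le> i'"
  shows "E (p i) (q (Suc J)) (app (B (col (Suc J) i' @ full J)) v) = 0"
  using assms(2)
proof (induct "b (Suc J) - i'" arbitrary: i')
  case 0
  then show ?case
    by (simp add: col_empty odd_kill_full)
next
  case (Suc d)
  let ?L = "col (Suc J) (Suc i') @ full J"
  have k: "i < Suc i'" "Suc i' \<le> b (Suc J)"
    using Suc by simp_all
  have "app (B []) (E (p i) (p (Suc i')) (app (B ?L) v)) = 0"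
  proof (rule p_kill)
    fix t assume "(i, t) \<in> set ?L"
    then have t: "1 \<le> t" "t \<le> J"
      using k by (auto simp: set_col set_full)
    then show "(Suc i', t) \<in> set [] \<union> set ?L"
      using b_antitone[of "Suc i'" t "Suc J"] k(2) by (simp add: set_full)
  next
    show "E (p i) (p (Suc i')) v = 0"
      using k assms(1) b_le[of "Suc J"] by (intro raise) auto
  qed (use k in simp)
  moreover have "E (p i) (q (Suc J)) (app (B ?L) v) = 0"
    using Suc.hyps(2) k by (intro Suc.hyps(1)) auto
  ultimately show ?case
    using k by (simp add: col_Cons AB_simps odd_in)
qed

definition cell_hook :: "nat \<times> nat \<Rightarrow> nat"
  where "cell_hook c = (case c of (i, j) \<Rightarrow> a i - j + (b j - i) + 1)"

lemma count_row:
  assumes "1 \<le> i" "\<And>t. 1 \<le> t \<Longrightarrow> t \<le> J \<Longrightarrow> i \<le> b t"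
  shows "length (filter (\<lambda>c. fst c = i) (full J)) = J"
  using assms(2)
proof (induct J)
  case (Suc J)
  have "filter (\<lambda>c. fst c = i) (map (\<lambda>m. (m, j)) xs) = map (\<lambda>m. (m, j)) (filter (\<lambda>m. m = i) xs)" for j :: nat and xs
    by (simp add: filter_map comp_def)
  moreover have "length (filter (\<lambda>m. m = i) [Suc 0..<Suc (b (Suc J))]) = 1"
    using assms(1) Suc.prems[of "Suc J"] by (subst distinct_length_filter) (auto simp del: upt_Suc)
  ultimately show ?case
    using Suc by (simp add: col_def del: upt_Suc)
qed simp

text \<open>Only the anticommutator survives, and it is the sum of two weights: the
  \<open>a i - J\<close> cells of row \<open>i\<close> not yet used and the
  \<open>b (Suc J) - i\<close> cells already used below. Counting the cell itself in the row gives
  the 1 in the hook length.\<close>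

lemma hook_step:
  assumes "1 \<le> i" "i \<le> b (Suc J)"
  shows "E (p i) (q (Suc J)) (app (B ((i, Suc J) # col (Suc J) i @ full J)) v) =
    scl (of_nat (cell_hook (i, Suc J))) (app (B (col (Suc J) i @ full J)) v)"
proof -
  let ?L = "col (Suc J) i @ full J"
  have r: "i \<le> r"
    using assms b_le[of "Suc J"] by simp
  have "Suc J \<le> a i"
    using assms shape[of i "Suc J"] by simp
  have "length (filter (\<lambda>c. fst c = i) (full J)) = J"
    using assms b_antitone[of i _ "Suc J"] by (intro count_row) auto
  moreover have "filter (\<lambda>c. fst c = i) (col (Suc J) i) = []"
    by (auto simp: col_def filter_empty_conv)
  ultimately have row: "E (p i) (p i) (app (B ?L) v) = scl (of_nat (a i) - of_nat J) (app (B ?L) v)"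
    using p_weight[OF weight[OF assms(1) r], of ?L] by simp
  have "filter (\<lambda>c. snd c = Suc J) (full J) = []"
    by (auto simp: filter_empty_conv set_full)
  moreover have "filter (\<lambda>c. snd c = Suc J) (col (Suc J) i) = col (Suc J) i"
    by (auto simp: col_def filter_id_conv)
  moreover have "length (col (Suc J) i) = b (Suc J) - i"
    by (simp add: col_def del: upt_Suc)
  ultimately have "E (q (Suc J)) (q (Suc J)) (app (B ?L) v) = scl (of_nat (b (Suc J) - i)) (app (B ?L) v)"
    using q_weight[OF no_q(2)[of "Suc J" "Suc J"], of ?L] by simp
  moreover have "E (p i) (q (Suc J)) (app (B ?L) v) = 0"
    using assms by (intro odd_kill) simp_all
  ultimately have "E (p i) (q (Suc J)) (app (B ((i, Suc J) # ?L)) v) =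
      scl (of_nat (a i) - of_nat J + of_nat (b (Suc J) - i)) (app (B ?L) v)"
    using row by (simp add: AB_simps odd_in scl_add)
  also have "of_nat (a i) - of_nat J + of_nat (b (Suc J) - i) = (of_nat (cell_hook (i, Suc J)) :: complex)"
    using \<open>Suc J \<le> a i\<close> by (simp add: cell_hook_def of_nat_diff)
  finally show ?thesis .
qed

lemma reflect_full: "app (A (rev (full J))) (app (B (full J)) v) = scl (of_nat (\<Prod>c\<leftarrow>full J. cell_hook c)) v"
proof (induct J)
  case (Suc J)
  have "app (A (rev (col (Suc J) i @ full J))) (app (B (col (Suc J) i @ full J)) v) =
    scl (of_nat (\<Prod>c\<leftarrow>col (Suc J) i @ full J. cell_hook c)) v" for i
  proof (induct "b (Suc J) - i" arbitrary: i)
    case 0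
    then show ?case
      using Suc by (simp add: col_empty)
  next
    case (Suc d)
    let ?L = "col (Suc J) (Suc i) @ full J"
    have L: "col (Suc J) i @ full J = (Suc i, Suc J) # ?L"
      using Suc by (simp add: col_Cons)
    have "app (A (rev ((Suc i, Suc J) # ?L))) (app (B ((Suc i, Suc J) # ?L)) v) =
        app (A (rev ?L)) (E (p (Suc i)) (q (Suc J)) (app (B ((Suc i, Suc J) # ?L)) v))"
      by (simp add: AB_simps)
    also have "\<dots> = app (A (rev ?L)) (scl (of_nat (cell_hook (Suc i, Suc J))) (app (B ?L) v))"
      using Suc.hyps(2) by (subst hook_step) simp_all
    also have "\<dots> = scl (of_nat (\<Prod>c\<leftarrow>(Suc i, Suc J) # ?L. cell_hook c)) v"
      using Suc.hyps(2) by (simp add: Suc.hyps(1) del: rev_append map_append prod_list.append)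
    finally show ?case
      by (simp only: L)
  qed
  from this[of 0] show ?case
    by (simp only: full.simps)
qed (simp add: AB_simps)

text \<open>Reflections are undone in the opposite order, whereas the monomials list the cells in
  the same order on both sides; hence \<open>rev_sign\<close>. The order itself is free, by
  \<open>AB_reorder\<close>.\<close>

lemma reflect:
  assumes "distinct M" "set M = {(i, j). 1 \<le> j \<and> j \<le> J \<and> 1 \<le> i \<and> i \<le> b j}"
  shows "app (A M) (app (B M) v) = scl (rev_sign (length M) * of_nat (\<Prod>c\<in>set M. cell_hook c)) v"
proof -
  have set: "set M = set (full J)"
    unfolding assms(2) using set_full by auto
  then have mset: "mset M = mset (full J)"
    using set_eq_iff_mset_eq_distinct[OF assms(1) distinct_full] by simp
  have len: "length (full J) = length M"
    using mset by (metis size_mset)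
  have prod: "(\<Prod>c\<leftarrow>full J. cell_hook c) = (\<Prod>c\<in>set M. cell_hook c)"
    unfolding set by (rule prod.distinct_set_conv_list[OF distinct_full, symmetric])
  have sign: "app (rev_sign k) x = scl (rev_sign k) x" for k x
    by (simp add: rev_sign_def minus_one_power_iff scl_add)
  have "app (A M) (app (B M) v) = app (A (full J) * B (full J)) v"
    using arg_cong[OF AB_reorder[OF mset], of "\<lambda>T. app T v"] by simp
  also have "\<dots> = scl (rev_sign (length M)) (app (A (rev (full J))) (app (B (full J)) v))"
    by (simp add: A_rev[of "full J"] len mult.assoc sign)
  finally show ?thesis
    by (simp only: reflect_full scl_simps prod)
qed

end

subsection \<open>Cells and hooks\<close>

lemma part_antitone:
  assumes "is_partition l" "1 \<le> i" "i \<le> k"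
  shows "part l k \<le> part l i"
proof (cases "k \<le> length l \<and> i < k")
  case True
  then have "l ! (i - 1) \<ge> l ! (k - 1)"
    using assms by (intro sorted_wrt_nth_less[of "(\<ge>)" l]) (auto simp: is_partition_def)
  then show ?thesis
    using assms True by (simp add: part_def)
qed (use assms in \<open>auto simp: part_def\<close>)

lemma conj_part_iff:
  assumes l: "is_partition l" and "1 \<le> i" "1 \<le> j"
  shows "j \<le> part l i \<longleftrightarrow> i \<le> conj_part l j"
proof
  assume *: "j \<le> part l i"
  then have "i \<le> length l"
    using assms(3) by (simp add: part_def split: if_splits)
  then have "{1..i} \<subseteq> {k \<in> {1..length l}. j \<le> part l k}"
    using * part_antitone[OF l, of _ i] by (auto intro: order_trans)
  then have "card {1..i} \<le> conj_part l j"
    unfolding conj_part_def by (intro card_mono) auto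
  then show "i \<le> conj_part l j"
    by simp
next
  assume *: "i \<le> conj_part l j"
  show "j \<le> part l i"
  proof (rule ccontr)
    assume "\<not> j \<le> part l i"
    then have "{k \<in> {1..length l}. j \<le> part l k} \<subseteq> {1..<i}"
      using part_antitone[OF l assms(2)] by (auto simp: not_le) (meson le_trans linorder_not_less)
    then have "conj_part l j \<le> card {1..<i}"
      unfolding conj_part_def by (intro card_mono) auto
    then show False
      using * assms(2) by simp
  qed
qed

lemma conj_part_le: "conj_part l j \<le> length l"
proof -
  have "conj_part l j \<le> card {1..length l}"
    unfolding conj_part_def by (intro card_mono) auto
  then show ?thesis
    by simp
qed

lemma conj_part_antitone: "i \<le> j \<Longrightarrow> conj_part l j \<le> conj_part l i"
  unfolding conj_part_def by (intro card_mono) auto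

lemma hook_eq:
  assumes l: "is_partition l" and c: "(i, j) \<in> cells l"
  shows "hook l i j = part l i - j + (conj_part l j - i) + 1"
proof -
  have ij: "1 \<le> i" "i \<le> length l" "1 \<le> j" "j \<le> part l i"
    using c by (auto simp: cells_def)
  have "i' \<le> length l" if "1 \<le> i'" "i' \<le> conj_part l j" for i'
    using that conj_part_le[of l j] by simp
  then have "{(i', j') \<in> cells l. (i' = i \<and> j \<le> j') \<or> (j' = j \<and> i \<le> i')} =
      Pair i ` {j..part l i} \<union> (\<lambda>k. (k, j)) ` {i<..conj_part l j}"
    using ij conj_part_iff[OF l _ ij(3)] by (auto simp: cells_def image_iff)
  moreover have "card (Pair i ` {j..part l i} \<union> (\<lambda>k. (k, j)) ` {i<..conj_part l j}) =
      card (Pair i ` {j..part l i}) + card ((\<lambda>k. (k, j)) ` {i<..conj_part l j})"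
    by (intro card_Un_disjoint) auto
  ultimately show ?thesis
    using ij by (simp add: hook_def card_image inj_on_def)
qed

definition row_cells :: "nat list \<Rightarrow> (nat \<times> nat) list"
  where "row_cells l = concat (map (\<lambda>i. map (Pair i) [1..<Suc (part l i)]) [1..<Suc (length l)])"

lemma set_row_cells: "set (row_cells l) = cells l"
  by (force simp: row_cells_def cells_def)

lemma distinct_row_cells: "distinct (row_cells l)"
proof -
  have "distinct (concat (map (\<lambda>i. map (Pair i) [1..<Suc (part l i)]) xs))" if "distinct xs" for xs
    using that by (induct xs) (auto simp: distinct_map inj_on_def)
  then show ?thesis
    by (simp add: row_cells_def)
qed

lemma concat_C_star_cells: "concat (C_star l) = map (\<lambda>(i, j). Alpha i) (row_cells l)"
proof -
  have "replicate r (Alpha i) = map (\<lambda>(i, j). Alpha i) (map (Pair i) [1..<Suc r])" for r i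
    by (simp add: map_replicate_const comp_def)
  then show ?thesis
    by (simp add: C_star_def row_cells_def map_concat comp_def)
qed

lemma map_part: "map (part l) [1..<Suc (length l)] = l"
proof -
  have "map (part l) [1..<Suc (length l)] = map (\<lambda>i. l ! i) [0..<length l]"
    by (rule nth_equalityI) (auto simp: part_def nth_upt simp del: upt_Suc)
  then show ?thesis
    by (simp add: map_nth)
qed

lemma concat_rows: "concat (map (\<lambda>r. map F [1..<Suc r]) l) = map (\<lambda>(i, j). F j) (row_cells l)"
proof -
  have "map (\<lambda>r. map F [1..<Suc r]) l = map (\<lambda>i. map F [1..<Suc (part l i)]) [1..<Suc (length l)]"
    by (subst map_part[of l, symmetric]) (simp add: comp_def del: upt_Suc)
  then show ?thesis
    by (simp add: row_cells_def map_concat comp_def del: upt_Suc)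
qed

subsection \<open>The eigenvalue at the weight of the conjugate partition\<close>

lemma proper_vec_kill:
  assumes "proper_vec v" "is_virtual b"
  shows "app (pol K s a b) v = 0"
proof (rule ccontr)
  assume "app (pol K s a b) v \<noteq> 0"
  then obtain m where "app (pol K s a b) v m \<noteq> 0"
    by (auto simp: fun_eq_iff vec_apply)
  then obtain p m0 where "v (m0((b, p) := Suc (m0 (b, p)))) \<noteq> 0"
    by (rule pol_support)
  then have "(m0((b, p) := Suc (m0 (b, p)))) (b, p) = 0"
    using assms unfolding proper_vec_def by blast
  then show False
    by simp
qed

lemma pol_word_kill:
  assumes "app (pol K s x y) v = 0" "\<And>c. c \<in> set ps \<Longrightarrow> fst c \<noteq> y \<and> snd c \<noteq> x"
  shows "app (pol K s x y) (app (pol_word K s ps) v) = 0"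
  using assms(2)
proof (induct ps)
  case (Cons c ps)
  let ?g = "(- 1) ^ ((parity x + parity y) * (parity (fst c) + parity (snd c))) :: endo"
  have "pol K s x y * pol K s (fst c) (snd c) = ?g * (pol K s (fst c) (snd c) * pol K s x y)"
    using pol_relation[of K s x y "fst c" "snd c"] Cons.prems[of c] by (auto simp: eq_diff_eq)
  from arg_cong[OF this, of "\<lambda>T. app T (app (pol_word K s ps) v)"] show ?case
    using Cons by (simp add: minus_one_power_iff)
qed (simp add: assms)

text \<open>The four factors of the monomial are two nested reflections, the inner one carried out
  on the result of the first half of the outer one. Both have the same number of cells, so their
  signs cancel.\<close>

lemma imm_word_top:
  assumes l: "is_partition l" "part l 1 \<le> n"
    and v: "hw_vec K s n (\<lambda>i. of_nat (conj_part l i)) v" "proper_vec v"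
  shows "app (pol_word K s (imm_word l (concat (map (\<lambda>r. [1..<Suc r]) l)))) v =
    scl (of_nat (hook_product l * hook_product l)) v"
proof -
  let ?L = "row_cells l" and ?M = "map prod.swap (row_cells l)" and ?E = "\<lambda>x y. app (pol K s x y)"
  have in_M: "(j, i) \<in> set ?M \<longleftrightarrow> (i, j) \<in> cells l" for i j
    unfolding set_map set_row_cells by force
  have kill: "?E x (Alpha j) v = 0" "?E x (Beta j) v = 0" for x j
    by (auto intro!: proper_vec_kill[OF v(2)] simp: is_virtual_def)
  have conj: "1 \<le> conj_part l j \<Longrightarrow> j \<le> n" if "1 \<le> j" for j
    using conj_part_iff[OF l(1) order_refl that] l(2) by simp
  \<comment> \<open>The shape is transposed: its rows belong to the letters \<open>i\<close>, of
    weight \<open>conj_part l i\<close>, and its columns to the symbols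
    \<open>Alpha j\<close>.\<close>
  interpret P1: odd_reflection K s Proper Alpha "conj_part l" "part l" n v
  proof unfold_locales
    fix i :: nat assume "1 \<le> i"
    then show "part l i \<le> n"
      using part_antitone[OF l(1) order_refl, of i] l(2) by simp
  next
    fix i j :: nat assume "1 \<le> i" "1 \<le> j"
    then show "j \<le> conj_part l i \<longleftrightarrow> i \<le> part l j"
      using conj_part_iff[OF l(1), of j i] by simp
  qed (use v(1) kill in \<open>auto simp: hw_vec_def inj_def\<close>)
  define u where "u = app (P1.B ?M) v"
  have "filter (\<lambda>c. snd c = i) ?M = map (\<lambda>j. (j, i)) [1..<Suc (part l i)]" if i: "i \<in> {1..length l}" for i
  proof -
    have "filter (\<lambda>c. snd c = i) (map prod.swap (concat (map (\<lambda>k. map (Pair k) [1..<Suc (part l k)]) xs))) =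
        (if i \<in> set xs then map (\<lambda>j. (j, i)) [1..<Suc (part l i)] else [])" if "distinct xs" for xs
      using that by (induct xs) (auto simp: filter_map comp_def filter_empty_conv filter_id_conv simp del: upt_Suc)
    from this[of "[1..<Suc (length l)]"] show ?thesis
      using i by (simp add: row_cells_def del: upt_Suc)
  qed
  then have count: "length (filter (\<lambda>c. snd c = i) ?M) = part l i" if "i \<in> {1..length l}" for i
    using that by (simp del: upt_Suc)
  \<comment> \<open>After the first half of the outer reflection the vector \<open>u\<close> is a
    highest weight vector of weight \<open>l\<close> for the symbols Alpha.\<close>
  interpret P2: odd_reflection K s Alpha Beta "part l" "conj_part l" "length l" u
  proof unfold_locales
    fix i :: nat assume "1 \<le> i" "i \<le> length l"
    then show "?E (Alpha i) (Alpha i) u = scl (of_nat (part l i)) u"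
      unfolding u_def using count[of i] by (subst P1.q_weight) (simp_all add: kill)
  next
    fix i k :: nat assume ik: "1 \<le> i" "i < k" "k \<le> length l"
    have "app (P1.B []) (?E (Alpha i) (Alpha k) (app (P1.B ?M) v)) = 0"
    proof (rule P1.q_kill)
      fix m assume "(m, k) \<in> set ?M"
      then have "(i, m) \<in> cells l"
        using ik part_antitone[OF l(1) ik(1), of k] unfolding in_M by (simp add: cells_def)
      then have "(m, i) \<in> set ?M"
        by (simp only: in_M)
      then show "(m, i) \<in> set [] \<union> set ?M"
        by (rule UnI2)
    qed (use ik kill in simp_all)
    then show "?E (Alpha i) (Alpha k) u = 0"
      by (simp add: u_def P1.AB_simps)
  next
    fix i j :: nat assume "1 \<le> i" "1 \<le> j"
    then show "j \<le> part l i \<longleftrightarrow> i \<le> conj_part l j"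
      by (rule conj_part_iff[OF l(1)])
  next
    have "?E x (Beta j) u = 0" if "x \<in> range Alpha \<union> range Beta" for x j
      unfolding u_def P1.B_def P1.in_cells_def using that by (intro pol_word_kill kill) auto
    then show "?E (Alpha i) (Beta j) u = 0" "?E (Beta i) (Beta j) u = 0" for i j
      by simp_all
  qed (auto simp: conj_part_le inj_def)
  have set_L: "set ?L = {(i, j). 1 \<le> j \<and> j \<le> n \<and> 1 \<le> i \<and> i \<le> conj_part l j}"
    unfolding set_row_cells using conj_part_iff[OF l(1)] conj conj_part_le[of l] by (auto simp: cells_def intro: order_trans)
  have set_M: "set ?M = {(j, i). 1 \<le> i \<and> i \<le> length l \<and> 1 \<le> j \<and> j \<le> part l i}"
    using in_M by (auto simp: cells_def)
  have dist: "distinct ?M"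
    using distinct_row_cells by (simp add: distinct_map)
  have hook: "P2.cell_hook c = P1.cell_hook (prod.swap c)" "P2.cell_hook c = hook l (fst c) (snd c)" if "c \<in> cells l" for c
    using hook_eq[OF l(1), of "fst c" "snd c"] that by (auto simp: P1.cell_hook_def P2.cell_hook_def split: prod.splits)
  have prod2: "(\<Prod>c\<in>set ?L. P2.cell_hook c) = hook_product l"
    unfolding hook_product_def set_row_cells by (intro prod.cong refl) (simp add: hook(2) split_beta)
  have "(\<Prod>c\<in>set ?M. P1.cell_hook c) = (\<Prod>c\<in>set ?L. P1.cell_hook (prod.swap c))"
    unfolding set_map by (rule prod.reindex_cong[of prod.swap]) (auto simp: inj_on_def)
  also have "\<dots> = (\<Prod>c\<in>set ?L. P2.cell_hook c)"
    unfolding set_row_cells by (intro prod.cong refl hook(1)[symmetric])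
  finally have prod1: "(\<Prod>c\<in>set ?M. P1.cell_hook c) = hook_product l"
    by (simp only: prod2)
  have w: "concat (map (\<lambda>r. [1..<Suc r]) l) = map snd ?L"
    using concat_rows[of "\<lambda>j. j" l] by (simp add: split_beta')
  have C: "concat (C_star l) = map (\<lambda>c. Alpha (fst c)) ?L"
    by (simp add: concat_C_star_cells split_beta')
  have D: "concat (D_star l) = map (\<lambda>c. Beta (snd c)) ?L"
    using concat_rows[of Beta l] by (simp add: D_star_def split_beta')
  have "pol_word K s (imm_word l (map snd ?L)) = P1.A ?M * (P2.A ?L * P2.B ?L) * P1.B ?M"
    by (simp add: imm_word_def out_word_def in_word_def mid_word_def C D zip_map1 zip_map2 zip_same_conv_map comp_def
        P1.A_def P1.B_def P2.A_def P2.B_def P1.in_cells_def P1.out_cells_def P2.in_cells_def P2.out_cells_def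
        split_beta' mult.assoc)
  then have "app (pol_word K s (imm_word l (map snd ?L))) v = app (P1.A ?M) (app (P2.A ?L) (app (P2.B ?L) u))"
    by (simp add: u_def)
  also have "\<dots> = scl (rev_sign (length ?L) * of_nat (hook_product l)) (app (P1.A ?M) (app (P1.B ?M) v))"
    by (subst P2.reflect[OF distinct_row_cells set_L]) (simp add: prod2 u_def)
  also have "\<dots> = scl (rev_sign (length ?L) * of_nat (hook_product l) * (rev_sign (length ?L) * of_nat (hook_product l))) v"
    by (simp only: P1.reflect[OF dist set_M] prod1 scl_simps length_map)
  also have "rev_sign (length ?L) * of_nat (hook_product l) * (rev_sign (length ?L) * of_nat (hook_product l)) =
      (of_nat (hook_product l * hook_product l) :: complex)"
    using rev_sign_square[of "length ?L", where 'a = complex] by (simp add: mult.assoc mult.left_commute)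
  finally show ?thesis
    by (simp only: w)
qed

subsection \<open>Vanishing at small weights\<close>

text \<open>In a strictly increasing row of positive numbers the entry in place \<open>k\<close> is
  at least \<open>k\<close>.\<close>

lemma strict_row_sum:
  assumes "sorted_wrt (<) w" "0 \<notin> set w"
  shows "sum_list [1..<Suc (length w)] \<le> sum_list w"
    and "sum_list w = sum_list [1..<Suc (length w)] \<Longrightarrow> w = [1..<Suc (length w)]"
proof -
  have "sum_list [1..<Suc (length w)] \<le> sum_list w \<and>
      (sum_list w = sum_list [1..<Suc (length w)] \<longrightarrow> w = [1..<Suc (length w)])"
    using assms
  proof (induct w rule: rev_induct)
    case (snoc x w)
    have x: "\<And>y. y \<in> set w \<Longrightarrow> y < x" and w: "sorted_wrt (<) w" "0 \<notin> set w" and "0 < x"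
      using snoc.prems by (auto simp: sorted_wrt_append)
    have "set w \<subseteq> {1..<x}"
      using x w(2) by (auto simp: Suc_le_eq intro: gr0I)
    then have "card (set w) \<le> card {1..<x}"
      by (intro card_mono) auto
    moreover have "card (set w) = length w"
      using w(1) by (simp add: strict_sorted_iff distinct_card)
    ultimately have "Suc (length w) \<le> x"
      using \<open>0 < x\<close> by simp
    then show ?case
      using snoc.hyps[OF w] by (auto simp del: upt_Suc simp: upt_Suc_append)
  qed simp
  then show "sum_list [1..<Suc (length w)] \<le> sum_list w"
    "sum_list w = sum_list [1..<Suc (length w)] \<Longrightarrow> w = [1..<Suc (length w)]"
    by simp_all
qed

abbreviation superstandard :: "nat list \<Rightarrow> nat list list"
  where "superstandard l \<equiv> map (\<lambda>r. [1..<Suc r]) l"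

lemma tableau_sum:
  assumes "S \<in> tableaux (strict_rows n) l"
  shows "sum_list (concat (superstandard l)) \<le> sum_list (concat S) \<and>
    (sum_list (concat S) = sum_list (concat (superstandard l)) \<longrightarrow> S = superstandard l)"
  using assms unfolding tableaux_def mem_Collect_eq
proof (induct rule: list_all2_induct)
  case (Cons w S r l)
  have w: "sorted_wrt (<) w" "0 \<notin> set w" "length w = r"
    using Cons.hyps(1) by (auto simp: strict_rows_def row_words_def)
  show ?case
    using strict_row_sum[OF w(1,2)] Cons.hyps(3) unfolding w(3) by (auto simp del: upt_Suc)
qed simp

lemma set_sum_ge:
  fixes T :: "nat set"
  assumes "finite T" "0 \<notin> T"
  shows "\<Sum>{1..card T} \<le> \<Sum>T"
proof -
  have "sum_list [1..<Suc (length (sorted_list_of_set T))] \<le> sum_list (sorted_list_of_set T)"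
    using assms by (intro strict_row_sum(1)) simp_all
  moreover have "sum_list (sorted_list_of_set T) = \<Sum>T"
    using assms sum.distinct_set_conv_list[of "sorted_list_of_set T" "\<lambda>x. x"] by simp
  moreover have "sum_list [1..<Suc k] = \<Sum>{1..k}" for k
    using sum.distinct_set_conv_list[of "[1..<Suc k]" "\<lambda>x. x"] by (simp add: atLeastLessThanSuc_atLeastAtMost del: upt_Suc)
  ultimately show ?thesis
    by simp
qed

text \<open>Polarizations act inside a column: they exchange one variable of it for another and
  create an odd variable only on an even exponent.\<close>

lemma pol_word_columns:
  assumes f: "\<And>m. f m \<noteq> 0 \<Longrightarrow> (\<forall>q. (\<Sum>a\<in>Z. m (a, q)) = g q) \<and> (\<forall>a q. odd_sym s a \<longrightarrow> m (a, q) \<le> 1)"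
    and Z: "finite Z" "ps \<in> lists (Z \<times> Z)" and m: "app (pol_word K s ps) f m \<noteq> 0"
  shows "(\<forall>q. (\<Sum>a\<in>Z. m (a, q)) = g q) \<and> (\<forall>a q. odd_sym s a \<longrightarrow> m (a, q) \<le> 1)"
  using Z(2) m
proof (induct ps arbitrary: m)
  case Nil
  then show ?case
    using f by simp
next
  case (Cons c ps)
  obtain q m0 where q: "m = m0((fst c, q) := Suc (m0 (fst c, q)))"
    "app (pol_word K s ps) f (m0((snd c, q) := Suc (m0 (snd c, q)))) \<noteq> 0"
    "odd_sym s (fst c) \<Longrightarrow> even (m0 (fst c, q))"
    using Cons.prems by (auto elim: pol_support)
  have c: "fst c \<in> Z" "snd c \<in> Z"
    using Cons.hyps(1) by auto
  have sum: "(\<Sum>a\<in>Z. (m0((b, q) := Suc (m0 (b, q)))) (a, q')) = (\<Sum>a\<in>Z. m0 (a, q')) + of_bool (q = q')"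
    if "b \<in> Z" for b q'
  proof -
    have "(\<Sum>a\<in>Z. (m0((b, q) := Suc (m0 (b, q)))) (a, q')) = (\<Sum>a\<in>Z. m0 (a, q') + (if a = b then of_bool (q = q') else 0))"
      by (intro sum.cong) auto
    then show ?thesis
      using that Z(1) by (simp add: sum.distrib)
  qed
  note IH = Cons.hyps(3)[OF q(2)]
  have "(\<Sum>a\<in>Z. m (a, q')) = g q'" for q'
    using IH sum[OF c(2), of q'] sum[OF c(1), of q', folded q(1)] by simp
  moreover have "m (a, q') \<le> 1" if odd: "odd_sym s a" for a q'
  proof -
    have prev: "(m0((snd c, q) := Suc (m0 (snd c, q)))) (a, q') \<le> 1"
      using IH odd by blast
    then have le: "m0 (a, q') \<le> 1"
      by (simp split: if_splits)
    show ?thesis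
    proof (cases "(a, q') = (fst c, q)")
      case True
      then have "even (m0 (a, q'))"
        using q(3) odd by simp
      then have "m0 (a, q') = 0"
        using le by presburger
      then show ?thesis
        using True by (simp add: q(1))
    next
      case False
      then show ?thesis
        using le by (simp only: q(1) fun_upd_other[OF False])
    qed
  qed
  ultimately show ?case
    by blast
qed

lemma sum_list_upto: "set xs \<subseteq> {1..N} \<Longrightarrow> sum_list xs = (\<Sum>j\<in>{1..N}. j * count_list xs j)" for xs :: "nat list"
  using sum_list_map_eq_sum_count2[of xs "{1..N}" "\<lambda>x. x"] by (simp add: mult.commute)

lemma initial_segment:
  fixes I :: "nat set"
  assumes "finite I" "0 \<notin> I" and down: "\<And>i i'. i \<in> I \<Longrightarrow> 1 \<le> i' \<Longrightarrow> i' \<le> i \<Longrightarrow> i' \<in> I"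
  shows "I = {1..card I}"
proof (cases "I = {}")
  case False
  then have "Max I \<in> I"
    using assms(1) by simp
  have "I = {1..Max I}"
  proof (intro equalityI subsetI)
    fix i assume "i \<in> I"
    then show "i \<in> {1..Max I}"
      using assms(1,2) by (cases i) simp_all
  next
    fix i assume "i \<in> {1..Max I}"
    then show "i \<in> I"
      using down[OF \<open>Max I \<in> I\<close>, of i] by simp
  qed
  then show ?thesis
    using card_atLeastAtMost[of 1 "Max I"] by simp
qed simp

text \<open>Counting letters forces \<open>m\<close> to be the content of \<open>S\<close>, so \<open>\<Sum>j. j * m j\<close> is the sum of
  the entries of \<open>S\<close>, at least the sum of the column indices of the cells. In the configuration
  reached after \<open>e(D, C)\<close> only odd variables occur, which bounds the sum of the column indices from
  below by \<open>\<Sum>i. i * m i\<close>. So equality holds throughout.\<close>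

lemma imm_word_small:
  assumes l: "is_partition l" and S: "S \<in> tableaux (strict_rows n) l"
    and m: "m \<in> gap_partitions n 0" "\<And>i. i \<in> {1..n} \<Longrightarrow> m i \<le> K" "(\<Sum>i\<in>{1..n}. m i) \<le> sum_list l"
    and nz: "app (pol_word K False (imm_word l (concat S))) (ind (hw_config n m)) \<noteq> 0"
  shows "S = superstandard l" and "\<And>j. j \<in> {1..n} \<Longrightarrow> m j = count_list (concat S) j"
proof -
  let ?v = "ind (hw_config n m)"
  define w C D where "w = concat S" and "C = concat (C_star l)" and "D = concat (D_star l)"
  define J where "J = part l 1"
  let ?Z = "all_symbols (length l) J n"
  have w: "length w = sum_list l" "set w \<subseteq> {1..n}"
    unfolding w_def using tableaux_concat[OF S] by (rule conjunct1, rule conjunct2)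
  have len: "length C = sum_list l" "length D = sum_list l"
    unfolding C_def D_def length_concat_D_star concat_C_star by (rule length_alpha_word, rule refl)
  have C: "set C \<subseteq> Alpha ` {1..length l}"
    using set_alpha_word[of 1 l] by (simp add: C_def concat_C_star atLeastLessThanSuc_atLeastAtMost)
  have D: "set D \<subseteq> Beta ` {1..J}"
    unfolding D_def J_def by (rule set_concat_D_star[OF l])
  have nz': "app (pol_word K False (out_word w C)) (app (pol_word K False (zip C D)) (app (pol_word K False (zip D C))
      (app (pol_word K False (in_word w C)) ?v))) \<noteq> 0"
    using nz by (simp add: imm_word_def mid_word_def w_def C_def D_def)
  have "app (pol_word K False (in_word w C)) ?v \<noteq> 0"
    using nz' by (rule contrapos_nn) simp
  then obtain M1 where M1: "app (pol_word K False (in_word w C)) ?v M1 \<noteq> 0"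
    by (auto simp: fun_eq_iff vec_apply)
  \<comment> \<open>The word is cut at the moment when the Alpha symbols are used up again and all
    remaining variables will turn out to be Beta symbols.\<close>
  define ps where "ps = zip D C @ in_word w C"
  have "app (pol_word K False ps) ?v \<noteq> 0"
    using nz' by (rule contrapos_nn) (simp add: ps_def)
  then obtain M where M: "app (pol_word K False ps) ?v M \<noteq> 0"
    by (auto simp: fun_eq_iff vec_apply)
  have start: "ind (hw_config n m) m' \<noteq> 0 \<Longrightarrow> m' = hw_config n m" for m'
    by (simp add: ind_def split: if_splits)
  have count_Proper: "count_list (map Proper xs) (Proper j) = count_list xs j" for xs j
    by (induct xs) simp_all
  have count_Beta: "count_list (map Beta xs) (Beta j) = count_list xs j" for xs j
    by (induct xs) simp_all
  have content_0: "content K (hw_config n m) (Alpha j) = 0" "content K (hw_config n m) (Beta j) = 0" for j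
    by (simp_all add: content_def)
  have notin: "count_list C (Proper j) = 0" "count_list C (Beta j) = 0" "count_list D (Proper j) = 0" "count_list D (Alpha j) = 0"
    "count_list (map Proper w) (Alpha j) = 0" "count_list (map Proper w) (Beta j) = 0" for j
    using C D by (auto simp: count_list_0_iff)
  have content: "int (content K m' a) = int (content K (hw_config n m) a) + wt qs a"
    if "app (pol_word K False qs) ?v m' \<noteq> 0" for qs m' a
    using that by (rule pol_word_content[rotated]) (auto dest: start)
  have wt_in: "wt (in_word w C) a = int (count_list C a) - int (count_list (map Proper w) a)" for a
    unfolding in_word_def by (rule wt_zip) (simp add: len w)
  have wt_ps: "wt ps a = int (count_list D a) - int (count_list (map Proper w) a)" for a
    using wt_zip[of D C a] by (simp add: ps_def wt_in len)
  have content_v: "content K (hw_config n m) (Proper j) = m j" if "j \<in> {1..n}" for j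
    by (rule content_hw_config[where m = m, OF that m(2)[OF that]])
  \<comment> \<open>The content of \<open>j\<close> left after the inner word cannot be negative.
    Together with the bound on the size of \<open>m\<close> these inequalities must all be
    equalities.\<close>
  have ge: "count_list w j \<le> m j" if "j \<in> {1..n}" for j
  proof -
    have "int (content K M1 (Proper j)) = int (m j) + (int 0 - int (count_list w j))"
      unfolding content[OF M1] content_v[OF that] wt_in notin count_Proper ..
    moreover have "0 \<le> int (content K M1 (Proper j))"
      by (rule of_nat_0_le_iff)
    ultimately show ?thesis
      by linarith
  qed
  have "(\<Sum>j\<in>{1..n}. count_list w j) = (\<Sum>x\<leftarrow>w. 1)"
    by (simp only: sum_list_map_eq_sum_count2[OF w(2) finite_atLeastAtMost] mult_1_right)
  also have "\<dots> = sum_list l"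
    by (simp only: sum_list_triv w(1) of_nat_id mult_1_right)
  finally have total: "(\<Sum>j\<in>{1..n}. count_list w j) = sum_list l" .
  have "(\<Sum>j\<in>{1..n}. count_list w j) \<le> (\<Sum>j\<in>{1..n}. m j)"
    by (rule sum_mono) (rule ge)
  then have "(\<Sum>j\<in>{1..n}. count_list w j) = (\<Sum>j\<in>{1..n}. m j)"
    using m(3) unfolding total by (rule antisym)
  then have eq: "m j = count_list w j" if "j \<in> {1..n}" for j
    by (rule sum_mono_inv[OF _ ge that finite_atLeastAtMost, symmetric])
  from eq show "m j = count_list (concat S) j" if "j \<in> {1..n}" for j
    using that by (simp only: w_def)
  have sub: "set C \<subseteq> ?Z" "set D \<subseteq> ?Z" "set (map Proper w) \<subseteq> ?Z"
    unfolding all_symbols_def proper_symbols_def set_map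
    by (rule le_supI1, rule le_supI1, rule C, rule le_supI1, rule le_supI2, rule D, rule le_supI2, rule image_mono, rule w(2))
  have zip: "set (zip xs ys) \<subseteq> ?Z \<times> ?Z" if xs: "set xs \<subseteq> ?Z" and ys: "set ys \<subseteq> ?Z" for xs ys
  proof (rule subrelI)
    fix x y assume xy: "(x, y) \<in> set (zip xs ys)"
    show "(x, y) \<in> ?Z \<times> ?Z"
      by (rule SigmaI[OF subsetD[OF xs set_zip_leftD[OF xy]] subsetD[OF ys set_zip_rightD[OF xy]]])
  qed
  have psZ: "ps \<in> lists (?Z \<times> ?Z)"
    unfolding lists_eq_set mem_Collect_eq ps_def in_word_def set_append
    by (rule Un_least[OF zip[OF sub(2,1)] zip[OF sub(1,3)]])
  have fin: "finite ?Z"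
    by (simp add: all_symbols_def proper_symbols_def)
  let ?g = "\<lambda>q. \<Sum>a\<in>?Z. hw_config n m (a, q)"
  have cols: "(\<forall>q. (\<Sum>a\<in>?Z. M (a, q)) = ?g q) \<and> (\<forall>a q. odd_sym False a \<longrightarrow> M (a, q) \<le> 1)"
  proof (rule pol_word_columns[OF _ fin psZ M])
    fix m' assume "?v m' \<noteq> 0"
    then have "m' = hw_config n m"
      by (rule start)
    then show "(\<forall>q. (\<Sum>a\<in>?Z. m' (a, q)) = ?g q) \<and> (\<forall>a q. odd_sym False a \<longrightarrow> m' (a, q) \<le> 1)"
      by (auto simp: hw_config_def split: symb.split)
  qed
  have Z_sum: "(\<Sum>a\<in>?Z. F a) = (\<Sum>i\<in>{1..length l}. F (Alpha i)) + (\<Sum>j\<in>{1..J}. F (Beta j)) + (\<Sum>i\<in>{1..n}. F (Proper i))"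
    for F :: "symb \<Rightarrow> nat"
  proof -
    have "(\<Sum>a\<in>?Z. F a) = (\<Sum>a\<in>Alpha ` {1..length l} \<union> Beta ` {1..J}. F a) + (\<Sum>a\<in>Proper ` {1..n}. F a)"
      unfolding all_symbols_def proper_symbols_def by (rule sum.union_disjoint) auto
    moreover have "(\<Sum>a\<in>Alpha ` {1..length l} \<union> Beta ` {1..J}. F a) = (\<Sum>a\<in>Alpha ` {1..length l}. F a) + (\<Sum>a\<in>Beta ` {1..J}. F a)"
      by (rule sum.union_disjoint) auto
    ultimately show ?thesis
      by (simp add: sum.reindex inj_on_def)
  qed
  have zero: "M (a, q) = 0" if "content K M a = 0" "q < K" for a q
    using that by (simp add: content_def)
  have alpha: "content K M (Alpha i) = 0" for i
    using content[OF M, of "Alpha i"] by (simp add: wt_ps notin content_0)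
  have proper: "content K M (Proper i) = 0" if "i \<in> {1..n}" for i
    using content[OF M, of "Proper i"] content_v[OF that] eq[OF that] by (simp add: wt_ps notin count_Proper)
  have col: "(\<Sum>j\<in>{1..J}. M (Beta j, q)) = card {i \<in> {1..n}. q < m i}" if "q < K" for q
  proof -
    have "(\<Sum>j\<in>{1..J}. M (Beta j, q)) = (\<Sum>a\<in>?Z. M (a, q))"
      unfolding Z_sum using zero[OF alpha that] zero[OF proper that] by simp
    also have "\<dots> = ?g q"
      using cols by blast
    also have "\<dots> = (\<Sum>i\<in>{1..n}. of_bool (q < m i))"
      unfolding Z_sum hw_config_simps sum.neutral_const add_0 by (intro sum.cong refl) simp
    also have "\<dots> = card {i \<in> {1..n}. q < m i}"
      by (simp only: card_eq_sum sum.inter_filter[OF finite_atLeastAtMost] of_bool_def)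
    finally show ?thesis .
  qed
  \<comment> \<open>In column \<open>q\<close> the letters of the weight vector are the initial
    segment \<open>1, 2, ...\<close>, while the Beta symbols there are odd, so their indices are
    distinct positive numbers, equally many of them.\<close>
  have col_ge: "\<Sum>{i \<in> {1..n}. q < m i} \<le> (\<Sum>j\<in>{1..J}. j * M (Beta j, q))" if "q < K" for q
  proof -
    let ?T = "{j \<in> {1..J}. M (Beta j, q) = 1}" and ?I = "{i \<in> {1..n}. q < m i}"
    have T: "(\<Sum>j\<in>{1..J}. F j * M (Beta j, q)) = (\<Sum>j\<in>?T. F j)" for F
    proof -
      have "(\<Sum>j\<in>{1..J}. F j * M (Beta j, q)) = (\<Sum>j\<in>{1..J}. if M (Beta j, q) = 1 then F j else 0)"
      proof (intro sum.cong refl)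
        fix j
        have "M (Beta j, q) \<le> 1"
          using cols by (simp add: odd_sym_def)
        then have "M (Beta j, q) = 0 \<or> M (Beta j, q) = 1"
          by linarith
        then show "F j * M (Beta j, q) = (if M (Beta j, q) = 1 then F j else 0)"
          by (elim disjE) simp_all
      qed
      then show ?thesis
        by (simp only: sum.inter_filter[OF finite_atLeastAtMost])
    qed
    have card: "card ?T = card ?I"
      using T[of "\<lambda>_. 1"] col[OF that] by simp
    have "?I = {1..card ?I}"
    proof (rule initial_segment)
      fix i i' assume i: "i \<in> ?I" "1 \<le> i'" "i' \<le> i"
      have "m i \<le> m i'"
        by (rule gap_partitions_mono[OF m(1)]) (use i in simp_all)
      then show "i' \<in> ?I"
        using i by simp
    qed simp_all
    then have "\<Sum>?I = \<Sum>{1..card ?T}"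
      by (simp only: card)
    also have "\<dots> \<le> \<Sum>?T"
      by (rule set_sum_ge) auto
    finally show ?thesis
      using T[of "\<lambda>j. j"] by simp
  qed
  let ?w0 = "concat (superstandard l)"
  have D_w0: "D = map Beta ?w0"
    by (simp add: D_def D_star_def map_concat comp_def del: upt_Suc)
  have beta: "content K M (Beta j) = count_list ?w0 j" for j
    using content[OF M, of "Beta j"] by (simp add: wt_ps notin content_0 D_w0 count_Beta)
  have "set ?w0 \<subseteq> {1..J}"
    using D unfolding D_w0 by auto
  have "sum_list w = (\<Sum>i\<in>{1..n}. i * m i)"
    unfolding sum_list_upto[OF w(2)] by (intro sum.cong refl) (simp only: eq)
  also have "\<dots> = (\<Sum>i\<in>{1..n}. \<Sum>q<K. i * of_bool (q < m i))"
  proof (intro sum.cong refl)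
    fix i assume "i \<in> {1..n}"
    then have "{q \<in> {..<K}. q < m i} = {..<m i}"
      using m(2)[of i] by auto
    moreover have "(\<Sum>q<K. of_bool (q < m i)) = card {q \<in> {..<K}. q < m i}"
      by (simp only: card_eq_sum sum.inter_filter[OF finite_lessThan] of_bool_def)
    ultimately have "(\<Sum>q<K. of_bool (q < m i)) = m i"
      by (simp only: card_lessThan)
    then show "i * m i = (\<Sum>q<K. i * of_bool (q < m i))"
      by (simp add: sum_distrib_left[symmetric])
  qed
  also have "\<dots> = (\<Sum>q<K. \<Sum>i\<in>{1..n}. i * of_bool (q < m i))"
    by (rule sum.swap)
  also have "\<dots> = (\<Sum>q<K. \<Sum>{i \<in> {1..n}. q < m i})"
    by (simp only: sum.inter_filter[OF finite_atLeastAtMost] of_bool_def if_distrib[of "(*) _"] mult_1_right mult_0_right)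
  also have "\<dots> \<le> (\<Sum>q<K. \<Sum>j\<in>{1..J}. j * M (Beta j, q))"
    by (rule sum_mono, rule col_ge) (simp only: lessThan_iff)
  also have "\<dots> = (\<Sum>j\<in>{1..J}. j * content K M (Beta j))"
    by (subst sum.swap) (simp add: content_def sum_distrib_left)
  also have "\<dots> = sum_list ?w0"
    using sum_list_upto[OF \<open>set ?w0 \<subseteq> {1..J}\<close>] by (simp add: beta)
  finally show "S = superstandard l"
    using tableau_sum[OF S] unfolding w_def by (metis antisym)
qed

lemma count_superstandard:
  assumes "1 \<le> j"
  shows "count_list (concat (superstandard l)) j = conj_part l j"
proof -
  have row: "count_list [Suc 0..<Suc r] j = of_bool (j \<le> r)" for r
    using assms by (induct r) auto
  have "count_list (concat (superstandard l)) j = length (filter (\<lambda>r. j \<le> r) l)"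
    by (induct l) (simp_all add: row del: upt_Suc)
  also have "\<dots> = card {i. i < length l \<and> j \<le> l ! i}"
    by (rule length_filter_conv_card)
  also have "\<dots> = card (Suc ` {i. i < length l \<and> j \<le> l ! i})"
    by (simp add: card_image)
  also have "Suc ` {i. i < length l \<and> j \<le> l ! i} = {i \<in> {1..length l}. j \<le> part l i}"
  proof (intro equalityI subsetI)
    fix i assume "i \<in> {i \<in> {1..length l}. j \<le> part l i}"
    then show "i \<in> Suc ` {i. i < length l \<and> j \<le> l ! i}"
      by (intro image_eqI[of _ _ "i - 1"]) (auto simp: part_def)
  qed (auto simp: part_def)
  finally show ?thesis
    by (simp only: conj_part_def)
qed

lemma eigenvalue_small:
  assumes l: "is_partition l" "part l 1 \<le> n" and n: "1 \<le> n"
    and f: "\<And>K s mu v. hw_vec K s n mu v \<Longrightarrow> proper_vec v \<Longrightarrow>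
      app (imm_op K s n l) v = scl (of_nat (hook_product l) * eval_poly f mu) v"
    and m: "m \<in> gap_partitions n 0" "(\<Sum>i\<in>{1..n}. m i) \<le> sum_list l"
  shows "eval_poly f (\<lambda>i. of_nat (m i)) = (if \<forall>i\<in>{1..n}. m i = conj_part l i then of_nat (hook_product l) else 0)"
proof -
  let ?v = "ind (hw_config n m)" and ?mu = "\<lambda>i. of_nat (m i) :: complex" and ?T = "tableaux (strict_rows n) l"
  \<comment> \<open>As many columns as the largest part are enough to hold the weight
    monomial.\<close>
  obtain K where K: "K = m 1"
    by blast
  have hw: "hw_vec K False n ?mu ?v"
    by (rule hw_vec_hw_config[OF m(1)]) (simp only: K order_refl)
  have m_le: "m i \<le> K" if "i \<in> {1..n}" for i
    unfolding K by (rule gap_partitions_mono[OF m(1)]) (use that in simp_all)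
  let ?a = "\<lambda>S. app (pol_word K False (imm_word l (concat S))) ?v"
  have nz: "S = superstandard l \<and> (\<forall>i\<in>{1..n}. m i = conj_part l i)" if "S \<in> ?T" "?a S \<noteq> 0" for S
  proof -
    have S: "S = superstandard l"
      by (rule imm_word_small(1)[OF l(1) that(1) m(1) m_le m(2) that(2)])
    have "m j = count_list (concat S) j" if j: "j \<in> {1..n}" for j
      by (rule imm_word_small(2)[OF l(1) \<open>S \<in> ?T\<close> m(1) m_le m(2) \<open>?a S \<noteq> 0\<close> j])
    then show ?thesis
      using S count_superstandard by (metis atLeastAtMost_iff)
  qed
  have "scl (of_nat (hook_product l) * eval_poly f ?mu) ?v = (\<Sum>S\<in>?T. ?a S)"
    unfolding f[OF hw proper_vec_hw, symmetric] imm_op_def by (rule app_sum)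
  also have "\<dots> = scl (of_nat (hook_product l) * (if \<forall>i\<in>{1..n}. m i = conj_part l i then of_nat (hook_product l) else 0)) ?v"
  proof (cases "\<forall>i\<in>{1..n}. m i = conj_part l i")
    case True
    have sup: "superstandard l \<in> ?T"
    proof -
      have "[1..<Suc r] \<in> strict_rows n r" if "r \<in> set l" for r
        using part_le_first[OF l(1) that] l(2) by (auto simp: strict_rows_def row_words_def simp del: upt_Suc)
      then show ?thesis
        unfolding tableaux_def mem_Collect_eq list_all2_map1 by (rule list.rel_refl_strong)
    qed
    have "hw_vec K False n (\<lambda>i. of_nat (conj_part l i)) ?v"
      using hw True unfolding hw_vec_def by simp
    then have top: "?a (superstandard l) = scl (of_nat (hook_product l * hook_product l)) ?v"
      by (rule imm_word_top[OF l _ proper_vec_hw])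
    have "(\<Sum>S\<in>?T. ?a S) = sum ?a {superstandard l}"
    proof (rule sum.mono_neutral_right)
      show "finite ?T"
        by (rule finite_tableaux) (simp add: strict_rows_def finite_row_words)
      show "\<forall>S\<in>?T - {superstandard l}. ?a S = 0"
        using nz by blast
    qed (use sup in blast)
    also have "sum ?a {superstandard l} = scl (of_nat (hook_product l * hook_product l)) ?v"
      by (simp only: sum.insert[OF finite.emptyI] sum.empty add_0_right empty_iff not_False_eq_True top)
    finally show ?thesis
      using True by simp
  next
    case False
    have "(\<Sum>S\<in>?T. ?a S) = 0"
      by (rule sum.neutral) (use nz False in blast)
    then show ?thesis
      by (simp only: False if_False mult_zero_right scl_simps)
  qed
  finally have "of_nat (hook_product l) * eval_poly f ?mu =
      of_nat (hook_product l) * (if \<forall>i\<in>{1..n}. m i = conj_part l i then of_nat (hook_product l) else 0)"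
    using scl_eq_0_iff[of "of_nat (hook_product l) * eval_poly f ?mu -
      of_nat (hook_product l) * (if \<forall>i\<in>{1..n}. m i = conj_part l i then of_nat (hook_product l) else 0)" ?v]
      ind_nonzero[of "hw_config n m"] by (simp add: scl_add(4) del: mult_eq_0_iff)
  then show ?thesis
    using hook_product_nonzero[of l] by simp
qed

section \<open>Interpolation and alternants\<close>

text \<open>Products of falling factorials replace monomials as a basis: at a natural point
  \<open>k\<close> the one with exponent \<open>e\<close> vanishes unless \<open>e \<le> k\<close>
  in every place, so interpolation at lattice points is triangular.\<close>

definition newton :: "nat \<Rightarrow> (nat \<Rightarrow> nat) \<Rightarrow> (nat \<Rightarrow> complex) \<Rightarrow> complex"
  where "newton n e z = (\<Prod>i<n. falling (z i) (e i))"

definition exps :: "nat \<Rightarrow> nat \<Rightarrow> (nat \<Rightarrow> nat) set"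
  where "exps n d = {e. (\<forall>i\<ge>n. e i = 0) \<and> (\<Sum>i<n. e i) \<le> d}"

definition newton_span :: "nat \<Rightarrow> nat \<Rightarrow> ((nat \<Rightarrow> complex) \<Rightarrow> complex) set"
  where "newton_span n d = {P. \<exists>c. \<forall>z. P z = (\<Sum>e\<in>exps n d. c e * newton n e z)}"

lemma falling_Suc: "falling z (Suc p) = falling z p * (z - of_nat p)"
  by (simp add: falling_def)

lemma falling_nat_eq_0: "falling (of_nat m :: complex) p = 0 \<longleftrightarrow> m < p"
  by (auto simp: falling_def)

lemma falling_self: "falling (of_nat m :: complex) m = fact m"
proof -
  have "falling (of_nat m :: complex) m = (\<Prod>k<m. of_nat (m - k))"
    unfolding falling_def by (intro prod.cong refl) (simp add: of_nat_diff)
  also have "\<dots> = of_nat (\<Prod>k<m. m - k)"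
    by simp
  also have "(\<Prod>k<m. m - k) = (\<Prod>k<m. Suc k)"
    by (subst prod.nat_diff_reindex[symmetric]) (intro prod.cong refl, simp add: Suc_diff_Suc)
  also have "of_nat (\<Prod>k<m. Suc k) = (fact m :: complex)"
    by (simp add: fact_prod_Suc atLeast0LessThan)
  finally show ?thesis .
qed

lemma finite_exps: "finite (exps n d)"
proof (rule finite_subset)
  show "exps n d \<subseteq> {e. \<forall>i. (i \<in> {..<n} \<longrightarrow> e i \<in> {..d}) \<and> (i \<notin> {..<n} \<longrightarrow> e i = 0)}"
  proof (intro subsetI CollectI allI conjI impI)
    fix e i assume e: "e \<in> exps n d" and i: "i \<in> {..<n}"
    have "e i \<le> (\<Sum>i<n. e i)"
      using i by (intro member_le_sum) simp_all
    then show "e i \<in> {..d}"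
      using e by (simp add: exps_def)
  qed (simp add: exps_def)
qed (rule finite_set_of_finite_funs; simp)

lemma newton_span_newton:
  assumes "e \<in> exps n d"
  shows "newton n e \<in> newton_span n d"
proof -
  have "newton n e z = (\<Sum>e'\<in>exps n d. (if e' = e then newton n e' z else 0))" for z
    using assms finite_exps by simp
  moreover have "(\<Sum>e'\<in>exps n d. (if e' = e then newton n e' z else 0)) = (\<Sum>e'\<in>exps n d. of_bool (e' = e) * newton n e' z)" for z
    by (intro sum.cong refl) simp
  ultimately show ?thesis
    unfolding newton_span_def by (intro CollectI exI[of _ "\<lambda>e'. of_bool (e' = e)"]) simp
qed

lemma newton_span_zero: "(\<lambda>z. 0) \<in> newton_span n d"
  unfolding newton_span_def by (intro CollectI exI[of _ "\<lambda>e. 0"]) simp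

lemma newton_span_add:
  assumes "P \<in> newton_span n d" "Q \<in> newton_span n d"
  shows "(\<lambda>z. P z + Q z) \<in> newton_span n d"
proof -
  obtain b c where "\<forall>z. P z = (\<Sum>e\<in>exps n d. b e * newton n e z)" "\<forall>z. Q z = (\<Sum>e\<in>exps n d. c e * newton n e z)"
    using assms unfolding newton_span_def by blast
  then show ?thesis
    unfolding newton_span_def by (intro CollectI exI[of _ "\<lambda>e. b e + c e"]) (simp add: sum.distrib distrib_right)
qed

lemma newton_span_scale:
  assumes "P \<in> newton_span n d"
  shows "(\<lambda>z. k * P z) \<in> newton_span n d"
proof -
  obtain b where "\<forall>z. P z = (\<Sum>e\<in>exps n d. b e * newton n e z)"
    using assms unfolding newton_span_def by blast
  then show ?thesis
    unfolding newton_span_def by (intro CollectI exI[of _ "\<lambda>e. k * b e"]) (simp add: sum_distrib_left mult.assoc)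
qed

lemma newton_span_diff: "P \<in> newton_span n d \<Longrightarrow> Q \<in> newton_span n d \<Longrightarrow> (\<lambda>z. P z - Q z) \<in> newton_span n d"
  using newton_span_add[OF _ newton_span_scale[of Q n d "- 1"], of P] by simp

lemma newton_span_sum:
  "(\<And>i. i \<in> I \<Longrightarrow> P i \<in> newton_span n d) \<Longrightarrow> (\<lambda>z. \<Sum>i\<in>I. P i z) \<in> newton_span n d"
  by (induct I rule: infinite_finite_induct) (simp_all add: newton_span_zero newton_span_add)

lemma newton_span_generate:
  assumes P: "P \<in> newton_span n d" and Q: "\<And>e. e \<in> exps n d \<Longrightarrow> (\<lambda>z. g z * newton n e z) \<in> newton_span n d'"
  shows "(\<lambda>z. g z * P z) \<in> newton_span n d'"
proof -
  obtain b where b: "\<forall>z. P z = (\<Sum>e\<in>exps n d. b e * newton n e z)"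
    using P unfolding newton_span_def by blast
  have "(\<lambda>z. \<Sum>e\<in>exps n d. b e * (g z * newton n e z)) \<in> newton_span n d'"
    by (intro newton_span_sum newton_span_scale Q)
  moreover have "g z * P z = (\<Sum>e\<in>exps n d. b e * (g z * newton n e z))" for z
    by (simp add: b sum_distrib_left mult.left_commute)
  ultimately show ?thesis
    by simp
qed

lemma newton_span_mono:
  assumes "P \<in> newton_span n d" "d \<le> d'"
  shows "P \<in> newton_span n d'"
  using newton_span_generate[OF assms(1), of "\<lambda>z. 1" d'] newton_span_newton[of _ n d'] assms(2)
  by (auto simp: exps_def)

text \<open>Writing \<open>z a - k\<close> as the sum of \<open>z a - e a\<close> and
  \<open>e a - k\<close>, the first part raises the exponent by one and the second is a
  scalar.\<close>

lemma newton_span_linear: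
  assumes "P \<in> newton_span n d" "a < n"
  shows "(\<lambda>z. (z a - k) * P z) \<in> newton_span n (Suc d)"
  using assms(1)
proof (rule newton_span_generate)
  fix e assume e: "e \<in> exps n d"
  let ?e = "e(a := Suc (e a))"
  have sum: "(\<Sum>i<n. ?e i) = Suc (\<Sum>i<n. e i)"
    using assms(2) by (simp add: sum.remove[of _ a])
  have "newton n ?e z = newton n e z * (z a - of_nat (e a))" for z
    using assms(2) by (simp add: newton_def prod.remove[of _ a] falling_Suc)
  then have "(z a - k) * newton n e z = newton n ?e z + (of_nat (e a) - k) * newton n e z" for z
    by (simp add: algebra_simps)
  moreover have "?e \<in> exps n (Suc d)" "e \<in> exps n (Suc d)"
    using e assms(2) sum by (auto simp: exps_def)
  ultimately show "(\<lambda>z. (z a - k) * newton n e z) \<in> newton_span n (Suc d)"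
    by (simp add: newton_span_add newton_span_scale newton_span_newton)
qed

lemma newton_span_linear_product:
  assumes "P \<in> newton_span n d" "\<And>x. x \<in> set xs \<Longrightarrow> a x < n"
  shows "(\<lambda>z. (\<Prod>x\<leftarrow>xs. z (a x) - k x) * P z) \<in> newton_span n (d + length xs)"
  using assms(2)
proof (induct xs)
  case (Cons x xs)
  then have "(\<lambda>z. (\<Prod>x\<leftarrow>xs. z (a x) - k x) * P z) \<in> newton_span n (d + length xs)"
    by simp
  from newton_span_linear[OF this, of "a x" "k x"] show ?case
    using Cons.prems[of x] by (simp add: mult.assoc)
qed (simp add: assms(1))

text \<open>At a minimal exponent with nonzero coefficient all other Newton polynomials vanish.\<close>

lemma newton_span_vanish:
  assumes P: "P \<in> newton_span n d" and zero: "\<And>k. k \<in> exps n d \<Longrightarrow> P (\<lambda>i. of_nat (k i)) = 0"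
  shows "P z = 0"
proof -
  obtain c where c: "\<And>z. P z = (\<Sum>e\<in>exps n d. c e * newton n e z)"
    using P unfolding newton_span_def by blast
  have "c e = 0" if e: "e \<in> exps n d" for e
  proof (rule ccontr)
    assume "c e \<noteq> 0"
    then obtain k where k: "k \<in> exps n d \<and> c k \<noteq> 0" "\<And>e. e \<in> exps n d \<and> c e \<noteq> 0 \<Longrightarrow> (\<Sum>i<n. k i) \<le> (\<Sum>i<n. e i)"
      using ex_has_least_nat[of "\<lambda>e. e \<in> exps n d \<and> c e \<noteq> 0" e "\<lambda>e. \<Sum>i<n. e i"] e by auto
    have other: "c e * newton n e (\<lambda>i. of_nat (k i)) = 0" if e: "e \<in> exps n d - {k}" for e
    proof (rule ccontr)
      assume *: "c e * newton n e (\<lambda>i. of_nat (k i)) \<noteq> 0"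
      then have le: "e i \<le> k i" if "i < n" for i
        using that by (force simp: newton_def falling_nat_eq_0)
      have "(\<Sum>i<n. k i) \<le> (\<Sum>i<n. e i)"
        using k(2)[of e] e * by simp
      moreover have "(\<Sum>i<n. e i) \<le> (\<Sum>i<n. k i)"
        by (rule sum_mono) (simp add: le)
      ultimately have eq: "(\<Sum>i<n. e i) = (\<Sum>i<n. k i)"
        by simp
      have "e i = k i" for i
      proof (cases "i < n")
        case True
        then show ?thesis
          using sum_mono_inv[OF eq, of i] le by simp
      next
        case False
        then show ?thesis
          using e k(1) by (simp add: exps_def)
      qed
      then show False
        using e by auto
    qed
    have "0 = (\<Sum>e\<in>exps n d. c e * newton n e (\<lambda>i. of_nat (k i)))"
      using zero[of k] k(1) by (simp add: c)
    also have "\<dots> = c k * newton n k (\<lambda>i. of_nat (k i))"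
      using other k(1) finite_exps[of n d] by (subst sum.remove[of _ k]) (simp_all add: sum.neutral)
    finally show False
      using k(1) by (simp add: newton_def falling_nat_eq_0)
  qed
  then show ?thesis
    by (simp add: c)
qed

text \<open>Exchanging an ascending pair of neighbours lowers \<open>\<Sum>i. i * k i\<close>.\<close>

lemma antisymmetric_vanish:
  assumes G: "G \<in> newton_span n d"
    and swap: "\<And>z i. Suc i < n \<Longrightarrow> G (z(i := z (Suc i), Suc i := z i)) = - G z"
    and zero: "\<And>k. k \<in> exps n d \<Longrightarrow> (\<And>i. Suc i < n \<Longrightarrow> k (Suc i) < k i) \<Longrightarrow> G (\<lambda>i. of_nat (k i)) = 0"
  shows "G z = 0"
proof (rule newton_span_vanish[OF G])
  fix k assume "k \<in> exps n d"
  then show "G (\<lambda>i. of_nat (k i)) = 0"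
  proof (induct "\<Sum>i<n. i * k i" arbitrary: k rule: less_induct)
    case less
    show ?case
    proof (cases "\<forall>i. Suc i < n \<longrightarrow> k (Suc i) < k i")
      case True
      then show ?thesis
        using zero[OF less.prems] by blast
    next
      case False
      then obtain i where i: "Suc i < n" "k i \<le> k (Suc i)"
        by (auto simp: not_less)
      let ?k = "k(i := k (Suc i), Suc i := k i)"
      have split: "(\<Sum>j<n. g j) = g i + g (Suc i) + (\<Sum>j\<in>{..<n} - {i, Suc i}. g j)" for g :: "nat \<Rightarrow> nat"
      proof -
        have "(\<Sum>j<n. g j) = (\<Sum>j\<in>{..<n} - {i, Suc i}. g j) + (\<Sum>j\<in>{i, Suc i}. g j)"
          using i by (intro sum.subset_diff) auto
        then show ?thesis
          by simp
      qed
      have rest: "(\<Sum>j\<in>{..<n} - {i, Suc i}. g j (?k j)) = (\<Sum>j\<in>{..<n} - {i, Suc i}. g j (k j))" for g :: "nat \<Rightarrow> nat \<Rightarrow> nat"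
        by (intro sum.cong) auto
      have of_nat: "(\<lambda>j. of_nat (?k j) :: complex) = (\<lambda>j. of_nat (k j))(i := of_nat (k (Suc i)), Suc i := of_nat (k i))"
        by auto
      have eq: "G (\<lambda>j. of_nat (?k j)) = - G (\<lambda>j. of_nat (k j))"
        unfolding of_nat by (rule swap[OF i(1)])
      show ?thesis
      proof (cases "k i = k (Suc i)")
        case True
        then have "?k = k"
          by auto
        then show ?thesis
          using eq by simp
      next
        case False
        have "(\<Sum>j<n. ?k j) = (\<Sum>j<n. k j)"
          using rest[of "\<lambda>j x. x"] unfolding split by simp
        then have "?k \<in> exps n d"
          using less.prems i by (simp add: exps_def)
        moreover have "(\<Sum>j<n. j * ?k j) < (\<Sum>j<n. j * k j)"
          using rest[of "\<lambda>j x. j * x"] False i(2) unfolding split by simp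
        ultimately show ?thesis
          using less.hyps[of ?k] eq by simp
      qed
    qed
  qed
qed

section \<open>Alternants of falling factorials\<close>

definition alternant :: "nat \<Rightarrow> (nat \<Rightarrow> nat) \<Rightarrow> (nat \<Rightarrow> complex) \<Rightarrow> complex"
  where "alternant n e z = det (mat n n (\<lambda>(i, j). falling (z i) (e j)))"

lemma alternant_swap:
  assumes "Suc i < n"
  shows "alternant n e (z(i := z (Suc i), Suc i := z i)) = - alternant n e z"
proof -
  let ?A = "mat n n (\<lambda>(i, j). falling (z i) (e j))"
  have "mat n n (\<lambda>(i', j). falling ((z(i := z (Suc i), Suc i := z i)) i') (e j)) = swaprows i (Suc i) ?A"
    using assms by (intro eq_matI) auto
  moreover have "det (swaprows i (Suc i) ?A) = - det ?A"
    using assms by (intro det_swaprows[where n = n]) auto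
  ultimately show ?thesis
    by (simp add: alternant_def)
qed

lemma alternant_expand:
  "alternant n e z = (\<Sum>p | p permutes {0..<n}. signof p * newton n (\<lambda>i. if i < n then e (p i) else 0) z)"
proof -
  have "alternant n e z = (\<Sum>p | p permutes {0..<n}. signof p * (\<Prod>i = 0..<n. mat n n (\<lambda>(i, j). falling (z i) (e j)) $$ (i, p i)))"
    unfolding alternant_def by (rule det_def') simp
  also have "\<dots> = (\<Sum>p | p permutes {0..<n}. signof p * newton n (\<lambda>i. if i < n then e (p i) else 0) z)"
  proof (intro sum.cong refl arg_cong2[where f = "(*)"])
    fix p assume "p \<in> {p. p permutes {0..<n}}"
    then have "p i < n" if "i < n" for i
      using that permutes_in_image[of p "{0..<n}" i] by simp
    then show "(\<Prod>i = 0..<n. mat n n (\<lambda>(i, j). falling (z i) (e j)) $$ (i, p i)) = newton n (\<lambda>i. if i < n then e (p i) else 0) z"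
      unfolding newton_def atLeast0LessThan by (intro prod.cong) auto
  qed
  finally show ?thesis .
qed

lemma permuted_exps:
  assumes "p permutes {0..<n}"
  shows "(\<lambda>i. if i < n then e (p i) else 0) \<in> exps n (\<Sum>i<n. e i)"
proof -
  have "(\<Sum>i<n. e (p i)) = (\<Sum>i<n. e i)"
    using sum.permute[OF assms, of e] by (simp add: atLeast0LessThan comp_def)
  then show ?thesis
    by (simp add: exps_def)
qed

lemma alternant_span: "alternant n e \<in> newton_span n (\<Sum>i<n. e i)"
  unfolding alternant_expand[abs_def]
  by (intro newton_span_sum newton_span_scale newton_span_newton permuted_exps) simp

lemma increasing_permutation:
  assumes p: "p permutes {0..<n}" and inc: "\<And>i. Suc i < n \<Longrightarrow> p i < p (Suc i)"
  shows "p = id"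
proof -
  have ge: "i \<le> p i" if "i < n" for i
    using that
  proof (induct i)
    case (Suc i)
    then show ?case
      using inc[of i] by simp
  qed simp
  have eq: "(\<Sum>i<n. i) = (\<Sum>i<n. p i)"
    using sum.permute[OF p, of "\<lambda>i. i"] by (simp add: atLeast0LessThan comp_def)
  show ?thesis
  proof
    fix i
    show "p i = id i"
    proof (cases "i < n")
      case True
      then show ?thesis
        using sum_mono_inv[OF eq, of i] ge by simp
    next
      case False
      then show ?thesis
        using permutes_not_in[OF p, of i] by simp
    qed
  qed
qed

text \<open>A term \<open>p\<close> of the permutation expansion is nonzero only if
  \<open>e (p i) \<le> k i\<close> for all \<open>i\<close>. The bound on the sums turns this into
  equality, and as both sequences decrease strictly, \<open>p\<close> is the identity.\<close>

lemma alternant_strict: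
  assumes k: "\<And>i. Suc i < n \<Longrightarrow> k (Suc i) < k i" "(\<Sum>i<n. k i) \<le> (\<Sum>i<n. e i)"
    and e: "\<And>i. Suc i < n \<Longrightarrow> e (Suc i) < e i"
  shows "alternant n e (\<lambda>i. of_nat (k i)) = (if \<forall>i<n. k i = e i then of_nat (\<Prod>i<n. fact (e i)) else 0)"
proof -
  have perm: "p = id \<and> (\<forall>i<n. k i = e i)"
    if p: "p permutes {0..<n}" "newton n (\<lambda>i. if i < n then e (p i) else 0) (\<lambda>i. of_nat (k i)) \<noteq> 0" for p
  proof -
    have le: "e (p i) \<le> k i" if "i < n" for i
      using p(2) that by (force simp: newton_def falling_nat_eq_0)
    have sum: "(\<Sum>i<n. e (p i)) = (\<Sum>i<n. e i)"
      using sum.permute[OF p(1), of e] by (simp add: atLeast0LessThan comp_def)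
    have "(\<Sum>i<n. e (p i)) \<le> (\<Sum>i<n. k i)"
      by (rule sum_mono) (simp add: le)
    then have total: "(\<Sum>i<n. e (p i)) = (\<Sum>i<n. k i)"
      using sum k(2) by simp
    have eq: "e (p i) = k i" if "i < n" for i
      by (rule sum_mono_inv[OF total]) (use that le in simp_all)
    have lt: "p i < n" if "i < n" for i
      using that permutes_in_image[OF p(1), of i] by simp
    have e_anti: "e j \<le> e i" if "i \<le> j" "j < n" for i j
      using that
    proof (induct j rule: dec_induct)
      case (step j)
      then show ?case
        using e[of j] by simp
    qed simp
    have "p i < p (Suc i)" if i: "Suc i < n" for i
    proof (rule ccontr)
      assume "\<not> p i < p (Suc i)"
      then have "e (p i) \<le> e (p (Suc i))"
        using e_anti lt i by simp
      then show False
        using eq[of i] eq[of "Suc i"] k(1)[OF i] i by simp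
    qed
    then have "p = id"
      by (rule increasing_permutation[OF p(1)])
    then show ?thesis
      using eq by simp
  qed
  show ?thesis
  proof (cases "\<forall>i<n. k i = e i")
    case True
    have "alternant n e (\<lambda>i. of_nat (k i)) =
        (\<Sum>p\<in>{id}. signof p * newton n (\<lambda>i. if i < n then e (p i) else 0) (\<lambda>i. of_nat (k i)))"
      unfolding alternant_expand by (rule sum.mono_neutral_right) (use perm in \<open>auto simp: finite_permutations permutes_id\<close>)
    moreover have "newton n (\<lambda>i. if i < n then e (id i) else 0) (\<lambda>i. of_nat (k i)) = of_nat (\<Prod>i<n. fact (e i))"
      unfolding newton_def of_nat_prod by (intro prod.cong refl) (simp add: True falling_self)
    ultimately show ?thesis
      using True by simp
  next
    case False
    have "alternant n e (\<lambda>i. of_nat (k i)) = 0"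
      unfolding alternant_expand by (rule sum.neutral) (use perm False in auto)
    then show ?thesis
      using False by simp
  qed
qed

section \<open>The Vandermonde product\<close>

definition delta :: "nat \<Rightarrow> nat \<Rightarrow> nat"
  where "delta n i = n - Suc i"

definition vandermonde :: "nat \<Rightarrow> (nat \<Rightarrow> complex) \<Rightarrow> complex"
  where "vandermonde n z = (\<Prod>(i, j) | i < j \<and> j < n. z i - z j)"

lemma finite_pairs: "finite {(i, j). i < j \<and> j < (n :: nat)}"
  by (rule finite_subset[of _ "{..<n} \<times> {..<n}"]) auto

lemma vandermonde_Suc: "vandermonde (Suc n) z = vandermonde n z * (\<Prod>i<n. z i - z n)"
proof -
  have "{(i, j). i < j \<and> j < Suc n} = {(i, j). i < j \<and> j < n} \<union> (\<lambda>i. (i, n)) ` {..<n}"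
    by (auto simp: less_Suc_eq)
  then have "vandermonde (Suc n) z = vandermonde n z * (\<Prod>(i, j)\<in>(\<lambda>i. (i, n)) ` {..<n}. z i - z j)"
    unfolding vandermonde_def by (simp only:) (rule prod.union_disjoint; (rule finite_pairs)?; auto)
  then show ?thesis
    by (simp add: prod.reindex inj_on_def)
qed

lemma vandermonde_swap:
  assumes "Suc i < n"
  shows "vandermonde n (z(i := z (Suc i), Suc i := z i)) = - vandermonde n z"
proof -
  let ?X = "{(a, b). a < b \<and> b < n}" and ?t = "\<lambda>a. if a = i then Suc i else if a = Suc i then i else a"
  let ?z = "z(i := z (Suc i), Suc i := z i)"
  have z: "?z a = z (?t a)" for a
    by simp
  have X: "(i, Suc i) \<in> ?X"
    using assms by simp
  \<comment> \<open>The exchange of \<open>i\<close> and \<open>Suc i\<close> permutes the remaining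
    pairs without reversing any, so only the factor of the pair itself changes sign.\<close>
  have eq: "(\<Prod>(a, b)\<in>?X - {(i, Suc i)}. ?z a - ?z b) = (\<Prod>(a, b)\<in>?X - {(i, Suc i)}. z a - z b)"
    by (rule prod.reindex_bij_witness[of _ "\<lambda>(a, b). (?t a, ?t b)" "\<lambda>(a, b). (?t a, ?t b)"])
      (use assms in \<open>auto split: if_splits\<close>)
  show ?thesis
    unfolding vandermonde_def prod.remove[OF finite_pairs X] eq by (simp add: left_diff_distrib)
qed

lemma vandermonde_span: "vandermonde n \<in> newton_span n (\<Sum>i<n. delta n i)"
proof -
  let ?X = "{(i, j). i < j \<and> j < n}"
  have one: "(\<lambda>z. 1) \<in> newton_span n 0"
    using newton_span_newton[of "\<lambda>i. 0" n 0] by (simp add: exps_def newton_def[abs_def] falling_def)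
  have "(\<lambda>z. \<Prod>(i, j)\<in>X. z i - z j) \<in> newton_span n (card X)" if "finite X" "X \<subseteq> ?X" for X
    using that
  proof (induct X)
    case (insert x X)
    obtain i j where x: "x = (i, j)" "i < n" "j < n"
      using insert.prems by (cases x) auto
    have P: "(\<lambda>z. \<Prod>(i, j)\<in>X. z i - z j) \<in> newton_span n (card X)"
      using insert by simp
    from newton_span_diff[OF newton_span_linear[OF P x(2), of 0] newton_span_linear[OF P x(3), of 0]]
    show ?case
      using insert.hyps by (simp add: x(1) left_diff_distrib)
  qed (simp add: one)
  from this[OF finite_pairs order_refl] have "vandermonde n \<in> newton_span n (card ?X)"
    by (simp only: vandermonde_def[abs_def])
  moreover have "?X = Sigma {..<n} (\<lambda>i. {i<..<n})"
    by auto
  then have "card ?X = (\<Sum>i<n. delta n i)"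
    by (simp only: card_SigmaI[OF finite_lessThan] finite_greaterThanLessThan card_greaterThanLessThan delta_def ball_triv simp_thms)
  ultimately show ?thesis
    by simp
qed

lemma vandermonde_delta: "vandermonde n (\<lambda>i. of_nat (delta n i)) = of_nat (\<Prod>i<n. fact (delta n i))"
proof (induct n)
  case (Suc n)
  have "vandermonde n (\<lambda>i. of_nat (delta (Suc n) i)) = vandermonde n (\<lambda>i. of_nat (delta n i))"
    unfolding vandermonde_def delta_def by (intro prod.cong refl) (auto simp: of_nat_diff)
  moreover have "(\<Prod>i<n. of_nat (delta (Suc n) i) - of_nat (delta (Suc n) n)) = (fact n :: complex)"
    unfolding falling_self[symmetric] falling_def delta_def by (intro prod.cong refl) (simp add: of_nat_diff)
  moreover have "(\<Prod>i<Suc n. fact (delta (Suc n) i)) = (fact n * (\<Prod>i<n. fact (delta n i)) :: nat)"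
    unfolding prod.lessThan_Suc_shift by (simp add: delta_def)
  ultimately show ?case
    using Suc by (simp add: vandermonde_Suc)
qed (simp add: vandermonde_def)

lemma delta_le:
  assumes "\<And>i. Suc i < n \<Longrightarrow> k (Suc i) < k i" "i < n"
  shows "delta n i \<le> k i"
proof -
  have "j < n \<Longrightarrow> j \<le> k (n - Suc j)" for j
  proof (induct j)
    case (Suc j)
    then have "Suc (n - Suc (Suc j)) = n - Suc j" "Suc (n - Suc (Suc j)) < n"
      by simp_all
    then show ?case
      using Suc assms(1)[of "n - Suc (Suc j)"] by simp
  qed simp
  from this[of "n - Suc i"] show ?thesis
    using assms(2) by (simp add: delta_def)
qed

text \<open>Both sides are antisymmetric of the same degree, and \<open>delta n\<close> is the only
  strictly decreasing point of at most that size; there both are the product of factorials.\<close>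

lemma alternant_delta: "alternant n (delta n) z = vandermonde n z"
proof -
  have "alternant n (delta n) z - vandermonde n z = 0"
  proof (rule antisymmetric_vanish[OF newton_span_diff[OF alternant_span vandermonde_span]])
    fix z :: "nat \<Rightarrow> complex" and i assume "Suc i < n"
    then show "alternant n (delta n) (z(i := z (Suc i), Suc i := z i)) - vandermonde n (z(i := z (Suc i), Suc i := z i)) =
        - (alternant n (delta n) z - vandermonde n z)"
      by (simp only: alternant_swap vandermonde_swap) simp
  next
    fix k assume k: "k \<in> exps n (\<Sum>i<n. delta n i)" "\<And>i. Suc i < n \<Longrightarrow> k (Suc i) < k i"
    have le: "delta n i \<le> k i" if "i < n" for i
      by (rule delta_le[where k = k, OF k(2) that])
    have "(\<Sum>i<n. delta n i) \<le> (\<Sum>i<n. k i)"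
      by (rule sum_mono) (simp add: le)
    then have sum: "(\<Sum>i<n. delta n i) = (\<Sum>i<n. k i)"
      using k(1) by (simp add: exps_def)
    have eq: "k i = delta n i" for i
    proof (cases "i < n")
      case True
      then show ?thesis
        using sum_mono_inv[OF sum, of i] le by simp
    next
      case False
      then show ?thesis
        using k(1) by (simp add: exps_def delta_def)
    qed
    have "alternant n (delta n) (\<lambda>i. of_nat (k i)) = of_nat (\<Prod>i<n. fact (delta n i))"
      by (subst alternant_strict) (auto simp: eq delta_def)
    then show "alternant n (delta n) (\<lambda>i. of_nat (k i)) - vandermonde n (\<lambda>i. of_nat (k i)) = 0"
      by (simp add: eq vandermonde_delta)
  qed
  then show ?thesis
    by simp
qed

section \<open>Beta numbers of the conjugate partition and the hook length formula\<close>

definition beta_number :: "nat \<Rightarrow> nat list \<Rightarrow> nat \<Rightarrow> nat"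
  where "beta_number n l i = conj_part l (Suc i) + n - Suc i"

lemma beta_number_strict: "Suc i < n \<Longrightarrow> beta_number n l (Suc i) < beta_number n l i"
  using conj_part_antitone[of "Suc i" "Suc (Suc i)" l] by (simp add: beta_number_def)

text \<open>The hooks of a column and the differences of its beta number with the later ones are the
  numbers \<open>1, \<dots>, beta_number n l i\<close>, each once.\<close>

lemma column_hooks:
  assumes l: "is_partition l" "part l 1 \<le> n" and i: "i < n"
  shows "(\<Prod>r\<in>{1..conj_part l (Suc i)}. hook l r (Suc i)) *
    (\<Prod>k\<in>{i<..<n}. beta_number n l i - beta_number n l k) = fact (beta_number n l i)"
proof -
  let ?b = "beta_number n l" and ?c = "conj_part l" and ?j = "Suc i"
  let ?h = "\<lambda>r. hook l r ?j" and ?R = "{1..?c ?j}" and ?D = "{i<..<n}"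
  have part: "?j \<le> part l r" if "r \<in> ?R" for r
    using that conj_part_iff[OF l(1), of r ?j] by simp
  have h: "?h r = part l r - ?j + (?c ?j - r) + 1" if r: "r \<in> ?R" for r
    using r part[OF r] conj_part_le[of l ?j] by (intro hook_eq[OF l(1)]) (simp add: cells_def)
  have h_int: "int (?h r) = int (part l r) - int ?j + int (?c ?j) - int r + 1" if r: "r \<in> ?R" for r
    using h[OF r] part[OF r] r by simp
  have b_int: "int (?b k) = int (?c (Suc k)) + int n - int (Suc k)" if "k < n" for k
    using that by (simp add: beta_number_def)
  have c_anti: "?c (Suc k) \<le> ?c (Suc k')" if "k' \<le> k" for k k'
    by (rule conj_part_antitone) (simp add: that)
  have b_le: "?b k \<le> ?b i" if "k \<in> ?D" for k
    using b_int[of k] b_int[of i] c_anti[of i k] that i by auto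
  have d_int: "int (?b i - ?b k) = int (?c ?j) - int (?c (Suc k)) + int k - int i" if k: "k \<in> ?D" for k
    using b_int[of k] b_int[of i] b_le[OF k] k i by (simp add: of_nat_diff)
  have inj_h: "inj_on ?h ?R"
  proof (rule linorder_inj_onI)
    fix r r' assume *: "r < r'" "r \<in> ?R" "r' \<in> ?R"
    then show "?h r \<noteq> ?h r'"
      using h_int[of r] h_int[of r'] part_antitone[OF l(1), of r r'] by simp
  qed auto
  have inj_d: "inj_on (\<lambda>k. ?b i - ?b k) ?D"
  proof (rule linorder_inj_onI)
    fix k k' assume *: "k < k'" "k \<in> ?D" "k' \<in> ?D"
    then show "?b i - ?b k \<noteq> ?b i - ?b k'"
      using d_int[of k] d_int[of k'] c_anti[of k k'] by linarith
  qed auto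
  have disj: "?h r \<noteq> ?b i - ?b k" if r: "r \<in> ?R" and k: "k \<in> ?D" for r k
  proof -
    \<comment> \<open>The position of the cell \<open>(r, Suc k)\<close> decides: if it lies in the
      diagram, the hook is longer than the difference of beta numbers, otherwise shorter.\<close>
    have iff: "Suc k \<le> part l r \<longleftrightarrow> r \<le> ?c (Suc k)"
      using r by (intro conj_part_iff[OF l(1)]) simp_all
    show ?thesis
      using h_int[OF r] d_int[OF k] iff by (cases "Suc k \<le> part l r") auto
  qed
  have "?h ` ?R \<union> (\<lambda>k. ?b i - ?b k) ` ?D \<subseteq> {1..?b i}"
  proof -
    have "?h r \<in> {1..?b i}" if r: "r \<in> ?R" for r
    proof -
      have "part l r \<le> n"
        using part_antitone[OF l(1), of 1 r] r l(2) by simp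
      then show ?thesis
        using h_int[OF r] h[OF r] b_int[OF i] r by auto
    qed
    moreover have "?b i - ?b k \<in> {1..?b i}" if k: "k \<in> ?D" for k
      using d_int[OF k] c_anti[of i k] k by auto
    ultimately show ?thesis
      by blast
  qed
  moreover have "card (?h ` ?R \<union> (\<lambda>k. ?b i - ?b k) ` ?D) = card (?h ` ?R) + card ((\<lambda>k. ?b i - ?b k) ` ?D)"
    by (rule card_Un_disjoint) (use disj in auto)
  \<comment> \<open>The counts add up: the column has \<open>conj_part l (Suc i)\<close> hooks and
    there are \<open>n - Suc i\<close> later beta numbers, together
    \<open>beta_number n l i\<close>.\<close>
  then have "card (?h ` ?R \<union> (\<lambda>k. ?b i - ?b k) ` ?D) = card {1..?b i}"
    unfolding card_image[OF inj_h] card_image[OF inj_d] using i by (simp add: beta_number_def)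
  ultimately have union: "?h ` ?R \<union> (\<lambda>k. ?b i - ?b k) ` ?D = {1..?b i}"
    by (intro card_subset_eq) simp_all
  have "(\<Prod>r\<in>?R. ?h r) * (\<Prod>k\<in>?D. ?b i - ?b k) = \<Prod>(?h ` ?R) * \<Prod>((\<lambda>k. ?b i - ?b k) ` ?D)"
    by (simp only: prod.reindex[OF inj_h] prod.reindex[OF inj_d] comp_def)
  also have "\<dots> = \<Prod>(?h ` ?R \<union> (\<lambda>k. ?b i - ?b k) ` ?D)"
    by (rule prod.union_disjoint[symmetric]) (use disj in auto)
  finally show ?thesis
    unfolding union by (simp add: fact_prod)
qed

text \<open>The product of \<open>column_hooks\<close> over the columns. All cells lie in the first
  \<open>n\<close> columns because \<open>part l 1 \<le> n\<close>; empty columns contribute no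
  hooks.\<close>

lemma hook_product_vandermonde:
  assumes l: "is_partition l" "part l 1 \<le> n"
  shows "of_nat (hook_product l) * vandermonde n (\<lambda>i. of_nat (beta_number n l i)) =
    of_nat (\<Prod>i<n. fact (beta_number n l i))"
proof -
  let ?b = "beta_number n l" and ?c = "conj_part l"
  have conj: "1 \<le> j \<Longrightarrow> 1 \<le> ?c j \<Longrightarrow> j \<le> n" for j
    using conj_part_iff[OF l(1), of 1 j] l(2) by simp
  have "hook_product l = (\<Prod>(i, r)\<in>Sigma {..<n} (\<lambda>i. {1..?c (Suc i)}). hook l r (Suc i))"
    unfolding hook_product_def
  proof (rule prod.reindex_bij_witness[of _ "\<lambda>(i, r). (r, Suc i)" "\<lambda>(r, j). (j - 1, r)"])
    fix x assume "x \<in> cells l"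
    then obtain r j where x: "x = (r, j)" "1 \<le> r" "r \<le> length l" "1 \<le> j" "j \<le> part l r"
      by (auto simp: cells_def)
    have "r \<le> ?c j"
      using x conj_part_iff[OF l(1), of r j] by simp
    then show "(case x of (r, j) \<Rightarrow> (j - 1, r)) \<in> Sigma {..<n} (\<lambda>i. {1..?c (Suc i)})"
      using x conj[of j] by simp
    show "(case case x of (r, j) \<Rightarrow> (j - 1, r) of (i, r) \<Rightarrow> (r, Suc i)) = x"
      "(case case x of (r, j) \<Rightarrow> (j - 1, r) of (i, r) \<Rightarrow> hook l r (Suc i)) = (case x of (i, j) \<Rightarrow> hook l i j)"
      using x by simp_all
  next
    fix y assume "y \<in> Sigma {..<n} (\<lambda>i. {1..?c (Suc i)})"
    then obtain i r where y: "y = (i, r)" "1 \<le> r" "r \<le> ?c (Suc i)"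
      by auto
    then show "(case y of (i, r) \<Rightarrow> (r, Suc i)) \<in> cells l"
      using conj_part_iff[OF l(1), of r "Suc i"] conj_part_le[of l "Suc i"] by (simp add: cells_def)
    show "(case case y of (i, r) \<Rightarrow> (r, Suc i) of (r, j) \<Rightarrow> (j - 1, r)) = y"
      using y by simp
  qed
  then have H: "hook_product l = (\<Prod>i<n. \<Prod>r\<in>{1..?c (Suc i)}. hook l r (Suc i))"
    by (simp add: prod.Sigma)
  have anti: "?b k \<le> ?b i" if "i < k" "k < n" for i k
    using that conj_part_antitone[of "Suc i" "Suc k" l] by (simp add: beta_number_def)
  have "{(i, j). i < j \<and> j < n} = Sigma {..<n} (\<lambda>i. {i<..<n})"
    by auto
  then have "vandermonde n (\<lambda>i. of_nat (?b i)) = (\<Prod>i<n. \<Prod>k\<in>{i<..<n}. of_nat (?b i) - of_nat (?b k))"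
    by (simp add: vandermonde_def prod.Sigma)
  also have "\<dots> = of_nat (\<Prod>i<n. \<Prod>k\<in>{i<..<n}. ?b i - ?b k)"
    unfolding of_nat_prod by (intro prod.cong refl) (simp add: of_nat_diff anti)
  finally have V: "vandermonde n (\<lambda>i. of_nat (?b i)) = of_nat (\<Prod>i<n. \<Prod>k\<in>{i<..<n}. ?b i - ?b k)" .
  have "hook_product l * (\<Prod>i<n. \<Prod>k\<in>{i<..<n}. ?b i - ?b k) = (\<Prod>i<n. fact (?b i))"
    unfolding H prod.distrib[symmetric] by (intro prod.cong refl column_hooks[OF l]) simp
  then show ?thesis
    unfolding V of_nat_mult[symmetric] by (simp only:)
qed

text \<open>The expansion of \<open>f\<close> supplies the degree bound: each summand multiplies the
  denominator by at most \<open>sum_list l\<close> linear factors, which is exactly the excess of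
  degree of the numerator. The strictly decreasing points left by antisymmetry are the shifted
  partitions treated in \<open>small\<close>.\<close>

lemma shifted_symmetric_alternant:
  assumes n: "1 \<le> n" and l: "is_partition l" "part l 1 \<le> n"
    and f: "f \<in> shifted_symmetric n"
    and expand: "finite I" "\<And>w. w \<in> I \<Longrightarrow> length (ps w) \<le> sum_list l \<and> set (ps w) \<subseteq> {1..n}"
      "\<And>x. eval_poly f x = (\<Sum>w\<in>I. c w * (\<Prod>p\<leftarrow>ps w. x p))"
    and small: "\<And>m. m \<in> gap_partitions n 0 \<Longrightarrow> (\<Sum>i\<in>{1..n}. m i) \<le> sum_list l \<Longrightarrow>
      eval_poly f (\<lambda>i. of_nat (m i)) = (if \<forall>i\<in>{1..n}. m i = conj_part l i then of_nat (hook_product l) else 0)"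
  shows "eval_poly f x * alternant n (delta n) (\<lambda>i. x (Suc i) + of_nat (n - Suc i)) =
    alternant n (beta_number n l) (\<lambda>i. x (Suc i) + of_nat (n - Suc i))"
proof -
  \<comment> \<open>Undoes the shift by the staircase and passes from coordinates counted from 0, as
    in the matrices, to variables counted from 1.\<close>
  define X where "X z = (\<lambda>i. z (i - 1) - of_nat (n - i))" for z :: "nat \<Rightarrow> complex"
  define F where "F z = eval_poly f (X z)" for z
  define G where "G z = F z * alternant n (delta n) z - alternant n (beta_number n l) z" for z
  let ?b = "beta_number n l"
  let ?D = "(\<Sum>i<n. delta n i) + sum_list l"
  have fp: "eval_poly f \<in> pfun n"
    using f by (intro eval_poly_pfun) (simp add: shifted_symmetric_def vars_in_def)
  \<comment> \<open>The size of the conjugate partition, obtained by counting the letters of the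
    superstandard filling once by value and once by row.\<close>
  have size: "(\<Sum>i<n. conj_part l (Suc i)) = sum_list l"
  proof -
    have "(\<Sum>i\<in>{1..n}. count_list (concat (superstandard l)) i) = (\<Sum>x\<leftarrow>concat (superstandard l). 1)"
    proof -
      have "set (concat (superstandard l)) \<subseteq> {1..n}"
        using order_trans[OF part_le_first[OF l(1)] l(2)] by (fastforce simp del: upt_Suc)
      from sum_list_map_eq_sum_count2[OF this finite_atLeastAtMost, of "\<lambda>x. 1"] show ?thesis
        by (simp only: mult_1_right)
    qed
    moreover have "(\<Sum>x\<leftarrow>concat (superstandard l). 1) = sum_list l"
      by (induct l) (simp_all add: sum_list_triv del: upt_Suc)
    moreover have "(\<Sum>i<n. conj_part l (Suc i)) = (\<Sum>i\<in>{1..n}. count_list (concat (superstandard l)) i)"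
      by (rule sum.reindex_bij_witness[of _ "\<lambda>i. i - 1" Suc]) (auto simp: count_superstandard[unfolded One_nat_def] simp del: upt_Suc)
    ultimately show ?thesis
      by (simp only:)
  qed
  have b: "(\<Sum>i<n. ?b i) = ?D"
  proof -
    have "(\<Sum>i<n. ?b i) = (\<Sum>i<n. delta n i + conj_part l (Suc i))"
      by (intro sum.cong) (auto simp: beta_number_def delta_def)
    then show ?thesis
      by (simp add: sum.distrib size)
  qed
  have "F z * alternant n (delta n) z = (\<Sum>w\<in>I. c w * ((\<Prod>p\<leftarrow>ps w. z (p - 1) - of_nat (n - p)) * alternant n (delta n) z))" for z
    by (simp add: F_def X_def expand(3) sum_distrib_right mult.assoc)
  moreover have "(\<lambda>z. \<Sum>w\<in>I. c w * ((\<Prod>p\<leftarrow>ps w. z (p - 1) - of_nat (n - p)) * alternant n (delta n) z)) \<in> newton_span n ?D"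
  proof (intro newton_span_sum newton_span_scale)
    fix w assume w: "w \<in> I"
    have p: "p - 1 < n" if "p \<in> set (ps w)" for p
    proof -
      have "p \<in> {1..n}"
        using expand(2)[OF w] that by blast
      then show ?thesis
        by auto
    qed
    have "(\<lambda>z. (\<Prod>p\<leftarrow>ps w. z (p - 1) - of_nat (n - p)) * alternant n (delta n) z)
        \<in> newton_span n ((\<Sum>i<n. delta n i) + length (ps w))"
      by (rule newton_span_linear_product[OF alternant_span, where a = "\<lambda>p. p - 1" and k = "\<lambda>p. of_nat (n - p)"]) (rule p)
    then show "(\<lambda>z. (\<Prod>p\<leftarrow>ps w. z (p - 1) - of_nat (n - p)) * alternant n (delta n) z) \<in> newton_span n ?D"
      by (rule newton_span_mono) (use expand(2)[OF w] in simp)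
  qed
  moreover have "alternant n ?b \<in> newton_span n ?D"
    using alternant_span[of n ?b] by (simp only: b)
  ultimately have span: "G \<in> newton_span n ?D"
    unfolding G_def[abs_def] by (simp add: newton_span_diff)
  \<comment> \<open>In the unshifted coordinates the shifted exchange is a plain transposition:
    consecutive shifts differ by 1.\<close>
  have F_swap: "F (z(i := z (Suc i), Suc i := z i)) = F z" if i: "Suc i < n" for z i
  proof -
    let ?x = "X z" and ?i = "Suc i"
    have diff: "of_nat (n - Suc i) = (of_nat (n - Suc (Suc i)) + 1 :: complex)"
      using i by (metis Suc_diff_Suc of_nat_Suc add.commute)
    have "F (z(i := z (Suc i), Suc i := z i)) = eval_poly f (?x(?i := ?x (Suc ?i) - 1, Suc ?i := ?x ?i + 1))"
      unfolding F_def by (rule pfun_cong[OF fp]) (use i diff in \<open>auto simp: X_def\<close>)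
    also have "\<dots> = F z"
      using f i unfolding F_def shifted_symmetric_def by auto
    finally show ?thesis .
  qed
  have zero: "G z = 0" for z
  proof (rule antisymmetric_vanish[OF span])
    fix z :: "nat \<Rightarrow> complex" and i assume "Suc i < n"
    then show "G (z(i := z (Suc i), Suc i := z i)) = - G z"
      by (simp only: G_def F_swap alternant_swap) simp
  next
    fix k assume k: "k \<in> exps n ?D" "\<And>i. Suc i < n \<Longrightarrow> k (Suc i) < k i"
    \<comment> \<open>The weight whose shift by the staircase is \<open>k\<close>; the subtraction
      is exact because a strictly decreasing sequence dominates \<open>delta\<close>.\<close>
    define m where "m i = k (i - 1) - delta n (i - 1)" for i
    have le: "delta n i \<le> k i" if "i < n" for i
      by (rule delta_le[where k = k, OF k(2) that])
    have "m \<in> gap_partitions n 0"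
      unfolding gap_partitions_def
    proof (intro CollectI ballI)
      fix i assume i: "i \<in> {1..<n}"
      then have "k i < k (i - 1)" "delta n i + 1 = delta n (i - 1)"
        using k(2)[of "i - 1"] by (auto simp: delta_def)
      then show "m (Suc i) + 0 \<le> m i"
        by (simp add: m_def)
    qed
    moreover have m_sum: "(\<Sum>i\<in>{1..n}. m i) + (\<Sum>i<n. delta n i) = (\<Sum>i<n. k i)"
    proof -
      have "(\<Sum>i\<in>{1..n}. m i) = (\<Sum>i<n. k i - delta n i)"
        by (rule sum.reindex_bij_witness[of _ Suc "\<lambda>i. i - 1"]) (auto simp: m_def)
      then show ?thesis
        by (simp add: sum.distrib[symmetric] le)
    qed
    then have "(\<Sum>i\<in>{1..n}. m i) \<le> sum_list l"
      using k(1) by (simp add: exps_def)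
    ultimately have "eval_poly f (\<lambda>i. of_nat (m i)) = (if \<forall>i\<in>{1..n}. m i = conj_part l i then of_nat (hook_product l) else 0)"
      by (rule small)
    moreover have "F (\<lambda>i. of_nat (k i)) = eval_poly f (\<lambda>i. of_nat (m i))"
      unfolding F_def
    proof (rule pfun_cong[OF fp])
      fix i assume i: "i \<in> {1..n}"
      then have le': "delta n (i - 1) \<le> k (i - 1)"
        by (intro le) auto
      have "n - i = delta n (i - 1)"
        using i by (simp add: delta_def)
      then show "X (\<lambda>i. of_nat (k i)) i = of_nat (m i)"
        by (simp only: X_def m_def of_nat_diff[OF le'])
    qed
    moreover have "(\<forall>i\<in>{1..n}. m i = conj_part l i) \<longleftrightarrow> (\<forall>i<n. k i = ?b i)"
    proof -
      have "m (Suc i) = conj_part l (Suc i) \<longleftrightarrow> k i = ?b i" if "i < n" for i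
        using le[OF that] that by (auto simp: m_def beta_number_def delta_def)
      then have "(\<forall>i\<in>Suc ` {..<n}. m i = conj_part l i) \<longleftrightarrow> (\<forall>i<n. k i = ?b i)"
        by blast
      then show ?thesis
        by (simp only: image_Suc_lessThan)
    qed
    ultimately have Fk: "F (\<lambda>i. of_nat (k i)) = (if \<forall>i<n. k i = ?b i then of_nat (hook_product l) else 0)"
      by simp
    have Ak: "alternant n ?b (\<lambda>i. of_nat (k i)) = (if \<forall>i<n. k i = ?b i then of_nat (\<Prod>i<n. fact (?b i)) else 0)"
      by (rule alternant_strict[where k = k, OF k(2)]) (use k(1) beta_number_strict in \<open>simp_all add: b exps_def\<close>)
    show "G (\<lambda>i. of_nat (k i)) = 0"
    proof (cases "\<forall>i<n. k i = ?b i")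
      case True
      have "vandermonde n (\<lambda>i. of_nat (k i)) = vandermonde n (\<lambda>i. of_nat (?b i))"
        unfolding vandermonde_def by (intro prod.cong refl) (use True in auto)
      then show ?thesis
        using hook_product_vandermonde[OF l] Ak Fk True by (simp add: G_def alternant_delta)
    next
      case False
      then show ?thesis
        by (simp only: G_def Fk Ak if_False mult_zero_left diff_self)
    qed
  qed
  have "F (\<lambda>i. x (Suc i) + of_nat (n - Suc i)) = eval_poly f x"
    unfolding F_def by (rule pfun_cong[OF fp]) (simp add: X_def)
  then show ?thesis
    using zero[of "\<lambda>i. x (Suc i) + of_nat (n - Suc i)"] by (simp only: G_def right_minus_eq)
qed

section \<open>From functions back to polynomials and fractions\<close>

lemma vandermonde_nonzero:
  assumes "\<And>i j. i < j \<Longrightarrow> j < n \<Longrightarrow> z i \<noteq> z j"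
  shows "vandermonde n z \<noteq> 0"
  unfolding vandermonde_def using assms by (auto simp: prod_zero_iff[OF finite_pairs])

lemma eval_poly_falling: "eval_poly (falling g p) x = falling (eval_poly g x) p"
  by (simp add: falling_def eval_poly_prod eval_poly_diff)

lemma eval_poly_det:
  "eval_poly (det (mat n n (\<lambda>(i, j). falling (var (Suc i) + of_nat (n - Suc i)) (e j)))) x =
    alternant n e (\<lambda>i. x (Suc i) + of_nat (n - Suc i))"
proof -
  let ?A = "mat n n (\<lambda>(i, j). falling (var (Suc i) + of_nat (n - Suc i)) (e j)) :: cpoly mat"
  have "eval_poly (det ?A) x = det (map_mat (\<lambda>f. eval_poly f x) ?A)"
    by (rule eval_poly.hom_det[symmetric])
  also have "map_mat (\<lambda>f. eval_poly f x) ?A = mat n n (\<lambda>(i, j). falling (x (Suc i) + of_nat (n - Suc i)) (e j))"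
    by (intro eq_matI) (auto simp: eval_poly_falling eval_poly_add eval_poly_var simp del: of_nat_diff of_nat_Suc)
  finally show ?thesis
    by (simp only: alternant_def)
qed

lemma vars_in_falling: "g \<in> vars_in n \<Longrightarrow> falling g p \<in> vars_in n"
  unfolding falling_def by (intro vars_in_prod vars_in_diff vars_in_of_nat)

lemma vars_in_det:
  assumes "\<And>i j. i < n \<Longrightarrow> j < n \<Longrightarrow> g i j \<in> vars_in k"
  shows "det (mat n n (\<lambda>(i, j). g i j)) \<in> vars_in k"
proof -
  have sign: "signof p \<in> vars_in k" for p :: "nat \<Rightarrow> nat"
    using vars_in_one[of k] vars_in_uminus[OF vars_in_one[of k]] by (simp add: sign_def)
  have "p i < n" if "p permutes {0..<n}" "i < n" for p i
    using that permutes_in_image[of p "{0..<n}" i] by simp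
  then show ?thesis
    by (subst det_def'[of _ n]) (auto intro!: vars_in_sum vars_in_mult sign vars_in_prod assms)
qed

theorem theorem6p5:
  fixes n m0 m1 :: nat and l :: "nat list"
  assumes "n \<ge> 1"
    and "is_partition l" and "part l 1 \<le> n"
    and "length l \<le> m0" and "part l 1 \<le> m1"
  shows "to_fract (harish_chandra n (S_elem m0 m1 n l)) = shifted_schur n l"
proof -
  obtain f where f: "harish_chandra n (S_elem m0 m1 n l) = f" "f \<in> shifted_symmetric n"
    "\<And>K s mu v. hw_vec K s n mu v \<Longrightarrow> proper_vec v \<Longrightarrow>
      app (imm_op K s n l) v = scl (of_nat (hook_product l) * eval_poly f mu) v"
    "\<exists>(I :: (symb \<times> symb) free_word set) c ps. finite I \<and>
      (\<forall>w\<in>I. length (ps w) \<le> sum_list l \<and> set (ps w) \<subseteq> {1..n}) \<and>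
      (\<forall>x. eval_poly f x = (\<Sum>w\<in>I. c w * (\<Prod>p\<leftarrow>ps w. x p)))"
    by (rule harish_chandra_S_elem[OF assms]) (rule that)
  obtain I :: "(symb \<times> symb) free_word set" and c ps where I: "finite I"
    "\<forall>w\<in>I. length (ps w) \<le> sum_list l \<and> set (ps w) \<subseteq> {1..n}"
    "\<forall>x. eval_poly f x = (\<Sum>w\<in>I. c w * (\<Prod>p\<leftarrow>ps w. x p))"
    using f(4) by (elim exE conjE) (rule that)
  define M :: "(nat \<Rightarrow> nat) \<Rightarrow> cpoly mat"
    where "M e = mat n n (\<lambda>(i, j). falling (var (Suc i) + of_nat (n - Suc i)) (e j))" for e
  have vars_M: "det (M e) \<in> vars_in n" for e
    unfolding M_def by (intro vars_in_det vars_in_falling vars_in_add vars_in_var vars_in_of_nat) simp_all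
  have eval_M: "eval_poly (det (M e)) x = alternant n e (\<lambda>i. x (Suc i) + of_nat (n - Suc i))" for e x
    unfolding M_def by (rule eval_poly_det)
  have vars_f: "f \<in> vars_in n"
    using f(2) by (simp add: shifted_symmetric_def vars_in_def)
  have "f * det (M (delta n)) = det (M (beta_number n l))"
  proof (rule eval_poly_inject[OF vars_in_mult[OF vars_f vars_M] vars_M])
    fix x
    have "eval_poly f x * alternant n (delta n) (\<lambda>i. x (Suc i) + of_nat (n - Suc i)) =
        alternant n (beta_number n l) (\<lambda>i. x (Suc i) + of_nat (n - Suc i))"
      by (rule shifted_symmetric_alternant[OF assms(1-3) f(2) I(1) bspec[OF I(2)] spec[OF I(3)]
          eigenvalue_small[OF assms(2,3,1) f(3)]])
    then show "eval_poly (f * det (M (delta n))) x = eval_poly (det (M (beta_number n l))) x"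
      by (simp only: eval_poly_mult eval_M)
  qed
  \<comment> \<open>At the origin the denominator is the Vandermonde product of the distinct numbers
    \<open>n - 1, ..., 0\<close>.\<close>
  moreover have "det (M (delta n)) \<noteq> 0"
  proof
    assume "det (M (delta n)) = 0"
    then have "vandermonde n (\<lambda>i. 0 + of_nat (n - Suc i)) = 0"
      using eval_M[of "delta n" "\<lambda>i. 0"] by (simp only: alternant_delta eval_poly_zero)
    moreover have "vandermonde n (\<lambda>i. 0 + of_nat (n - Suc i)) \<noteq> 0"
      by (rule vandermonde_nonzero) simp
    ultimately show False
      by blast
  qed
  moreover have "shifted_schur n l = Fract (det (M (beta_number n l))) (det (M (delta n)))"
    by (simp only: shifted_schur_def M_def Let_def beta_number_def delta_def)
  ultimately show ?thesis
    by (simp add: f(1) to_fract_def eq_fract)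
qed

end
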